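(* Let $\Gamma$ be a smooth closed curve bounding $\Omega\subset\mathbb R^2$. Let $g\in L^2(\Gamma)$ have $\int_\Gamma g\,ds=0$, and let $u\in H^2(\Gamma)$ be the solution of $-\Delta_\Gamma u=g$ on $\Gamma$ with $\int_\Gamma u\,ds=0$. Let $U$ be its harmonic extension to $\Omega$. Assume the active-grid geometry assumptions, the local extrapolation assumption and the data/regularity assumption stated in the context (in particular $U\in W^{4,\infty}(\Omega\cap U_\Gamma)$). Fix the single-layer or the double-layer construction and assume that the corresponding block $P_2$ is invertible. Let $u_h\in W_{h,\diamond}^{\mathrm{red}}$ be the reduced trace solution, i.e. $$\int_{\Gamma^h}\nabla_{\Gamma^h}u_h\cdot\nabla_{\Gamma^h}v_h\,ds_h=\int_{\Gamma^h}(g\circ p)\,v_h\,ds_h\qquad\forall v_h\in W_{h,\diamond}^{\mathrm{red}},$$ and let $u^e:=u\circ p-|\Gamma^h|^{-1}\int_{\Gamma^h}u\circ p\,ds_h$. Then $$\|u^e-u_h\|_{H^1(\Gamma^h)}\le C\,h\bigl(\|u\|_{H^2(\Gamma)}+\|U\|_{W^{4,\infty}(\Omega\cap U_\Gamma)}\bigr),$$ with $C$ independent of $h$ and of the cut configuration (the position of $\Gamma$ relative to the mesh).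
   Context: **Geometry and mesh.** $\Omega\subset\mathbb R^2$ is a bounded domain (possibly nonconvex) whose boundary $\Gamma$ is a smooth connected closed curve; $\psi$ is a level-set function with $\Gamma=\{\psi=0\}$, $\psi<0$ in $\Omega$, $\psi>0$ outside $\overline\Omega$. $\mathcal T_h$ is the uniform Cartesian mesh of closed squares of side $h$ with vertex set $h\mathbb Z^2$; $x\sim y$ means that $x,y\in h\mathbb Z^2$ are nearest (axial) lattice neighbours. A cell $K$ is active if $K\cap\Gamma\ne\varnothing$; $\mathcal T_h^\Gamma$ is the set of active cells, $\gamma$ the set of their vertices, $\Omega_h^\Gamma$ their union. Put $\gamma_1=\{x\in\gamma:\psi(x)<0\}$, $\gamma_2=\{x\in\gamma:\psi(x)>0,\ x\sim y\text{ for some }y\in\gamma_1\}$, $\gamma_3=\{x\in\gamma:\psi(x)>0\}\setminus\gamma_2$, $\mathcal V_h^{\rm int}=\{\xi\in h\mathbb Z^2:\psi(\xi)<0\}$. *Active-grid geometry assumptions* ($h$ sufficiently small): no lattice vertex lies on $\Gamma$; all intersections of $\Gamma$ with mesh edges are transverse; each active cell is cut by at most one connected interface segment; every active cell has vertices of both signs of $\psi$; $\mathcal V_h^{\rm int}$ is finite and connected as a lattice graph. No lower bound on cut ratios is imposed. **Discrete surface and finite elements.** $V_h$ is the continuous bilinear ($\mathcal Q_1$) finite element space on $\mathcal T_h^\Gamma$ with nodal basis $\{\phi_\xi\}_{\xi\in\gamma}$. In each active cell $K$, $\Gamma_K^h$ is the straight segment joining the zero crossings of $\psi$ on $\partial K$;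 $\Gamma^h=\bigcup_K\Gamma^h_K$. $\operatorname{Tr}_hv_h=v_h|_{\Gamma^h}$. $\nabla_{\Gamma^h}$ is the tangential gradient on $\Gamma^h$, $ds_h$ its arclength, $\|v\|_{H^1(\Gamma^h)}^2=\|v\|_{L^2(\Gamma^h)}^2+\|\nabla_{\Gamma^h}v\|_{L^2(\Gamma^h)}^2$. $p:\Gamma^h\to\Gamma$ is the closest-point projection; the standard estimates $\|p-\mathrm{id}\|_{L^\infty(\Gamma^h)}\lesssim h^2$, $\|\mathbf n\circ p-\mathbf n_h\|_{L^\infty(\Gamma^h)}\lesssim h$, $\|1-ds/ds_h\|_{L^\infty(\Gamma^h)}\lesssim h^2$ hold. **Layer potentials and harmonic extension.** $L_hv(x)=h^{-2}\bigl(\sum_{y\sim x}v(y)-4v(x)\bigr)$. $G_h$ is the lattice Green's function on $h\mathbb Z^2$: $-L_hG_h=\delta_0$ with $\delta_0(0)=h^{-2}$, $\delta_0=0$ elsewhere, normalized by $G_h(0)=0$; explicitly $G_h(hm)=\frac1{4\pi^2}\int_{[-\pi,\pi]^2}\frac{\cos(m\cdot t)-1}{4-2\cos t_1-2\cos t_2}\,dt$. Set $S_{ij}=G_h(x_i-x_j)$ and $D_{ij}=\sum_{x_k\sim x_j,\,x_k\notin\gamma}[G_h(x_i-x_k)-G_h(x_i-x_j)]$. With sources in $\gamma_2$ and targets in $\gamma_1$, resp. $\gamma_2$, one gets the blocks $S_{12},D_{12}$, resp. $S_{22},D_{22}$. Either $(P_1,P_2)=(S_{12},S_{22})$ (single layer)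 or $(P_1,P_2)=(D_{12},D_{22})$ (double layer). If $P_2$ is invertible, $H:=P_1P_2^{-1}$. **Local extrapolation assumption.** For $\eta\in\gamma_3$, a direction $e\in\{\pm e_1,\pm e_2\}$ is admissible if $\eta-he,\eta-2he\in\gamma_1\cup\gamma_2$; then one sets $v(\eta)=2v(\eta-he)-v(\eta-2he)$, averaging over two orthogonal admissible directions when available. Assume every $\eta\in\gamma_3$ has at least one admissible direction, and the stencil patches have diameter $O(h)$ and uniformly finite overlap, independently of the cut position. (A local least-squares affine extrapolation may be substituted provided each stencil uses a uniformly bounded number of nodes with uniformly bounded weights, is exact on affine functions, and patches keep uniformly finite overlap.) The relations are written $R_1u_1+R_2u_2+u_3=0$, where $u_i$ is the vector of values on $\gamma_i$; $J:=R_1H+R_2$. **Reduced spaces.** For $v_2\in\mathcal M_h:=\mathbb R^{|\gamma_2|}$ let $Ev_2=(Hv_2,v_2,-Jv_2)\in\mathbb R^{|\gamma|}$ (blocks on $\gamma_1,\gamma_2,\gamma_3$), $\mathcal E_hv_2=\sum_{\xi\in\gamma}(Ev_2)_\xi\phi_\xi$, $V_h^{\rm red}=\mathcal E_h\mathcal M_h$, $W_h^{\rm red}=\operatorname{Tr}_hV_h^{\rm red}$, and $W_{h,\diamond}^{\rm red}=\{w\in W_h^{\rm red}:\int_{\Gamma^h}w\,ds_h=0\}$. **Data/regularity assumption.** $g\in L^2(\Gamma)$, $\int_\Gamma g\,ds=0$, $\int_\Gamma u\,ds=0$, $u\in H^2(\Gamma)$; the harmonic extension $U$ of $u$ to $\Omega$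 satisfies $U\in W^{4,\infty}(\Omega\cap U_\Gamma)$ for a fixed tubular neighbourhood $U_\Gamma$ of $\Gamma$. $\mathfrak E:W^{4,\infty}(\Omega)\to W^{4,\infty}(\mathbb R^2)$ is a fixed bounded extension operator (e.g. Stein's), $\widetilde U=\mathfrak EU$, and $\|\widetilde U\|_{W^{4,\infty}(\mathbb R^2)}\lesssim\|U\|_{W^{4,\infty}(\Omega)}\lesssim\|U\|_{W^{4,\infty}(\Omega\cap U_\Gamma)}$. *)

theory Defs
  imports "HOL-Analysis.Analysis" "HOL-Probability.Essential_Supremum"
begin

type_synonym pt = "real^2"

definition pd :: "2 \<Rightarrow> (pt \<Rightarrow> real) \<Rightarrow> pt \<Rightarrow> real"
  where "pd k f x = frechet_derivative f (at x) (axis k 1)"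

text \<open>Infinitely differentiable: all iterated partial derivatives exist and are differentiable.\<close>
definition smooth_fun :: "(pt \<Rightarrow> real) \<Rightarrow> bool"
  where "smooth_fun f \<longleftrightarrow> (\<forall>ks. foldr pd ks f differentiable_on UNIV)"

definition test_fun :: "pt set \<Rightarrow> (pt \<Rightarrow> real) \<Rightarrow> bool"
  where "test_fun S \<phi> \<longleftrightarrow>
    smooth_fun \<phi> \<and> compact (closure {x. \<phi> x \<noteq> 0}) \<and> closure {x. \<phi> x \<noteq> 0} \<subseteq> S"

definition is_weak_pderiv :: "pt set \<Rightarrow> nat \<Rightarrow> nat \<Rightarrow> (pt \<Rightarrow> real) \<Rightarrow> (pt \<Rightarrow> real) \<Rightarrow> bool"
  where "is_weak_pderiv S i j v w \<longleftrightarrow> (\<forall>\<phi>. test_fun S \<phi> \<longrightarrow>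
    (LINT x|lebesgue_on S. v x * (pd 1 ^^ i) ((pd 2 ^^ j) \<phi>) x)
      = (- 1) ^ (i + j) * (LINT x|lebesgue_on S. w x * \<phi> x))"

definition Linf :: "pt set \<Rightarrow> (pt \<Rightarrow> real) \<Rightarrow> bool"
  where "Linf S v \<longleftrightarrow> v \<in> borel_measurable (lebesgue_on S) \<and>
    (\<exists>B. AE x in lebesgue_on S. \<bar>v x\<bar> \<le> B)"

definition Linf_norm :: "pt set \<Rightarrow> (pt \<Rightarrow> real) \<Rightarrow> real"
  where "Linf_norm S v = real_of_ereal (esssup (lebesgue_on S) (\<lambda>x. ereal \<bar>v x\<bar>))"

definition Winf :: "nat \<Rightarrow> pt set \<Rightarrow> (pt \<Rightarrow> real) \<Rightarrow> bool"
  where "Winf k S v \<longleftrightarrow> Linf S v \<and>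
    (\<forall>i j. i + j \<le> k \<longrightarrow> (\<exists>w. Linf S w \<and> is_weak_pderiv S i j v w))"

definition weak_pderiv :: "pt set \<Rightarrow> nat \<Rightarrow> nat \<Rightarrow> (pt \<Rightarrow> real) \<Rightarrow> pt \<Rightarrow> real"
  where "weak_pderiv S i j v = (SOME w. Linf S w \<and> is_weak_pderiv S i j v w)"

definition Winf_norm :: "nat \<Rightarrow> pt set \<Rightarrow> (pt \<Rightarrow> real) \<Rightarrow> real"
  where "Winf_norm k S v =
    Max ((\<lambda>(i, j). Linf_norm S (weak_pderiv S i j v)) ` {(i, j). i + j \<le> k})"

definition bounded_extension :: "nat \<Rightarrow> pt set \<Rightarrow> ((pt \<Rightarrow> real) \<Rightarrow> pt \<Rightarrow> real) \<Rightarrow> real \<Rightarrow> bool"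
  where "bounded_extension k S Ext B \<longleftrightarrow>
    (\<forall>v. Winf k S v \<longrightarrow> Winf k UNIV (Ext v) \<and> (AE x in lebesgue_on S. Ext v x = v x) \<and>
        Winf_norm k UNIV (Ext v) \<le> B * Winf_norm k S v) \<and>
    (\<forall>v w a b. Winf k S v \<longrightarrow> Winf k S w \<longrightarrow>
        (AE x in lebesgue. Ext (\<lambda>y. a * v y + b * w y) x = a * Ext v x + b * Ext w x))"

definition harmonic_extension :: "pt set \<Rightarrow> (pt \<Rightarrow> real) \<Rightarrow> (pt \<Rightarrow> real) \<Rightarrow> bool"
  where "harmonic_extension \<Omega> u U \<longleftrightarrow>
    continuous_on (closure \<Omega>) U \<and> (\<forall>x\<in>frontier \<Omega>. U x = u x) \<and>
    (\<forall>ks. length ks < 2 \<longrightarrow> foldr pd ks U differentiable_on \<Omega>) \<and>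
    (\<forall>ks. length ks = 2 \<longrightarrow> continuous_on \<Omega> (foldr pd ks U)) \<and>
    (\<forall>x\<in>\<Omega>. pd 1 (pd 1 U) x + pd 2 (pd 2 U) x = 0)"

text \<open>\<open>c\<close> is a periodic arclength parametrization of a closed curve of length \<open>L\<close>. Functions on
  the curve are functions on the plane of which only the values on \<open>range c\<close> are used.\<close>
definition smooth_closed_curve :: "(real \<Rightarrow> pt) \<Rightarrow> real \<Rightarrow> bool"
  where "smooth_closed_curve c L \<longleftrightarrow> 0 < L \<and>
    (\<forall>n. ((\<lambda>f s. vector_derivative f (at s)) ^^ n) c differentiable_on UNIV) \<and>
    (\<forall>s. c (s + L) = c s) \<and> inj_on c {0..<L} \<and>
    (\<forall>s. norm (vector_derivative c (at s)) = 1)"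

definition curve_integral :: "(real \<Rightarrow> pt) \<Rightarrow> real \<Rightarrow> (pt \<Rightarrow> real) \<Rightarrow> real"
  where "curve_integral c L v = (LINT s|lebesgue_on {0..L}. v (c s))"

definition L2_curve :: "(real \<Rightarrow> pt) \<Rightarrow> real \<Rightarrow> (pt \<Rightarrow> real) \<Rightarrow> bool"
  where "L2_curve c L v \<longleftrightarrow> (\<lambda>s. v (c s)) \<in> borel_measurable (lebesgue_on {0..L}) \<and>
    integrable (lebesgue_on {0..L}) (\<lambda>s. (v (c s))\<^sup>2)"

definition is_weak_sderiv :: "(real \<Rightarrow> pt) \<Rightarrow> real \<Rightarrow> (pt \<Rightarrow> real) \<Rightarrow> (pt \<Rightarrow> real) \<Rightarrow> bool"
  where "is_weak_sderiv c L v w \<longleftrightarrow>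
    (\<forall>\<phi>::real \<Rightarrow> real. (\<forall>n. (deriv ^^ n) \<phi> differentiable_on UNIV) \<and> (\<forall>s. \<phi> (s + L) = \<phi> s) \<longrightarrow>
      (LINT s|lebesgue_on {0..L}. v (c s) * deriv \<phi> s)
        = - (LINT s|lebesgue_on {0..L}. w (c s) * \<phi> s))"

definition H1_curve :: "(real \<Rightarrow> pt) \<Rightarrow> real \<Rightarrow> (pt \<Rightarrow> real) \<Rightarrow> bool"
  where "H1_curve c L v \<longleftrightarrow> L2_curve c L v \<and> (\<exists>w. L2_curve c L w \<and> is_weak_sderiv c L v w)"

text \<open>The weak arclength derivative; its square is the squared length of the tangential gradient.\<close>
definition sderiv :: "(real \<Rightarrow> pt) \<Rightarrow> real \<Rightarrow> (pt \<Rightarrow> real) \<Rightarrow> pt \<Rightarrow> real"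
  where "sderiv c L v = (SOME w. L2_curve c L w \<and> is_weak_sderiv c L v w)"

definition laplace_beltrami :: "(real \<Rightarrow> pt) \<Rightarrow> real \<Rightarrow> (pt \<Rightarrow> real) \<Rightarrow> pt \<Rightarrow> real"
  where "laplace_beltrami c L v = sderiv c L (sderiv c L v)"

definition H2_curve :: "(real \<Rightarrow> pt) \<Rightarrow> real \<Rightarrow> (pt \<Rightarrow> real) \<Rightarrow> bool"
  where "H2_curve c L v \<longleftrightarrow> H1_curve c L v \<and> H1_curve c L (sderiv c L v)"

definition H2_norm :: "(real \<Rightarrow> pt) \<Rightarrow> real \<Rightarrow> (pt \<Rightarrow> real) \<Rightarrow> real"
  where "H2_norm c L v = sqrt (curve_integral c L
    (\<lambda>x. (v x)\<^sup>2 + (sderiv c L v x)\<^sup>2 + (laplace_beltrami c L v x)\<^sup>2))"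

definition tube :: "pt set \<Rightarrow> real \<Rightarrow> pt set"
  where "tube \<Gamma> \<delta> = {x. infdist x \<Gamma> < \<delta>}"

definition tubular :: "pt set \<Rightarrow> real \<Rightarrow> bool"
  where "tubular \<Gamma> \<delta> \<longleftrightarrow> 0 < \<delta> \<and> (\<forall>x\<in>tube \<Gamma> \<delta>. \<exists>!y. y \<in> \<Gamma> \<and> dist x y = infdist x \<Gamma>)"

definition outer_normal :: "(real \<Rightarrow> pt) \<Rightarrow> pt set \<Rightarrow> pt \<Rightarrow> pt"
  where "outer_normal c \<Omega> x = (SOME \<nu>. \<exists>s. c s = x \<and> norm \<nu> = 1 \<and>
    \<nu> \<bullet> vector_derivative c (at s) = 0 \<and> (\<forall>\<^sub>F t in at_right 0. x + t *\<^sub>R \<nu> \<notin> closure \<Omega>))"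

definition level_set_function :: "pt set \<Rightarrow> (pt \<Rightarrow> real) \<Rightarrow> bool"
  where "level_set_function \<Omega> \<psi> \<longleftrightarrow> continuous_on UNIV \<psi> \<and> {x. \<psi> x = 0} = frontier \<Omega> \<and>
    (\<forall>x\<in>\<Omega>. \<psi> x < 0) \<and> (\<forall>x. x \<notin> closure \<Omega> \<longrightarrow> 0 < \<psi> x)"

definition lattice_pts :: "real \<Rightarrow> pt set"
  where "lattice_pts h = {x. \<forall>i. \<exists>m::int. x $ i = h * of_int m}"

definition dirs :: "pt set"
  where "dirs = {axis i 1 | i. True} \<union> {- axis i 1 | i. True}"

definition nbr :: "real \<Rightarrow> pt \<Rightarrow> pt \<Rightarrow> bool"
  where "nbr h x y \<longleftrightarrow> x \<in> lattice_pts h \<and> y \<in> lattice_pts h \<and> (\<exists>e\<in>dirs. y = x + h *\<^sub>R e)"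

definition cells :: "real \<Rightarrow> pt set set"
  where "cells h = {cbox x (x + vec h) | x. x \<in> lattice_pts h}"

definition zero_set :: "(pt \<Rightarrow> real) \<Rightarrow> pt set"
  where "zero_set \<psi> = {x. \<psi> x = 0}"

definition active_cells :: "(pt \<Rightarrow> real) \<Rightarrow> real \<Rightarrow> pt set set"
  where "active_cells \<psi> h = {K \<in> cells h. K \<inter> zero_set \<psi> \<noteq> {}}"

text \<open>The lattice points in a cell are precisely its four vertices.\<close>
definition gam :: "(pt \<Rightarrow> real) \<Rightarrow> real \<Rightarrow> pt set"
  where "gam \<psi> h = lattice_pts h \<inter> \<Union> (active_cells \<psi> h)"

definition gam1 :: "(pt \<Rightarrow> real) \<Rightarrow> real \<Rightarrow> pt set"
  where "gam1 \<psi> h = {x \<in> gam \<psi> h. \<psi> x < 0}"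

definition gam2 :: "(pt \<Rightarrow> real) \<Rightarrow> real \<Rightarrow> pt set"
  where "gam2 \<psi> h = {x \<in> gam \<psi> h. 0 < \<psi> x \<and> (\<exists>y\<in>gam1 \<psi> h. nbr h x y)}"

definition gam3 :: "(pt \<Rightarrow> real) \<Rightarrow> real \<Rightarrow> pt set"
  where "gam3 \<psi> h = {x \<in> gam \<psi> h. 0 < \<psi> x} - gam2 \<psi> h"

definition V_int :: "(pt \<Rightarrow> real) \<Rightarrow> real \<Rightarrow> pt set"
  where "V_int \<psi> h = {x \<in> lattice_pts h. \<psi> x < 0}"

text \<open>Transversality: where the curve meets a mesh edge on which the \<open>i\<close>-th coordinate is constant,
  its tangent is not parallel to that edge, i.e. has a nonzero \<open>i\<close>-th component.\<close>
definition active_grid :: "(real \<Rightarrow> pt) \<Rightarrow> (pt \<Rightarrow> real) \<Rightarrow> real \<Rightarrow> bool"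
  where "active_grid c \<psi> h \<longleftrightarrow>
    lattice_pts h \<inter> zero_set \<psi> = {} \<and>
    (\<forall>s i. (\<exists>m::int. c s $ i = h * of_int m) \<longrightarrow> vector_derivative c (at s) $ i \<noteq> 0) \<and>
    (\<forall>K\<in>active_cells \<psi> h. connected (K \<inter> zero_set \<psi>)) \<and>
    (\<forall>K\<in>active_cells \<psi> h.
      (\<exists>x\<in>K \<inter> lattice_pts h. \<psi> x < 0) \<and> (\<exists>x\<in>K \<inter> lattice_pts h. 0 < \<psi> x)) \<and>
    finite (V_int \<psi> h) \<and>
    (\<forall>x\<in>V_int \<psi> h. \<forall>y\<in>V_int \<psi> h.
      (x, y) \<in> {(x, y). x \<in> V_int \<psi> h \<and> y \<in> V_int \<psi> h \<and> nbr h x y}\<^sup>*)"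

text \<open>The two zero crossings on the boundary of a cell. Under the grid assumptions there are exactly
  two, and nothing below depends on their order.\<close>
definition cut_ends :: "(pt \<Rightarrow> real) \<Rightarrow> pt set \<Rightarrow> pt \<times> pt"
  where "cut_ends \<psi> K =
    (SOME q. fst q \<noteq> snd q \<and> frontier K \<inter> zero_set \<psi> = {fst q, snd q})"

definition cut_point :: "(pt \<Rightarrow> real) \<Rightarrow> pt set \<Rightarrow> real \<Rightarrow> pt"
  where "cut_point \<psi> K t = (1 - t) *\<^sub>R fst (cut_ends \<psi> K) + t *\<^sub>R snd (cut_ends \<psi> K)"

definition cut_segment :: "(pt \<Rightarrow> real) \<Rightarrow> pt set \<Rightarrow> pt set"
  where "cut_segment \<psi> K = closed_segment (fst (cut_ends \<psi> K)) (snd (cut_ends \<psi> K))"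

definition Gamh :: "(pt \<Rightarrow> real) \<Rightarrow> real \<Rightarrow> pt set"
  where "Gamh \<psi> h = (\<Union>K\<in>active_cells \<psi> h. cut_segment \<psi> K)"

definition Gamh_integral :: "(pt \<Rightarrow> real) \<Rightarrow> real \<Rightarrow> (pt \<Rightarrow> real) \<Rightarrow> real"
  where "Gamh_integral \<psi> h f = (\<Sum>K\<in>active_cells \<psi> h.
    dist (fst (cut_ends \<psi> K)) (snd (cut_ends \<psi> K)) *
      (LINT t|lebesgue_on {0..1}. f (cut_point \<psi> K t)))"

definition AE_Gamh :: "(pt \<Rightarrow> real) \<Rightarrow> real \<Rightarrow> (pt \<Rightarrow> bool) \<Rightarrow> bool"
  where "AE_Gamh \<psi> h P \<longleftrightarrow>
    (\<forall>K\<in>active_cells \<psi> h. AE t in lebesgue_on {0..1}. P (cut_point \<psi> K t))"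

text \<open>A cell containing a given point of the discrete curve, unique except at the finitely many
  vertices of the polygon; so tangent, normal and tangential gradient are defined off these.\<close>
definition cell_at :: "(pt \<Rightarrow> real) \<Rightarrow> real \<Rightarrow> pt \<Rightarrow> pt set"
  where "cell_at \<psi> h x = (SOME K. K \<in> active_cells \<psi> h \<and> x \<in> cut_segment \<psi> K)"

definition tangent_h :: "(pt \<Rightarrow> real) \<Rightarrow> real \<Rightarrow> pt \<Rightarrow> pt"
  where "tangent_h \<psi> h x =
    (let q = cut_ends \<psi> (cell_at \<psi> h x) in sgn (snd q - fst q))"

text \<open>The discrete normal points from the negative to the positive vertices of the cell.\<close>
definition normal_h :: "(pt \<Rightarrow> real) \<Rightarrow> real \<Rightarrow> pt \<Rightarrow> pt"
  where "normal_h \<psi> h x = (SOME \<nu>. norm \<nu> = 1 \<and> \<nu> \<bullet> tangent_h \<psi> h x = 0 \<and>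
    (\<forall>\<xi>\<in>cell_at \<psi> h x \<inter> lattice_pts h. 0 < \<psi> \<xi> \<longrightarrow> 0 < \<nu> \<bullet> (\<xi> - x)))"

definition tgrad_h :: "(pt \<Rightarrow> real) \<Rightarrow> real \<Rightarrow> (pt \<Rightarrow> real) \<Rightarrow> pt \<Rightarrow> pt"
  where "tgrad_h \<psi> h v x =
    deriv (\<lambda>r. v (x + r *\<^sub>R tangent_h \<psi> h x)) 0 *\<^sub>R tangent_h \<psi> h x"

definition H1_norm_h :: "(pt \<Rightarrow> real) \<Rightarrow> real \<Rightarrow> (pt \<Rightarrow> real) \<Rightarrow> real"
  where "H1_norm_h \<psi> h v = sqrt (Gamh_integral \<psi> h (\<lambda>x. (v x)\<^sup>2)
    + Gamh_integral \<psi> h (\<lambda>x. (norm (tgrad_h \<psi> h v x))\<^sup>2))"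

definition proj :: "(pt \<Rightarrow> real) \<Rightarrow> pt \<Rightarrow> pt"
  where "proj \<psi> = closest_point (zero_set \<psi>)"

text \<open>The density \<open>ds/ds_h\<close> is the speed at which the projection traverses the curve when its
  argument runs through the segment at unit speed.\<close>
definition standard_estimates ::
    "(real \<Rightarrow> pt) \<Rightarrow> pt set \<Rightarrow> (pt \<Rightarrow> real) \<Rightarrow> real \<Rightarrow> real \<Rightarrow> bool"
  where "standard_estimates c \<Omega> \<psi> h B \<longleftrightarrow>
    AE_Gamh \<psi> h (\<lambda>x. norm (proj \<psi> x - x) \<le> B * h\<^sup>2) \<and>
    AE_Gamh \<psi> h (\<lambda>x. norm (outer_normal c \<Omega> (proj \<psi> x) - normal_h \<psi> h x) \<le> B * h) \<and>
    AE_Gamh \<psi> h (\<lambda>x. \<bar>1 - norm (vector_derivative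
      (\<lambda>r. proj \<psi> (x + r *\<^sub>R tangent_h \<psi> h x)) (at 0))\<bar> \<le> B * h\<^sup>2)"

definition green :: "real \<Rightarrow> pt \<Rightarrow> real"
  where "green h x = 1 / (4 * pi\<^sup>2) *
    (LINT t|lebesgue_on (cbox (vec (- pi)) (vec pi) :: pt set).
      (cos (((1 / h) *\<^sub>R x) \<bullet> t) - 1) / (4 - 2 * cos (t $ 1) - 2 * cos (t $ 2)))"

datatype layer = Single | Double

fun layer_kernel :: "(pt \<Rightarrow> real) \<Rightarrow> real \<Rightarrow> layer \<Rightarrow> pt \<Rightarrow> pt \<Rightarrow> real"
  where
    "layer_kernel \<psi> h Single x y = green h (x - y)"
  | "layer_kernel \<psi> h Double x y =
      (\<Sum>z | nbr h y z \<and> z \<notin> gam \<psi> h. green h (x - z) - green h (x - y))"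

text \<open>Matrices with rows and columns indexed by finite sets of points are functions of two
  arguments, of which only the values on the index sets are used.\<close>
definition is_inverse_on :: "'a set \<Rightarrow> ('a \<Rightarrow> 'a \<Rightarrow> real) \<Rightarrow> ('a \<Rightarrow> 'a \<Rightarrow> real) \<Rightarrow> bool"
  where "is_inverse_on I A B \<longleftrightarrow> (\<forall>i\<in>I. \<forall>j\<in>I.
    (\<Sum>k\<in>I. A i k * B k j) = (if i = j then 1 else 0) \<and>
    (\<Sum>k\<in>I. B i k * A k j) = (if i = j then 1 else 0))"

definition invertible_on :: "'a set \<Rightarrow> ('a \<Rightarrow> 'a \<Rightarrow> real) \<Rightarrow> bool"
  where "invertible_on I A \<longleftrightarrow> (\<exists>B. is_inverse_on I A B)"

definition inverse_on :: "'a set \<Rightarrow> ('a \<Rightarrow> 'a \<Rightarrow> real) \<Rightarrow> 'a \<Rightarrow> 'a \<Rightarrow> real"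
  where "inverse_on I A = (SOME B. is_inverse_on I A B)"

definition H_mat :: "(pt \<Rightarrow> real) \<Rightarrow> real \<Rightarrow> layer \<Rightarrow> pt \<Rightarrow> pt \<Rightarrow> real"
  where "H_mat \<psi> h l x y = (\<Sum>z\<in>gam2 \<psi> h.
    layer_kernel \<psi> h l x z * inverse_on (gam2 \<psi> h) (layer_kernel \<psi> h l) z y)"

text \<open>An extrapolation rule consists of a stencil \<open>N \<eta>\<close> and weights \<open>w \<eta>\<close> for each \<open>\<eta>\<close> in the third
  vertex class; the extrapolated value is the weighted sum over the stencil.\<close>

definition admissible :: "(pt \<Rightarrow> real) \<Rightarrow> real \<Rightarrow> pt \<Rightarrow> pt \<Rightarrow> bool"
  where "admissible \<psi> h \<eta> e \<longleftrightarrow> e \<in> dirs \<and>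
    \<eta> - h *\<^sub>R e \<in> gam1 \<psi> h \<union> gam2 \<psi> h \<and> \<eta> - (2 * h) *\<^sub>R e \<in> gam1 \<psi> h \<union> gam2 \<psi> h"

definition ray_value :: "real \<Rightarrow> pt \<Rightarrow> pt \<Rightarrow> (pt \<Rightarrow> real) \<Rightarrow> real"
  where "ray_value h \<eta> e v = 2 * v (\<eta> - h *\<^sub>R e) - v (\<eta> - (2 * h) *\<^sub>R e)"

definition ray_nodes :: "real \<Rightarrow> pt \<Rightarrow> pt \<Rightarrow> pt set"
  where "ray_nodes h \<eta> e = {\<eta> - h *\<^sub>R e, \<eta> - (2 * h) *\<^sub>R e}"

definition axial_rule ::
    "(pt \<Rightarrow> real) \<Rightarrow> real \<Rightarrow> (pt \<Rightarrow> pt set) \<Rightarrow> (pt \<Rightarrow> pt \<Rightarrow> real) \<Rightarrow> bool"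
  where "axial_rule \<psi> h N w \<longleftrightarrow> (\<forall>\<eta>\<in>gam3 \<psi> h.
    (\<exists>e. admissible \<psi> h \<eta> e) \<and>
    (if \<exists>e e'. admissible \<psi> h \<eta> e \<and> admissible \<psi> h \<eta> e' \<and> e \<bullet> e' = 0
     then \<exists>e e'. admissible \<psi> h \<eta> e \<and> admissible \<psi> h \<eta> e' \<and> e \<bullet> e' = 0 \<and>
       N \<eta> = ray_nodes h \<eta> e \<union> ray_nodes h \<eta> e' \<and>
       (\<forall>v. (\<Sum>\<xi>\<in>N \<eta>. w \<eta> \<xi> * v \<xi>) = (ray_value h \<eta> e v + ray_value h \<eta> e' v) / 2)
     else \<exists>e. admissible \<psi> h \<eta> e \<and> N \<eta> = ray_nodes h \<eta> e \<and>
       (\<forall>v. (\<Sum>\<xi>\<in>N \<eta>. w \<eta> \<xi> * v \<xi>) = ray_value h \<eta> e v)))"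

definition affine_fun :: "(pt \<Rightarrow> real) \<Rightarrow> bool"
  where "affine_fun q \<longleftrightarrow> (\<exists>a b. \<forall>x. q x = a + b \<bullet> x)"

definition least_squares_fit :: "pt set \<Rightarrow> (pt \<Rightarrow> real) \<Rightarrow> (pt \<Rightarrow> real) \<Rightarrow> bool"
  where "least_squares_fit A v q \<longleftrightarrow> affine_fun q \<and>
    (\<forall>q'. affine_fun q' \<longrightarrow> (\<Sum>\<xi>\<in>A. (v \<xi> - q \<xi>)\<^sup>2) \<le> (\<Sum>\<xi>\<in>A. (v \<xi> - q' \<xi>)\<^sup>2))"

definition least_squares_rule ::
    "(pt \<Rightarrow> real) \<Rightarrow> real \<Rightarrow> (pt \<Rightarrow> pt set) \<Rightarrow> (pt \<Rightarrow> pt \<Rightarrow> real) \<Rightarrow> nat \<Rightarrow> real \<Rightarrow> bool"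
  where "least_squares_rule \<psi> h N w n W \<longleftrightarrow> (\<forall>\<eta>\<in>gam3 \<psi> h.
    N \<eta> \<subseteq> gam1 \<psi> h \<union> gam2 \<psi> h \<and> card (N \<eta>) \<le> n \<and> (\<forall>\<xi>\<in>N \<eta>. \<bar>w \<eta> \<xi>\<bar> \<le> W) \<and>
    (\<forall>v. \<exists>q. least_squares_fit (N \<eta>) v q \<and> (\<Sum>\<xi>\<in>N \<eta>. w \<eta> \<xi> * v \<xi>) = q \<eta>) \<and>
    (\<forall>q. affine_fun q \<longrightarrow> (\<Sum>\<xi>\<in>N \<eta>. w \<eta> \<xi> * q \<xi>) = q \<eta>))"

definition local_patches ::
    "(pt \<Rightarrow> real) \<Rightarrow> real \<Rightarrow> (pt \<Rightarrow> pt set) \<Rightarrow> nat \<Rightarrow> real \<Rightarrow> bool"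
  where "local_patches \<psi> h N n \<kappa> \<longleftrightarrow>
    (\<forall>\<eta>\<in>gam3 \<psi> h. diameter (insert \<eta> (N \<eta>)) \<le> \<kappa> * h) \<and>
    (\<forall>\<xi>\<in>gam \<psi> h. card {\<eta> \<in> gam3 \<psi> h. \<xi> \<in> insert \<eta> (N \<eta>)} \<le> n)"

definition local_extrapolation ::
    "(pt \<Rightarrow> real) \<Rightarrow> real \<Rightarrow> (pt \<Rightarrow> pt set) \<Rightarrow> (pt \<Rightarrow> pt \<Rightarrow> real) \<Rightarrow> nat \<Rightarrow> real \<Rightarrow> real \<Rightarrow> bool"
  where "local_extrapolation \<psi> h N w n W \<kappa> \<longleftrightarrow>
    (axial_rule \<psi> h N w \<or> least_squares_rule \<psi> h N w n W) \<and> local_patches \<psi> h N n \<kappa>"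

text \<open>The columns of \<open>R_mat\<close> in the first and second vertex class form the blocks \<open>R\<^sub>1\<close>, \<open>R\<^sub>2\<close>.\<close>
definition R_mat :: "(pt \<Rightarrow> pt set) \<Rightarrow> (pt \<Rightarrow> pt \<Rightarrow> real) \<Rightarrow> pt \<Rightarrow> pt \<Rightarrow> real"
  where "R_mat N w \<eta> \<xi> = (if \<xi> \<in> N \<eta> then - w \<eta> \<xi> else 0)"

definition J_mat :: "(pt \<Rightarrow> real) \<Rightarrow> real \<Rightarrow> layer \<Rightarrow> (pt \<Rightarrow> pt set) \<Rightarrow> (pt \<Rightarrow> pt \<Rightarrow> real)
    \<Rightarrow> pt \<Rightarrow> pt \<Rightarrow> real"
  where "J_mat \<psi> h l N w \<eta> y =
    (\<Sum>x\<in>gam1 \<psi> h. R_mat N w \<eta> x * H_mat \<psi> h l x y) + R_mat N w \<eta> y"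

definition hat :: "real \<Rightarrow> real"
  where "hat t = max 0 (1 - \<bar>t\<bar>)"

text \<open>The bilinear nodal basis function of a vertex is a product of one-dimensional hat functions.\<close>
definition nodal :: "real \<Rightarrow> pt \<Rightarrow> pt \<Rightarrow> real"
  where "nodal h \<xi> x = hat ((x $ 1 - \<xi> $ 1) / h) * hat ((x $ 2 - \<xi> $ 2) / h)"

definition E_vec :: "(pt \<Rightarrow> real) \<Rightarrow> real \<Rightarrow> layer \<Rightarrow> (pt \<Rightarrow> pt set) \<Rightarrow> (pt \<Rightarrow> pt \<Rightarrow> real)
    \<Rightarrow> (pt \<Rightarrow> real) \<Rightarrow> pt \<Rightarrow> real"
  where "E_vec \<psi> h l N w v2 \<xi> =
    (if \<xi> \<in> gam1 \<psi> h then \<Sum>y\<in>gam2 \<psi> h. H_mat \<psi> h l \<xi> y * v2 y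
     else if \<xi> \<in> gam2 \<psi> h then v2 \<xi>
     else - (\<Sum>y\<in>gam2 \<psi> h. J_mat \<psi> h l N w \<xi> y * v2 y))"

definition V_red :: "(pt \<Rightarrow> real) \<Rightarrow> real \<Rightarrow> layer \<Rightarrow> (pt \<Rightarrow> pt set) \<Rightarrow> (pt \<Rightarrow> pt \<Rightarrow> real)
    \<Rightarrow> (pt \<Rightarrow> real) set"
  where "V_red \<psi> h l N w =
    {restrict (\<lambda>x. \<Sum>\<xi>\<in>gam \<psi> h. E_vec \<psi> h l N w v2 \<xi> * nodal h \<xi> x) (\<Union> (active_cells \<psi> h))
      | v2. True}"

definition W_red :: "(pt \<Rightarrow> real) \<Rightarrow> real \<Rightarrow> layer \<Rightarrow> (pt \<Rightarrow> pt set) \<Rightarrow> (pt \<Rightarrow> pt \<Rightarrow> real)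
    \<Rightarrow> (pt \<Rightarrow> real) set"
  where "W_red \<psi> h l N w = (\<lambda>v. restrict v (Gamh \<psi> h)) ` V_red \<psi> h l N w"

definition W_red0 :: "(pt \<Rightarrow> real) \<Rightarrow> real \<Rightarrow> layer \<Rightarrow> (pt \<Rightarrow> pt set) \<Rightarrow> (pt \<Rightarrow> pt \<Rightarrow> real)
    \<Rightarrow> (pt \<Rightarrow> real) set"
  where "W_red0 \<psi> h l N w = {v \<in> W_red \<psi> h l N w. Gamh_integral \<psi> h v = 0}"

definition reduced_trace_solution :: "(pt \<Rightarrow> real) \<Rightarrow> real \<Rightarrow> layer \<Rightarrow> (pt \<Rightarrow> pt set)
    \<Rightarrow> (pt \<Rightarrow> pt \<Rightarrow> real) \<Rightarrow> (pt \<Rightarrow> real) \<Rightarrow> (pt \<Rightarrow> real) \<Rightarrow> bool"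
  where "reduced_trace_solution \<psi> h l N w g uh \<longleftrightarrow> uh \<in> W_red0 \<psi> h l N w \<and>
    (\<forall>v\<in>W_red0 \<psi> h l N w.
      Gamh_integral \<psi> h (\<lambda>x. tgrad_h \<psi> h uh x \<bullet> tgrad_h \<psi> h v x)
        = Gamh_integral \<psi> h (\<lambda>x. g (proj \<psi> x) * v x))"

definition lifted :: "(pt \<Rightarrow> real) \<Rightarrow> real \<Rightarrow> (pt \<Rightarrow> real) \<Rightarrow> pt \<Rightarrow> real"
  where "lifted \<psi> h u x = u (proj \<psi> x)
    - Gamh_integral \<psi> h (\<lambda>y. u (proj \<psi> y)) / Gamh_integral \<psi> h (\<lambda>y. 1)"

definition problem_data :: "(real \<Rightarrow> pt) \<Rightarrow> real \<Rightarrow> (pt \<Rightarrow> real) \<Rightarrow> (pt \<Rightarrow> real) \<Rightarrow> bool"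
  where "problem_data c L g u \<longleftrightarrow>
    L2_curve c L g \<and> curve_integral c L g = 0 \<and>
    H2_curve c L u \<and> curve_integral c L u = 0 \<and>
    (AE s in lebesgue_on {0..L}. - laplace_beltrami c L u (c s) = g (c s))"

definition data_regularity :: "pt set \<Rightarrow> pt set \<Rightarrow> ((pt \<Rightarrow> real) \<Rightarrow> pt \<Rightarrow> real)
    \<Rightarrow> (pt \<Rightarrow> real) \<Rightarrow> real \<Rightarrow> real \<Rightarrow> bool"
  where "data_regularity \<Omega> T Ext U BE BI \<longleftrightarrow>
    Winf 4 (\<Omega> \<inter> T) U \<and> bounded_extension 4 \<Omega> Ext BE \<and> Winf 4 \<Omega> U \<and>
    Winf_norm 4 UNIV (Ext U) \<le> BE * Winf_norm 4 \<Omega> U \<and>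
    Winf_norm 4 \<Omega> U \<le> BI * Winf_norm 4 (\<Omega> \<inter> T) U"

text \<open>Moving the curve against the fixed mesh produces the different cut configurations.\<close>
definition rigid_motion :: "(pt \<Rightarrow> pt) \<Rightarrow> bool"
  where "rigid_motion M \<longleftrightarrow> (\<exists>a R. orthogonal_transformation R \<and> M = (\<lambda>x. a + R x))"

end

theory Submission
  imports Defs
begin

text \<open>The potential kernels with sources in \<open>gam2\<close> are discretely harmonic at the interior nodes. So
  for a smooth field \<open>V\<close> that is harmonic in the domain, the reduced vector with data \<open>V\<close> on \<open>gam2\<close>
  differs from \<open>V\<close> by a lattice function that vanishes on \<open>gam2\<close> and has five-point Laplacian
  \<open>O(h\<^sup>4)\<close> (undivided by \<open>h\<^sup>2\<close>) inside; the discrete maximum principle bounds it by \<open>O(h\<^sup>2)\<close>, whatever the condition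
  of the block \<open>P\<^sub>2\<close>, and affine exactness carries the bound over to \<open>gam3\<close>. Hence the reduced space
  contains a function whose nodal values are \<open>O(h\<^sup>2)\<close> and whose gradients are \<open>O(h)\<close> close to the
  extended solution, at any position of the cut. Constants are reproduced exactly, so its mean can be
  corrected inside the space. Strang's argument on the closed polygon, where integration by parts
  leaves no boundary terms and the load is a total derivative along the curve, gives the energy estimate.

  Fields with bounded weak derivatives up to fourth order are made classical by mollification: the
  mollified derivatives are bounded uniformly in the radius, so those up to third order converge
  uniformly at the rate of the radius.\<close>

section \<open>Mollification and weak derivatives\<close>

text \<open>No lower bound on the cut ratios is available, so edges of the polygon can be
  arbitrarily short and inverse inequalities on them are out of reach. Every geometric and
  consistency error is therefore measured relative to the length of its own edge, and the passage
  from energy to values goes through the total variation, in which edge lengths do not appear. A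
  first-order rate tolerates geometric errors of relative size h; these are derived from the
  curvature bound by describing the closest-point projection on each chord explicitly. The constants
  are built from length, curvature bound, radius of the domain and the data of extrapolation and
  extension, the threshold for h also from a modulus of injectivity of the curve. All of these are
  invariant under rigid motions, whence the uniformity in the cut position. Fourth derivatives of
  the extended field exist only weakly; they enter solely through the five-point defect, whose bound
  is proved for the mollified fields and survives the limit.\<close>

inductive_set fun_alg :: "(real \<Rightarrow> real) set \<Rightarrow> (real \<Rightarrow> real) set" for G where
  fun_alg_gen: "f \<in> G \<Longrightarrow> f \<in> fun_alg G"
| fun_alg_const: "(\<lambda>x. a) \<in> fun_alg G"
| fun_alg_add: "f \<in> fun_alg G \<Longrightarrow> g \<in> fun_alg G \<Longrightarrow> (\<lambda>x. f x + g x) \<in> fun_alg G"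
| fun_alg_mult: "f \<in> fun_alg G \<Longrightarrow> g \<in> fun_alg G \<Longrightarrow> (\<lambda>x. f x * g x) \<in> fun_alg G"

text \<open>Sum and product rules propagate closure under differentiation from the generators to the
  whole algebra. Smoothness of a bump then only requires generators whose derivatives are again
  polynomials in generators, and no formula for n-th derivatives.\<close>

lemma fun_alg_has_derivative:
  assumes G: "\<And>f. f \<in> G \<Longrightarrow> \<exists>f'\<in>fun_alg G. \<forall>x. (f has_real_derivative f' x) (at x)"
    and "f \<in> fun_alg G"
  shows "\<exists>f'\<in>fun_alg G. \<forall>x. (f has_real_derivative f' x) (at x)"
  using assms(2)
proof induction
  case (fun_alg_gen f) then show ?case using G by blast
next
  case (fun_alg_const a)
  then show ?case by (intro bexI[of _ "\<lambda>x. 0"]) (auto intro: fun_alg.fun_alg_const)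
next
  case (fun_alg_add f g)
  then obtain f' g' where "f' \<in> fun_alg G" "g' \<in> fun_alg G"
    "\<And>x. (f has_real_derivative f' x) (at x)" "\<And>x. (g has_real_derivative g' x) (at x)" by blast
  then show ?case
    by (intro bexI[of _ "\<lambda>x. f' x + g' x"]) (auto intro: fun_alg.fun_alg_add DERIV_add)
next
  case (fun_alg_mult f g)
  then obtain f' g' where "f' \<in> fun_alg G" "g' \<in> fun_alg G"
    "\<And>x. (f has_real_derivative f' x) (at x)" "\<And>x. (g has_real_derivative g' x) (at x)" by blast
  with fun_alg_mult.hyps show ?case
    by (intro bexI[of _ "\<lambda>x. f' x * g x + g' x * f x"])
      (auto intro!: fun_alg.fun_alg_add fun_alg.fun_alg_mult DERIV_mult)
qed

lemma fun_alg_deriv_funpow: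
  assumes G: "\<And>f. f \<in> G \<Longrightarrow> \<exists>f'\<in>fun_alg G. \<forall>x. (f has_real_derivative f' x) (at x)"
    and f: "f \<in> fun_alg G"
  shows "((deriv ^^ n) f has_real_derivative (deriv ^^ Suc n) f x) (at x)"
proof -
  have step: "deriv g \<in> fun_alg G \<and> (\<forall>x. (g has_real_derivative deriv g x) (at x))" if "g \<in> fun_alg G" for g
  proof -
    have "\<exists>g'\<in>fun_alg G. \<forall>x. (g has_real_derivative g' x) (at x)"
      by (rule fun_alg_has_derivative[OF G that])
    then obtain g' where g': "g' \<in> fun_alg G" "\<And>x. (g has_real_derivative g' x) (at x)"
      by blast
    then have "deriv g = g'" by (auto intro: DERIV_imp_deriv)
    with g' show ?thesis by simp
  qed
  have "(deriv ^^ n) f \<in> fun_alg G" by (induction n) (auto simp: f step)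
  then show ?thesis using step by simp
qed

text \<open>The classical exp(-1/x), continued by zero, times powers of 1/x. The exponent
  \<open>k\<close> is a parameter because the derivative of \<open>flat k\<close> is a combination
  of \<open>flat (k + 2)\<close> and \<open>flat (k + 1)\<close>, so that only the whole family is
  closed under differentiation.\<close>

definition flat :: "nat \<Rightarrow> real \<Rightarrow> real"
  where "flat k x = (if 0 < x then (1 / x) ^ k * exp (- (1 / x)) else 0)"

lemma flat_tendsto_0: "((\<lambda>x. (1 / x) ^ k * exp (- (1 / x))) \<longlongrightarrow> 0) (at_right (0::real))"
proof -
  have "((\<lambda>x. x ^ k / exp x) \<longlongrightarrow> 0) (at_top :: real filter)" by (rule tendsto_power_div_exp_0)
  from filterlim_compose[OF this filterlim_inverse_at_top_right]
  show ?thesis by (simp add: exp_minus divide_inverse)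
qed

lemma flat_has_derivative:
  "(flat k has_real_derivative flat (k + 2) x - real k * flat (k + 1) x) (at x)"
proof -
  consider "x > 0" | "x < 0" | "x = 0" by linarith
  then show ?thesis
  proof cases
    case 1
    have "((\<lambda>x. (1 / x) ^ k * exp (- (1 / x))) has_real_derivative
        real k * (1 / x) ^ (k - Suc 0) * (- 1 / x\<^sup>2) * exp (- (1 / x)) + (1 / x) ^ k * (exp (- (1 / x)) * (1 / x\<^sup>2))) (at x)"
      using 1 by (auto intro!: derivative_eq_intros simp: power2_eq_square)
    moreover have "real k * (1 / x) ^ (k - Suc 0) * (- 1 / x\<^sup>2) * exp (- (1 / x)) + (1 / x) ^ k * (exp (- (1 / x)) * (1 / x\<^sup>2))
        = flat (k + 2) x - real k * flat (k + 1) x"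
      using 1 by (cases k) (auto simp: flat_def power_divide power2_eq_square field_simps)
    ultimately have "((\<lambda>x. (1 / x) ^ k * exp (- (1 / x))) has_real_derivative flat (k + 2) x - real k * flat (k + 1) x) (at x)"
      by simp
    moreover have "\<forall>\<^sub>F y in nhds x. flat k y = (1 / y) ^ k * exp (- (1 / y))"
      using eventually_nhds_in_open[of "{0<..}" x] 1 by (auto elim!: eventually_mono simp: flat_def)
    ultimately show ?thesis by (subst DERIV_cong_ev[OF refl _ refl]) auto
  next
    case 2
    have "\<forall>\<^sub>F y in nhds x. flat k y = 0"
      using eventually_nhds_in_open[of "{..<0}" x] 2 by (auto elim!: eventually_mono simp: flat_def)
    moreover have "((\<lambda>x. 0) has_real_derivative flat (k + 2) x - real k * flat (k + 1) x) (at x)"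
      using 2 by (auto simp: flat_def)
    ultimately show ?thesis by (subst DERIV_cong_ev[OF refl _ refl]) auto
  next
    case 3
    \<comment> \<open>At the origin the difference quotient from the right is the same expression
      with exponent \<open>Suc k\<close>, so the limit just established for all exponents applies
      again.\<close>
    have r: "((\<lambda>y. flat k y / y) \<longlongrightarrow> 0) (at_right 0)"
    proof (rule Lim_transform_eventually[OF flat_tendsto_0[of "Suc k"]])
      show "\<forall>\<^sub>F x in at_right 0. (1 / x) ^ Suc k * exp (- (1 / x)) = flat k x / x"
        using eventually_at_right_less[of 0] by eventually_elim (auto simp: flat_def field_simps)
    qed
    have l: "((\<lambda>y. flat k y / y) \<longlongrightarrow> 0) (at_left 0)"
    proof (rule Lim_transform_eventually[OF tendsto_const])
      show "\<forall>\<^sub>F x in at_left 0. 0 = flat k x / x"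
        using eventually_at_left_real[of "-1" 0] by (auto elim!: eventually_mono simp: flat_def)
    qed
    have "((\<lambda>y. flat k y / y) \<longlongrightarrow> 0) (at 0)" using l r by (simp add: filterlim_at_split)
    then show ?thesis using 3 by (simp add: has_field_derivative_iff flat_def)
  qed
qed

lemma flat_nonneg: "0 \<le> flat k x" by (simp add: flat_def)

text \<open>The inner function e^2 - t^2 contributes the factor -2t, so adding the identity to the
  generators closes the algebra under differentiation. The bump is positive for |t| < |e| and zero
  elsewhere.\<close>

lemma flat_bump_has_derivative:
  "((deriv ^^ n) (\<lambda>t. flat 0 (e\<^sup>2 - t\<^sup>2)) has_real_derivative (deriv ^^ Suc n) (\<lambda>t. flat 0 (e\<^sup>2 - t\<^sup>2)) x) (at x)"
proof -
  let ?G = "insert (\<lambda>t. t) (range (\<lambda>k t. flat k (e\<^sup>2 - t\<^sup>2)))"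
  show ?thesis
  proof (rule fun_alg_deriv_funpow[of ?G])
    fix f assume "f \<in> ?G"
    then consider "f = (\<lambda>t. t)" | k where "f = (\<lambda>t. flat k (e\<^sup>2 - t\<^sup>2))" by auto
    then show "\<exists>f'\<in>fun_alg ?G. \<forall>x. (f has_real_derivative f' x) (at x)"
    proof cases
      case 1 then show ?thesis
        by (intro bexI[of _ "\<lambda>x. 1"]) (auto intro: fun_alg_const)
    next
      case 2
      show ?thesis
      proof (intro bexI[of _ "\<lambda>t. (flat (k + 2) (e\<^sup>2 - t\<^sup>2) + (- real k) * flat (k + 1) (e\<^sup>2 - t\<^sup>2)) * ((- 2) * t)"] allI)
        fix x
        have "((\<lambda>t. e\<^sup>2 - t\<^sup>2) has_real_derivative - 2 * x) (at x)"
          by (auto intro!: derivative_eq_intros)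
        from DERIV_chain2[OF flat_has_derivative this]
        show "(f has_real_derivative (flat (k + 2) (e\<^sup>2 - x\<^sup>2) + (- real k) * flat (k + 1) (e\<^sup>2 - x\<^sup>2)) * ((- 2) * x)) (at x)"
          using 2 by simp
      next
        show "(\<lambda>t. (flat (k + 2) (e\<^sup>2 - t\<^sup>2) + (- real k) * flat (k + 1) (e\<^sup>2 - t\<^sup>2)) * ((- 2) * t)) \<in> fun_alg ?G"
          by (intro fun_alg_mult fun_alg_add fun_alg_const) (auto intro: fun_alg_gen)
      qed
    qed
  qed (auto intro: fun_alg_gen)
qed

text \<open>A derivative depends only on values near the point, so vanishing on an open set passes
  up the sequence of derivatives. This gives the support of all derivatives of a bump at
  once.\<close>

lemma smooth_vanish:
  assumes D: "\<And>n x. ((D n :: real \<Rightarrow> real) has_real_derivative D (Suc n) x) (at x)"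
    and S: "open S" "\<And>x. x \<in> S \<Longrightarrow> D 0 x = 0" and "x \<in> S"
  shows "D n x = 0"
  using \<open>x \<in> S\<close>
proof (induction n arbitrary: x)
  case 0 then show ?case using S by simp
next
  case (Suc n)
  have "\<forall>\<^sub>F y in nhds x. D n y = 0"
    using eventually_nhds_in_open[OF S(1) Suc.prems] by eventually_elim (rule Suc.IH)
  then have "(D n has_real_derivative 0) (at x)" by (subst DERIV_cong_ev[OF refl _ refl]) auto
  then show ?case using D DERIV_unique by blast
qed

section \<open>Families of partial derivatives in the plane\<close>

text \<open>A function together with all its mixed partial derivatives: \<open>R i j\<close> is
  differentiated \<open>i\<close> times in the first and \<open>j\<close> times in the second
  coordinate. Carrying the family along makes equality of mixed derivatives a matter of indexing and
  replaces iterated \<open>frechet_derivative\<close> terms by named functions.\<close>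

definition pd_tower :: "(nat \<Rightarrow> nat \<Rightarrow> pt \<Rightarrow> real) \<Rightarrow> bool"
  where "pd_tower R \<longleftrightarrow> (\<forall>i j x.
    (R i j has_derivative (\<lambda>k. k $ 1 * R (Suc i) j x + k $ 2 * R i (Suc j) x)) (at x))"

lemma pd_tower_pd:
  assumes "pd_tower R"
  shows "pd 1 (R i j) = R (Suc i) j" "pd 2 (R i j) = R i (Suc j)"
proof -
  have "frechet_derivative (R i j) (at x) = (\<lambda>k. k $ 1 * R (Suc i) j x + k $ 2 * R i (Suc j) x)" for x
    using assms frechet_derivative_at[symmetric] unfolding pd_tower_def by blast
  then show "pd 1 (R i j) = R (Suc i) j" "pd 2 (R i j) = R i (Suc j)"
    by (auto simp: pd_def axis_def fun_eq_iff)
qed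

lemma pd_tower_funpow:
  assumes "pd_tower R"
  shows "(pd 1 ^^ i) ((pd 2 ^^ j) (R 0 0)) = R i j"
proof -
  have "(pd 2 ^^ j) (R 0 0) = R 0 j" by (induction j) (simp_all add: pd_tower_pd[OF assms])
  moreover have "(pd 1 ^^ i) (R 0 j) = R i j" by (induction i) (simp_all add: pd_tower_pd[OF assms])
  ultimately show ?thesis by simp
qed

text \<open>\<open>smooth_fun\<close> asks for all words of partial derivatives in any order; each
  word lands on an entry \<open>R i j\<close>, because a letter only raises one of the two
  indices.\<close>

lemma pd_tower_smooth:
  assumes "pd_tower R"
  shows "smooth_fun (R 0 0)"
proof -
  have "\<exists>i j. foldr pd ks (R 0 0) = R i j" for ks
  proof (induction ks)
    case (Cons k ks)
    then obtain i j where "foldr pd ks (R 0 0) = R i j" by blast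
    moreover have "k = 1 \<or> k = 2" by (rule exhaust_2)
    ultimately show ?case by (elim disjE) (simp only: foldr.simps o_apply pd_tower_pd[OF assms]; blast)+
  qed auto
  moreover have "R i j differentiable_on UNIV" for i j
    using assms unfolding pd_tower_def differentiable_on_def differentiable_def by blast
  ultimately show ?thesis unfolding smooth_fun_def by metis
qed

text \<open>The test function that evaluates a mollification at \<open>x\<close> is the reflected
  kernel y -> phi(x - y). The sign collected here in order i + j is the one in the definition of a
  weak derivative.\<close>

lemma pd_tower_reflect:
  assumes "pd_tower R"
  shows "pd_tower (\<lambda>i j y. (- 1) ^ (i + j) * R i j (x - y))"
  unfolding pd_tower_def
proof (intro allI)
  fix i j y
  have "(R i j has_derivative (\<lambda>k. k $ 1 * R (Suc i) j (x - y) + k $ 2 * R i (Suc j) (x - y))) (at (x - y))"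
    using assms unfolding pd_tower_def by blast
  moreover have "((\<lambda>y. x - y) has_derivative (\<lambda>k. - k)) (at y)"
    by (auto intro!: derivative_eq_intros)
  ultimately have "((\<lambda>y. R i j (x - y)) has_derivative (\<lambda>k. (- k) $ 1 * R (Suc i) j (x - y) + (- k) $ 2 * R i (Suc j) (x - y))) (at y)"
    by (rule has_derivative_compose[rotated])
  from has_derivative_mult_right[OF this, of "(- 1) ^ (i + j)"]
  show "((\<lambda>y. (- 1) ^ (i + j) * R i j (x - y)) has_derivative
    (\<lambda>k. k $ 1 * ((- 1) ^ (Suc i + j) * R (Suc i) j (x - y)) + k $ 2 * ((- 1) ^ (i + Suc j) * R i (Suc j) (x - y)))) (at y)"
    by (rule has_derivative_eq_rhs) (auto simp: algebra_simps)
qed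

lemma pd_tower_tensor:
  assumes D: "\<And>n x. ((D n :: real \<Rightarrow> real) has_real_derivative D (Suc n) x) (at x)"
  shows "pd_tower (\<lambda>i j x. a * (D i (x $ 1) * D j (x $ 2)))"
  unfolding pd_tower_def
proof (intro allI)
  fix i j and x :: pt
  have *: "((\<lambda>x. D n (x $ k)) has_derivative (\<lambda>v. v $ k * D (Suc n) (x $ k))) (at x)" for n k
  proof -
    have "((\<lambda>x::pt. x $ k) has_derivative (\<lambda>v. v $ k)) (at x)"
      by (rule bounded_linear_imp_has_derivative) (rule bounded_linear_vec_nth)
    from has_derivative_compose[OF this D[THEN has_field_derivative_imp_has_derivative]]
    show ?thesis by (simp add: mult.commute)
  qed
  show "((\<lambda>x. a * (D i (x $ 1) * D j (x $ 2))) has_derivative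
     (\<lambda>k. k $ 1 * (a * (D (Suc i) (x $ 1) * D j (x $ 2))) + k $ 2 * (a * (D i (x $ 1) * D (Suc j) (x $ 2))))) (at x)"
    by (rule has_derivative_eq_rhs[OF has_derivative_mult_right[OF has_derivative_mult[OF * *]]])
      (auto simp: algebra_simps)
qed

lemma pd_tower_continuous:
  assumes "pd_tower R" shows "continuous_on S (R i j)"
proof (rule continuous_at_imp_continuous_on, rule ballI)
  fix x
  have "(R i j has_derivative (\<lambda>k. k $ 1 * R (Suc i) j x + k $ 2 * R i (Suc j) x)) (at x)"
    using assms unfolding pd_tower_def by blast
  then show "isCont (R i j) x" by (rule has_derivative_continuous)
qed

section \<open>Convolution with compactly supported kernels\<close>

lemma lborel_integral_reflect:
  fixes g :: "'a::euclidean_space \<Rightarrow> real"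
  assumes [measurable]: "g \<in> borel_measurable borel"
  shows "(LINT y|lborel. g (x - y)) = (LINT y|lborel. g y)"
proof -
  have "lborel = distr lborel borel (\<lambda>y. x - y)"
    using lborel_affine[of "- 1" x] by (simp add: density_1)
  then have "(LINT y|lborel. g y) = (LINT y|distr lborel borel (\<lambda>y. x - y). g y)" by simp
  also have "\<dots> = (LINT y|lborel. g (x - y))" by (rule integral_distr) auto
  finally show ?thesis by simp
qed

lemma lborel_integrable_compact_support:
  fixes g :: "'a::euclidean_space \<Rightarrow> real"
  assumes [measurable]: "g \<in> borel_measurable borel"
    and "bounded S" "\<And>x. x \<notin> S \<Longrightarrow> g x = 0" "\<And>x. \<bar>g x\<bar> \<le> b"
  shows "integrable lborel g"
proof -
  obtain a where a: "S \<subseteq> cbox (- a) a"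
    using bounded_subset_cbox_symmetric[OF \<open>bounded S\<close>] by blast
  have "emeasure lborel (cbox (- a) a) < \<infinity>" by (rule emeasure_lborel_cbox_finite)
  then have "integrable lborel (\<lambda>x. indicator (cbox (- a) a) x * b :: real)"
    by (intro integrable_mult_left integrable_real_indicator) auto
  then show ?thesis
  proof (rule Bochner_Integration.integrable_bound)
  show "AE x in lborel. norm (g x) \<le> norm (indicator (cbox (- a) a) x * b :: real)"
  proof (intro AE_I2)
    fix x show "norm (g x) \<le> norm (indicator (cbox (- a) a) x * b :: real)"
      using assms(3)[of x] assms(4)[of x] a by (cases "x \<in> cbox (- a) a") auto
  qed
  qed measurable
qed

definition conv2 :: "(pt \<Rightarrow> real) \<Rightarrow> (pt \<Rightarrow> real) \<Rightarrow> pt \<Rightarrow> real"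
  where "conv2 f \<phi> x = (LINT y|lborel. f y * \<phi> (x - y))"

lemma conv2_integrable:
  fixes f \<phi> :: "pt \<Rightarrow> real"
  assumes [measurable]: "f \<in> borel_measurable borel" "\<phi> \<in> borel_measurable borel"
    and f: "\<And>y. \<bar>f y\<bar> \<le> b" and S: "bounded S" "\<And>x. x \<notin> S \<Longrightarrow> \<phi> x = 0" and b': "\<And>x. \<bar>\<phi> x\<bar> \<le> b'"
  shows "integrable lborel (\<lambda>y. f y * \<phi> (x - y))"
proof (rule lborel_integrable_compact_support)
  show "bounded ((\<lambda>y. x - y) ` S)" 
  proof -
    obtain r where "\<And>y. y \<in> S \<Longrightarrow> norm y \<le> r" using S(1) bounded_iff by blast
    then have "\<forall>z\<in>(\<lambda>y. x - y) ` S. norm z \<le> norm x + r"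
      by (auto intro: order_trans[OF norm_triangle_ineq4])
    then show ?thesis using bounded_iff by blast
  qed
  show "f y * \<phi> (x - y) = 0" if "y \<notin> (\<lambda>y. x - y) ` S" for y
  proof -
    have "x - y \<notin> S" using that by (metis add_diff_cancel_left' diff_add_cancel image_eqI)
    then show ?thesis using S by simp
  qed
  show "\<bar>f y * \<phi> (x - y)\<bar> \<le> b * b'" for y
    using f[of y] b'[of "x - y"] by (auto simp: abs_mult intro!: mult_mono)
qed measurable

text \<open>By Fubini either side is the integral of \<open>w\<close> against the convolution of the
  two kernels, and the reflection x -> z + y - x shows that convolution to be symmetric. This makes
  mollifications with two different radii comparable.\<close>

lemma conv2_commute:
  assumes [measurable]: "w \<in> borel_measurable borel" "\<rho> \<in> borel_measurable borel" "\<sigma> \<in> borel_measurable borel"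
    and w: "\<And>y. \<bar>w y\<bar> \<le> b"
    and S: "bounded S" "\<And>x. x \<notin> S \<Longrightarrow> \<rho> x = 0" "\<And>x. x \<notin> S \<Longrightarrow> \<sigma> x = 0"
    and b': "\<And>x. \<bar>\<rho> x\<bar> \<le> b'" "\<And>x. \<bar>\<sigma> x\<bar> \<le> b'"
  shows "conv2 (conv2 w \<rho>) \<sigma> z = conv2 (conv2 w \<sigma>) \<rho> z"
proof -
  have key: "conv2 (conv2 w \<rho>) \<sigma> z = (LINT y|lborel. w y * (LINT x|lborel. \<sigma> (z - x) * \<rho> (x - y)))"
    if [measurable]: "\<rho> \<in> borel_measurable borel" "\<sigma> \<in> borel_measurable borel"
    and S2: "\<And>x. x \<notin> S \<Longrightarrow> \<rho> x = 0" "\<And>x. x \<notin> S \<Longrightarrow> \<sigma> x = 0"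
    and b': "\<And>x. \<bar>\<rho> x\<bar> \<le> b'" "\<And>x. \<bar>\<sigma> x\<bar> \<le> b'" for \<rho> \<sigma>
  proof -
    let ?F = "\<lambda>(x, y). \<sigma> (z - x) * (w y * \<rho> (x - y))"
    obtain r where r: "\<And>x. x \<in> S \<Longrightarrow> norm x \<le> r" using S(1) bounded_iff by blast
    have "?F \<in> borel_measurable (borel \<Otimes>\<^sub>M borel)" by measurable
    then have Fm: "?F \<in> borel_measurable borel" unfolding borel_prod .
    have "integrable lborel ?F"
    proof (rule lborel_integrable_compact_support)
      \<comment> \<open>The factor with \<open>\<sigma>\<close> confines x to distance r from z, and
        then the factor with \<open>\<rho>\<close> confines y to distance r from x.\<close>
      show "bounded (cball 0 (norm z + \<bar>r\<bar>) \<times> cball (0::pt) (norm z + 2 * \<bar>r\<bar>) :: (pt \<times> pt) set)"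
        by (intro bounded_Times) auto
      show "?F p = 0" if "p \<notin> cball 0 (norm z + \<bar>r\<bar>) \<times> cball (0::pt) (norm z + 2 * \<bar>r\<bar>)" for p
      proof (cases p)
        case (Pair x y)
        have "z - x \<notin> S \<or> x - y \<notin> S"
        proof (rule ccontr)
          assume "\<not> ?thesis"
          then have "norm (z - x) \<le> r" "norm (x - y) \<le> r" using r by auto
          moreover have "norm x \<le> norm z + norm (z - x)"
            by (metis norm_minus_commute norm_triangle_sub)
          moreover have "norm y \<le> norm x + norm (x - y)"
            by (metis norm_minus_commute norm_triangle_sub)
          ultimately show False using that Pair by auto
        qed
        then show ?thesis using S2 Pair by auto
      qed
      show "\<bar>?F p\<bar> \<le> b' * (b * b')" for p
      proof (cases p)
        case (Pair x y)
        have "\<bar>\<sigma> (z - x) * (w y * \<rho> (x - y))\<bar> = \<bar>\<sigma> (z - x)\<bar> * (\<bar>w y\<bar> * \<bar>\<rho> (x - y)\<bar>)" by (simp add: abs_mult)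
        also have "\<dots> \<le> b' * (b * b')"
          using b'(2)[of "z - x"] b'(1)[of "x - y"] w[of y] by (intro mult_mono) auto
        finally show ?thesis using Pair by simp
      qed
    qed (fact Fm)
    then have int: "integrable (lborel \<Otimes>\<^sub>M lborel) ?F" by (simp add: lborel_prod)
    have "conv2 (conv2 w \<rho>) \<sigma> z = (LINT x|lborel. LINT y|lborel. ?F (x, y))"
      unfolding conv2_def by (simp add: mult.commute[of _ "\<sigma> _"] flip: integral_mult_right_zero)
    also have "\<dots> = (LINT y|lborel. LINT x|lborel. ?F (x, y))"
      using lborel_pair.Fubini_integral[of "\<lambda>x y. ?F (x, y)"] int by (simp add: case_prod_unfold)
    also have "\<dots> = (LINT y|lborel. w y * (LINT x|lborel. \<sigma> (z - x) * \<rho> (x - y)))"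
      by (simp add: mult.left_commute[of "\<sigma> _"] flip: integral_mult_right_zero)
    finally show ?thesis .
  qed
  have "(LINT x|lborel. \<sigma> (z - x) * \<rho> (x - y)) = (LINT x|lborel. \<rho> (z - x) * \<sigma> (x - y))" for y
  proof -
    have "(LINT x|lborel. \<sigma> (z - (z + y - x)) * \<rho> (z + y - x - y)) = (LINT x|lborel. \<sigma> (z - x) * \<rho> (x - y))"
      by (rule lborel_integral_reflect[of "\<lambda>x. \<sigma> (z - x) * \<rho> (x - y)" "z + y"]) measurable
    then show ?thesis by (simp add: algebra_simps)
  qed
  then show ?thesis
    using key[of \<rho> \<sigma>] key[of \<sigma> \<rho>] assms by simp
qed

lemma conv2_bound:
  assumes [measurable]: "w \<in> borel_measurable borel" "\<rho> \<in> borel_measurable borel"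
    and w: "\<And>y. \<bar>w y\<bar> \<le> b" and S: "bounded S" "\<And>x. x \<notin> S \<Longrightarrow> \<rho> x = 0" 
    and b': "\<And>x. \<bar>\<rho> x\<bar> \<le> b'" and pos: "\<And>x. 0 \<le> \<rho> x" and one: "(LINT x|lborel. \<rho> x) = 1"
  shows "\<bar>conv2 w \<rho> x\<bar> \<le> b"
proof -
  have "\<bar>conv2 w \<rho> x\<bar> \<le> (LINT y|lborel. \<bar>w y * \<rho> (x - y)\<bar>)"
    unfolding conv2_def by (rule integral_abs_bound)
  also have "\<dots> \<le> (LINT y|lborel. b * \<rho> (x - y))"
  proof (rule integral_mono)
    show "integrable lborel (\<lambda>y. \<bar>w y * \<rho> (x - y)\<bar>)"
      by (intro integrable_abs conv2_integrable[where b=b and S=S and b'=b']) (use assms in auto)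
    show "integrable lborel (\<lambda>y. b * \<rho> (x - y))"
      by (intro conv2_integrable[where b="\<bar>b\<bar>" and S=S and b'=b']) (use assms in auto)
    show "\<bar>w y * \<rho> (x - y)\<bar> \<le> b * \<rho> (x - y)" for y
      using w[of y] pos[of "x - y"] by (auto simp: abs_mult intro: mult_right_mono)
  qed
  also have "\<dots> = b" using lborel_integral_reflect[of \<rho> x] one by simp
  finally show ?thesis .
qed

text \<open>Because the kernel has mass one, \<open>a\<close> can be put under the integral, where
  only points with \<open>x - y\<close> in the support count. Closeness is thus required locally,
  while \<open>v\<close> is merely bounded elsewhere.\<close>

lemma conv2_close:
  assumes [measurable]: "v \<in> borel_measurable borel" "\<rho> \<in> borel_measurable borel"
    and v: "\<And>y. \<bar>v y\<bar> \<le> b" and S: "bounded S" "\<And>x. x \<notin> S \<Longrightarrow> \<rho> x = 0" 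
    and b': "\<And>x. \<bar>\<rho> x\<bar> \<le> b'" and pos: "\<And>x. 0 \<le> \<rho> x" and one: "(LINT x|lborel. \<rho> x) = 1"
    and close: "\<And>y. x - y \<in> S \<Longrightarrow> \<bar>v y - a\<bar> \<le> \<delta>"
  shows "\<bar>conv2 v \<rho> x - a\<bar> \<le> \<delta>"
proof -
  have i1: "integrable lborel (\<lambda>y. v y * \<rho> (x - y))"
    by (intro conv2_integrable[where b=b and S=S and b'=b']) (use assms in auto)
  have i2: "integrable lborel (\<lambda>y. c * \<rho> (x - y))" for c
    by (intro conv2_integrable[where b="\<bar>c\<bar>" and S=S and b'=b']) (use assms in auto)
  have c: "(LINT y|lborel. c * \<rho> (x - y)) = c" for c
    using lborel_integral_reflect[of \<rho> x] one by simp
  have "conv2 v \<rho> x - a = (LINT y|lborel. v y * \<rho> (x - y) - a * \<rho> (x - y))"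
    unfolding conv2_def using i1 i2[of a] c[of a] by (subst Bochner_Integration.integral_diff) auto
  then have "\<bar>conv2 v \<rho> x - a\<bar> \<le> (LINT y|lborel. \<bar>v y * \<rho> (x - y) - a * \<rho> (x - y)\<bar>)"
    by (metis integral_abs_bound)
  also have "\<dots> \<le> (LINT y|lborel. \<delta> * \<rho> (x - y))"
  proof (rule integral_mono)
    fix y
    show "\<bar>v y * \<rho> (x - y) - a * \<rho> (x - y)\<bar> \<le> \<delta> * \<rho> (x - y)"
    proof (cases "x - y \<in> S")
      case True
      have "\<bar>v y * \<rho> (x - y) - a * \<rho> (x - y)\<bar> = \<bar>v y - a\<bar> * \<rho> (x - y)"
        using pos[of "x - y"] by (simp add: abs_mult flip: left_diff_distrib)
      then show ?thesis using close[OF True] pos[of "x - y"] by (simp add: mult_right_mono)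
    qed (use S in simp)
  qed (use i1 i2 in auto)
  also have "\<dots> = \<delta>" by (rule c)
  finally show ?thesis .
qed

text \<open>The line through \<open>x\<close> in direction \<open>k\<close> reduces this to Taylor's
  formula in one variable. The second derivative there is a sum of four products bounded by M |k|^2,
  halved by the factorial. Differentiability is assumed only up to one order beyond the base entry,
  so the lemma also serves families that stop at second derivatives.\<close>

lemma second_order_expansion:
  assumes R: "\<And>i j x. i + j \<le> Suc (i0 + j0) \<Longrightarrow>
      (R i j has_derivative (\<lambda>k. k $ 1 * R (Suc i) j x + k $ 2 * R i (Suc j) x)) (at x)"
    and M: "\<And>i j x. i + j = 2 \<Longrightarrow> \<bar>R (i0 + i) (j0 + j) x\<bar> \<le> M"
  shows "\<bar>R i0 j0 (x + k) - R i0 j0 x - (k $ 1 * R (Suc i0) j0 x + k $ 2 * R i0 (Suc j0) x)\<bar> \<le> 2 * M * (norm k)\<^sup>2"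
proof -
  define g where "g n t = (if n = 0 then R i0 j0 (x + t *\<^sub>R k)
    else if n = 1 then k $ 1 * R (Suc i0) j0 (x + t *\<^sub>R k) + k $ 2 * R i0 (Suc j0) (x + t *\<^sub>R k)
    else (k $ 1)\<^sup>2 * R (Suc (Suc i0)) j0 (x + t *\<^sub>R k) + 2 * k $ 1 * k $ 2 * R (Suc i0) (Suc j0) (x + t *\<^sub>R k)
      + (k $ 2)\<^sup>2 * R i0 (Suc (Suc j0)) (x + t *\<^sub>R k))" for n :: nat and t :: real
  have d: "((\<lambda>t. R i j (x + t *\<^sub>R k)) has_real_derivative
     k $ 1 * R (Suc i) j (x + t *\<^sub>R k) + k $ 2 * R i (Suc j) (x + t *\<^sub>R k)) (at t)"
    if "i + j \<le> Suc (i0 + j0)" for i j t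
  proof -
    have "((\<lambda>t. x + t *\<^sub>R k) has_derivative (\<lambda>s. s *\<^sub>R k)) (at t)"
      by (auto intro!: derivative_eq_intros)
    moreover have "(R i j has_derivative (\<lambda>v. v $ 1 * R (Suc i) j (x + t *\<^sub>R k) + v $ 2 * R i (Suc j) (x + t *\<^sub>R k))) (at (x + t *\<^sub>R k))"
      by (rule R[OF that])
    ultimately have "((\<lambda>t. R i j (x + t *\<^sub>R k)) has_derivative
      (\<lambda>s. (s *\<^sub>R k) $ 1 * R (Suc i) j (x + t *\<^sub>R k) + (s *\<^sub>R k) $ 2 * R i (Suc j) (x + t *\<^sub>R k))) (at t)"
      by (rule has_derivative_compose)
    then show ?thesis
      unfolding has_field_derivative_def by (rule has_derivative_eq_rhs) (auto simp: algebra_simps)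
  qed
  have dg: "(g n has_real_derivative g (Suc n) t) (at t)" if "n < 2" for n t
  proof -
    have "n = 0 \<or> n = 1" using that by linarith
    then consider "n = 0" | "n = 1" by blast
    then show ?thesis
    proof cases
      case 1
      have "g 0 = (\<lambda>t. R i0 j0 (x + t *\<^sub>R k))" by (simp add: g_def fun_eq_iff)
      then show ?thesis using 1 d[of i0 j0 t] by (simp add: g_def)
    next
      case 2
      have "((\<lambda>t. k $ 1 * R (Suc i0) j0 (x + t *\<^sub>R k) + k $ 2 * R i0 (Suc j0) (x + t *\<^sub>R k)) has_real_derivative
        k $ 1 * (k $ 1 * R (Suc (Suc i0)) j0 (x + t *\<^sub>R k) + k $ 2 * R (Suc i0) (Suc j0) (x + t *\<^sub>R k))
        + k $ 2 * (k $ 1 * R (Suc i0) (Suc j0) (x + t *\<^sub>R k) + k $ 2 * R i0 (Suc (Suc j0)) (x + t *\<^sub>R k))) (at t)"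
        by (intro DERIV_add DERIV_cmult d) auto
      moreover have "g 1 = (\<lambda>t. k $ 1 * R (Suc i0) j0 (x + t *\<^sub>R k) + k $ 2 * R i0 (Suc j0) (x + t *\<^sub>R k))"
        by (simp add: g_def fun_eq_iff)
      ultimately show ?thesis using 2 by (simp add: g_def power2_eq_square algebra_simps)
    qed
  qed
  obtain t where t: "g 0 1 = (\<Sum>m<2. g m 0 / fact m * 1 ^ m) + g 2 t / fact 2 * 1 ^ 2"
    using Maclaurin2[of 1 g "g 0" 2] dg by auto
  have s: "R i0 j0 (x + k) - R i0 j0 x - (k $ 1 * R (Suc i0) j0 x + k $ 2 * R i0 (Suc j0) x) = g 2 t / 2"
    using t by (simp add: g_def eval_nat_numeral)
  have c: "\<bar>k $ i\<bar> \<le> norm k" for i by (rule component_le_norm_cart)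
  have M': "\<bar>R (Suc (Suc i0)) j0 y\<bar> \<le> M" "\<bar>R (Suc i0) (Suc j0) y\<bar> \<le> M" "\<bar>R i0 (Suc (Suc j0)) y\<bar> \<le> M" for y
    using M[of 2 0 y] M[of 1 1 y] M[of 0 2 y] by auto
  have q: "\<bar>a * b * r\<bar> \<le> (norm k)\<^sup>2 * M" if "\<bar>a\<bar> \<le> norm k" "\<bar>b\<bar> \<le> norm k" "\<bar>r\<bar> \<le> M" for a b r
    unfolding abs_mult power2_eq_square by (intro mult_mono that) auto
  have "\<bar>g 2 t\<bar> \<le> 4 * ((norm k)\<^sup>2 * M)"
    using q[OF c[of 1] c[of 1] M'(1)[of "x + t *\<^sub>R k"]] q[OF c[of 1] c[of 2] M'(2)[of "x + t *\<^sub>R k"]]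
      q[OF c[of 2] c[of 2] M'(3)[of "x + t *\<^sub>R k"]]
    by (auto simp: g_def power2_eq_square)
  then show ?thesis unfolding s by (simp add: mult.commute)
qed

definition supported :: "real \<Rightarrow> (nat \<Rightarrow> nat \<Rightarrow> pt \<Rightarrow> real) \<Rightarrow> bool"
  where "supported r R \<longleftrightarrow> (\<forall>i j x. r < norm x \<longrightarrow> R i j x = 0)"

lemma tower_bounded:
  assumes "pd_tower R" "supported r R"
  shows "\<exists>M. \<forall>x. \<bar>R i j x\<bar> \<le> M"
proof -
  have "compact (R i j ` cball 0 r)"
    by (intro compact_continuous_image pd_tower_continuous[OF assms(1)] compact_cball)
  then obtain M where "\<And>y. y \<in> R i j ` cball 0 r \<Longrightarrow> norm y \<le> M"
    using compact_imp_bounded bounded_iff by metis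
  then have "\<bar>R i j x\<bar> \<le> M" if "norm x \<le> r" for x using that by (metis imageI mem_cball_0 real_norm_def)
  moreover have "R i j x = 0" if "\<not> norm x \<le> r" for x using assms(2) that by (simp add: supported_def)
  ultimately have "\<bar>R i j x\<bar> \<le> max 0 M" for x by (cases "norm x \<le> r") (auto simp: le_max_iff_disj)
  then show ?thesis by blast
qed

lemma tower_conv2_integrable:
  assumes [measurable]: "f \<in> borel_measurable borel" and f: "\<And>y. \<bar>f y\<bar> \<le> b" 
   and R: "pd_tower R" "supported r R"
  shows "integrable lborel (\<lambda>y. f y * R i j (x - y))"
proof -
  obtain M where M: "\<And>x. \<bar>R i j x\<bar> \<le> M" using tower_bounded[OF R] by blast
  have [measurable]: "R i j \<in> borel_measurable borel"
    by (intro borel_measurable_continuous_onI pd_tower_continuous R)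
  show ?thesis
    by (rule conv2_integrable[where b=b and S="cball 0 r" and b'=M])
      (use f M R(2) in \<open>auto simp: supported_def\<close>)
qed

text \<open>Differentiation under the integral by a uniform remainder: the kernel has bounded second
  derivatives and compact support, so its first-order expansion fails by O(|k|^2) on a ball of fixed
  radius and is exact outside.\<close>

lemma conv2_tower:
  assumes [measurable]: "f \<in> borel_measurable borel" and f: "\<And>y. \<bar>f y\<bar> \<le> b" 
   and R: "pd_tower R" "supported r R"
  shows "pd_tower (\<lambda>i j. conv2 f (R i j))"
  unfolding pd_tower_def
proof (intro allI)
  fix i j and x :: pt
  obtain Mf where Mf: "\<And>i j x. \<bar>R i j x\<bar> \<le> Mf i j" using tower_bounded[OF R] by metis
  define M where "M = Mf (Suc (Suc i)) j + Mf (Suc i) (Suc j) + Mf i (Suc (Suc j))"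
  have "0 \<le> Mf i j" for i j using Mf[of i j 0] by linarith
  then have M: "\<bar>R (i + i') (j + j') x\<bar> \<le> M" if "i' + j' = 2" for i' j' x
  proof -
    have "(i' = 2 \<and> j' = 0) \<or> (i' = 1 \<and> j' = 1) \<or> (i' = 0 \<and> j' = 2)" using that by linarith
    then show ?thesis using Mf[of "Suc (Suc i)" j x] Mf[of "Suc i" "Suc j" x] Mf[of i "Suc (Suc j)" x] 
       \<open>\<And>i j. 0 \<le> Mf i j\<close>[of "Suc (Suc i)" j] \<open>\<And>i j. 0 \<le> Mf i j\<close>[of "Suc i" "Suc j"] \<open>\<And>i j. 0 \<le> Mf i j\<close>[of i "Suc (Suc j)"]
      unfolding M_def by auto
  qed
  note I = tower_conv2_integrable[OF assms]
  \<comment> \<open>Volume of a ball that contains every \<open>y\<close> for which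
    \<open>x - y\<close> or \<open>x + k - y\<close> lies in the support, as long as |k| \<le>
    1.\<close>
  define V where "V = measure lborel (cball x (r + 1))"
  have b0: "0 \<le> b" using f[of 0] by linarith
  have M0: "0 \<le> M" using M[of 2 0 0] by simp
  have est: "\<bar>conv2 f (R i j) (x + k) - conv2 f (R i j) x - (k $ 1 * conv2 f (R (Suc i) j) x + k $ 2 * conv2 f (R i (Suc j)) x)\<bar>
     \<le> (b * 2 * M * V) * (norm k)\<^sup>2" if k: "norm k \<le> 1" for k :: pt
  proof -
    let ?q = "\<lambda>y. R i j (x - y + k) - R i j (x - y) - (k $ 1 * R (Suc i) j (x - y) + k $ 2 * R i (Suc j) (x - y))"
    have e: "x + k - y = x - y + k" for y by simp
    have eq: "conv2 f (R i j) (x + k) - conv2 f (R i j) x - (k $ 1 * conv2 f (R (Suc i) j) x + k $ 2 * conv2 f (R i (Suc j)) x)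
      = (LINT y|lborel. f y * ?q y)" 
    proof -
      have "f y * ?q y = f y * R i j (x + k - y) - f y * R i j (x - y) - (k $ 1 * (f y * R (Suc i) j (x - y)) + k $ 2 * (f y * R i (Suc j) (x - y)))" for y
        by (simp add: algebra_simps)
      then show ?thesis unfolding conv2_def using I by simp
    qed
    have int: "integrable lborel (\<lambda>y. f y * ?q y)"
    proof -
      have "f y * ?q y = f y * R i j (x + k - y) - f y * R i j (x - y) - (k $ 1 * (f y * R (Suc i) j (x - y)) + k $ 2 * (f y * R i (Suc j) (x - y)))" for y
        by (simp add: algebra_simps)
      then show ?thesis using I by simp
    qed
    have "\<bar>LINT y|lborel. f y * ?q y\<bar> \<le> (LINT y|lborel. \<bar>f y * ?q y\<bar>)" by (rule integral_abs_bound)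
    also have "\<dots> \<le> (LINT y|lborel. indicator (cball x (r + 1)) y * (b * (2 * M * (norm k)\<^sup>2)))"
    proof (rule integral_mono)
      show "integrable lborel (\<lambda>y. indicator (cball x (r + 1)) y * (b * (2 * M * (norm k)\<^sup>2)))"
        using emeasure_bounded_finite[of "cball x (r + 1)"]
        by (intro integrable_mult_left integrable_real_indicator) auto
      fix y
      show "\<bar>f y * ?q y\<bar> \<le> indicator (cball x (r + 1)) y * (b * (2 * M * (norm k)\<^sup>2))"
      proof (cases "y \<in> cball x (r + 1)")
        case True
        have "\<bar>f y * ?q y\<bar> \<le> b * (2 * M * (norm k)\<^sup>2)"
          unfolding abs_mult using second_order_expansion[OF R(1)[unfolded pd_tower_def, rule_format] M, of "x - y" k] f[of y] b0 by (intro mult_mono) auto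
        then show ?thesis using True by simp
      next
        case False
        then have "norm (x - y) > r + 1" by (simp add: dist_norm)
        moreover from this have "norm (x - y + k) > r" using k norm_triangle_sub[of "x - y" "x - y + k"] by simp
        ultimately have "R i j (x - y + k) = 0" "R i' j' (x - y) = 0" for i' j'
          using R(2) unfolding supported_def by auto
        then show ?thesis using False by simp
      qed
    qed (use int in auto)
    also have "\<dots> = (b * 2 * M * V) * (norm k)\<^sup>2" by (simp add: V_def)
    finally show ?thesis unfolding eq .
  qed
  define C where "C = b * 2 * M * V"
  have C0: "0 \<le> C" using b0 M0 by (simp add: C_def V_def)
  show "(conv2 f (R i j) has_derivative (\<lambda>k. k $ 1 * conv2 f (R (Suc i) j) x + k $ 2 * conv2 f (R i (Suc j)) x)) (at x)"
    unfolding has_derivative_at_alt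
  proof (intro conjI allI impI)
    show "bounded_linear (\<lambda>k. k $ 1 * conv2 f (R (Suc i) j) x + k $ 2 * conv2 f (R i (Suc j)) x)"
      by (intro bounded_linear_add bounded_linear_mult_const bounded_linear_vec_nth)
    fix e :: real assume e: "0 < e"
    show "\<exists>d>0. \<forall>y. norm (y - x) < d \<longrightarrow> norm (conv2 f (R i j) y - conv2 f (R i j) x - ((y - x) $ 1 * conv2 f (R (Suc i) j) x + (y - x) $ 2 * conv2 f (R i (Suc j)) x)) \<le> e * norm (y - x)"
    proof (intro exI[of _ "min 1 (e / (C + 1))"] conjI allI impI)
      show "0 < min 1 (e / (C + 1))" using e C0 by simp
      fix y assume y: "norm (y - x) < min 1 (e / (C + 1))"
      have "norm (conv2 f (R i j) y - conv2 f (R i j) x - ((y - x) $ 1 * conv2 f (R (Suc i) j) x + (y - x) $ 2 * conv2 f (R i (Suc j)) x)) \<le> C * (norm (y - x))\<^sup>2"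
        using est[of "y - x"] y by (simp add: C_def)
      also have "\<dots> = (C * norm (y - x)) * norm (y - x)" by (simp add: power2_eq_square)
      also have "\<dots> \<le> e * norm (y - x)"
      proof (rule mult_right_mono)
        have "norm (y - x) * (C + 1) < e" using y C0 by (simp add: pos_less_divide_eq)
        then show "C * norm (y - x) \<le> e" using norm_ge_zero[of "y - x"] by (simp add: algebra_simps del: norm_ge_zero)
      qed simp
      finally show "norm (conv2 f (R i j) y - conv2 f (R i j) x - ((y - x) $ 1 * conv2 f (R (Suc i) j) x + (y - x) $ 2 * conv2 f (R i (Suc j)) x)) \<le> e * norm (y - x)" .
    qed
  qed
qed

text \<open>A product of one-dimensional bumps in place of a radial one, so that each partial
  derivative is a product of one-dimensional derivatives. For e > 0 the support lies in the square
  of half side \<open>e\<close>, hence in the ball of radius \<open>2 * e\<close>; the leading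
  factor normalises the mass of entry \<open>0 0\<close> to one.\<close>

definition mollifier :: "real \<Rightarrow> nat \<Rightarrow> nat \<Rightarrow> pt \<Rightarrow> real"
  where "mollifier e i j x = 1 / (LINT y|lborel. flat 0 (e\<^sup>2 - (y $ 1 :: real)\<^sup>2) * flat 0 (e\<^sup>2 - ((y :: pt) $ 2)\<^sup>2)) *
    ((deriv ^^ i) (\<lambda>t. flat 0 (e\<^sup>2 - t\<^sup>2)) (x $ 1) * (deriv ^^ j) (\<lambda>t. flat 0 (e\<^sup>2 - t\<^sup>2)) (x $ 2))"

lemma mollifier_tower: "pd_tower (mollifier e)"
proof -
  have "mollifier e = (\<lambda>i j x. 1 / (LINT y|lborel. flat 0 (e\<^sup>2 - (y $ 1 :: real)\<^sup>2) * flat 0 (e\<^sup>2 - ((y :: pt) $ 2)\<^sup>2)) *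
    ((deriv ^^ i) (\<lambda>t. flat 0 (e\<^sup>2 - t\<^sup>2)) (x $ 1) * (deriv ^^ j) (\<lambda>t. flat 0 (e\<^sup>2 - t\<^sup>2)) (x $ 2)))"
    by (simp add: mollifier_def fun_eq_iff)
  then show ?thesis
    by (simp only:) (rule pd_tower_tensor[where D="\<lambda>n. (deriv ^^ n) (\<lambda>t. flat 0 (e\<^sup>2 - t\<^sup>2))", OF flat_bump_has_derivative])
qed

lemma norm_pt_le: "norm (x :: pt) \<le> \<bar>x $ 1\<bar> + \<bar>x $ 2\<bar>"
  using norm_le_l1_cart[of x] by (simp add: UNIV_2)

lemma mollifier_supported:
  assumes "0 < e" shows "supported (2 * e) (mollifier e)"
  unfolding supported_def
proof (intro allI impI)
  fix i j and x :: pt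
  assume x: "2 * e < norm x"
  have v: "(deriv ^^ n) (\<lambda>t. flat 0 (e\<^sup>2 - t\<^sup>2)) t = 0" if "\<bar>t\<bar> > e" for n t
  proof (rule smooth_vanish[where S="{t. \<bar>t\<bar> > e}" and D="\<lambda>n. (deriv ^^ n) (\<lambda>t. flat 0 (e\<^sup>2 - t\<^sup>2))"])
    show "((deriv ^^ n) (\<lambda>t. flat 0 (e\<^sup>2 - t\<^sup>2)) has_real_derivative (deriv ^^ Suc n) (\<lambda>t. flat 0 (e\<^sup>2 - t\<^sup>2)) x) (at x)" for n x
      by (rule flat_bump_has_derivative)
    show "open {t :: real. \<bar>t\<bar> > e}" by (intro open_Collect_less continuous_intros)
    show "(deriv ^^ 0) (\<lambda>t. flat 0 (e\<^sup>2 - t\<^sup>2)) x = 0" if "x \<in> {t. \<bar>t\<bar> > e}" for x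
      using that assms power_mono[of e "\<bar>x\<bar>" 2] by (auto simp: flat_def)
  qed (use that in auto)
  have "\<bar>x $ 1\<bar> > e \<or> \<bar>x $ 2\<bar> > e" using x norm_pt_le[of x] by linarith
  then show "mollifier e i j x = 0" using v by (auto simp: mollifier_def)
qed

text \<open>A nonnegative function with zero integral vanishes almost everywhere; for a continuous
  one this would make a nonempty open set negligible.\<close>

lemma integral_pos_continuous:
  fixes g :: "'a::euclidean_space \<Rightarrow> real"
  assumes "continuous_on UNIV g" "integrable lborel g" "\<And>x. 0 \<le> g x" "g x0 > 0"
  shows "0 < (LINT x|lborel. g x)"
proof (rule ccontr)
  assume "\<not> ?thesis"
  moreover have "0 \<le> (LINT x|lborel. g x)" by (rule integral_nonneg_AE) (use assms(3) in simp)
  ultimately have "(LINT x|lborel. g x) = 0" by linarith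
  then have "AE x in lborel. g x = 0"
    using integral_nonneg_eq_0_iff_AE[OF assms(2)] assms(3) by simp
  moreover have op: "open {x. g x \<noteq> 0}" using assms(1) by (intro open_Collect_neq) auto
  ultimately have "{x. g x \<noteq> 0} \<in> null_sets lborel"
    using AE_iff_null[of lborel "\<lambda>x. g x = 0"] by (simp add: borel_open)
  then have "negligible {x. g x \<noteq> 0}"
    by (simp add: negligible_iff_null_sets null_sets_completionI)
  moreover have "x0 \<in> {x. g x \<noteq> 0}" using assms(4) by simp
  ultimately show False using op open_not_negligible by blast
qed

lemma mollifier_nonneg_integral:
  assumes "0 < e"
  shows "0 \<le> mollifier e 0 0 x" "(LINT x|lborel. mollifier e 0 0 x) = 1"
proof -
  let ?g = "\<lambda>y::pt. flat 0 (e\<^sup>2 - (y $ 1)\<^sup>2) * flat 0 (e\<^sup>2 - (y $ 2)\<^sup>2)"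
  have tower: "pd_tower (\<lambda>i j x. 1 * ((deriv ^^ i) (\<lambda>t. flat 0 (e\<^sup>2 - t\<^sup>2)) (x $ 1) * (deriv ^^ j) (\<lambda>t. flat 0 (e\<^sup>2 - t\<^sup>2)) (x $ 2)))"
    by (rule pd_tower_tensor[where D="\<lambda>n. (deriv ^^ n) (\<lambda>t. flat 0 (e\<^sup>2 - t\<^sup>2))", OF flat_bump_has_derivative])
  have cont: "continuous_on UNIV ?g" using pd_tower_continuous[OF tower, of UNIV 0 0] by simp
  have nn: "0 \<le> ?g y" for y by (simp add: flat_nonneg)
  have "integrable lborel ?g"
  proof (rule lborel_integrable_compact_support)
    show "?g \<in> borel_measurable borel" using cont by (rule borel_measurable_continuous_onI)
    show "bounded (cball (0::pt) (2 * e))" by simp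
    show "?g x = 0" if "x \<notin> cball 0 (2 * e)" for x
    proof -
      have "\<bar>x $ 1\<bar> > e \<or> \<bar>x $ 2\<bar> > e" using that norm_pt_le[of x] by auto
      then show ?thesis using assms power_mono[of e "\<bar>x $ 1\<bar>" 2] power_mono[of e "\<bar>x $ 2\<bar>" 2] by (auto simp: flat_def)
    qed
    have f1: "\<bar>flat 0 t\<bar> \<le> 1" for t by (simp add: flat_def)
    show "\<bar>?g x\<bar> \<le> 1 * 1" for x unfolding abs_mult by (intro mult_mono f1) auto
  qed
  from integral_pos_continuous[OF cont this nn, of 0] assms have pos: "0 < (LINT y|lborel. ?g y)" by (simp add: flat_def)
  then show "0 \<le> mollifier e 0 0 x" using nn[of x] by (simp add: mollifier_def)
  show "(LINT x|lborel. mollifier e 0 0 x) = 1" using pos by (simp add: mollifier_def)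
qed

lemma tower_lipschitz:
  assumes R: "pd_tower R" and b: "\<And>x. \<bar>R (Suc i) j x\<bar> \<le> b" "\<And>x. \<bar>R i (Suc j) x\<bar> \<le> b"
  shows "\<bar>R i j x - R i j y\<bar> \<le> 2 * b * norm (x - y)"
proof -
  have "norm (R i j x - R i j y) \<le> 2 * b * norm (x - y)"
  proof (rule differentiable_bound[of UNIV "R i j" "\<lambda>x k. k $ 1 * R (Suc i) j x + k $ 2 * R i (Suc j) x"])
    fix x
    show "(R i j has_derivative (\<lambda>k. k $ 1 * R (Suc i) j x + k $ 2 * R i (Suc j) x)) (at x within UNIV)"
      using R unfolding pd_tower_def by simp
    show "onorm (\<lambda>k :: pt. k $ 1 * R (Suc i) j x + k $ 2 * R i (Suc j) x) \<le> 2 * b"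
    proof (rule onorm_bound)
      show "0 \<le> 2 * b" using b(1)[of x] by simp
    next
      fix k :: pt
      have "\<bar>k $ 1 * R (Suc i) j x\<bar> \<le> norm k * b" "\<bar>k $ 2 * R i (Suc j) x\<bar> \<le> norm k * b"
        unfolding abs_mult by (intro mult_mono b component_le_norm_cart; simp)+
      then have "norm (k $ 1 * R (Suc i) j x + k $ 2 * R i (Suc j) x) \<le> norm k * b + norm k * b"
        unfolding real_norm_def by linarith
      also have "\<dots> = 2 * b * norm k" by simp
      finally show "norm (k $ 1 * R (Suc i) j x + k $ 2 * R i (Suc j) x) \<le> 2 * b * norm k" .
    qed
  qed auto
  then show ?thesis by simp
qed

text \<open>In the sum of the Taylor expansions at \<open>h\<close> and \<open>- h\<close> the odd
  terms cancel; the two fourth-order remainders, each at most b h^4/24, give the constant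
  1/12.\<close>

lemma central_second_difference:
  assumes d: "\<And>n t. n < 4 \<Longrightarrow> (g n has_real_derivative g (Suc n) t) (at t)"
    and b: "\<And>t. \<bar>g 4 t\<bar> \<le> b"
  shows "\<bar>g 0 h + g 0 (- h) - 2 * g 0 0 - h\<^sup>2 * g 2 0\<bar> \<le> b * h ^ 4 / 12"
proof -
  have T: "\<exists>t. g 0 x = (\<Sum>m<4. g m 0 / fact m * x ^ m) + g 4 t / fact 4 * x ^ 4" for x
    using Maclaurin_bi_le[of g "g 0" 4 x] d by auto
  obtain t1 where t1: "g 0 h = (\<Sum>m<4. g m 0 / fact m * h ^ m) + g 4 t1 / fact 4 * h ^ 4" using T by blast
  obtain t2 where t2: "g 0 (- h) = (\<Sum>m<4. g m 0 / fact m * (- h) ^ m) + g 4 t2 / fact 4 * (- h) ^ 4" using T by blast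
  have sum4: "(\<Sum>m<4. F m) = F 0 + F 1 + F 2 + F 3" for F :: "nat \<Rightarrow> real"
    by (simp add: eval_nat_numeral)
  have f: "fact 2 = (2::real)" "fact 3 = (6::real)" "fact 4 = (24::real)"
    by (simp_all add: fact_numeral)
  have p: "(- h) ^ 3 = - (h ^ 3)" "(- h) ^ 4 = h ^ 4" by simp_all
  have eq: "g 0 h + g 0 (- h) - 2 * g 0 0 - h\<^sup>2 * g 2 0 = (g 4 t1 + g 4 t2) * (h ^ 4 / 24)"
    unfolding t1 t2 sum4 f p by (simp add: distrib_right)
  have "\<bar>(g 4 t1 + g 4 t2) * (h ^ 4 / 24)\<bar> \<le> (b + b) * (h ^ 4 / 24)"
    unfolding abs_mult by (intro mult_mono) (use b[of t1] b[of t2] in auto)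
  then show ?thesis unfolding eq by simp
qed

lemma pd_tower_line:
  assumes "pd_tower R"
  shows "((\<lambda>t. R i j (x + t *\<^sub>R axis 1 1)) has_real_derivative R (Suc i) j (x + t *\<^sub>R axis 1 1)) (at t)"
    "((\<lambda>t. R i j (x + t *\<^sub>R axis 2 1)) has_real_derivative R i (Suc j) (x + t *\<^sub>R axis 2 1)) (at t)"
proof -
  have *: "((\<lambda>t. R i j (x + t *\<^sub>R v)) has_real_derivative v $ 1 * R (Suc i) j (x + t *\<^sub>R v) + v $ 2 * R i (Suc j) (x + t *\<^sub>R v)) (at t)" for v
  proof -
    have "((\<lambda>t. x + t *\<^sub>R v) has_derivative (\<lambda>s. s *\<^sub>R v)) (at t)"
      by (auto intro!: derivative_eq_intros)
    moreover have "(R i j has_derivative (\<lambda>k. k $ 1 * R (Suc i) j (x + t *\<^sub>R v) + k $ 2 * R i (Suc j) (x + t *\<^sub>R v))) (at (x + t *\<^sub>R v))"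
      using assms unfolding pd_tower_def by blast
    ultimately have "((\<lambda>t. R i j (x + t *\<^sub>R v)) has_derivative
      (\<lambda>s. (s *\<^sub>R v) $ 1 * R (Suc i) j (x + t *\<^sub>R v) + (s *\<^sub>R v) $ 2 * R i (Suc j) (x + t *\<^sub>R v))) (at t)"
      by (rule has_derivative_compose)
    then show ?thesis
      unfolding has_field_derivative_def by (rule has_derivative_eq_rhs) (auto simp: algebra_simps)
  qed
  show "((\<lambda>t. R i j (x + t *\<^sub>R axis 1 1)) has_real_derivative R (Suc i) j (x + t *\<^sub>R axis 1 1)) (at t)"
    "((\<lambda>t. R i j (x + t *\<^sub>R axis 2 1)) has_real_derivative R i (Suc j) (x + t *\<^sub>R axis 2 1)) (at t)"
    using *[of "axis 1 1"] *[of "axis 2 1"] by (simp_all add: axis_def)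
qed

text \<open>This is h^2 times the lattice Laplacian L_h. Kept undivided, it compares a value
  directly with its four neighbours, which is the form in which the maximum principle uses
  it.\<close>

definition five_point :: "real \<Rightarrow> (pt \<Rightarrow> real) \<Rightarrow> pt \<Rightarrow> real"
  where "five_point h v x = v (x + h *\<^sub>R axis 1 1) + v (x - h *\<^sub>R axis 1 1)
    + v (x + h *\<^sub>R axis 2 1) + v (x - h *\<^sub>R axis 2 1) - 4 * v x"

lemma tower_five_point:
  assumes R: "pd_tower R" and b: "\<And>x. \<bar>R 4 0 x\<bar> \<le> b" "\<And>x. \<bar>R 0 4 x\<bar> \<le> b"
  shows "\<bar>five_point h (R 0 0) x - h\<^sup>2 * (R 2 0 x + R 0 2 x)\<bar> \<le> b * h ^ 4 / 6"
proof -
  have 1: "\<bar>R 0 0 (x + h *\<^sub>R axis 1 1) + R 0 0 (x + (- h) *\<^sub>R axis 1 1) - 2 * R 0 0 (x + 0 *\<^sub>R axis 1 1) - h\<^sup>2 * R 2 0 (x + 0 *\<^sub>R axis 1 1)\<bar> \<le> b * h ^ 4 / 12"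
    by (rule central_second_difference[of "\<lambda>n t. R n 0 (x + t *\<^sub>R axis 1 1)"]) (auto intro: pd_tower_line R b)
  have 2: "\<bar>R 0 0 (x + h *\<^sub>R axis 2 1) + R 0 0 (x + (- h) *\<^sub>R axis 2 1) - 2 * R 0 0 (x + 0 *\<^sub>R axis 2 1) - h\<^sup>2 * R 0 2 (x + 0 *\<^sub>R axis 2 1)\<bar> \<le> b * h ^ 4 / 12"
    by (rule central_second_difference[of "\<lambda>n t. R 0 n (x + t *\<^sub>R axis 2 1)"]) (auto intro: pd_tower_line R b)
  have "x + (- h) *\<^sub>R v = x - h *\<^sub>R v" "x + 0 *\<^sub>R v = x" for v :: pt by simp_all
  then have "five_point h (R 0 0) x - h\<^sup>2 * (R 2 0 x + R 0 2 x)
    = (R 0 0 (x + h *\<^sub>R axis 1 1) + R 0 0 (x + (- h) *\<^sub>R axis 1 1) - 2 * R 0 0 (x + 0 *\<^sub>R axis 1 1) - h\<^sup>2 * R 2 0 (x + 0 *\<^sub>R axis 1 1))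
    + (R 0 0 (x + h *\<^sub>R axis 2 1) + R 0 0 (x + (- h) *\<^sub>R axis 2 1) - 2 * R 0 0 (x + 0 *\<^sub>R axis 2 1) - h\<^sup>2 * R 0 2 (x + 0 *\<^sub>R axis 2 1))"
    by (simp add: five_point_def distrib_left)
  then show ?thesis using 1 2 by linarith
qed

section \<open>Weak derivatives with essential bounds\<close>

text \<open>The convolution estimates ask for Borel functions that are bounded at every point. A
  Borel representative exists up to null sets; truncating it at the essential bound changes nothing
  almost everywhere.\<close>

lemma bounded_borel_representative:
  fixes w :: "'a::euclidean_space \<Rightarrow> real"
  assumes "w \<in> borel_measurable lebesgue" "AE x in lebesgue. \<bar>w x\<bar> \<le> b"
  obtains w' where "w' \<in> borel_measurable borel" "\<And>x. \<bar>w' x\<bar> \<le> \<bar>b\<bar>" "AE x in lebesgue. w x = w' x"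
proof -
  obtain v where v: "v \<in> borel_measurable lborel" "AE x in lborel. w x = v x"
    using completion_ex_borel_measurable_real[OF assms(1)] by blast
  have vb: "v \<in> borel_measurable borel" using v(1) by simp
  show ?thesis
  proof (rule that[of "\<lambda>x. max (- \<bar>b\<bar>) (min \<bar>b\<bar> (v x))"])
    show "(\<lambda>x. max (- \<bar>b\<bar>) (min \<bar>b\<bar> (v x))) \<in> borel_measurable borel" using vb by measurable
    show "AE x in lebesgue. w x = max (- \<bar>b\<bar>) (min \<bar>b\<bar> (v x))"
      using AE_completion[OF v(2)] assms(2) by eventually_elim auto
  qed auto
qed

lemma lebesgue_integral_representative:
  fixes f :: "'a::euclidean_space \<Rightarrow> real"
  assumes "f \<in> borel_measurable lebesgue" "f' \<in> borel_measurable borel" "AE x in lebesgue. f x = f' x"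
    and g: "g \<in> borel_measurable borel"
  shows "(LINT x|lebesgue. f x * g x) = (LINT x|lborel. f' x * g x)"
proof -
  have m: "h \<in> borel_measurable lebesgue" if "h \<in> borel_measurable borel" for h :: "'a \<Rightarrow> real"
    using that by (simp add: measurable_completion)
  have "(LINT x|lebesgue. f x * g x) = (LINT x|lebesgue. f' x * g x)"
  proof (rule integral_cong_AE)
    show "AE x in lebesgue. f x * g x = f' x * g x" using assms(3) by eventually_elim simp
  qed (intro borel_measurable_times assms(1) m[OF assms(2)] m[OF g])+
  also have "\<dots> = (LINT x|lborel. f' x * g x)"
    using assms by (intro integral_completion) simp
  finally show ?thesis .
qed

text \<open>The norm is read off from an essential supremum in the extended reals. A bound excludes
  plus infinity; minus infinity occurs when the domain is null, and its conversion to 0 is then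
  harmless because any property holds almost everywhere.\<close>

lemma Linf_norm_props:
  assumes "Linf S w"
  shows "0 \<le> Linf_norm S w" "AE x in lebesgue_on S. \<bar>w x\<bar> \<le> Linf_norm S w"
proof -
  let ?M = "lebesgue_on S" and ?f = "\<lambda>x. ereal \<bar>w x\<bar>"
  let ?e = "esssup ?M ?f"
  have m: "?f \<in> borel_measurable ?M" using assms unfolding Linf_def by auto
  obtain b where b: "AE x in ?M. \<bar>w x\<bar> \<le> b" using assms unfolding Linf_def by blast
  have "?e \<le> ereal b" by (rule esssup_I[OF m]) (use b in simp)
  then have top: "?e \<noteq> \<infinity>" by auto
  have ae: "AE x in ?M. ?f x \<le> ?e" by (rule esssup_AE)
  show "0 \<le> Linf_norm S w"
  proof (cases "0 \<le> ?e")
    case True then show ?thesis by (simp add: Linf_norm_def real_of_ereal_pos)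
  next
    case False
    have "AE x in ?M. False" using ae
    proof eventually_elim
      case (elim x)
      then have "0 \<le> ?e" using order_trans[of 0 "?f x" ?e] by simp
      with False show ?case by simp
    qed
    then have "esssup ?M ?f \<le> - \<infinity>" by (intro esssup_I[OF m]) (auto elim: eventually_mono)
    then have "?e = - \<infinity>" by simp
    then show ?thesis by (simp add: Linf_norm_def)
  qed
  show "AE x in ?M. \<bar>w x\<bar> \<le> Linf_norm S w"
    using ae
  proof eventually_elim
    case (elim x)
    then have "?e \<noteq> - \<infinity>" by auto
    with top have "ereal (real_of_ereal ?e) = ?e" by (intro ereal_real') auto
    then show ?case using elim unfolding Linf_norm_def by (metis ereal_less_eq(3))
  qed
qed

lemma weak_pderiv_props:
  assumes "Winf k S v" "i + j \<le> k"
  shows "Linf S (weak_pderiv S i j v)" "is_weak_pderiv S i j v (weak_pderiv S i j v)"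
    "AE x in lebesgue_on S. \<bar>weak_pderiv S i j v x\<bar> \<le> Winf_norm k S v"
    "0 \<le> Winf_norm k S v"
proof -
  have "\<exists>w. Linf S w \<and> is_weak_pderiv S i j v w" using assms unfolding Winf_def by blast
  then have "Linf S (weak_pderiv S i j v) \<and> is_weak_pderiv S i j v (weak_pderiv S i j v)"
    unfolding weak_pderiv_def by (rule someI_ex)
  then show *: "Linf S (weak_pderiv S i j v)" "is_weak_pderiv S i j v (weak_pderiv S i j v)" by auto
  have "finite {(i, j). i + j \<le> k}"
    by (rule finite_subset[of _ "{..k} \<times> {..k}"]) auto
  then have le: "Linf_norm S (weak_pderiv S i j v) \<le> Winf_norm k S v"
    unfolding Winf_norm_def using assms(2) by (intro Max_ge) auto
  show "0 \<le> Winf_norm k S v" using le Linf_norm_props(1)[OF *(1)] by linarith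
  show "AE x in lebesgue_on S. \<bar>weak_pderiv S i j v x\<bar> \<le> Winf_norm k S v"
    using Linf_norm_props(2)[OF *(1)] by eventually_elim (use le in linarith)
qed

text \<open>Sobolev regularity: mollification turns the weak derivatives into classical ones.\<close>
theorem W4inf_classical:
  assumes W: "Winf 4 UNIV f" and B: "B = Winf_norm 4 UNIV f"
  obtains V :: "nat \<Rightarrow> nat \<Rightarrow> pt \<Rightarrow> real" where
    "\<And>i j x. i + j \<le> 2 \<Longrightarrow>
      (V i j has_derivative (\<lambda>k. k $ 1 * V (Suc i) j x + k $ 2 * V i (Suc j) x)) (at x)"
    "\<And>i j x. i + j \<le> 3 \<Longrightarrow> \<bar>V i j x\<bar> \<le> B"
    "\<And>h x. \<bar>five_point h (V 0 0) x - h\<^sup>2 * (V 2 0 x + V 0 2 x)\<bar> \<le> B * h ^ 4 / 6"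
    "\<And>S u x. open S \<Longrightarrow> continuous_on S u \<Longrightarrow> (AE x in lebesgue_on S. f x = u x) \<Longrightarrow> x \<in> S \<Longrightarrow> V 0 0 x = u x"
proof -
  have leb: "lebesgue_on UNIV = (lebesgue :: pt measure)" by (rule lebesgue_on_UNIV_eq)
  have B0: "0 \<le> B" using weak_pderiv_props(4)[OF W, of 0 0] B by simp
  let ?w = "\<lambda>i j. weak_pderiv UNIV i j f"
  have "\<exists>w'. w' \<in> borel_measurable borel \<and> (\<forall>x. \<bar>w' x\<bar> \<le> B) \<and> (AE x in lebesgue. ?w i j x = w' x)" if "i + j \<le> 4" for i j
  proof (rule bounded_borel_representative)
    show "?w i j \<in> borel_measurable lebesgue"
      using weak_pderiv_props(1)[OF W that] unfolding Linf_def leb by simp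
    show "AE x in lebesgue. \<bar>?w i j x\<bar> \<le> B"
      using weak_pderiv_props(3)[OF W that] unfolding leb B by simp
  qed (use B0 in auto)
  note ex = this
  define w' where "w' i j = (SOME w'. w' \<in> borel_measurable borel \<and> (\<forall>x. \<bar>w' x\<bar> \<le> B) \<and> (AE x in lebesgue. ?w i j x = w' x))" for i j
  have "w' i j \<in> borel_measurable borel \<and> (\<forall>x. \<bar>w' i j x\<bar> \<le> B) \<and> (AE x in lebesgue. ?w i j x = w' i j x)" if "i + j \<le> 4" for i j
    unfolding w'_def by (rule someI_ex[OF ex[OF that]])
  then have w': "\<And>i j. i + j \<le> 4 \<Longrightarrow> w' i j \<in> borel_measurable borel"
    "\<And>i j x. i + j \<le> 4 \<Longrightarrow> \<bar>w' i j x\<bar> \<le> B" "\<And>i j. i + j \<le> 4 \<Longrightarrow> AE x in lebesgue. ?w i j x = w' i j x"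
    by blast+
  have "Linf UNIV f" using W unfolding Winf_def by blast
  then have fm: "f \<in> borel_measurable lebesgue" unfolding Linf_def leb by simp
  obtain bf where "AE x in lebesgue. \<bar>f x\<bar> \<le> bf" using \<open>Linf UNIV f\<close> unfolding Linf_def leb by blast
  then obtain f' where f': "f' \<in> borel_measurable borel" "\<And>x. \<bar>f' x\<bar> \<le> \<bar>bf\<bar>" "AE x in lebesgue. f x = f' x"
    using bounded_borel_representative[OF fm] by metis
  \<comment> \<open>Mollification at radius \<open>e\<close> with all derivatives on the kernel.
    Below, \<open>Aw\<close> moves them to the function by the definition of the weak derivative,
    which bounds \<open>A e i j\<close> by \<open>B\<close> independently of \<open>e\<close> up to
    order four.\<close>
  define A where "A e i j = conv2 f' (mollifier e i j)" for e i j
  have tower: "pd_tower (A e)" if "0 < e" for e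
  proof -
    have "pd_tower (\<lambda>i j. conv2 f' (mollifier e i j))"
      by (rule conv2_tower[OF f'(1,2) mollifier_tower mollifier_supported[OF that]])
    then show ?thesis by (simp add: A_def[abs_def])
  qed
  have mol_borel [measurable]: "mollifier e i j \<in> borel_measurable borel" for e i j
    by (intro borel_measurable_continuous_onI pd_tower_continuous mollifier_tower)
  have mol_bound: "\<exists>b. \<forall>x. \<bar>mollifier e i j x\<bar> \<le> b" if "0 < e" for e i j
    using tower_bounded[OF mollifier_tower mollifier_supported[OF that]] .
  have mol_supp: "mollifier e i j x = 0" if "0 < e" "x \<notin> cball 0 (2 * e)" for e i j x
    using mollifier_supported[OF that(1)] that(2) by (simp add: supported_def)
  have Aw: "A e i j = conv2 (w' i j) (mollifier e 0 0)" if e: "0 < e" and ij: "i + j \<le> 4" for e i j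
  proof
    fix x
    \<comment> \<open>The reflected kernel is the test function. The two signs (-1)^(i+j), one from
      the reflection and one from the weak derivative, cancel.\<close>
    define R where "R i j y = (- 1) ^ (i + j) * mollifier e i j (x - y)" for i j y
    have R: "pd_tower R" using pd_tower_reflect[OF mollifier_tower, of e x] by (simp add: R_def[abs_def])
    have Rb: "R i j \<in> borel_measurable borel" for i j
      by (intro borel_measurable_continuous_onI pd_tower_continuous R)
    have sub: "{y. R 0 0 y \<noteq> 0} \<subseteq> cball x (2 * e)"
      using mol_supp[OF e, of "x - _" 0 0] by (force simp: R_def dist_norm norm_minus_commute)
    have "closure {y. R 0 0 y \<noteq> 0} \<subseteq> cball x (2 * e)"
      using sub closure_minimal closed_cball by blast
    then have "compact (closure {y. R 0 0 y \<noteq> 0})"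
      using compact_closure bounded_subset[OF bounded_cball sub] by blast
    then have "test_fun UNIV (R 0 0)" unfolding test_fun_def using pd_tower_smooth[OF R] by simp
    then have "(LINT y|lebesgue_on UNIV. f y * (pd 1 ^^ i) ((pd 2 ^^ j) (R 0 0)) y)
        = (- 1) ^ (i + j) * (LINT y|lebesgue_on UNIV. ?w i j y * R 0 0 y)"
      using weak_pderiv_props(2)[OF W ij] unfolding is_weak_pderiv_def by blast
    then have "(LINT y|lebesgue. f y * R i j y) = (- 1) ^ (i + j) * (LINT y|lebesgue. ?w i j y * R 0 0 y)"
      unfolding leb pd_tower_funpow[OF R] .
    moreover have "(LINT y|lebesgue. f y * R i j y) = (LINT y|lborel. f' y * R i j y)"
      by (rule lebesgue_integral_representative[OF fm f'(1,3) Rb])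
    moreover have "(LINT y|lebesgue. ?w i j y * R 0 0 y) = (LINT y|lborel. w' i j y * R 0 0 y)"
      by (rule lebesgue_integral_representative[OF _ w'(1,3)[OF ij] Rb])
        (use weak_pderiv_props(1)[OF W ij] in \<open>simp add: Linf_def leb\<close>)
    moreover have "(LINT y|lborel. f' y * R i j y) = (- 1) ^ (i + j) * A e i j x"
      by (simp add: A_def R_def conv2_def mult.left_commute[of "f' _"])
    moreover have "(LINT y|lborel. w' i j y * R 0 0 y) = conv2 (w' i j) (mollifier e 0 0) x"
      by (simp add: R_def conv2_def)
    ultimately have "(- 1) ^ (i + j) * A e i j x = (- 1) ^ (i + j) * conv2 (w' i j) (mollifier e 0 0) x" by simp
    then show "A e i j x = conv2 (w' i j) (mollifier e 0 0) x" by simp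
  qed
  have Abound: "\<bar>A e i j x\<bar> \<le> B" if e: "0 < e" and ij: "i + j \<le> 4" for e i j x
  proof -
    obtain b where b: "\<And>x. \<bar>mollifier e 0 0 x\<bar> \<le> b" using mol_bound[OF e] by blast
    show ?thesis unfolding Aw[OF that]
      by (rule conv2_bound[where S="cball 0 (2 * e)" and b'=b])
        (use w' ij b mol_supp e mollifier_nonneg_integral in auto)
  qed
  have Alip: "\<bar>A e i j x - A e i j y\<bar> \<le> 2 * B * norm (x - y)" if e: "0 < e" and ij: "i + j \<le> 3" for e i j x y
    by (rule tower_lipschitz[OF tower[OF e]]) (use Abound e ij in auto)
  have Acont: "continuous_on S (A e i j)" if "0 < e" for e i j S
    by (rule pd_tower_continuous[OF tower[OF that]])
  have Aborel: "A e i j \<in> borel_measurable borel" if "0 < e" for e i j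
    by (intro borel_measurable_continuous_onI Acont that)
  \<comment> \<open>\<open>A e i j\<close> is Lipschitz with constant 2B because the next order is
    bounded, hence the restriction to order three; averaging over a radius 2e' moves it by at most
    4Be'.\<close>
  have smear: "\<bar>conv2 (A e i j) (mollifier e' 0 0) x - A e i j x\<bar> \<le> 4 * B * e'" if e: "0 < e" "0 < e'" and ij: "i + j \<le> 3" for e e' i j x
  proof -
    obtain b where b: "\<And>x. \<bar>mollifier e' 0 0 x\<bar> \<le> b" using mol_bound[OF e(2)] by blast
    show ?thesis
    proof (rule conv2_close[where S="cball 0 (2 * e')" and b'=b and b=B])
      show "\<bar>A e i j y - A e i j x\<bar> \<le> 4 * B * e'" if "x - y \<in> cball 0 (2 * e')" for y
      proof -
        have "norm (y - x) \<le> 2 * e'" using that by (simp add: norm_minus_commute)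
        then have "2 * B * norm (y - x) \<le> 2 * B * (2 * e')" using B0 by (intro mult_left_mono) auto
        then show ?thesis using Alip[OF e(1) ij, of y x] by simp
      qed
    qed (use Aborel[OF e(1)] Abound[OF e(1)] ij b mol_supp[OF e(2)] mollifier_nonneg_integral[OF e(2)] in auto)
  qed
  have commute: "conv2 (A e i j) (mollifier e' 0 0) x = conv2 (A e' i j) (mollifier e 0 0) x" if e: "0 < e" "0 < e'" and ij: "i + j \<le> 3" for e e' i j x
  proof -
    obtain b where b: "\<And>x. \<bar>mollifier e 0 0 x\<bar> \<le> b" using mol_bound[OF e(1)] by blast
    obtain b' where b': "\<And>x. \<bar>mollifier e' 0 0 x\<bar> \<le> b'" using mol_bound[OF e(2)] by blast
    have ij4: "i + j \<le> 4" using ij by simp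
    show ?thesis unfolding Aw[OF e(1) ij4] Aw[OF e(2) ij4]
    proof (rule conv2_commute[where b=B and S="cball 0 (2 * max e e')" and b'="max b b'"])
      show "mollifier e 0 0 x = 0" if "x \<notin> cball 0 (2 * max e e')" for x
        by (rule mol_supp[OF e(1)]) (use that in auto)
      show "mollifier e' 0 0 x = 0" if "x \<notin> cball 0 (2 * max e e')" for x
        by (rule mol_supp[OF e(2)]) (use that in auto)
    qed (use w' ij4 b b' in \<open>auto simp: le_max_iff_disj\<close>)
  qed
  \<comment> \<open>Both mollifications are compared with the one that is smoothed twice, which by
    \<open>commute\<close> does not depend on the order of the two radii.\<close>
  have cauchy: "\<bar>A e i j x - A e' i j x\<bar> \<le> 4 * B * e + 4 * B * e'" if "0 < e" "0 < e'" "i + j \<le> 3" for e e' i j x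
    using smear[OF that, of x] smear[OF that(2,1,3), of x] commute[OF that, of x] by linarith
  define \<epsilon> where "\<epsilon> n = 1 / real (Suc n)" for n
  have eps: "0 < \<epsilon> n" for n by (simp add: \<epsilon>_def)
  have eps0: "\<epsilon> \<longlonglongrightarrow> 0" unfolding \<epsilon>_def by (rule lim_1_over_n[THEN LIMSEQ_Suc])
  define V where "V i j x = lim (\<lambda>n. A (\<epsilon> n) i j x)" for i j x
  have conv: "(\<lambda>n. A (\<epsilon> n) i j x) \<longlonglongrightarrow> V i j x" if ij: "i + j \<le> 3" for i j x
  proof -
    have "Cauchy (\<lambda>n. A (\<epsilon> n) i j x)"
    proof (rule metric_CauchyI)
      fix r :: real assume r: "0 < r"
      have "(\<lambda>n. 4 * B * \<epsilon> n) \<longlonglongrightarrow> 4 * B * 0" by (intro tendsto_intros eps0)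
      then have "\<forall>\<^sub>F n in sequentially. 4 * B * \<epsilon> n < r / 2" by (rule order_tendstoD) (use r in simp)
      then obtain N where N: "\<And>n. n \<ge> N \<Longrightarrow> 4 * B * \<epsilon> n < r / 2" unfolding eventually_sequentially by blast
      show "\<exists>N. \<forall>m\<ge>N. \<forall>n\<ge>N. dist (A (\<epsilon> m) i j x) (A (\<epsilon> n) i j x) < r"
      proof (intro exI[of _ N] allI impI)
        fix m n assume "N \<le> m" "N \<le> n"
        then show "dist (A (\<epsilon> m) i j x) (A (\<epsilon> n) i j x) < r"
          using N[of m] N[of n] cauchy[OF eps eps ij, of m x n] unfolding dist_real_def by linarith
      qed
    qed
    then show ?thesis unfolding V_def by (simp add: Cauchy_convergent_iff convergent_LIMSEQ_iff)
  qed
  have close: "\<bar>A e i j x - V i j x\<bar> \<le> 4 * B * e" if e: "0 < e" and ij: "i + j \<le> 3" for e i j x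
  proof (rule tendsto_le[OF _ _ _ always_eventually])
    show "(\<lambda>n. 4 * B * e + 4 * B * \<epsilon> n) \<longlonglongrightarrow> 4 * B * e"
      using tendsto_add[OF tendsto_const[of "4 * B * e"] tendsto_mult[OF tendsto_const[of "4 * B"] eps0]] by simp
    show "(\<lambda>n. \<bar>A e i j x - A (\<epsilon> n) i j x\<bar>) \<longlonglongrightarrow> \<bar>A e i j x - V i j x\<bar>"
      by (intro tendsto_intros conv ij)
    show "\<forall>n. \<bar>A e i j x - A (\<epsilon> n) i j x\<bar> \<le> 4 * B * e + 4 * B * \<epsilon> n" using cauchy[OF e eps ij] by blast
  qed simp
  show ?thesis
  proof (rule that[of V])
    fix i j :: nat and x :: pt assume ij: "i + j \<le> 2"
    \<comment> \<open>The derivatives converge uniformly, each of the two components within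
      4B\<epsilon>, so the limit may be differentiated. Differentiability is claimed up to order two
      because convergence is known up to order three.\<close>
    have "\<exists>g. \<forall>x\<in>UNIV. (\<lambda>n. A (\<epsilon> n) i j x) \<longlonglongrightarrow> g x \<and>
      (g has_derivative (\<lambda>k. k $ 1 * V (Suc i) j x + k $ 2 * V i (Suc j) x)) (at x within UNIV)"
    proof (rule has_derivative_sequence)
      show "convex (UNIV :: pt set)" by simp
      show "(A (\<epsilon> n) i j has_derivative (\<lambda>k. k $ 1 * A (\<epsilon> n) (Suc i) j x + k $ 2 * A (\<epsilon> n) i (Suc j) x)) (at x within UNIV)" for n x
        using tower[OF eps, of n] unfolding pd_tower_def by simp
      show "(\<lambda>n. A (\<epsilon> n) i j 0) \<longlonglongrightarrow> V i j 0" by (rule conv) (use ij in simp)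
      fix r :: real assume r: "0 < r"
      have "(\<lambda>n. 8 * B * \<epsilon> n) \<longlonglongrightarrow> 8 * B * 0" by (intro tendsto_intros eps0)
      then have "\<forall>\<^sub>F n in sequentially. 8 * B * \<epsilon> n < r" by (rule order_tendstoD) (use r in simp)
      then show "\<forall>\<^sub>F n in sequentially. \<forall>x\<in>UNIV. \<forall>k :: pt. norm (k $ 1 * A (\<epsilon> n) (Suc i) j x + k $ 2 * A (\<epsilon> n) i (Suc j) x - (k $ 1 * V (Suc i) j x + k $ 2 * V i (Suc j) x)) \<le> r * norm k"
      proof eventually_elim
        case (elim n)
        show ?case
        proof (intro ballI allI)
          fix x k :: pt
          have 1: "\<bar>k $ 1 * (A (\<epsilon> n) (Suc i) j x - V (Suc i) j x)\<bar> \<le> norm k * (4 * B * \<epsilon> n)"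
            unfolding abs_mult by (intro mult_mono component_le_norm_cart close eps) (use ij in auto)
          have 2: "\<bar>k $ 2 * (A (\<epsilon> n) i (Suc j) x - V i (Suc j) x)\<bar> \<le> norm k * (4 * B * \<epsilon> n)"
            unfolding abs_mult by (intro mult_mono component_le_norm_cart close eps) (use ij in auto)
          have "norm (k $ 1 * A (\<epsilon> n) (Suc i) j x + k $ 2 * A (\<epsilon> n) i (Suc j) x - (k $ 1 * V (Suc i) j x + k $ 2 * V i (Suc j) x))
            = \<bar>k $ 1 * (A (\<epsilon> n) (Suc i) j x - V (Suc i) j x) + k $ 2 * (A (\<epsilon> n) i (Suc j) x - V i (Suc j) x)\<bar>"
            by (simp add: algebra_simps)
          also have "\<dots> \<le> norm k * (4 * B * \<epsilon> n) + norm k * (4 * B * \<epsilon> n)" using 1 2 by linarith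
          also have "\<dots> = (8 * B * \<epsilon> n) * norm k" by simp
          also have "\<dots> \<le> r * norm k" using elim by (intro mult_right_mono) auto
          finally show "norm (k $ 1 * A (\<epsilon> n) (Suc i) j x + k $ 2 * A (\<epsilon> n) i (Suc j) x - (k $ 1 * V (Suc i) j x + k $ 2 * V i (Suc j) x)) \<le> r * norm k" .
        qed
      qed
    qed auto
    then obtain g where g: "\<And>x. (\<lambda>n. A (\<epsilon> n) i j x) \<longlonglongrightarrow> g x"
      "\<And>x. (g has_derivative (\<lambda>k. k $ 1 * V (Suc i) j x + k $ 2 * V i (Suc j) x)) (at x)" by auto
    have "g = V i j"
    proof
      fix x show "g x = V i j x" using LIMSEQ_unique[OF g(1) conv] ij by simp
    qed
    then show "(V i j has_derivative (\<lambda>k. k $ 1 * V (Suc i) j x + k $ 2 * V i (Suc j) x)) (at x)" using g(2) by simp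
  next
    fix i j :: nat and x :: pt assume ij: "i + j \<le> 3"
    have "(\<lambda>n. \<bar>A (\<epsilon> n) i j x\<bar>) \<longlonglongrightarrow> \<bar>V i j x\<bar>" by (intro tendsto_intros conv ij)
    then show "\<bar>V i j x\<bar> \<le> B"
      by (rule LIMSEQ_le_const2) (use Abound eps ij in auto)
  next
    \<comment> \<open>The bound on the five-point defect uses fourth derivatives of the mollified
      field; the inequality itself contains only orders zero and two, which converge.\<close>
    fix h and x :: pt
    have "(\<lambda>n. \<bar>five_point h (A (\<epsilon> n) 0 0) x - h\<^sup>2 * (A (\<epsilon> n) 2 0 x + A (\<epsilon> n) 0 2 x)\<bar>) \<longlonglongrightarrow>
      \<bar>five_point h (V 0 0) x - h\<^sup>2 * (V 2 0 x + V 0 2 x)\<bar>"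
      unfolding five_point_def by (intro tendsto_intros conv) auto
    then show "\<bar>five_point h (V 0 0) x - h\<^sup>2 * (V 2 0 x + V 0 2 x)\<bar> \<le> B * h ^ 4 / 6"
      by (rule LIMSEQ_le_const2) (use tower_five_point[OF tower[OF eps]] Abound eps in auto)
  next
    fix S and u :: "pt \<Rightarrow> real" and x :: pt
    assume S: "open S" "continuous_on S u" "AE x in lebesgue_on S. f x = u x" "x \<in> S"
    obtain r where r: "0 < r" "cball x r \<subseteq> S" using S(1,4) open_contains_cball by blast
    have cu: "continuous_on (cball x r) u" using S(2) r(2) continuous_on_subset by blast
    \<comment> \<open>Near \<open>x\<close> the representative is replaced by the continuous
      function \<open>u\<close>. For small radius the mollifier sees only this neighbourhood, so the
      limit is u(x) at every point and not merely almost everywhere.\<close>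
    define f2 where "f2 y = (if y \<in> cball x r then u y else f' y)" for y
    have f2m [measurable]: "f2 \<in> borel_measurable borel"
    proof -
      have "f2 = (\<lambda>y. indicator (cball x r) y *\<^sub>R u y + indicator (- cball x r) y * f' y)"
        by (auto simp: f2_def fun_eq_iff)
      moreover have "(\<lambda>y. indicator (cball x r) y *\<^sub>R u y) \<in> borel_measurable borel"
        by (intro borel_measurable_continuous_on_indicator cu) auto
      moreover have "(\<lambda>y. indicator (- cball x r) y * f' y) \<in> borel_measurable borel"
        by (intro borel_measurable_times f'(1) borel_measurable_indicator) auto
      ultimately show ?thesis by simp
    qed
    obtain bu where bu: "\<And>y. y \<in> cball x r \<Longrightarrow> \<bar>u y\<bar> \<le> bu"
      using compact_imp_bounded[OF compact_continuous_image[OF cu compact_cball]]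
      unfolding bounded_iff by (metis image_eqI real_norm_def)
    have f2b: "\<bar>f2 y\<bar> \<le> \<bar>bf\<bar> + \<bar>bu\<bar>" for y
      using bu[of y] f'(2)[of y] by (auto simp: f2_def)
    have "AE y in lebesgue. y \<in> S \<longrightarrow> f y = u y"
      using S(1,3) by (simp add: AE_restrict_space_iff borel_open)
    then have "AE y in lebesgue. f' y = f2 y"
      using f'(3) by eventually_elim (use r in \<open>auto simp: f2_def\<close>)
    then have "AE y in lborel. f' y = f2 y" by (simp add: AE_completion_iff)
    then have "AE y in lborel. f' y * mollifier e 0 0 (x - y) = f2 y * mollifier e 0 0 (x - y)" for e
      by eventually_elim simp
    then have A2: "A e 0 0 x = conv2 f2 (mollifier e 0 0) x" for e
      unfolding A_def conv2_def by (intro integral_cong_AE) (use f'(1) in measurable)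
    show "V 0 0 x = u x"
    proof (rule LIMSEQ_unique[OF conv])
      show "(\<lambda>n. A (\<epsilon> n) 0 0 x) \<longlonglongrightarrow> u x"
      proof (rule metric_LIMSEQ_I)
        fix \<eta> :: real assume "0 < \<eta>"
        then obtain d where d: "0 < d" "\<And>y. y \<in> cball x r \<Longrightarrow> dist y x < d \<Longrightarrow> dist (u y) (u x) < \<eta> / 2"
          using cu r(1) unfolding continuous_on_iff by (metis centre_in_cball half_gt_zero less_imp_le)
        have "(\<lambda>n. 2 * \<epsilon> n) \<longlonglongrightarrow> 2 * 0" by (intro tendsto_intros eps0)
        then have "\<forall>\<^sub>F n in sequentially. 2 * \<epsilon> n < min d r" by (rule order_tendstoD) (use d r in simp)
        then obtain N where N: "\<And>n. n \<ge> N \<Longrightarrow> 2 * \<epsilon> n < min d r" unfolding eventually_sequentially by blast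
        show "\<exists>N. \<forall>n\<ge>N. dist (A (\<epsilon> n) 0 0 x) (u x) < \<eta>"
        proof (intro exI[of _ N] allI impI)
          fix n assume n: "N \<le> n"
          obtain b where b: "\<And>x. \<bar>mollifier (\<epsilon> n) 0 0 x\<bar> \<le> b" using mol_bound[OF eps] by blast
          have "\<bar>conv2 f2 (mollifier (\<epsilon> n) 0 0) x - u x\<bar> \<le> \<eta> / 2"
          proof (rule conv2_close[where S="cball 0 (2 * \<epsilon> n)" and b'=b and b="\<bar>bf\<bar> + \<bar>bu\<bar>"])
            show "\<bar>f2 y - u x\<bar> \<le> \<eta> / 2" if "x - y \<in> cball 0 (2 * \<epsilon> n)" for y
            proof -
              have "dist y x \<le> 2 * \<epsilon> n" using that by (simp add: dist_norm norm_minus_commute)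
              then have "dist y x < d" "y \<in> cball x r" using N[OF n] by (auto simp: dist_commute)
              then show ?thesis using d(2)[of y] by (simp add: f2_def dist_real_def)
            qed
          qed (use f2m f2b b mol_supp[OF eps] mollifier_nonneg_integral[OF eps] in auto)
          then show "dist (A (\<epsilon> n) 0 0 x) (u x) < \<eta>" using \<open>0 < \<eta>\<close> by (simp add: A2 dist_real_def)
        qed
      qed
    qed simp
  qed
qed

section \<open>Discrete potentials\<close>

lemma norm_pt_sq: "(norm (x :: pt))\<^sup>2 = (x $ 1)\<^sup>2 + (x $ 2)\<^sup>2"
  by (simp add: norm_vec_def L2_set_def UNIV_2)

lemma inner_pt: "(x :: pt) \<bullet> y = x $ 1 * y $ 1 + x $ 2 * y $ 2"
  by (simp add: inner_vec_def UNIV_2)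

text \<open>Makes the symbol of the lattice Laplacian comparable with t^2 on the whole torus. The
  cubic Taylor bound for the sine suffices: with u = |t|/2 \<le> 8/5 the correction u^2/6 stays
  below 1/2, hence sin u \<ge> u/2.\<close>

lemma sin_half_lower: "\<bar>t\<bar> \<le> pi \<Longrightarrow> t\<^sup>2 / 4 \<le> 2 - 2 * cos (t :: real)"
proof -
  assume t: "\<bar>t\<bar> \<le> pi"
  define u where "u = \<bar>t\<bar> / 2"
  have u: "0 \<le> u" "u \<le> 8 / 5" using t pi_less_4 pi_approx by (auto simp: u_def)
  have "\<bar>sin u - u\<bar> \<le> u ^ 3 / 6"
    using Maclaurin_sin_bound[of u 3] u by (simp add: sin_coeff_def eval_nat_numeral)
  then have "u - u ^ 3 / 6 \<le> sin u" by linarith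
  moreover have "u ^ 3 \<le> (8 / 5)\<^sup>2 * u"
    using mult_right_mono[OF power_mono[OF u(2) u(1), of 2] u(1)] by (simp add: eval_nat_numeral)
  ultimately have "u / 2 \<le> sin u" using u by (simp add: power2_eq_square)
  then have "(u / 2)\<^sup>2 \<le> (sin u)\<^sup>2" using u by (intro power_mono) auto
  moreover have "cos t = 1 - 2 * (sin u)\<^sup>2" using cos_double_sin[of u] by (simp add: u_def)
  moreover have "u\<^sup>2 = t\<^sup>2 / 4" by (simp add: u_def power_divide)
  ultimately show ?thesis by (simp add: power_divide)
qed

lemma one_minus_cos_le: "\<bar>cos a - 1\<bar> \<le> (a :: real)\<^sup>2 / 2"
proof -
  have "cos a = 1 - 2 * (sin (a / 2))\<^sup>2" using cos_double_sin[of "a / 2"] by simp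
  moreover have "(sin (a / 2))\<^sup>2 \<le> (a / 2)\<^sup>2"
    using abs_sin_x_le_abs_x[of "a / 2"] by (simp only: abs_le_square_iff)
  ultimately show ?thesis by (simp add: power_divide)
qed

section \<open>The lattice Green's function\<close>

definition green_integrand :: "pt \<Rightarrow> pt \<Rightarrow> real"
  where "green_integrand y t = (cos (y \<bullet> t) - 1) / (4 - 2 * cos (t $ 1) - 2 * cos (t $ 2))"

abbreviation "torus_box \<equiv> cbox (vec (- pi)) (vec pi) :: pt set"

lemma torus_box_denominator:
  assumes "t \<in> torus_box"
  shows "(norm t)\<^sup>2 / 4 \<le> 4 - 2 * cos (t $ 1) - 2 * cos (t $ 2)"
proof -
  have "\<bar>t $ 1\<bar> \<le> pi" "\<bar>t $ 2\<bar> \<le> pi" using assms by (auto simp: mem_box_cart abs_le_iff) (metis neg_le_iff_le minus_minus)+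
  from sin_half_lower[OF this(1)] sin_half_lower[OF this(2)] show ?thesis
    by (simp add: norm_pt_sq)
qed

lemma borel_lebesgue_on: "f \<in> borel_measurable borel \<Longrightarrow> f \<in> borel_measurable (lebesgue_on S)"
  for f :: "'a::euclidean_space \<Rightarrow> real"
  by (intro measurable_restrict_space1) (simp add: measurable_completion)

text \<open>Numerator and denominator both vanish quadratically at the origin: the quotient is at
  most (|y|^2 |t|^2 / 2) / (|t|^2 / 4) = 2 |y|^2. The subtraction of one in the numerator is what
  makes the integral converge.\<close>

lemma green_integrand_integrable: "integrable (lebesgue_on torus_box) (green_integrand y)"
proof (rule finite_measure.integrable_const_bound)
  show "finite_measure (lebesgue_on torus_box)"
    by (rule finite_measure_lebesgue_on) (rule lmeasurable_cbox)
  show "AE t in lebesgue_on torus_box. norm (green_integrand y t) \<le> 2 * (norm y)\<^sup>2"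
  proof (rule AE_I2)
    fix t assume "t \<in> space (lebesgue_on torus_box)"
    then have t: "t \<in> torus_box" by simp
    let ?d = "4 - 2 * cos (t $ 1) - 2 * cos (t $ 2)"
    have "\<bar>cos (y \<bullet> t) - 1\<bar> \<le> (y \<bullet> t)\<^sup>2 / 2" by (rule one_minus_cos_le)
    also have "(y \<bullet> t)\<^sup>2 \<le> (norm y * norm t)\<^sup>2"
      using Cauchy_Schwarz_ineq2[of y t] by (metis abs_ge_zero power2_abs power_mono)
    also have "(norm y * norm t)\<^sup>2 / 2 = (2 * (norm y)\<^sup>2) * ((norm t)\<^sup>2 / 4)" by (simp add: power_mult_distrib)
    also have "\<dots> \<le> (2 * (norm y)\<^sup>2) * ?d" by (intro mult_left_mono torus_box_denominator t) auto
    finally have *: "\<bar>cos (y \<bullet> t) - 1\<bar> \<le> (2 * (norm y)\<^sup>2) * ?d" by simp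
    have "0 \<le> ?d" using torus_box_denominator[OF t] by (smt (verit) zero_le_divide_iff zero_le_power2)
    then show "norm (green_integrand y t) \<le> 2 * (norm y)\<^sup>2"
      using * by (cases "?d = 0") (auto simp: green_integrand_def pos_divide_le_eq)
  qed
  have "(\<lambda>t::pt. cos (y \<bullet> t) - 1) \<in> borel_measurable borel"
    by (intro borel_measurable_continuous_onI continuous_intros)
  moreover have "(\<lambda>t::pt. 4 - 2 * cos (t $ 1) - 2 * cos (t $ 2)) \<in> borel_measurable borel"
    by (intro borel_measurable_continuous_onI continuous_intros)
  ultimately show "green_integrand y \<in> borel_measurable (lebesgue_on torus_box)"
    unfolding green_integrand_def[abs_def] by (intro borel_lebesgue_on borel_measurable_divide)
qed

text \<open>Points are vectors and not pairs, so Fubini is applied to the product measure over the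
  basis, of which \<open>lborel\<close> is the image.\<close>

lemma lborel_pt_product_integral:
  fixes f g :: "real \<Rightarrow> real"
  assumes f: "integrable lborel f" and g: "integrable lborel g"
  shows "integrable lborel (\<lambda>t::pt. f (t $ 1) * g (t $ 2))"
    "(LINT t|lborel. f ((t::pt) $ 1) * g (t $ 2)) = (LINT s|lborel. f s) * (LINT s|lborel. g s)"
proof -
  interpret product_sigma_finite "\<lambda>_::pt. lborel :: real measure" by standard
  define e1 e2 :: pt where "e1 = axis 1 1" and "e2 = axis 2 1"
  define F where "F b = (if b = e1 then f else g)" for b
  have B: "(Basis :: pt set) = {e1, e2}"
    by (auto simp: Basis_vec_def e1_def e2_def) (metis exhaust_2)
  have ne: "e1 \<noteq> e2" by (simp add: e1_def e2_def axis_eq_axis)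
  have F: "integrable lborel (F b)" for b using f g by (simp add: F_def)
  let ?\<Phi> = "\<lambda>\<omega>::pt \<Rightarrow> real. \<Sum>b\<in>Basis. \<omega> b *\<^sub>R b"
  have c: "?\<Phi> \<omega> $ 1 = \<omega> e1" "?\<Phi> \<omega> $ 2 = \<omega> e2" for \<omega>
    using ne by (simp_all add: B) (simp_all add: e1_def e2_def axis_def)
  have fm: "f \<in> borel_measurable borel" "g \<in> borel_measurable borel" using f g by auto
  have n: "(\<lambda>t::pt. t $ i) \<in> borel_measurable borel" for i by (intro borel_measurable_continuous_onI continuous_intros)
  have m: "(\<lambda>t::pt. f (t $ 1) * g (t $ 2)) \<in> borel_measurable borel"
    by (intro borel_measurable_times measurable_compose[OF n fm(1)] measurable_compose[OF n fm(2)])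
  have P: "(\<Prod>b\<in>Basis. F b (\<omega> b)) = f (?\<Phi> \<omega> $ 1) * g (?\<Phi> \<omega> $ 2)" for \<omega>
    using ne unfolding c by (simp add: B F_def)
  have \<Phi>m: "?\<Phi> \<in> (\<Pi>\<^sub>M b\<in>Basis. lborel) \<rightarrow>\<^sub>M borel" by measurable
  have "integrable (\<Pi>\<^sub>M b\<in>(Basis :: pt set). lborel) (\<lambda>\<omega>. \<Prod>b\<in>Basis. F b (\<omega> b))"
    by (rule product_integrable_prod) (auto intro: F)
  then show "integrable lborel (\<lambda>t::pt. f (t $ 1) * g (t $ 2))"
    unfolding P by (subst lborel_eq) (subst integrable_distr_eq[OF \<Phi>m m])
  have "(LINT t|lborel. f ((t::pt) $ 1) * g (t $ 2)) = (LINT \<omega>|(\<Pi>\<^sub>M b\<in>(Basis :: pt set). lborel). f (?\<Phi> \<omega> $ 1) * g (?\<Phi> \<omega> $ 2))"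
    by (subst lborel_eq) (rule integral_distr[OF \<Phi>m m])
  also have "\<dots> = (LINT \<omega>|(\<Pi>\<^sub>M b\<in>(Basis :: pt set). lborel). (\<Prod>b\<in>Basis. F b (\<omega> b)))"
    unfolding P ..
  also have "\<dots> = (\<Prod>b\<in>Basis. integral\<^sup>L lborel (F b))"
    by (rule product_integral_prod) (auto intro: F)
  also have "\<dots> = (LINT s|lborel. f s) * (LINT s|lborel. g s)"
    using ne by (simp add: B F_def)
  finally show "(LINT t|lborel. f ((t::pt) $ 1) * g (t $ 2)) = (LINT s|lborel. f s) * (LINT s|lborel. g s)" .
qed

text \<open>Expanding the cosine of y1 t1 + y2 t2 gives products of one-dimensional integrals. The
  sine integrals always vanish, and the cosine integral vanishes for a nonzero integer frequency, of
  which there is at least one.\<close>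

lemma integral_cos_torus:
  fixes m :: "2 \<Rightarrow> int"
  assumes y: "\<And>i. y $ i = of_int (m i)" and "y \<noteq> 0"
  shows "(LINT t|lebesgue_on torus_box. cos (y \<bullet> t)) = 0"
proof -
  let ?I = "indicator {-pi..pi} :: real \<Rightarrow> real"
  have ci: "integrable lborel (\<lambda>s. cos (a * s) * ?I s)" "integrable lborel (\<lambda>s. sin (a * s) * ?I s)" for a
  proof -
    have "continuous_on {-pi..pi} (\<lambda>s. cos (a * s))" "continuous_on {-pi..pi} (\<lambda>s. sin (a * s))"
      by (intro continuous_intros)+
    from this[THEN borel_integrable_atLeastAtMost']
    show "integrable lborel (\<lambda>s. cos (a * s) * ?I s)" "integrable lborel (\<lambda>s. sin (a * s) * ?I s)"
      by (simp_all add: set_integrable_def mult.commute)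
  qed
  have c0: "(LINT s|lborel. cos (of_int k * s) * ?I s) = 0" if "k \<noteq> 0" for k :: int
  proof -
    have "(LINT s|lborel. cos (of_int k * s) * ?I s) = sin (of_int k * pi) / of_int k - sin (of_int k * (- pi)) / of_int k"
      by (rule integral_FTC_Icc_real) (use that in \<open>auto intro!: derivative_eq_intros continuous_intros\<close>)
    then show ?thesis by (simp add: mult.commute[of "of_int k"])
  qed
  have s0: "(LINT s|lborel. sin (of_int k * s) * ?I s) = 0" for k :: int
  proof (cases "k = 0")
    case False
    have "(LINT s|lborel. sin (of_int k * s) * ?I s) = - cos (of_int k * pi) / of_int k - (- cos (of_int k * (- pi)) / of_int k)"
      by (rule integral_FTC_Icc_real) (use False in \<open>auto intro!: derivative_eq_intros continuous_intros\<close>)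
    then show ?thesis by simp
  qed simp
  have ind: "indicator torus_box t = ?I (t $ 1) * ?I (t $ 2)" for t
    by (auto simp: indicator_def mem_box_cart forall_2)
  have "(LINT t|lebesgue_on torus_box. cos (y \<bullet> t)) = (LINT t|lebesgue. indicator torus_box t *\<^sub>R cos (y \<bullet> t))"
    by (subst integral_restrict_space) auto
  also have "\<dots> = (LINT t|lborel. indicator torus_box t *\<^sub>R cos (y \<bullet> t))"
  proof (rule integral_completion)
    have "(\<lambda>t. indicator torus_box t *\<^sub>R cos (y \<bullet> t)) \<in> borel_measurable borel"
      by (intro borel_measurable_continuous_on_indicator continuous_intros) simp
    then show "(\<lambda>t. indicator torus_box t *\<^sub>R cos (y \<bullet> t)) \<in> borel_measurable lborel" by simp
  qed
  also have "\<dots> = (LINT t|lborel. (cos (y $ 1 * ((t :: pt) $ 1)) * ?I (t $ 1)) * (cos (y $ 2 * (t $ 2)) * ?I (t $ 2))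
      - (sin (y $ 1 * (t $ 1)) * ?I (t $ 1)) * (sin (y $ 2 * (t $ 2)) * ?I (t $ 2)))"
    by (intro Bochner_Integration.integral_cong) (auto simp: ind inner_pt cos_add algebra_simps)
  also have "\<dots> = (LINT s|lborel. cos (y $ 1 * s) * ?I s) * (LINT s|lborel. cos (y $ 2 * s) * ?I s)
      - (LINT s|lborel. sin (y $ 1 * s) * ?I s) * (LINT s|lborel. sin (y $ 2 * s) * ?I s)"
    using lborel_pt_product_integral[OF ci(1)[of "y $ 1"] ci(1)[of "y $ 2"]]
      lborel_pt_product_integral[OF ci(2)[of "y $ 1"] ci(2)[of "y $ 2"]]
    by (simp add: Bochner_Integration.integral_diff)
  also have "\<dots> = 0"
  proof -
    have "m 1 \<noteq> 0 \<or> m 2 \<noteq> 0" using y \<open>y \<noteq> 0\<close> by (auto simp: vec_eq_iff forall_2)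
    then show ?thesis unfolding y using c0 s0 by auto
  qed
  finally show ?thesis .
qed

text \<open>The stencil multiplies the cosine by minus the denominator and cancels the constant -1,
  so the quotient collapses to - cos(y \<bullet> t). The claim is then orthogonality of characters:
  the integral vanishes away from the origin, where the source sits.\<close>

lemma green_five_point:
  assumes h: "0 < h" and x: "x \<in> lattice_pts h" "x \<noteq> 0"
  shows "five_point h (green h) x = 0"
proof -
  define y where "y = (1 / h) *\<^sub>R x"
  let ?e1 = "axis 1 1 :: pt" and ?e2 = "axis 2 1 :: pt"
  let ?M = "lebesgue_on torus_box"
  obtain m :: "2 \<Rightarrow> int" where m: "\<And>i. x $ i = h * of_int (m i)"
    using x(1) unfolding lattice_pts_def by (simp, metis)
  have ym: "y $ i = of_int (m i)" for i using h m by (simp add: y_def)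
  have y0: "y \<noteq> 0" using x(2) h by (simp add: y_def)
  have g: "green h v = 1 / (4 * pi\<^sup>2) * (LINT t|?M. green_integrand ((1 / h) *\<^sub>R v) t)" for v
    by (simp add: green_def green_integrand_def)
  have sh: "(1 / h) *\<^sub>R (x + h *\<^sub>R e) = y + e" "(1 / h) *\<^sub>R (x - h *\<^sub>R e) = y - e" for e
    using h by (simp_all add: y_def scaleR_add_right scaleR_diff_right)
  note I = green_integrand_integrable
  have "five_point h (green h) x = 1 / (4 * pi\<^sup>2) *
    (LINT t|?M. green_integrand (y + ?e1) t + green_integrand (y - ?e1) t + green_integrand (y + ?e2) t
       + green_integrand (y - ?e2) t - 4 * green_integrand y t)"
    unfolding five_point_def g sh y_def[symmetric] using I by (simp add: algebra_simps)
  also have "(LINT t|?M. green_integrand (y + ?e1) t + green_integrand (y - ?e1) t + green_integrand (y + ?e2) t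
       + green_integrand (y - ?e2) t - 4 * green_integrand y t) = (LINT t|?M. - cos (y \<bullet> t))"
  proof (rule integral_cong_AE)
    \<comment> \<open>At the origin the quotient is 0/0, which evaluates to 0, while the right-hand
      side is -1; the identity holds off this null set.\<close>
    have "AE t in ?M. t \<noteq> 0"
      by (rule AE_I'[of "{0}"]) (auto simp: null_sets_restrict_space negligible_iff_null_sets[symmetric] mem_box_cart)
    moreover have "AE t in ?M. t \<in> torus_box" by (rule AE_I2) simp
    ultimately show "AE t in ?M. green_integrand (y + ?e1) t + green_integrand (y - ?e1) t + green_integrand (y + ?e2) t
       + green_integrand (y - ?e2) t - 4 * green_integrand y t = - cos (y \<bullet> t)"
    proof eventually_elim
      case (elim t)
      let ?d = "4 - 2 * cos (t $ 1) - 2 * cos (t $ 2)"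
      have "0 < (norm t)\<^sup>2" using elim by simp
      then have d: "?d \<noteq> 0" using torus_box_denominator[OF elim(2)] by linarith
      have e: "?e1 \<bullet> t = t $ 1" "?e2 \<bullet> t = t $ 2" by (simp_all add: inner_pt axis_def)
      have "cos (y \<bullet> t + t $ i) + cos (y \<bullet> t - t $ i) = 2 * (cos (y \<bullet> t) * cos (t $ i))" for i
        by (simp add: cos_add cos_diff)
      from this[of 1] this[of 2] have "(cos (y \<bullet> t + t $ 1) - 1) + (cos (y \<bullet> t - t $ 1) - 1) + (cos (y \<bullet> t + t $ 2) - 1)
        + (cos (y \<bullet> t - t $ 2) - 1) - 4 * (cos (y \<bullet> t) - 1) = - cos (y \<bullet> t) * ?d"
        by (simp add: algebra_simps)
      then have "((cos (y \<bullet> t + t $ 1) - 1) + (cos (y \<bullet> t - t $ 1) - 1) + (cos (y \<bullet> t + t $ 2) - 1)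
        + (cos (y \<bullet> t - t $ 2) - 1) - 4 * (cos (y \<bullet> t) - 1)) / ?d = - cos (y \<bullet> t)" using d by (simp add: field_simps)
      then show ?case
        unfolding green_integrand_def inner_add_left inner_diff_left e
        by (simp only: add_divide_distrib diff_divide_distrib times_divide_eq_right right_diff_distrib)
    qed
    show "(\<lambda>t. - cos (y \<bullet> t)) \<in> borel_measurable ?M"
      by (intro borel_lebesgue_on borel_measurable_continuous_onI continuous_intros)
  qed (use I in \<open>auto intro!: borel_measurable_integrable\<close>)
  also have "\<dots> = 0" using integral_cos_torus[OF ym y0] by simp
  finally show ?thesis by simp
qed

section \<open>The discrete maximum principle\<close>

text \<open>At an interior maximum that exceeds the boundary bound no neighbour is larger, so the
  stencil is nonpositive there. Finiteness of the interior set provides the maximum.\<close>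

lemma discrete_max_strict:
  assumes fin: "finite I" and nb: "\<And>x. x \<in> I \<Longrightarrow> x + h *\<^sub>R axis 1 1 \<in> I \<union> A \<and> x - h *\<^sub>R axis 1 1 \<in> I \<union> A
      \<and> x + h *\<^sub>R axis 2 1 \<in> I \<union> A \<and> x - h *\<^sub>R axis 2 1 \<in> I \<union> A"
    and pos: "\<And>x. x \<in> I \<Longrightarrow> 0 < five_point h e x" and bd: "\<And>x. x \<in> A \<Longrightarrow> e x \<le> m" and "x \<in> I"
  shows "e x \<le> m"
proof (rule ccontr)
  assume "\<not> ?thesis"
  have "Max (e ` I) \<in> e ` I" using fin \<open>x \<in> I\<close> by (intro Max_in) auto
  then obtain y where y0: "y \<in> I" "e y = Max (e ` I)" by auto
  have y: "y \<in> I" "\<And>z. z \<in> I \<Longrightarrow> e z \<le> e y" using y0 fin by auto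
  have "e z \<le> e y" if "z \<in> I \<union> A" for z
    using that y(2)[of z] bd[of z] y(2)[OF \<open>x \<in> I\<close>] \<open>\<not> e x \<le> m\<close> by auto
  with nb[OF y(1)] have "five_point h e y \<le> 0" unfolding five_point_def by (smt (verit))
  then show False using pos[OF y(1)] by simp
qed

lemma five_point_norm_sq: "five_point h (\<lambda>x. (norm (x - x0))\<^sup>2) x = 4 * h\<^sup>2"
  unfolding five_point_def norm_pt_sq by (simp add: axis_def power2_eq_square algebra_simps)

lemma five_point_lincomb: "five_point h (\<lambda>x. a * u x + b * v x) x = a * five_point h u x + b * five_point h v x"
  by (simp add: five_point_def algebra_simps)

lemma five_point_diff: "five_point h (\<lambda>x. u x - v x) x = five_point h u x - five_point h v x"
  by (simp add: five_point_def)

lemma five_point_sum: "five_point h (\<lambda>x. \<Sum>k\<in>S. u k x) x = (\<Sum>k\<in>S. five_point h (u k) x)"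
  by (simp add: five_point_def sum.distrib sum_subtractf sum_distrib_left)

text \<open>The paraboloid (\<tau> + \<eta>)/4 |x - x0|^2 has stencil exactly h^2 (\<tau> + \<eta>),
  which strictly dominates the defect of \<open>e\<close>. Adding it to plus or minus
  \<open>e\<close> makes the strict principle applicable; then \<eta> tends to zero.\<close>

lemma discrete_max_principle:
  assumes h: "0 < h" and fin: "finite I"
    and nb: "\<And>x. x \<in> I \<Longrightarrow> x + h *\<^sub>R axis 1 1 \<in> I \<union> A \<and> x - h *\<^sub>R axis 1 1 \<in> I \<union> A
      \<and> x + h *\<^sub>R axis 2 1 \<in> I \<union> A \<and> x - h *\<^sub>R axis 2 1 \<in> I \<union> A"
    and lap: "\<And>x. x \<in> I \<Longrightarrow> \<bar>five_point h e x\<bar> \<le> h\<^sup>2 * \<tau>" and bd: "\<And>x. x \<in> A \<Longrightarrow> e x = 0"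
    and ball: "I \<union> A \<subseteq> cball x0 r" and x: "x \<in> I"
  shows "\<bar>e x\<bar> \<le> \<tau> * r\<^sup>2 / 4"
proof -
  have r0: "0 \<le> r" using x ball by (metis UnI1 cball_eq_empty empty_iff not_less subset_empty subset_iff)
  have in_ball: "(norm (z - x0))\<^sup>2 \<le> r\<^sup>2" if "z \<in> I \<union> A" for z
    using that ball by (intro power_mono) (auto simp: dist_norm norm_minus_commute)
  have \<tau>0: "0 \<le> \<tau>"
    using lap[OF x] h by (smt (verit, best) zero_less_power zero_le_mult_iff)
  have key: "s * e x \<le> (\<tau> + \<eta>) * r\<^sup>2 / 4" if s: "\<bar>s\<bar> = 1" and \<eta>: "0 < \<eta>" for s \<eta>
  proof -
    let ?f = "\<lambda>x. s * e x + (\<tau> + \<eta>) / 4 * (norm (x - x0))\<^sup>2"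
    have "?f x \<le> (\<tau> + \<eta>) / 4 * r\<^sup>2"
    proof (rule discrete_max_strict[OF fin nb _ _ x])
      fix y assume y: "y \<in> I"
      have "\<bar>s * five_point h e y\<bar> \<le> h\<^sup>2 * \<tau>" using lap[OF y] s by (simp add: abs_mult)
      moreover have "0 < h\<^sup>2 * \<eta>" using h \<eta> by simp
      moreover have "five_point h ?f y = s * five_point h e y + (h\<^sup>2 * \<tau> + h\<^sup>2 * \<eta>)"
        unfolding five_point_lincomb five_point_norm_sq by (simp add: algebra_simps)
      ultimately show "0 < five_point h ?f y" by linarith
    next
      fix y assume "y \<in> A"
      then show "?f y \<le> (\<tau> + \<eta>) / 4 * r\<^sup>2" using bd in_ball[of y] \<tau>0 \<eta> by (simp add: mult_left_mono)
    qed auto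
    moreover have "0 \<le> (\<tau> + \<eta>) / 4 * (norm (x - x0))\<^sup>2" using \<tau>0 \<eta> by simp
    ultimately show ?thesis by simp
  qed
  have "\<bar>e x\<bar> \<le> \<tau> * r\<^sup>2 / 4 + \<delta>" if "0 < \<delta>" for \<delta>
  proof -
    \<comment> \<open>The summand 1 in the denominator keeps the quotient meaningful when
      \<open>r = 0\<close>.\<close>
    define \<eta> where "\<eta> = 4 * \<delta> / (r\<^sup>2 + 1)"
    have "0 < \<eta>" using that by (simp add: \<eta>_def add_nonneg_pos)
    have "\<eta> * r\<^sup>2 / 4 \<le> \<delta>"
      using that by (simp add: \<eta>_def divide_le_eq add_nonneg_pos mult_left_mono)
    moreover have "(\<tau> + \<eta>) * r\<^sup>2 / 4 = \<tau> * r\<^sup>2 / 4 + \<eta> * r\<^sup>2 / 4" by (simp add: field_simps)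
    ultimately show ?thesis using key[of 1 \<eta>] key[of "- 1" \<eta>] \<open>0 < \<eta>\<close> by (simp add: abs_le_iff)
  qed
  then show ?thesis by (rule field_le_epsilon)
qed

section \<open>Lattice neighbours and discrete harmonic extension\<close>

lemma dirs_eq: "dirs = {axis 1 1, axis 2 1, - axis 1 1, - axis 2 1}"
proof -
  have "{axis i 1 | i. True} = (\<lambda>i. axis i 1 :: pt) ` UNIV" "{- axis i 1 | i. True} = (\<lambda>i. - axis i 1 :: pt) ` UNIV"
    by auto
  then show ?thesis unfolding dirs_def UNIV_2 by auto
qed

lemma lattice_add_dir:
  assumes "x \<in> lattice_pts h" "e \<in> dirs" shows "x + h *\<^sub>R e \<in> lattice_pts h"
proof -
  obtain m :: "2 \<Rightarrow> int" where m: "\<And>i. x $ i = h * of_int (m i)"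
    using assms(1) unfolding lattice_pts_def by (simp, metis)
  have "\<exists>k::int. e $ i = of_int k" for i
  proof -
    have "e $ i = 0 \<or> e $ i = 1 \<or> e $ i = - 1" using assms(2) unfolding dirs_eq by (auto simp: axis_def split: if_splits)
    then show ?thesis by (metis of_int_0 of_int_1 of_int_minus)
  qed
  then obtain k :: "2 \<Rightarrow> int" where k: "\<And>i. e $ i = of_int (k i)" by metis
  have "(x + h *\<^sub>R e) $ i = h * of_int (m i + k i)" for i by (simp add: m k distrib_left)
  then show ?thesis unfolding lattice_pts_def by blast
qed

lemma lattice_diff:
  assumes "x \<in> lattice_pts h" "y \<in> lattice_pts h" shows "x - y \<in> lattice_pts h"
proof -
  obtain m k :: "2 \<Rightarrow> int" where m: "\<And>i. x $ i = h * of_int (m i)" and k: "\<And>i. y $ i = h * of_int (k i)"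
    using assms unfolding lattice_pts_def by (simp, metis)
  have "(x - y) $ i = h * of_int (m i - k i)" for i by (simp add: m k right_diff_distrib)
  then show ?thesis unfolding lattice_pts_def by blast
qed

lemma nbr_sym: "nbr h x y \<Longrightarrow> nbr h y x"
proof -
  assume "nbr h x y"
  then obtain e where e: "x \<in> lattice_pts h" "y \<in> lattice_pts h" "e \<in> dirs" "y = x + h *\<^sub>R e" unfolding nbr_def by blast
  then have "- e \<in> dirs" "x = y + h *\<^sub>R (- e)" by (auto simp: dirs_eq)
  then show ?thesis using e unfolding nbr_def by blast
qed

lemma nbr_finite: "finite {y. nbr h x y}"
proof (rule finite_subset)
  show "{y. nbr h x y} \<subseteq> (\<lambda>e. x + h *\<^sub>R e) ` dirs" by (auto simp: nbr_def)
qed (simp add: dirs_eq)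

lemma nbr_common_cell:
  assumes h: "0 < h" and "nbr h x y"
  obtains K where "K \<in> cells h" "closed_segment x y \<subseteq> K"
proof -
  obtain e where e: "x \<in> lattice_pts h" "y \<in> lattice_pts h" "e \<in> dirs" "y = x + h *\<^sub>R e"
    using assms(2) unfolding nbr_def by blast
  define w where "w = (if e \<in> {axis 1 1, axis 2 1} then x else y)"
  have "w \<in> lattice_pts h" using e by (simp add: w_def)
  moreover have "x \<in> cbox w (w + vec h)" "y \<in> cbox w (w + vec h)"
    using e(3) h unfolding e(4) w_def dirs_eq
    by (auto simp: mem_box_cart axis_def axis_eq_axis)
  then have "closed_segment x y \<subseteq> cbox w (w + vec h)" by (rule closed_segment_subset) simp
  ultimately show ?thesis using that unfolding cells_def by blast
qed

text \<open>By the intermediate value theorem the level set meets the common edge, so a cell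
  containing the edge is active and has both end points among its vertices.\<close>

lemma nbr_crossing_gam:
  assumes h: "0 < h" and xy: "nbr h x y" and \<psi>: "continuous_on UNIV \<psi>" "\<psi> x < 0" "0 < \<psi> y"
  shows "x \<in> gam \<psi> h" "y \<in> gam \<psi> h"
proof -
  obtain K where K: "K \<in> cells h" "closed_segment x y \<subseteq> K" using nbr_common_cell[OF h xy] .
  have "connected (\<psi> ` closed_segment x y)"
    by (intro connected_continuous_image continuous_on_subset[OF \<psi>(1)]) auto
  then have "0 \<in> \<psi> ` closed_segment x y"
    using \<psi>(2,3) connected_contains_Icc[of "\<psi> ` closed_segment x y" "\<psi> x" "\<psi> y"] by auto
  then obtain z where "z \<in> K" "\<psi> z = 0" using K(2) by (auto simp: image_iff)
  then have "K \<in> active_cells \<psi> h" using K(1) unfolding active_cells_def zero_set_def by auto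
  moreover have "x \<in> K" "y \<in> K" using K(2) by auto
  ultimately show "x \<in> gam \<psi> h" "y \<in> gam \<psi> h" using xy unfolding gam_def nbr_def by auto
qed

lemma is_inverse_on_inverse_on: "invertible_on I A \<Longrightarrow> is_inverse_on I A (inverse_on I A)"
  unfolding invertible_on_def inverse_on_def using someI_ex[of "is_inverse_on I A"] by blast

locale cut_grid =
  fixes \<psi> :: "pt \<Rightarrow> real" and h :: real
  assumes h_pos: "0 < h"
    and cont_psi: "continuous_on UNIV \<psi>"
    and no_vertex: "lattice_pts h \<inter> zero_set \<psi> = {}"
    and V_int_finite: "finite (V_int \<psi> h)"
begin

lemma lattice_sign: "x \<in> lattice_pts h \<Longrightarrow> \<psi> x < 0 \<or> 0 < \<psi> x"
  using no_vertex unfolding zero_set_def by (smt (verit) disjoint_iff mem_Collect_eq)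

text \<open>Identifies \<open>gam2\<close> as the outer lattice boundary of the set of all interior
  nodes. The maximum principle therefore asks for boundary values on \<open>gam2\<close> only,
  although the interior reaches far beyond \<open>gam1\<close>.\<close>

lemma V_int_nbr:
  assumes "x \<in> V_int \<psi> h" "nbr h x y"
  shows "y \<in> V_int \<psi> h \<union> gam2 \<psi> h"
proof (cases "\<psi> y < 0")
  case True then show ?thesis using assms by (auto simp: V_int_def nbr_def)
next
  case False
  then have y: "0 < \<psi> y" using lattice_sign[of y] assms(2) by (auto simp: nbr_def)
  have x: "\<psi> x < 0" using assms(1) by (simp add: V_int_def)
  from nbr_crossing_gam[OF h_pos assms(2) cont_psi x y] x y nbr_sym[OF assms(2)]
  show ?thesis unfolding gam2_def gam1_def by blast
qed

lemma V_int_axis: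
  assumes "x \<in> V_int \<psi> h"
  shows "x + h *\<^sub>R axis 1 1 \<in> V_int \<psi> h \<union> gam2 \<psi> h \<and> x - h *\<^sub>R axis 1 1 \<in> V_int \<psi> h \<union> gam2 \<psi> h
      \<and> x + h *\<^sub>R axis 2 1 \<in> V_int \<psi> h \<union> gam2 \<psi> h \<and> x - h *\<^sub>R axis 2 1 \<in> V_int \<psi> h \<union> gam2 \<psi> h"
proof -
  have xl: "x \<in> lattice_pts h" using assms by (simp add: V_int_def)
  have "x + h *\<^sub>R e \<in> V_int \<psi> h \<union> gam2 \<psi> h" if "e \<in> dirs" for e
    by (rule V_int_nbr[OF assms]) (use xl lattice_add_dir[OF xl that] that in \<open>auto simp: nbr_def\<close>)
  from this[of "axis 1 1"] this[of "axis 2 1"] this[of "- axis 1 1"] this[of "- axis 2 1"]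
  show ?thesis by (simp add: dirs_eq)
qed

lemma gam1_subset: "gam1 \<psi> h \<subseteq> V_int \<psi> h"
  by (auto simp: gam1_def gam_def V_int_def)

lemma gam2_finite: "finite (gam2 \<psi> h)"
proof (rule finite_subset)
  show "gam2 \<psi> h \<subseteq> (\<Union>x\<in>V_int \<psi> h. {y. nbr h x y})"
    using gam1_subset nbr_sym unfolding gam2_def by blast
qed (use V_int_finite nbr_finite in auto)

text \<open>Lattice harmonicity in the target fails only at the source, and all sources are
  exterior. For the double layer this includes the auxiliary nodes: a neighbour of an exterior node
  that is not in \<open>gam\<close> cannot be interior, since the edge between them would be
  cut.\<close>

lemma layer_kernel_five_point:
  assumes x: "x \<in> V_int \<psi> h" and y: "y \<in> gam2 \<psi> h"
  shows "five_point h (\<lambda>x. layer_kernel \<psi> h l x y) x = 0"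
proof -
  have xl: "x \<in> lattice_pts h" "\<psi> x < 0" using x by (auto simp: V_int_def)
  have yl: "y \<in> lattice_pts h" "0 < \<psi> y" using y by (auto simp: gam2_def gam_def)
  have g: "five_point h (\<lambda>x. green h (x - z)) x = 0" if "z \<in> lattice_pts h" "0 < \<psi> z" for z
  proof -
    have "five_point h (\<lambda>x. green h (x - z)) x = five_point h (green h) (x - z)"
      by (simp add: five_point_def algebra_simps)
    also have "\<dots> = 0"
      by (rule green_five_point[OF h_pos lattice_diff[OF xl(1) that(1)]]) (use xl that in auto)
    finally show ?thesis .
  qed
  show ?thesis
  proof (cases l)
    case Single then show ?thesis using g[OF yl] by simp
  next
    case Double
    let ?Z = "{z. nbr h y z \<and> z \<notin> gam \<psi> h}"
    have fin: "finite ?Z" using nbr_finite[of h y] by (rule rev_finite_subset) auto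
    have "five_point h (\<lambda>x. layer_kernel \<psi> h l x y) x =
      (\<Sum>z\<in>?Z. five_point h (\<lambda>x. green h (x - z)) x - five_point h (\<lambda>x. green h (x - y)) x)"
      unfolding Double by (simp add: five_point_sum five_point_diff)
    also have "\<dots> = 0"
    proof (rule sum.neutral, rule ballI)
      fix z assume z: "z \<in> ?Z"
      have zl: "z \<in> lattice_pts h" using z by (simp add: nbr_def)
      have "\<not> \<psi> z < 0"
      proof
        assume "\<psi> z < 0"
        from nbr_crossing_gam(1)[OF h_pos nbr_sym cont_psi this yl(2)] z show False by blast
      qed
      then have "0 < \<psi> z" using lattice_sign[OF zl] by simp
      then show "five_point h (\<lambda>x. green h (x - z)) x - five_point h (\<lambda>x. green h (x - y)) x = 0"
        using g[OF zl] g[OF yl] by simp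
    qed
    finally show ?thesis .
  qed
qed

text \<open>\<open>H_mat\<close> makes sense with any lattice point as first argument. Read on all
  interior nodes it is the potential \<open>z\<close> with density \<open>q\<close>, the inverse
  block applied to \<open>v\<close>: discretely harmonic inside and equal to \<open>v\<close> on
  \<open>gam2\<close>, so that the maximum principle applies to \<open>z - v\<close>.\<close>

lemma H_mat_approximates:
  assumes inv: "invertible_on (gam2 \<psi> h) (layer_kernel \<psi> h l)"
    and lap: "\<And>x. x \<in> V_int \<psi> h \<Longrightarrow> \<bar>five_point h v x\<bar> \<le> h\<^sup>2 * \<tau>"
    and ball: "V_int \<psi> h \<union> gam2 \<psi> h \<subseteq> cball x0 r" and \<xi>: "\<xi> \<in> V_int \<psi> h"
  shows "\<bar>(\<Sum>y\<in>gam2 \<psi> h. H_mat \<psi> h l \<xi> y * v y) - v \<xi>\<bar> \<le> \<tau> * r\<^sup>2 / 4"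
proof -
  let ?I = "gam2 \<psi> h" and ?P = "layer_kernel \<psi> h l"
  let ?B = "inverse_on ?I ?P"
  have B: "(\<Sum>k\<in>?I. ?P i k * ?B k j) = (if i = j then 1 else 0)" if "i \<in> ?I" "j \<in> ?I" for i j
    using is_inverse_on_inverse_on[OF inv] that unfolding is_inverse_on_def by blast
  define q where "q k = (\<Sum>y\<in>?I. ?B k y * v y)" for k
  define z where "z x = (\<Sum>k\<in>?I. ?P x k * q k)" for x
  have zH: "z x = (\<Sum>y\<in>?I. H_mat \<psi> h l x y * v y)" for x
  proof -
    have "z x = (\<Sum>k\<in>?I. \<Sum>y\<in>?I. ?P x k * ?B k y * v y)"
      unfolding z_def q_def by (simp add: sum_distrib_left mult.assoc)
    also have "\<dots> = (\<Sum>y\<in>?I. H_mat \<psi> h l x y * v y)"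
      unfolding H_mat_def by (subst sum.swap) (simp add: sum_distrib_right)
    finally show ?thesis .
  qed
  have zv: "z x = v x" if x: "x \<in> ?I" for x
  proof -
    have "z x = (\<Sum>y\<in>?I. (\<Sum>k\<in>?I. ?P x k * ?B k y) * v y)"
      unfolding zH H_mat_def ..
    also have "\<dots> = (\<Sum>y\<in>?I. if x = y then v y else 0)" using B[OF x] by (intro sum.cong) auto
    also have "\<dots> = v x" using x gam2_finite by simp
    finally show ?thesis .
  qed
  have zlap: "five_point h z x = 0" if x: "x \<in> V_int \<psi> h" for x
  proof -
    have "five_point h z x = (\<Sum>k\<in>?I. five_point h (\<lambda>x. ?P x k) x * q k)"
      unfolding z_def five_point_sum by (simp add: five_point_def algebra_simps)
    also have "\<dots> = 0" using layer_kernel_five_point[OF x] by simp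
    finally show ?thesis .
  qed
  have "\<bar>z \<xi> - v \<xi>\<bar> \<le> \<tau> * r\<^sup>2 / 4"
  proof (rule discrete_max_principle[OF h_pos V_int_finite V_int_axis _ _ ball \<xi>])
    fix x assume x: "x \<in> V_int \<psi> h"
    have "five_point h (\<lambda>x. z x - v x) x = five_point h z x - five_point h v x" by (simp add: five_point_def)
    then show "\<bar>five_point h (\<lambda>x. z x - v x) x\<bar> \<le> h\<^sup>2 * \<tau>" using zlap[OF x] lap[OF x] by simp
  qed (use zv in auto)
  then show ?thesis by (simp add: zH)
qed

end

section \<open>Extrapolation and the reduced vector\<close>

lemma ray_value_affine: "affine_fun q \<Longrightarrow> ray_value h \<eta> e q = q \<eta>"
  by (auto simp: affine_fun_def ray_value_def inner_diff_right algebra_simps)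

lemma ray_value_bound:
  assumes "\<And>\<xi>. \<xi> \<in> ray_nodes h \<eta> e \<Longrightarrow> \<bar>f \<xi>\<bar> \<le> \<epsilon>"
  shows "\<bar>ray_value h \<eta> e f\<bar> \<le> 3 * \<epsilon>"
  using assms[of "\<eta> - h *\<^sub>R e"] assms[of "\<eta> - (2 * h) *\<^sub>R e"]
  unfolding ray_value_def ray_nodes_def by simp

text \<open>Puts both extrapolation rules under one interface. A ray has weights 2 and -1, of
  absolute sum 3, and averaging two rays does not increase this; a least-squares stencil has at most
  \<open>n\<close> weights of size at most \<open>W\<close>.\<close>

lemma (in cut_grid) extrapolation_props:
  assumes ex: "local_extrapolation \<psi> h N w n W \<kappa>" and \<eta>: "\<eta> \<in> gam3 \<psi> h"
  shows "N \<eta> \<subseteq> gam1 \<psi> h \<union> gam2 \<psi> h" "finite (N \<eta>)"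
    "\<And>f \<epsilon>. 0 \<le> \<epsilon> \<Longrightarrow> (\<And>\<xi>. \<xi> \<in> N \<eta> \<Longrightarrow> \<bar>f \<xi>\<bar> \<le> \<epsilon>) \<Longrightarrow> \<bar>\<Sum>\<xi>\<in>N \<eta>. w \<eta> \<xi> * f \<xi>\<bar> \<le> (3 + real n * \<bar>W\<bar>) * \<epsilon>"
    "\<And>q. affine_fun q \<Longrightarrow> (\<Sum>\<xi>\<in>N \<eta>. w \<eta> \<xi> * q \<xi>) = q \<eta>"
    "\<And>\<xi>. \<xi> \<in> N \<eta> \<Longrightarrow> norm (\<xi> - \<eta>) \<le> \<kappa> * h"
proof -
  have fin: "finite (gam1 \<psi> h \<union> gam2 \<psi> h)"
    using gam1_subset V_int_finite gam2_finite finite_subset by auto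
  have W0: "0 \<le> real n * \<bar>W\<bar>" by simp
  consider (ax) "axial_rule \<psi> h N w" | (ls) "least_squares_rule \<psi> h N w n W"
    using ex unfolding local_extrapolation_def by blast
  then have "N \<eta> \<subseteq> gam1 \<psi> h \<union> gam2 \<psi> h \<and>
    (\<forall>f \<epsilon>. 0 \<le> \<epsilon> \<longrightarrow> (\<forall>\<xi>\<in>N \<eta>. \<bar>f \<xi>\<bar> \<le> \<epsilon>) \<longrightarrow> \<bar>\<Sum>\<xi>\<in>N \<eta>. w \<eta> \<xi> * f \<xi>\<bar> \<le> (3 + real n * \<bar>W\<bar>) * \<epsilon>) \<and>
    (\<forall>q. affine_fun q \<longrightarrow> (\<Sum>\<xi>\<in>N \<eta>. w \<eta> \<xi> * q \<xi>) = q \<eta>)"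
  proof cases
    case ax
    have bnd: "3 * \<epsilon> \<le> (3 + real n * \<bar>W\<bar>) * \<epsilon>" if "0 \<le> \<epsilon>" for \<epsilon> :: real
      using that W0 by (intro mult_right_mono) auto
    have rule: "if \<exists>e e'. admissible \<psi> h \<eta> e \<and> admissible \<psi> h \<eta> e' \<and> e \<bullet> e' = 0
     then \<exists>e e'. admissible \<psi> h \<eta> e \<and> admissible \<psi> h \<eta> e' \<and> e \<bullet> e' = 0 \<and>
       N \<eta> = ray_nodes h \<eta> e \<union> ray_nodes h \<eta> e' \<and>
       (\<forall>v. (\<Sum>\<xi>\<in>N \<eta>. w \<eta> \<xi> * v \<xi>) = (ray_value h \<eta> e v + ray_value h \<eta> e' v) / 2)
     else \<exists>e. admissible \<psi> h \<eta> e \<and> N \<eta> = ray_nodes h \<eta> e \<and>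
       (\<forall>v. (\<Sum>\<xi>\<in>N \<eta>. w \<eta> \<xi> * v \<xi>) = ray_value h \<eta> e v)"
      using ax \<eta> unfolding axial_rule_def by blast
    show ?thesis
    proof (cases "\<exists>e e'. admissible \<psi> h \<eta> e \<and> admissible \<psi> h \<eta> e' \<and> e \<bullet> e' = 0")
      case True
      then obtain e e' where e: "admissible \<psi> h \<eta> e" "admissible \<psi> h \<eta> e'"
        "N \<eta> = ray_nodes h \<eta> e \<union> ray_nodes h \<eta> e'"
        "\<And>v. (\<Sum>\<xi>\<in>N \<eta>. w \<eta> \<xi> * v \<xi>) = (ray_value h \<eta> e v + ray_value h \<eta> e' v) / 2"
        using rule[unfolded if_P[OF True]] by blast
      have "N \<eta> \<subseteq> gam1 \<psi> h \<union> gam2 \<psi> h"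
        using e(1,2) unfolding e(3) ray_nodes_def admissible_def by auto
      moreover have "\<bar>\<Sum>\<xi>\<in>N \<eta>. w \<eta> \<xi> * f \<xi>\<bar> \<le> (3 + real n * \<bar>W\<bar>) * \<epsilon>" if "0 \<le> \<epsilon>" "\<forall>\<xi>\<in>N \<eta>. \<bar>f \<xi>\<bar> \<le> \<epsilon>" for f \<epsilon>
      proof -
        have "\<bar>ray_value h \<eta> e f\<bar> \<le> 3 * \<epsilon>" "\<bar>ray_value h \<eta> e' f\<bar> \<le> 3 * \<epsilon>"
          by (rule ray_value_bound; use that e(3) in blast)+
        then have "\<bar>ray_value h \<eta> e f + ray_value h \<eta> e' f\<bar> \<le> 3 * \<epsilon> + 3 * \<epsilon>" by linarith
        then have "\<bar>(ray_value h \<eta> e f + ray_value h \<eta> e' f) / 2\<bar> \<le> 3 * \<epsilon>" by simp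
        then show ?thesis unfolding e(4) using bnd[OF that(1)] by linarith
      qed
      ultimately show ?thesis using ray_value_affine by (auto simp: e(4))
    next
      case False
      then obtain e where e: "admissible \<psi> h \<eta> e" "N \<eta> = ray_nodes h \<eta> e"
        "\<And>v. (\<Sum>\<xi>\<in>N \<eta>. w \<eta> \<xi> * v \<xi>) = ray_value h \<eta> e v"
        using rule[unfolded if_not_P[OF False]] by blast
      have "N \<eta> \<subseteq> gam1 \<psi> h \<union> gam2 \<psi> h"
        using e(1) unfolding e(2) ray_nodes_def admissible_def by auto
      moreover have "\<bar>\<Sum>\<xi>\<in>N \<eta>. w \<eta> \<xi> * f \<xi>\<bar> \<le> (3 + real n * \<bar>W\<bar>) * \<epsilon>" if "0 \<le> \<epsilon>" "\<forall>\<xi>\<in>N \<eta>. \<bar>f \<xi>\<bar> \<le> \<epsilon>" for f \<epsilon>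
      proof -
        have "\<bar>ray_value h \<eta> e f\<bar> \<le> 3 * \<epsilon>"
          by (rule ray_value_bound; use that e(2) in blast)
        then show ?thesis unfolding e(3) using bnd[OF that(1)] by linarith
      qed
      ultimately show ?thesis using ray_value_affine by (auto simp: e(3))
    qed
  next
    case ls
    then have N: "N \<eta> \<subseteq> gam1 \<psi> h \<union> gam2 \<psi> h" "card (N \<eta>) \<le> n" "\<And>\<xi>. \<xi> \<in> N \<eta> \<Longrightarrow> \<bar>w \<eta> \<xi>\<bar> \<le> W"
      "\<And>q. affine_fun q \<Longrightarrow> (\<Sum>\<xi>\<in>N \<eta>. w \<eta> \<xi> * q \<xi>) = q \<eta>"
      using \<eta> unfolding least_squares_rule_def by blast+
    have "\<bar>\<Sum>\<xi>\<in>N \<eta>. w \<eta> \<xi> * f \<xi>\<bar> \<le> (3 + real n * \<bar>W\<bar>) * \<epsilon>" if "0 \<le> \<epsilon>" "\<forall>\<xi>\<in>N \<eta>. \<bar>f \<xi>\<bar> \<le> \<epsilon>" for f \<epsilon>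
    proof -
      have "\<bar>\<Sum>\<xi>\<in>N \<eta>. w \<eta> \<xi> * f \<xi>\<bar> \<le> (\<Sum>\<xi>\<in>N \<eta>. \<bar>w \<eta> \<xi> * f \<xi>\<bar>)" by (rule sum_abs)
      also have "\<dots> \<le> (\<Sum>\<xi>\<in>N \<eta>. \<bar>W\<bar> * \<epsilon>)"
        unfolding abs_mult using that N(3) by (intro sum_mono mult_mono) (auto intro: order_trans[OF _ abs_ge_self])
      also have "\<dots> = real (card (N \<eta>)) * (\<bar>W\<bar> * \<epsilon>)" by simp
      also have "\<dots> \<le> real n * (\<bar>W\<bar> * \<epsilon>)" using N(2) that(1) by (intro mult_right_mono) auto
      also have "\<dots> \<le> (3 + real n * \<bar>W\<bar>) * \<epsilon>" using that(1) by (simp add: algebra_simps)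
      finally show ?thesis .
    qed
    then show ?thesis using N(1,4) by blast
  qed
  then show *: "N \<eta> \<subseteq> gam1 \<psi> h \<union> gam2 \<psi> h"
    "\<And>f \<epsilon>. 0 \<le> \<epsilon> \<Longrightarrow> (\<And>\<xi>. \<xi> \<in> N \<eta> \<Longrightarrow> \<bar>f \<xi>\<bar> \<le> \<epsilon>) \<Longrightarrow> \<bar>\<Sum>\<xi>\<in>N \<eta>. w \<eta> \<xi> * f \<xi>\<bar> \<le> (3 + real n * \<bar>W\<bar>) * \<epsilon>"
    "\<And>q. affine_fun q \<Longrightarrow> (\<Sum>\<xi>\<in>N \<eta>. w \<eta> \<xi> * q \<xi>) = q \<eta>"
    by blast+
  show finN: "finite (N \<eta>)" using *(1) fin finite_subset by blast
  show "norm (\<xi> - \<eta>) \<le> \<kappa> * h" if "\<xi> \<in> N \<eta>" for \<xi>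
  proof -
    have "dist \<xi> \<eta> \<le> diameter (insert \<eta> (N \<eta>))"
      by (rule diameter_bounded_bound) (use finN that in \<open>auto intro: finite_imp_bounded\<close>)
    then show ?thesis using ex \<eta> unfolding local_extrapolation_def local_patches_def by (force simp: dist_norm)
  qed
qed

text \<open>The sign of \<open>R_mat\<close> and the minus before \<open>J_mat\<close> cancel, so on
  \<open>gam3\<close> the reduced vector is the extrapolation of its own values on
  \<open>gam1\<close> and \<open>gam2\<close>.\<close>

lemma (in cut_grid) E_vec_gam3:
  assumes ex: "local_extrapolation \<psi> h N w n W \<kappa>" and \<eta>: "\<eta> \<in> gam3 \<psi> h"
  shows "E_vec \<psi> h l N w v \<eta> = (\<Sum>\<xi>\<in>N \<eta>. w \<eta> \<xi> * E_vec \<psi> h l N w v \<xi>)"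
proof -
  note N = extrapolation_props[OF ex \<eta>]
  let ?E = "E_vec \<psi> h l N w v" and ?Y = "gam2 \<psi> h" and ?X = "gam1 \<psi> h"
  have fin: "finite ?X" using gam1_subset V_int_finite finite_subset by auto
  have disj: "?X \<inter> ?Y = {}" by (auto simp: gam1_def gam2_def)
  have e3: "\<eta> \<notin> ?X" "\<eta> \<notin> ?Y" using \<eta> by (auto simp: gam3_def gam1_def)
  have E1: "?E \<xi> = (\<Sum>y\<in>?Y. H_mat \<psi> h l \<xi> y * v y)" if "\<xi> \<in> ?X" for \<xi> using that by (simp add: E_vec_def)
  have E2: "?E \<xi> = v \<xi>" if "\<xi> \<in> ?Y" for \<xi> using that disj by (auto simp: E_vec_def)
  have "?E \<eta> = - (\<Sum>y\<in>?Y. J_mat \<psi> h l N w \<eta> y * v y)" using e3 by (simp add: E_vec_def)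
  also have "\<dots> = (\<Sum>x\<in>?X. - R_mat N w \<eta> x * ?E x) + (\<Sum>y\<in>?Y. - R_mat N w \<eta> y * ?E y)"
  proof -
    have "(\<Sum>y\<in>?Y. J_mat \<psi> h l N w \<eta> y * v y)
      = (\<Sum>y\<in>?Y. \<Sum>x\<in>?X. R_mat N w \<eta> x * H_mat \<psi> h l x y * v y) + (\<Sum>y\<in>?Y. R_mat N w \<eta> y * v y)"
      by (simp add: J_mat_def distrib_right sum.distrib sum_distrib_right)
    also have "(\<Sum>y\<in>?Y. \<Sum>x\<in>?X. R_mat N w \<eta> x * H_mat \<psi> h l x y * v y) = (\<Sum>x\<in>?X. R_mat N w \<eta> x * ?E x)"
      by (subst sum.swap) (simp add: E1 sum_distrib_left mult.assoc)
    finally show ?thesis using E2 by (simp add: sum_negf)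
  qed
  also have "\<dots> = (\<Sum>\<xi>\<in>?X \<union> ?Y. - R_mat N w \<eta> \<xi> * ?E \<xi>)"
    by (rule sum.union_disjoint[symmetric, OF fin gam2_finite disj])
  also have "\<dots> = (\<Sum>\<xi>\<in>N \<eta>. - R_mat N w \<eta> \<xi> * ?E \<xi>)"
    by (rule sum.mono_neutral_right) (use fin gam2_finite N(1) in \<open>auto simp: R_mat_def\<close>)
  also have "\<dots> = (\<Sum>\<xi>\<in>N \<eta>. w \<eta> \<xi> * ?E \<xi>)" by (simp add: R_mat_def)
  finally show ?thesis .
qed

lemma (in cut_grid) gam_cases:
  assumes "\<xi> \<in> gam \<psi> h"
  obtains "\<xi> \<in> gam1 \<psi> h" | "\<xi> \<in> gam2 \<psi> h" | "\<xi> \<in> gam3 \<psi> h"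
  using lattice_sign[of \<xi>] assms unfolding gam1_def gam3_def by (auto simp: gam_def)

text \<open>On \<open>gam3\<close> vector and field are compared with an affine function that
  matches the field at the node. Exactness of the stencil cancels it, and the error on the stencil,
  \<tau> r^2/4 from the maximum principle plus \<delta> from the affine fit, is multiplied by the
  total weight.\<close>

lemma (in cut_grid) E_vec_approximates:
  assumes ex: "local_extrapolation \<psi> h N w n W \<kappa>"
    and inv: "invertible_on (gam2 \<psi> h) (layer_kernel \<psi> h l)"
    and lap: "\<And>x. x \<in> V_int \<psi> h \<Longrightarrow> \<bar>five_point h v x\<bar> \<le> h\<^sup>2 * \<tau>"
    and ball: "V_int \<psi> h \<union> gam2 \<psi> h \<subseteq> cball x0 r"
    and \<tau>: "0 \<le> \<tau>"
    and aff: "\<And>\<eta>. \<eta> \<in> gam3 \<psi> h \<Longrightarrow> \<exists>q. affine_fun q \<and> q \<eta> = v \<eta> \<and> (\<forall>\<xi>\<in>N \<eta>. \<bar>v \<xi> - q \<xi>\<bar> \<le> \<delta>)"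
    and \<delta>: "0 \<le> \<delta>" and \<xi>: "\<xi> \<in> gam \<psi> h"
  shows "\<bar>E_vec \<psi> h l N w v \<xi> - v \<xi>\<bar> \<le> (3 + real n * \<bar>W\<bar>) * (\<tau> * r\<^sup>2 / 4 + \<delta>)"
proof -
  define \<epsilon> where "\<epsilon> = \<tau> * r\<^sup>2 / 4"
  have \<epsilon>: "0 \<le> \<epsilon>" using \<tau> by (simp add: \<epsilon>_def)
  let ?E = "E_vec \<psi> h l N w v"
  have W0: "0 \<le> real n * \<bar>W\<bar>" by simp
  have 12: "\<bar>?E \<xi> - v \<xi>\<bar> \<le> \<epsilon>" if "\<xi> \<in> gam1 \<psi> h \<union> gam2 \<psi> h" for \<xi>
  proof (cases "\<xi> \<in> gam1 \<psi> h")
    case True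
    then show ?thesis using H_mat_approximates[OF inv lap ball] gam1_subset by (auto simp: E_vec_def \<epsilon>_def)
  next
    case False
    then show ?thesis using that \<epsilon> by (simp add: E_vec_def)
  qed
  have le: "\<epsilon> \<le> (3 + real n * \<bar>W\<bar>) * (\<epsilon> + \<delta>)"
  proof -
    have "1 * (\<epsilon> + \<delta>) \<le> (3 + real n * \<bar>W\<bar>) * (\<epsilon> + \<delta>)" using W0 \<epsilon> \<delta> by (intro mult_right_mono) auto
    then show ?thesis using \<delta> by simp
  qed
  show ?thesis unfolding \<epsilon>_def[symmetric]
  proof (rule gam_cases[OF \<xi>])
    assume \<eta>: "\<xi> \<in> gam3 \<psi> h"
    note N = extrapolation_props[OF ex \<eta>]
    obtain q where q: "affine_fun q" "q \<xi> = v \<xi>" "\<And>\<zeta>. \<zeta> \<in> N \<xi> \<Longrightarrow> \<bar>v \<zeta> - q \<zeta>\<bar> \<le> \<delta>" using aff[OF \<eta>] by blast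
    have "?E \<xi> - v \<xi> = (\<Sum>\<zeta>\<in>N \<xi>. w \<xi> \<zeta> * (?E \<zeta> - q \<zeta>))"
      using N(4)[OF q(1)] q(2) E_vec_gam3[OF ex \<eta>, of l v] by (simp add: right_diff_distrib sum_subtractf)
    also have "\<bar>\<dots>\<bar> \<le> (3 + real n * \<bar>W\<bar>) * (\<epsilon> + \<delta>)"
    proof (rule N(3))
      show "\<bar>?E \<zeta> - q \<zeta>\<bar> \<le> \<epsilon> + \<delta>" if "\<zeta> \<in> N \<xi>" for \<zeta>
        using 12[of \<zeta>] q(3)[OF that] N(1) that by fastforce
    qed (use \<epsilon> \<delta> in simp)
    finally show "\<bar>?E \<xi> - v \<xi>\<bar> \<le> (3 + real n * \<bar>W\<bar>) * (\<epsilon> + \<delta>)" .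
  qed (use 12[of \<xi>] le in \<open>auto intro: order_trans\<close>)
qed

text \<open>For constants the five-point defect and the affine defect are zero, and the general
  error bound degenerates to equality.\<close>

lemma (in cut_grid) E_vec_const:
  assumes ex: "local_extrapolation \<psi> h N w n W \<kappa>"
    and inv: "invertible_on (gam2 \<psi> h) (layer_kernel \<psi> h l)"
    and \<xi>: "\<xi> \<in> gam \<psi> h"
  shows "E_vec \<psi> h l N w (\<lambda>_. a) \<xi> = a"
proof -
  have "bounded (V_int \<psi> h \<union> gam2 \<psi> h)" using V_int_finite gam2_finite by (intro finite_imp_bounded) auto
  then obtain x0 r where ball: "V_int \<psi> h \<union> gam2 \<psi> h \<subseteq> cball x0 r" unfolding bounded_subset_cball by blast
  have "affine_fun (\<lambda>_. a)" unfolding affine_fun_def by (intro exI[of _ a] exI[of _ 0]) simp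
  then have "\<bar>E_vec \<psi> h l N w (\<lambda>_. a) \<xi> - a\<bar> \<le> (3 + real n * \<bar>W\<bar>) * (0 * r\<^sup>2 / 4 + 0)"
    by (intro E_vec_approximates[OF ex inv _ ball _ _ _ \<xi>]) (auto simp: five_point_def)
  then show ?thesis by simp
qed

lemma E_vec_linear:
  "E_vec \<psi> h l N w (\<lambda>x. a * u x + b * v x) \<xi> = a * E_vec \<psi> h l N w u \<xi> + b * E_vec \<psi> h l N w v \<xi>"
  by (simp add: E_vec_def sum.distrib sum_distrib_left algebra_simps)

section \<open>Closed curves and their chords\<close>

locale param_curve =
  fixes c c' c'' :: "real \<Rightarrow> pt" and L K :: real
  assumes c_deriv: "\<And>s. (c has_vector_derivative c' s) (at s)"
    and c'_deriv: "\<And>s. (c' has_vector_derivative c'' s) (at s)"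
    and c''_cont: "continuous_on UNIV c''"
    and unit_speed: "\<And>s. norm (c' s) = 1"
    and curvature: "\<And>s. norm (c'' s) \<le> K"
    and K_pos: "0 < K"
    and period: "\<And>s. c (s + L) = c s"
    and L_pos: "0 < L"
    and inj: "inj_on c {0..<L}"
begin

lemma c_cont: "continuous_on S c"
  by (intro continuous_at_imp_continuous_on ballI has_vector_derivative_continuous[OF c_deriv])

lemma c'_cont: "continuous_on S c'"
  by (intro continuous_at_imp_continuous_on ballI has_vector_derivative_continuous[OF c'_deriv])

lemma vector_diff_bound:
  fixes f :: "real \<Rightarrow> pt"
  assumes "\<And>s. (f has_vector_derivative f' s) (at s)"
    and "\<And>s. min a b \<le> s \<Longrightarrow> s \<le> max a b \<Longrightarrow> norm (f' s) \<le> B"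
  shows "norm (f a - f b) \<le> B * \<bar>a - b\<bar>"
proof -
  have "norm (f a - f b) \<le> B * norm (a - b)"
  proof (rule differentiable_bound[of "{min a b..max a b}" f "\<lambda>s h. h *\<^sub>R f' s"])
    fix s assume s: "s \<in> {min a b..max a b}"
    show "(f has_derivative (\<lambda>h. h *\<^sub>R f' s)) (at s within {min a b..max a b})"
      using assms(1)[of s] unfolding has_vector_derivative_def by (rule has_derivative_at_withinI)
    show "onorm (\<lambda>h. h *\<^sub>R f' s) \<le> B"
    proof (rule onorm_le)
      fix h :: real
      have "\<bar>h\<bar> * norm (f' s) \<le> \<bar>h\<bar> * B" using assms(2)[of s] s by (intro mult_left_mono) auto
      then show "norm (h *\<^sub>R f' s) \<le> B * norm h" by (simp add: mult.commute)
    qed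
  qed auto
  then show ?thesis by simp
qed

lemma c_lip: "norm (c s - c t) \<le> \<bar>s - t\<bar>"
  using vector_diff_bound[OF c_deriv, of s t 1] unit_speed by simp

lemma c'_lip: "norm (c' s - c' t) \<le> K * \<bar>s - t\<bar>"
  using vector_diff_bound[OF c'_deriv, of s t K] curvature by simp

text \<open>The tangent may be taken at any parameter between the two, since on the arc it varies by
  at most K |t - s|. This lets a chord be compared with the tangent at the foot of any of its
  points.\<close>

lemma c_taylor:
  assumes "min s t \<le> r" "r \<le> max s t"
  shows "norm (c t - c s - (t - s) *\<^sub>R c' r) \<le> K * (t - s)\<^sup>2"
proof -
  have d: "((\<lambda>u. c u - u *\<^sub>R c' r) has_vector_derivative (c' u - c' r)) (at u)" for u
    by (auto intro!: derivative_eq_intros c_deriv)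
  have "norm ((c t - t *\<^sub>R c' r) - (c s - s *\<^sub>R c' r)) \<le> (K * \<bar>t - s\<bar>) * \<bar>t - s\<bar>"
  proof (rule vector_diff_bound[OF d])
    fix u assume "min t s \<le> u" "u \<le> max t s"
    then have "\<bar>u - r\<bar> \<le> \<bar>t - s\<bar>" using assms by (auto simp: min_def max_def split: if_splits)
    then show "norm (c' u - c' r) \<le> K * \<bar>t - s\<bar>"
      using c'_lip[of u r] K_pos by (meson mult_left_mono less_imp_le order_trans)
  qed
  then show ?thesis by (simp add: power2_eq_square algebra_simps abs_mult_self_eq flip: abs_mult)
qed

lemma period_nat: "c (s + real n * L) = c s"
proof (induction n)
  case (Suc n)
  have "c (s + real (Suc n) * L) = c ((s + real n * L) + L)" by (simp add: algebra_simps)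
  then show ?case using period Suc by simp
qed simp

lemma period_int: "c (s + of_int k * L) = c s"
proof (cases "0 \<le> k")
  case True then show ?thesis using period_nat[of s "nat k"] by simp
next
  case False
  then show ?thesis using period_nat[of "s + of_int k * L" "nat (- k)"] by (simp add: algebra_simps)
qed

lemma reduce_period: "\<exists>k::int. s + of_int k * L \<in> {a..<a + L}"
proof -
  define k where "k = - \<lfloor>(s - a) / L\<rfloor>"
  have "of_int \<lfloor>(s - a) / L\<rfloor> \<le> (s - a) / L" "(s - a) / L < of_int \<lfloor>(s - a) / L\<rfloor> + 1" by linarith+
  then have "of_int \<lfloor>(s - a) / L\<rfloor> * L \<le> s - a" "s - a < (of_int \<lfloor>(s - a) / L\<rfloor> + 1) * L"
    by (simp_all only: pos_le_divide_eq[OF L_pos] pos_divide_less_eq[OF L_pos])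
  then have "s + of_int k * L \<in> {a..<a + L}" by (simp add: k_def algebra_simps)
  then show ?thesis by blast
qed

lemma range_c: "range c = c ` {a..<a + L}"
proof
  show "range c \<subseteq> c ` {a..<a + L}"
  proof
    fix y assume "y \<in> range c"
    then obtain s where s: "y = c s" by auto
    obtain k :: int where "s + of_int k * L \<in> {a..<a + L}" using reduce_period by blast
    then show "y \<in> c ` {a..<a + L}" using period_int[of s k] s by (metis imageI)
  qed
qed auto

lemma compact_range: "compact (range c)"
proof -
  have "c ` {0..<0 + L} \<subseteq> c ` {0..L}" by auto
  then have "range c = c ` {0..L}" using range_c[of 0] by blast
  moreover have "compact (c ` {0..L})" by (intro compact_continuous_image c_cont compact_Icc)
  ultimately show ?thesis by simp
qed

lemma inj_period:
  assumes "c s = c t" shows "\<exists>k::int. s - t = of_int k * L"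
proof -
  obtain j k :: int where jk: "s + of_int j * L \<in> {0..<0 + L}" "t + of_int k * L \<in> {0..<0 + L}"
    using reduce_period by meson
  have "c (s + of_int j * L) = c (t + of_int k * L)" using assms by (simp add: period_int)
  then have "s + of_int j * L = t + of_int k * L" using inj jk by (auto simp: inj_on_def)
  then have "s - t = of_int (k - j) * L" by (simp add: algebra_simps)
  then show ?thesis by blast
qed

lemma inj_small:
  assumes "c s = c t" "\<bar>s - t\<bar> < L" shows "s = t"
proof -
  obtain k :: int where k: "s - t = of_int k * L" using inj_period[OF assms(1)] by blast
  then have "\<bar>of_int k\<bar> * L < 1 * L" using assms(2) L_pos by (simp add: abs_mult)
  then have "\<bar>of_int k :: real\<bar> < 1" using L_pos by (simp only: mult_less_cancel_right)
  then have "k = 0" by linarith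
  then show ?thesis using k by simp
qed

text \<open>Under the hypothesis the Taylor remainder K (t - s)^2 is at most an eighth of the arc
  length, so chord and arc are comparable.\<close>

lemma chord_lower:
  assumes "K * \<bar>t - s\<bar> \<le> 1 / 8" shows "7 / 8 * \<bar>t - s\<bar> \<le> norm (c t - c s)"
proof -
  have "norm ((t - s) *\<^sub>R c' s) \<le> norm (c t - c s) + norm (c t - c s - (t - s) *\<^sub>R c' s)"
    by (metis norm_minus_commute norm_triangle_sub)
  moreover have "K * (t - s)\<^sup>2 \<le> 1 / 8 * \<bar>t - s\<bar>"
    using mult_right_mono[OF assms abs_ge_zero[of "t - s"]] by (simp add: power2_eq_square abs_mult_self_eq mult.assoc)
  ultimately show ?thesis using c_taylor[of s t s] by (simp add: unit_speed)
qed

lemma inner_c'_le: "\<bar>v \<bullet> c' s\<bar> \<le> norm v"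
  using Cauchy_Schwarz_ineq2[of v "c' s"] by (simp add: unit_speed)

lemma inner_c''_le: "\<bar>v \<bullet> c'' s\<bar> \<le> K * norm v"
proof -
  have "\<bar>v \<bullet> c'' s\<bar> \<le> norm v * norm (c'' s)" by (rule Cauchy_Schwarz_ineq2)
  also have "\<dots> \<le> norm v * K" using curvature by (intro mult_left_mono) auto
  finally show ?thesis by (simp add: mult.commute)
qed

lemma inner_deriv:
  assumes "(f has_vector_derivative f') (at s)" "(g has_vector_derivative g') (at s)"
  shows "((\<lambda>s. (f s :: pt) \<bullet> g s) has_real_derivative f' \<bullet> g s + f s \<bullet> g') (at s)"
  using has_derivative_inner[OF assms[unfolded has_vector_derivative_def]]
  unfolding has_field_derivative_def
  by (rule has_derivative_eq_rhs) (auto simp: algebra_simps)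

end

text \<open>The last assumption is a quantitative form of embeddedness: points at distance below
  \<open>d\<close> in the plane are within \<open>\<eta>\<close> along the curve, up to full turns.
  The bounds on \<open>\<eta>\<close> keep such arcs nearly straight and well below half a
  period.\<close>

locale proper_curve = param_curve +
  fixes d \<eta> :: real
  assumes d_pos: "0 < d" and eta_pos: "0 < \<eta>" and eta_L: "\<eta> \<le> L / 4" and eta_K: "K * \<eta> \<le> 1 / 8"
    and chord: "\<And>s t. dist (c s) (c t) < d \<Longrightarrow> \<exists>k::int. \<bar>s - t - of_int k * L\<bar> < \<eta>"

text \<open>An arc short against the radius of curvature. The condition on \<open>d\<close> ensures
  that a closest point to the chord lies near the arc and not on another stretch of the
  curve.\<close>

locale curve_chord = proper_curve +
  fixes a b :: real
  assumes ab: "a < b" and b_K: "K * (b - a) \<le> 1 / 8" and b_d: "2 * (b - a) < d" 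
begin

text \<open>\<open>foot_param s\<close> is the position on the chord of the point whose closest point on the curve is
  \<open>c s\<close>; its inverse is the closest-point projection.\<close>
definition "P = c a"
definition "Q = c b"
definition "len = norm (Q - P)"
definition "chord_pt t = P + t *\<^sub>R (Q - P)"
definition "den s = (Q - P) \<bullet> c' s"
definition "foot_param s = ((c s - P) \<bullet> c' s) / den s"
definition "foot_speed s = ((1 + (c s - P) \<bullet> c'' s) * den s - ((c s - P) \<bullet> c' s) * ((Q - P) \<bullet> c'' s)) / (den s)\<^sup>2"

lemma K_sq: "K * (b - a)\<^sup>2 \<le> (b - a) / 8"
  using mult_right_mono[OF b_K, of "b - a"] ab by (simp add: power2_eq_square mult.assoc)

lemma len_bounds: "7 / 8 * (b - a) \<le> len" "len \<le> b - a" "0 < len" "b - a - len \<le> K * (b - a)\<^sup>2"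
proof -
  show 1: "7 / 8 * (b - a) \<le> len" using chord_lower[of b a] b_K ab by (simp add: len_def P_def Q_def)
  show "len \<le> b - a" using c_lip[of b a] ab by (simp add: len_def P_def Q_def)
  show "0 < len" using 1 ab by simp
  have "norm ((b - a) *\<^sub>R c' a) \<le> norm (Q - P) + norm (Q - P - (b - a) *\<^sub>R c' a)"
    by (metis norm_minus_commute norm_triangle_sub)
  then show "b - a - len \<le> K * (b - a)\<^sup>2"
    using c_taylor[of a b a] ab by (simp add: unit_speed len_def P_def Q_def)
qed

lemma chord_tangent:
  assumes "a \<le> s" "s \<le> b" shows "norm (Q - P - (b - a) *\<^sub>R c' s) \<le> K * (b - a)\<^sup>2"
  using c_taylor[of a b s] assms by (simp add: P_def Q_def)

text \<open>The error is a multiple of the chord length \<open>len\<close> itself, so arbitrarily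
  short chords do no harm. The 3 comes from 2 (b - a) \<le> 3 len.\<close>

lemma direction_close:
  assumes "a \<le> s" "s \<le> b" shows "norm ((Q - P) - len *\<^sub>R c' s) \<le> 3 * K * (b - a) * len"
proof -
  have "(Q - P) - len *\<^sub>R c' s = (Q - P - (b - a) *\<^sub>R c' s) + (b - a - len) *\<^sub>R c' s"
    by (simp add: algebra_simps)
  then have "norm ((Q - P) - len *\<^sub>R c' s) \<le> norm (Q - P - (b - a) *\<^sub>R c' s) + norm ((b - a - len) *\<^sub>R c' s)"
    by (metis norm_triangle_ineq)
  also have "\<dots> \<le> K * (b - a)\<^sup>2 + K * (b - a)\<^sup>2"
    using chord_tangent[OF assms] len_bounds by (simp add: unit_speed)
  also have "\<dots> = (K * (b - a)) * (2 * (b - a))" by (simp add: power2_eq_square)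
  also have "\<dots> \<le> (K * (b - a)) * (3 * len)" using len_bounds K_pos ab by (intro mult_left_mono) auto
  finally show ?thesis by (simp only: mult_ac)
qed

lemma den_bounds:
  assumes "a \<le> s" "s \<le> b"
  shows "\<bar>den s - (b - a)\<bar> \<le> K * (b - a)\<^sup>2" "7 / 8 * (b - a) \<le> den s" "den s \<le> len" "0 < den s"
proof -
  have "(Q - P - (b - a) *\<^sub>R c' s) \<bullet> c' s = den s - (b - a)"
    using unit_speed[of s] by (simp add: den_def inner_diff_left norm_eq_1)
  then show 1: "\<bar>den s - (b - a)\<bar> \<le> K * (b - a)\<^sup>2"
    using chord_tangent[OF assms] inner_c'_le[of "Q - P - (b - a) *\<^sub>R c' s" s] by simp
  then show 2: "7 / 8 * (b - a) \<le> den s" using K_sq by (simp add: abs_le_iff)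
  show "den s \<le> len" using inner_c'_le[of "Q - P" s] by (simp add: den_def len_def)
  show "0 < den s" using 2 ab by simp
qed

lemma foot_param_deriv:
  assumes "a \<le> s" "s \<le> b"
  shows "(foot_param has_real_derivative foot_speed s) (at s)"
proof -
  have n: "((\<lambda>s. (c s - P) \<bullet> c' s) has_real_derivative 1 + (c s - P) \<bullet> c'' s) (at s)"
  proof -
    have "((\<lambda>s. c s - P) has_vector_derivative c' s) (at s)"
      using has_vector_derivative_diff[OF c_deriv has_vector_derivative_const] by simp
    from inner_deriv[OF this c'_deriv] show ?thesis using unit_speed[of s] by (simp add: norm_eq_1)
  qed
  have m: "(den has_real_derivative (Q - P) \<bullet> c'' s) (at s)"
    unfolding den_def[abs_def] using inner_deriv[OF has_vector_derivative_const c'_deriv, of "Q - P"] by simp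
  have "den s \<noteq> 0" using den_bounds[OF assms] by simp
  from DERIV_divide[OF n m this] show ?thesis
    unfolding foot_param_def[abs_def] foot_speed_def by (simp add: power2_eq_square)
qed

text \<open>The corrections in the numerator carry a factor \<open>K\<close>, and \<open>den\<close>
  is at least 7/8 of the arc length; the square of 8/7 takes the 3 of the numerator to less than 5.
  Hence the product with \<open>len\<close> is at least 3/8, and the reciprocal costs a factor 8/3,
  with 5 times 8/3 below 14.\<close>

lemma foot_speed_bounds:
  assumes s: "a \<le> s" "s \<le> b"
  shows "\<bar>1 - foot_speed s * len\<bar> \<le> 5 * K * (b - a)" "0 < foot_speed s" "\<bar>1 / foot_speed s - len\<bar> \<le> 14 * K * (b - a) * len"
proof -
  let ?D = "b - a"
  note den = den_bounds[OF s]
  have D: "0 < ?D" using ab by simp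
  have cs: "norm (c s - P) \<le> ?D" using c_lip[of s a] s by (simp add: P_def)
  have A: "\<bar>(c s - P) \<bullet> c'' s\<bar> \<le> K * ?D"
    using inner_c''_le[of "c s - P" s] mult_left_mono[OF cs, of K] K_pos by linarith
  have Bb: "\<bar>(c s - P) \<bullet> c' s\<bar> \<le> ?D" using inner_c'_le[of "c s - P" s] cs by linarith
  have C: "\<bar>(Q - P) \<bullet> c'' s\<bar> \<le> K * ?D"
    using inner_c''_le[of "Q - P" s] mult_left_mono[OF len_bounds(2), of K] K_pos unfolding len_def by linarith
  define r where "r = ((c s - P) \<bullet> c'' s) * den s - ((c s - P) \<bullet> c' s) * ((Q - P) \<bullet> c'' s)"
  have "\<bar>((c s - P) \<bullet> c'' s) * den s\<bar> \<le> (K * ?D) * ?D"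
    unfolding abs_mult using A den len_bounds D by (intro mult_mono) auto
  moreover have "\<bar>((c s - P) \<bullet> c' s) * ((Q - P) \<bullet> c'' s)\<bar> \<le> ?D * (K * ?D)"
    unfolding abs_mult using Bb C D by (intro mult_mono) auto
  ultimately have "\<bar>r\<bar> \<le> (K * ?D) * ?D + ?D * (K * ?D)" unfolding r_def by linarith
  also have "\<dots> = 2 * K * ?D\<^sup>2" by (simp only: power2_eq_square mult_2 distrib_left distrib_right mult_ac)
  finally have r: "\<bar>r\<bar> \<le> 2 * K * ?D\<^sup>2" .
  have "foot_speed s * (den s)\<^sup>2 = (1 + (c s - P) \<bullet> c'' s) * den s - ((c s - P) \<bullet> c' s) * ((Q - P) \<bullet> c'' s)"
    using den(4) by (simp add: foot_speed_def)
  then have fs: "foot_speed s * (den s)\<^sup>2 = den s + r" by (simp only: r_def distrib_right)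
  have d2: "(7 / 8 * ?D)\<^sup>2 \<le> (den s)\<^sup>2" using den(2) D by (intro power_mono) auto
  have den0: "den s \<noteq> 0" using den(4) by simp
  have "foot_speed s * len - 1 = ((den s + r) * len - (den s)\<^sup>2) / (den s)\<^sup>2"
    using den0 fs by (simp add: field_simps) 
  also have "(den s + r) * len - (den s)\<^sup>2 = den s * (len - den s) + r * len"
    by (simp add: power2_eq_square algebra_simps)
  finally have e: "foot_speed s * len - 1 = (den s * (len - den s) + r * len) / (den s)\<^sup>2" .
  have ld: "0 \<le> len - den s" "len - den s \<le> K * ?D\<^sup>2" using den len_bounds by linarith+
  have "\<bar>den s * (len - den s)\<bar> \<le> ?D * (K * ?D\<^sup>2)"
    unfolding abs_mult using ld den len_bounds D by (intro mult_mono) auto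
  moreover have "\<bar>r * len\<bar> \<le> (2 * K * ?D\<^sup>2) * ?D"
    unfolding abs_mult using r len_bounds D K_pos by (intro mult_mono) auto
  ultimately have "\<bar>den s * (len - den s) + r * len\<bar> \<le> ?D * (K * ?D\<^sup>2) + (2 * K * ?D\<^sup>2) * ?D" by linarith
  also have "\<dots> = 3 * (K * ?D * ?D\<^sup>2)" by (simp only: mult_ac)
  finally have num: "\<bar>den s * (len - den s) + r * len\<bar> \<le> 3 * K * ?D * ?D\<^sup>2" by (simp only: mult.assoc)
  have "3 * K * ?D * ?D\<^sup>2 \<le> (5 * K * ?D) * (7 / 8 * ?D)\<^sup>2"
  proof -
    have "(7 / 8 * ?D)\<^sup>2 = 49 / 64 * ?D\<^sup>2" unfolding power_mult_distrib by (simp add: power_divide)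
    then have "3 * ?D\<^sup>2 \<le> 5 * (7 / 8 * ?D)\<^sup>2" using zero_le_power2[of ?D] by linarith
    from mult_left_mono[OF this, of "K * ?D"] K_pos D show ?thesis by (simp only: mult_ac zero_le_mult_iff less_imp_le) simp
  qed
  also have "\<dots> \<le> (5 * K * ?D) * (den s)\<^sup>2" using d2 K_pos D by (intro mult_left_mono) auto
  finally have "\<bar>den s * (len - den s) + r * len\<bar> \<le> (5 * K * ?D) * (den s)\<^sup>2" using num by linarith
  then have "\<bar>foot_speed s * len - 1\<bar> \<le> 5 * K * ?D"
    unfolding e using den0 by (simp add: abs_divide pos_divide_le_eq)
  then show 1: "\<bar>1 - foot_speed s * len\<bar> \<le> 5 * K * ?D" by (simp add: abs_minus_commute)
  then have fl: "3 / 8 \<le> foot_speed s * len" using b_K by linarith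
  then show 2: "0 < foot_speed s" using len_bounds(3) by (smt (verit) zero_less_mult_pos2 divide_pos_pos)
  have "1 / foot_speed s - len = (1 - foot_speed s * len) / foot_speed s" using 2 by (simp add: field_simps)
  then have "\<bar>1 / foot_speed s - len\<bar> \<le> (5 * K * ?D) / foot_speed s"
    using 1 2 by (simp add: abs_divide divide_right_mono)
  also have "\<dots> \<le> (5 * K * ?D) * (8 / 3 * len)"
  proof -
    have "1 / foot_speed s \<le> 8 / 3 * len" using fl 2 by (simp add: field_simps)
    from mult_left_mono[OF this, of "5 * K * ?D"] show ?thesis using K_pos D by simp
  qed
  also have "\<dots> \<le> 14 * K * ?D * len"
  proof -
    have "(5 * (8 / 3)) * (K * ?D * len) \<le> 14 * (K * ?D * len)"
      using K_pos D len_bounds(3) by (intro mult_right_mono) auto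
    then show ?thesis by (simp only: mult_ac)
  qed
  finally show "\<bar>1 / foot_speed s - len\<bar> \<le> 14 * K * ?D * len" .
qed

lemma foot_param_ends: "foot_param a = 0" "foot_param b = 1"
  using den_bounds(4)[of b] ab by (simp_all add: foot_param_def P_def den_def Q_def)

lemma foot_param_strict_mono:
  assumes "a \<le> s" "s < t" "t \<le> b" shows "foot_param s < foot_param t"
proof (rule DERIV_pos_imp_increasing[OF assms(2)])
  fix x assume "s \<le> x" "x \<le> t"
  with assms have "a \<le> x" "x \<le> b" by linarith+
  then show "\<exists>y. DERIV foot_param x :> y \<and> 0 < y"
    using foot_param_deriv foot_speed_bounds(2) by blast
qed

lemma foot_param_cont: "continuous_on {a..b} foot_param"
  using foot_param_deriv by (intro DERIV_continuous_on) (auto intro: DERIV_subset)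

lemma foot_param_inj: "inj_on foot_param {a..b}"
  by (rule linorder_inj_onI') (use foot_param_strict_mono in force)

lemma foot_param_image: "foot_param ` {a..b} = {0..1}"
proof
  show "foot_param ` {a..b} \<subseteq> {0..1}"
  proof
    fix y assume "y \<in> foot_param ` {a..b}"
    then obtain s where "a \<le> s" "s \<le> b" "y = foot_param s" by auto
    then show "y \<in> {0..1}" using foot_param_strict_mono[of a s] foot_param_strict_mono[of s b] foot_param_ends
      by (cases "s = a"; cases "s = b") auto
  qed
  show "{0..1} \<subseteq> foot_param ` {a..b}"
  proof
    fix y :: real assume "y \<in> {0..1}"
    then have "\<exists>s. a \<le> s \<and> s \<le> b \<and> foot_param s = y"
      by (intro IVT') (use foot_param_ends foot_param_cont ab in auto)
    then show "y \<in> foot_param ` {a..b}" by auto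
  qed
qed

definition "foot t = the_inv_into {a..b} foot_param t"

lemma foot_in: "t \<in> {0..1} \<Longrightarrow> foot t \<in> {a..b}"
  unfolding foot_def by (rule the_inv_into_into[OF foot_param_inj]) (auto simp: foot_param_image)

lemma foot_param_foot: "t \<in> {0..1} \<Longrightarrow> foot_param (foot t) = t"
  unfolding foot_def by (rule f_the_inv_into_f[OF foot_param_inj]) (auto simp: foot_param_image)

lemma foot_foot_param: "s \<in> {a..b} \<Longrightarrow> foot (foot_param s) = s"
  unfolding foot_def by (rule the_inv_into_f_f[OF foot_param_inj])

lemma foot_ends: "foot 0 = a" "foot 1 = b"
  using foot_foot_param[of a] foot_foot_param[of b] foot_param_ends ab by simp_all

lemma foot_cont: "continuous_on {0..1} foot"
  using continuous_on_inv[OF foot_param_cont compact_Icc, of foot] foot_foot_param foot_param_image by simp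

lemma foot_deriv:
  assumes "0 < t" "t < 1" shows "(foot has_real_derivative 1 / foot_speed (foot t)) (at t)"
proof -
  have ft: "a \<le> foot t" "foot t \<le> b" using foot_in[of t] assms by auto
  have "(foot has_real_derivative inverse (foot_speed (foot t))) (at t)"
  proof (rule DERIV_inverse_function[where f=foot_param and a=0 and b=1])
    show "isCont foot t" using foot_cont assms by (simp add: continuous_on_interior)
  qed (use foot_param_deriv[OF ft] foot_speed_bounds(2)[OF ft] assms foot_param_foot in auto)
  then show ?thesis by (simp add: inverse_eq_divide)
qed

lemma foot_speed_cont: "continuous_on {a..b} foot_speed"
proof -
  have "den s \<noteq> 0" if "s \<in> {a..b}" for s using den_bounds(4)[of s] that by auto
  then show ?thesis unfolding foot_speed_def[abs_def] 
    by (intro continuous_intros c_cont c'_cont continuous_on_subset[OF c''_cont]) (auto simp: den_def[abs_def] intro!: continuous_intros c'_cont)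
qed

lemma foot_rate_cont: "continuous_on {0..1} (\<lambda>t. 1 / foot_speed (foot t))"
proof -
  have "foot ` {0..1} \<subseteq> {a..b}" using foot_in by auto
  then have "continuous_on {0..1} (\<lambda>t. foot_speed (foot t))"
    by (rule continuous_on_compose2[OF foot_speed_cont foot_cont])
  moreover have "foot_speed (foot t) \<noteq> 0" if "t \<in> {0..1}" for t
    using foot_speed_bounds(2)[of "foot t"] foot_in[OF that] by auto
  ultimately show ?thesis by (intro continuous_intros) auto
qed

text \<open>\<open>foot_param\<close> solves precisely this orthogonality for the position on the
  chord, in which it is linear; solving it for the curve parameter would be implicit.\<close>

lemma foot_normal: "t \<in> {0..1} \<Longrightarrow> (chord_pt t - c (foot t)) \<bullet> c' (foot t) = 0"
proof -
  assume t: "t \<in> {0..1}"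
  have "den (foot t) \<noteq> 0" using den_bounds(4)[of "foot t"] foot_in[OF t] by auto
  then have "(c (foot t) - P) \<bullet> c' (foot t) = t * den (foot t)"
    using foot_param_foot[OF t] unfolding foot_param_def by (simp add: field_simps)
  then show ?thesis by (simp add: chord_pt_def den_def inner_diff_left inner_add_left)
qed

lemma chord_pt_dist: "t \<in> {0..1} \<Longrightarrow> norm (chord_pt t - P) \<le> b - a"
proof -
  assume t: "t \<in> {0..1}"
  have "norm (chord_pt t - P) = t * len" using t by (simp add: chord_pt_def len_def)
  also have "\<dots> \<le> 1 * len" using t len_bounds(3) by (intro mult_right_mono) auto
  finally show ?thesis using len_bounds(2) by simp
qed

text \<open>The closest point is critical for the distance, so its parameter and the foot are both
  zeros of \<open>\<Phi>\<close>. The derivative of \<open>\<Phi>\<close> is (x - c) \<bullet> c'' -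
  1, which is negative as long as x is closer to the curve point than the radius of curvature; hence
  the zero is unique.\<close>

lemma closest_point_foot:
  assumes t: "t \<in> {0..1}"
  shows "closest_point (range c) (chord_pt t) = c (foot t)" "norm (chord_pt t - c (foot t)) \<le> b - a"
proof -
  let ?x = "chord_pt t" and ?y = "closest_point (range c) (chord_pt t)"
  have cl: "closed (range c)" "range c \<noteq> {}" using compact_range compact_imp_closed by auto
  obtain s0 where s0: "?y = c s0" using closest_point_in_set[OF cl] by auto
  have min: "dist ?x ?y \<le> dist ?x (c s)" for s by (rule closest_point_le[OF cl(1)]) simp
  have dy: "dist ?x ?y \<le> b - a" using min[of a] chord_pt_dist[OF t] by (simp add: dist_norm P_def)
  have "dist (c s0) (c a) \<le> dist ?x ?y + dist ?x (c a)" unfolding s0[symmetric] by (rule dist_triangle3)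
  also have "\<dots> < d" using dy chord_pt_dist[OF t] b_d by (simp add: dist_norm P_def)
  finally obtain k :: int where k: "\<bar>s0 - a - of_int k * L\<bar> < \<eta>" using chord by blast
  \<comment> \<open>Shifts the parameter of the closest point by full periods next to
    \<open>a\<close>, so that it can be compared with the foot along one short arc.\<close>
  define s1 where "s1 = s0 - of_int k * L"
  have cs1: "?y = c s1" using period_int[of s1 k] by (simp add: s1_def s0)
  have s1: "\<bar>s1 - a\<bar> < \<eta>" using k by (simp add: s1_def algebra_simps)
  define \<Phi> where "\<Phi> s = (?x - c s) \<bullet> c' s" for s
  have d0: "((\<lambda>s. ?x - c s) has_vector_derivative - c' s) (at s)" for s
    using has_vector_derivative_diff[OF has_vector_derivative_const c_deriv] by simp
  have \<Phi>d: "(\<Phi> has_real_derivative (?x - c s) \<bullet> c'' s - 1) (at s)" for s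
    unfolding \<Phi>_def[abs_def] using inner_deriv[OF d0 c'_deriv, of s] unit_speed[of s] by (simp add: norm_eq_1)
  have "((\<lambda>s. (?x - c s) \<bullet> (?x - c s)) has_real_derivative - 2 * \<Phi> s1) (at s1)"
    using inner_deriv[OF d0 d0, of s1] by (simp add: \<Phi>_def inner_commute)
  moreover have "\<forall>y. \<bar>s1 - y\<bar> < 1 \<longrightarrow> (?x - c s1) \<bullet> (?x - c s1) \<le> (?x - c y) \<bullet> (?x - c y)"
    using min unfolding cs1 by (auto simp: dist_norm dot_square_norm intro!: power_mono)
  ultimately have "- 2 * \<Phi> s1 = 0" using DERIV_local_min zero_less_one by blast
  then have z1: "\<Phi> s1 = 0" by simp
  have z2: "\<Phi> (foot t) = 0" unfolding \<Phi>_def by (rule foot_normal[OF t])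
  have ft: "a \<le> foot t" "foot t \<le> b" using foot_in[OF t] by auto
  \<comment> \<open>Between the two zeros, K |x - c| is at most 1/8 for the way along the chord plus
    1/8 for the way along the curve.\<close>
  have neg: "(?x - c s) \<bullet> c'' s - 1 < 0" if "min s1 (foot t) \<le> s" "s \<le> max s1 (foot t)" for s
  proof -
    have "\<bar>s - a\<bar> \<le> max \<eta> (b - a)" using that s1 ft by (auto simp: min_def max_def split: if_splits)
    then have "norm (?x - c s) \<le> (b - a) + max \<eta> (b - a)"
      using chord_pt_dist[OF t] c_lip[of a s] norm_triangle_ineq[of "?x - P" "P - c s"] by (simp add: P_def)
    then have "K * norm (?x - c s) \<le> K * ((b - a) + max \<eta> (b - a))" using K_pos by (intro mult_left_mono) auto
    also have "\<dots> \<le> 1 / 8 + 1 / 8" using b_K eta_K by (auto simp: max_def distrib_left)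
    finally show ?thesis using inner_c''_le[of "?x - c s" s] by linarith
  qed
  have "s1 = foot t"
  proof (rule ccontr)
    assume "s1 \<noteq> foot t"
    then consider "s1 < foot t" | "foot t < s1" by linarith
    then show False
    proof cases
      case 1
      have "\<Phi> (foot t) < \<Phi> s1" by (rule DERIV_neg_imp_decreasing[OF 1]) (use \<Phi>d neg 1 in force)
      then show False using z1 z2 by simp
    next
      case 2
      have "\<Phi> s1 < \<Phi> (foot t)" by (rule DERIV_neg_imp_decreasing[OF 2]) (use \<Phi>d neg 2 in force)
      then show False using z1 z2 by simp
    qed
  qed
  then show "?y = c (foot t)" using cs1 by simp
  then show "norm (?x - c (foot t)) \<le> b - a" using dy by (simp add: dist_norm)
qed

text \<open>The inverse of \<open>foot\<close> is differentiable and thus maps null sets to null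
  sets. An identity that holds almost everywhere on the curve can so be transported to the
  chord.\<close>

lemma foot_null:
  assumes "negligible S"
  shows "negligible {t \<in> {0..1}. foot t \<in> S}"
proof (rule negligible_subset)
  have "foot_param differentiable_on S \<inter> {a..b}"
    unfolding differentiable_on_def
  proof
    fix x assume "x \<in> S \<inter> {a..b}"
    then have "(foot_param has_real_derivative foot_speed x) (at x within S \<inter> {a..b})"
      by (auto intro: has_field_derivative_at_within[OF foot_param_deriv])
    then show "foot_param differentiable at x within S \<inter> {a..b}" by (auto simp: real_differentiable_def)
  qed
  moreover have "negligible (S \<inter> {a..b})" using assms by (rule negligible_subset) auto
  ultimately show "negligible (foot_param ` (S \<inter> {a..b}))"
    by (intro negligible_differentiable_image_negligible) auto
  show "{t \<in> {0..1}. foot t \<in> S} \<subseteq> foot_param ` (S \<inter> {a..b})"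
  proof
    fix t assume t: "t \<in> {t \<in> {0..1}. foot t \<in> S}"
    then have "foot t \<in> S \<inter> {a..b}" using foot_in by blast
    then have "foot_param (foot t) \<in> foot_param ` (S \<inter> {a..b})" by (rule imageI)
    then show "t \<in> foot_param ` (S \<inter> {a..b})" using t foot_param_foot by simp
  qed
qed

end

section \<open>The curve and the mesh\<close>

lemma eventually_side:
  assumes "((f :: real \<Rightarrow> real) has_real_derivative l) (at s)"
  shows "0 < l \<Longrightarrow> (\<forall>\<^sub>F t in at_right s. f s < f t) \<and> (\<forall>\<^sub>F t in at_left s. f t < f s)"
    "l < 0 \<Longrightarrow> (\<forall>\<^sub>F t in at_right s. f t < f s) \<and> (\<forall>\<^sub>F t in at_left s. f s < f t)"
proof -
  have R: "\<forall>\<^sub>F t in at_right s. P t" if "0 < e" "\<And>h. 0 < h \<Longrightarrow> h < e \<Longrightarrow> P (s + h)" for P e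
    unfolding eventually_at_right_field
  proof (intro exI[of _ "s + e"] conjI allI impI)
    fix y assume "s < y" "y < s + e"
    then show "P y" using that(2)[of "y - s"] by simp
  qed (use that in simp)
  have Lf: "\<forall>\<^sub>F t in at_left s. P t" if "0 < e" "\<And>h. 0 < h \<Longrightarrow> h < e \<Longrightarrow> P (s - h)" for P e
    unfolding eventually_at_left_field
  proof (intro exI[of _ "s - e"] conjI allI impI)
    fix y assume "s - e < y" "y < s"
    then show "P y" using that(2)[of "s - y"] by simp
  qed (use that in simp)
  show "0 < l \<Longrightarrow> (\<forall>\<^sub>F t in at_right s. f s < f t) \<and> (\<forall>\<^sub>F t in at_left s. f t < f s)"
    using DERIV_pos_inc_right[OF assms] DERIV_pos_inc_left[OF assms] R[of _ "\<lambda>t. f s < f t"] Lf[of _ "\<lambda>t. f t < f s"] by blast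
  show "l < 0 \<Longrightarrow> (\<forall>\<^sub>F t in at_right s. f t < f s) \<and> (\<forall>\<^sub>F t in at_left s. f s < f t)"
    using DERIV_neg_dec_right[OF assms] DERIV_neg_dec_left[OF assms] R[of _ "\<lambda>t. f t < f s"] Lf[of _ "\<lambda>t. f s < f t"] by blast
qed

definition lattice_line :: "real \<Rightarrow> real \<Rightarrow> bool"
  where "lattice_line h x \<longleftrightarrow> (\<exists>m::int. x = h * of_int m)"

lemma lattice_pts_iff: "x \<in> lattice_pts h \<longleftrightarrow> (\<forall>i. lattice_line h (x $ i))"
  by (simp add: lattice_pts_def lattice_line_def)

lemma lattice_line_gap:
  assumes "0 < h" "lattice_line h z" "z < x" "x < z + h" shows "\<not> lattice_line h x"
proof
  assume "lattice_line h x"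
  then obtain m k :: int where "x = h * of_int m" "z = h * of_int k" using assms(2) by (auto simp: lattice_line_def)
  then have "h * of_int k < h * of_int m" "h * of_int m < h * (of_int k + 1)" using assms by (simp_all add: algebra_simps)
  then have "(of_int k :: real) < of_int m" "(of_int m :: real) < of_int (k + 1)" using assms(1) by simp_all
  then have "k < m" "m < k + 1" by (simp_all only: of_int_less_iff)
  then show False by linarith
qed

lemma lattice_line_floor: "0 < h \<Longrightarrow> \<exists>z. lattice_line h z \<and> z \<le> x \<and> x < z + h"
proof -
  assume h: "0 < h"
  have "of_int \<lfloor>x / h\<rfloor> \<le> x / h" "x / h < of_int \<lfloor>x / h\<rfloor> + 1" by linarith+
  then have "of_int \<lfloor>x / h\<rfloor> * h \<le> x" "x < (of_int \<lfloor>x / h\<rfloor> + 1) * h"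
    by (simp_all only: pos_le_divide_eq[OF h] pos_divide_less_eq[OF h])
  then show ?thesis by (intro exI[of _ "h * of_int \<lfloor>x / h\<rfloor>"]) (auto simp: lattice_line_def algebra_simps)
qed

lemma lattice_line_add: "lattice_line h z \<Longrightarrow> lattice_line h (z + h)"
  unfolding lattice_line_def by (metis distrib_left mult.right_neutral of_int_1 of_int_add)

lemma lattice_line_endpoints:
  assumes "0 < h" "lattice_line h z" "lattice_line h x" "z \<le> x" "x \<le> z + h" shows "x = z \<or> x = z + h"
  using lattice_line_gap[OF assms(1,2), of x] assms by linarith

lemma mem_cell: "x \<in> cbox z (z + vec h) \<longleftrightarrow> (\<forall>i. z $ i \<le> x $ i \<and> x $ i \<le> z $ i + h)" for x :: pt
  by (auto simp: mem_box_cart)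

lemma mem_open_cell: "x \<in> box z (z + vec h) \<longleftrightarrow> (\<forall>i. z $ i < x $ i \<and> x $ i < z $ i + h)" for x :: pt
  by (auto simp: mem_box_cart)

lemma open_cell_unique:
  assumes h: "0 < h" and z: "z \<in> lattice_pts h" "z' \<in> lattice_pts h"
    and x: "x \<in> box z (z + vec h)" "x \<in> cbox z' (z' + vec h)"
  shows "z = z'"
proof -
  have "z $ i = z' $ i" for i
  proof -
    obtain m k :: int where mk: "z $ i = h * of_int m" "z' $ i = h * of_int k"
      using z by (auto simp: lattice_pts_iff lattice_line_def) metis
    have "h * of_int m < h * (of_int k + 1)" "h * of_int k < h * (of_int m + 1)"
      using spec[OF x(1)[unfolded mem_open_cell], of i] spec[OF x(2)[unfolded mem_cell], of i] mk
      unfolding distrib_left by linarith+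
    then have "(of_int m :: real) < of_int (k + 1)" "(of_int k :: real) < of_int (m + 1)" using h by simp_all
    then have "m < k + 1" "k < m + 1" by (simp_all only: of_int_less_iff)
    then show ?thesis using mk by simp
  qed
  then show ?thesis by (simp add: vec_eq_iff)
qed

lemma cell_diam:
  fixes x y :: pt
  assumes "x \<in> cbox z (z + vec h)" "y \<in> cbox z (z + vec h)"
  shows "norm (x - y) \<le> 2 * h"
proof -
  have "\<bar>(x - y) $ i\<bar> \<le> h" for i
    using spec[OF assms(1)[unfolded mem_cell], of i] spec[OF assms(2)[unfolded mem_cell], of i]
    unfolding vector_minus_component by linarith
  from this[of 1] this[of 2] norm_pt_le[of "x - y"] show ?thesis by linarith
qed

text \<open>An arc inside one cell will turn out to have length at most 3h; the bounds on
  \<open>h\<close> are chosen so that such an arc satisfies 2 (3h) < d and K (3h) \<le> 1/8.\<close>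

locale curve_grid = proper_curve c c' c'' L K d \<eta> + cut_grid \<psi> h
  for c c' c'' L K d \<eta> \<psi> h +
  assumes zero_set: "zero_set \<psi> = range c"
    and transversal: "\<And>s i. lattice_line h (c s $ i) \<Longrightarrow> c' s $ i \<noteq> 0"
    and connected_cut: "\<And>A. A \<in> active_cells \<psi> h \<Longrightarrow> connected (A \<inter> zero_set \<psi>)"
    and h_d: "8 * h < d" and h_K: "24 * K * h \<le> 1"
begin

text \<open>Parameters at which the curve meets a mesh line. Between consecutive ones the curve
  stays in a single open cell.\<close>

definition "Cr = {s. \<exists>i. lattice_line h (c s $ i)}"

abbreviation "cell z \<equiv> cbox z (z + vec h) :: pt set"
abbreviation "ocell z \<equiv> box z (z + vec h) :: pt set"

lemma c_comp_deriv: "((\<lambda>s. c s $ i) has_real_derivative c' s $ i) (at s)"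
  using bounded_linear.has_vector_derivative[OF bounded_linear_vec_nth c_deriv]
  by (simp add: has_real_derivative_iff_has_vector_derivative)

lemma c_comp_cont: "continuous_on S (\<lambda>s. c s $ i)"
  by (intro continuous_intros c_cont)

lemma c_comp_isCont: "isCont (\<lambda>s. c s $ i) s"
  using c_comp_deriv DERIV_isCont by blast

lemma c_not_lattice: "c s \<notin> lattice_pts h"
  using no_vertex zero_set by auto

lemma eventually_inside:
  assumes "x < c s $ i" "c s $ i < y"
  shows "\<forall>\<^sub>F t in at s. x < c t $ i \<and> c t $ i < y"
  using order_tendstoD(1)[OF c_comp_isCont[where i=i and s=s, unfolded isCont_def]] order_tendstoD(2)[OF c_comp_isCont[where i=i and s=s, unfolded isCont_def]] assms
  by (intro eventually_conj) auto

text \<open>A coordinate that is off the mesh lines stays off for a while; one that is on a mesh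
  line is separated from it at once by transversality, and does not reach the next line immediately.
  Finiteness on compact intervals follows.\<close>

lemma Cr_isolated: "\<forall>\<^sub>F t in at s. t \<notin> Cr"
proof -
  have "\<forall>\<^sub>F t in at s. \<not> lattice_line h (c t $ i)" for i
  proof (cases "lattice_line h (c s $ i)")
    case False
    obtain z where z: "lattice_line h z" "z \<le> c s $ i" "c s $ i < z + h" using lattice_line_floor[OF h_pos] by blast
    then have "z < c s $ i" using False by (cases "z = c s $ i") auto
    from eventually_inside[OF this z(3)] show ?thesis
      by eventually_elim (use lattice_line_gap[OF h_pos z(1)] in blast)
  next
    case True
    have "\<forall>\<^sub>F t in at s. c t $ i \<noteq> c s $ i"
    proof (cases "0 < c' s $ i")
      case True
      show ?thesis unfolding eventually_at_split
        using eventually_side(1)[OF c_comp_deriv[where i=i and s=s] True]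
        by (auto elim!: eventually_mono)
    next
      case False
      then have "c' s $ i < 0" using transversal[OF \<open>lattice_line h (c s $ i)\<close>] by linarith
      from eventually_side(2)[OF c_comp_deriv[where i=i and s=s] this]
      show ?thesis unfolding eventually_at_split by (auto elim!: eventually_mono)
    qed
    moreover have "\<forall>\<^sub>F t in at s. c s $ i - h < c t $ i \<and> c t $ i < c s $ i + h"
      by (rule eventually_inside) (use h_pos in auto)
    ultimately show ?thesis
    proof eventually_elim
      case (elim t)
      have "lattice_line h (c s $ i - h)"
        using True unfolding lattice_line_def by (metis mult.right_neutral of_int_1 of_int_diff right_diff_distrib)
      show ?case
        using lattice_line_gap[OF h_pos True, of "c t $ i"] lattice_line_gap[OF h_pos \<open>lattice_line h (c s $ i - h)\<close>, of "c t $ i"] elim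
        by linarith
    qed
  qed
  from this[of 1] this[of 2] show ?thesis
  proof eventually_elim
    case (elim t)
    have "\<not> lattice_line h (c t $ i)" for i using exhaust_2[of i] elim by auto
    then show ?case by (simp add: Cr_def)
  qed
qed

lemma Cr_finite: "finite (Cr \<inter> {a..b})"
proof -
  have "\<not> s islimpt Cr \<inter> {a..b}" for s
    using Cr_isolated[of s] unfolding islimpt_iff_eventually by (auto elim: eventually_mono)
  then show ?thesis
    using finite_not_islimpt_in_compact[of "{a..b}" "Cr \<inter> {a..b}"] by (simp add: Int_ac)
qed

lemma Cr_period: "s + of_int k * L \<in> Cr \<longleftrightarrow> s \<in> Cr"
  by (simp add: Cr_def period_int)

lemma gap_component:
  assumes ab: "a < b" and no: "\<And>t. a < t \<Longrightarrow> t < b \<Longrightarrow> t \<notin> Cr"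
  shows "\<exists>z. lattice_line h z \<and> (\<forall>t. a < t \<longrightarrow> t < b \<longrightarrow> z < c t $ i \<and> c t $ i < z + h)"
proof -
  let ?m = "(a + b) / 2"
  obtain z where z: "lattice_line h z" "z \<le> c ?m $ i" "c ?m $ i < z + h" using lattice_line_floor[OF h_pos] by blast
  let ?S = "(\<lambda>t. c t $ i) ` {a<..<b}"
  have con: "connected ?S" by (intro connected_continuous_image c_comp_cont connected_Ioo)
  have nl: "\<not> lattice_line h x" if "x \<in> ?S" for x using that no unfolding Cr_def by auto
  have m: "c ?m $ i \<in> ?S" using ab by auto
  show ?thesis
  proof (intro exI[of _ z] conjI allI impI z(1))
    fix t assume t: "a < t" "t < b"
    then have tS: "c t $ i \<in> ?S" by auto
    show "z < c t $ i"
    proof (rule ccontr)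
      assume "\<not> z < c t $ i"
      then have "z \<in> ?S" using connected_contains_Icc[OF con tS m] z(2) by auto
      then show False using nl z(1) by blast
    qed
    show "c t $ i < z + h"
    proof (rule ccontr)
      assume "\<not> c t $ i < z + h"
      then have "z + h \<in> ?S" using connected_contains_Icc[OF con m tS] z(3) by auto
      then show False using nl lattice_line_add[OF z(1)] by blast
    qed
  qed
qed

lemma gap_cell:
  assumes ab: "a < b" and no: "\<And>t. a < t \<Longrightarrow> t < b \<Longrightarrow> t \<notin> Cr"
  obtains z where "z \<in> lattice_pts h" "\<And>t. a < t \<Longrightarrow> t < b \<Longrightarrow> c t \<in> ocell z"
    "\<And>t. a \<le> t \<Longrightarrow> t \<le> b \<Longrightarrow> c t \<in> cell z"
proof -
  have "\<forall>i. \<exists>z. lattice_line h z \<and> (\<forall>t. a < t \<longrightarrow> t < b \<longrightarrow> z < c t $ i \<and> c t $ i < z + h)"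
    using gap_component[OF ab] no by blast
  then obtain zz where zz: "\<And>i. lattice_line h (zz i)" "\<And>i t. a < t \<Longrightarrow> t < b \<Longrightarrow> zz i < c t $ i \<and> c t $ i < zz i + h"
    by metis
  define z :: pt where "z = (\<chi> i. zz i)"
  have o: "c t \<in> ocell z" if "a < t" "t < b" for t using zz(2)[OF that] by (simp add: mem_open_cell z_def)
  have "c ` closure {a<..<b} \<subseteq> closure (c ` {a<..<b})"
    by (intro image_closure_subset[OF c_cont closed_closure closure_subset])
  also have "\<dots> \<subseteq> cell z"
  proof (rule closure_minimal)
    show "c ` {a<..<b} \<subseteq> cell z"
    proof
      fix x assume "x \<in> c ` {a<..<b}"
      then obtain t where "x = c t" "a < t" "t < b" by auto
      then show "x \<in> cell z" using o[of t] by (auto simp: mem_cell mem_open_cell intro: less_imp_le)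
    qed
  qed (rule closed_cbox)
  finally have "c t \<in> cell z" if "a \<le> t" "t \<le> b" for t using that ab by (auto simp: closure_greaterThanLessThan)
  then show ?thesis using that[of z] o zz(1) by (simp add: lattice_pts_iff z_def)
qed

text \<open>Since no vertex lies on the curve, exactly one coordinate is on a mesh line and the
  other is strictly between two. The nonzero tangent component then decides on which side in time
  the curve is in the cell interior; on the other side it is outside the cell.\<close>

lemma crossing_sides:
  assumes z: "z \<in> lattice_pts h" and s: "s \<in> Cr" "c s \<in> cell z"
  shows "((\<forall>\<^sub>F t in at_right s. c t \<in> ocell z) \<and> (\<forall>\<^sub>F t in at_left s. c t \<notin> cell z))
     \<or> ((\<forall>\<^sub>F t in at_left s. c t \<in> ocell z) \<and> (\<forall>\<^sub>F t in at_right s. c t \<notin> cell z))"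
proof -
  obtain i where i: "lattice_line h (c s $ i)" using s(1) unfolding Cr_def by blast
  have zl: "lattice_line h (z $ i)" for i using z by (simp add: lattice_pts_iff)
  obtain j where j: "\<not> lattice_line h (c s $ j)" using c_not_lattice[of s] by (auto simp: lattice_pts_iff)
  have "i \<noteq> j" using i j by blast
  then have ij: "k = i \<or> k = j" for k using exhaust_2[of i] exhaust_2[of j] exhaust_2[of k] by auto
  have box_j: "z $ j < c s $ j" "c s $ j < z $ j + h"
  proof -
    have "c s $ j \<noteq> z $ j" using j zl[of j] by metis
    moreover have "c s $ j \<noteq> z $ j + h" using j lattice_line_add[OF zl[of j]] by metis
    moreover have "z $ j \<le> c s $ j" "c s $ j \<le> z $ j + h" using spec[OF s(2)[unfolded mem_cell], of j] by auto
    ultimately show "z $ j < c s $ j" "c s $ j < z $ j + h" by linarith+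
  qed
  have evj: "\<forall>\<^sub>F t in at s. z $ j < c t $ j \<and> c t $ j < z $ j + h" by (rule eventually_inside[OF box_j])
  have evi: "\<forall>\<^sub>F t in at s. c s $ i - h < c t $ i \<and> c t $ i < c s $ i + h"
    by (rule eventually_inside) (use h_pos in auto)
  have evR: "\<forall>\<^sub>F t in at_right s. z $ j < c t $ j \<and> c t $ j < z $ j + h \<and> c s $ i - h < c t $ i \<and> c t $ i < c s $ i + h"
    and evL: "\<forall>\<^sub>F t in at_left s. z $ j < c t $ j \<and> c t $ j < z $ j + h \<and> c s $ i - h < c t $ i \<and> c t $ i < c s $ i + h"
    using eventually_conj[OF evj evi] unfolding eventually_at_split by (simp_all add: conj_assoc)
  have ends: "c s $ i = z $ i \<or> c s $ i = z $ i + h"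
    by (rule lattice_line_endpoints[OF h_pos zl i]) (use s(2) in \<open>auto simp: mem_cell\<close>)
  have inn: "c t \<in> ocell z" if "z $ j < c t $ j \<and> c t $ j < z $ j + h" "z $ i < c t $ i" "c t $ i < z $ i + h" for t
    unfolding mem_open_cell
  proof
    fix k show "z $ k < c t $ k \<and> c t $ k < z $ k + h" using ij[of k] that by auto
  qed
  have out: "c t \<notin> cell z" if "c t $ i < z $ i \<or> z $ i + h < c t $ i" for t
    unfolding mem_cell
  proof
    assume "\<forall>i. z $ i \<le> c t $ i \<and> c t $ i \<le> z $ i + h"
    from spec[OF this, of i] that show False by linarith
  qed
  have up: "(\<forall>\<^sub>F t in F. c t \<in> ocell z)" if "\<forall>\<^sub>F t in F. z $ j < c t $ j \<and> c t $ j < z $ j + h \<and> c s $ i - h < c t $ i \<and> c t $ i < c s $ i + h"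
    "c s $ i = z $ i \<and> (\<forall>\<^sub>F t in F. c s $ i < c t $ i) \<or> c s $ i = z $ i + h \<and> (\<forall>\<^sub>F t in F. c t $ i < c s $ i)" for F
    using that(2)
  proof
    assume a: "c s $ i = z $ i \<and> (\<forall>\<^sub>F t in F. c s $ i < c t $ i)"
    show ?thesis using that(1) a[THEN conjunct2] by eventually_elim (rule inn; use a in linarith)
  next
    assume a: "c s $ i = z $ i + h \<and> (\<forall>\<^sub>F t in F. c t $ i < c s $ i)"
    show ?thesis using that(1) a[THEN conjunct2] by eventually_elim (rule inn; use a in linarith)
  qed
  have dn: "(\<forall>\<^sub>F t in F. c t \<notin> cell z)" if 
    "c s $ i = z $ i \<and> (\<forall>\<^sub>F t in F. c t $ i < c s $ i) \<or> c s $ i = z $ i + h \<and> (\<forall>\<^sub>F t in F. c s $ i < c t $ i)" for F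
    using that
  proof
    assume a: "c s $ i = z $ i \<and> (\<forall>\<^sub>F t in F. c t $ i < c s $ i)"
    show ?thesis using a[THEN conjunct2] by eventually_elim (rule out, use a in linarith)
  next
    assume a: "c s $ i = z $ i + h \<and> (\<forall>\<^sub>F t in F. c s $ i < c t $ i)"
    show ?thesis using a[THEN conjunct2] by eventually_elim (rule out, use a in linarith)
  qed
  note side = eventually_side[OF c_comp_deriv[where i=i and s=s]]
  consider "0 < c' s $ i" | "c' s $ i < 0" using transversal[OF i] by linarith
  then show ?thesis
  proof cases
    case 1
    show ?thesis using ends
    proof
      assume "c s $ i = z $ i" then show ?thesis using up[OF evR] dn[of "at_left s"] side(1)[OF 1] by simp
    next
      assume "c s $ i = z $ i + h" then show ?thesis using up[OF evL] dn[of "at_right s"] side(1)[OF 1] by simp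
    qed
  next
    case 2
    show ?thesis using ends
    proof
      assume "c s $ i = z $ i" then show ?thesis using up[OF evL] dn[of "at_right s"] side(2)[OF 2] by simp
    next
      assume "c s $ i = z $ i + h" then show ?thesis using up[OF evR] dn[of "at_left s"] side(2)[OF 2] by simp
    qed
  qed
qed

lemma eventually_right_witness:
  assumes "\<forall>\<^sub>F t in at_right (s::real). P t" "s < u" shows "\<exists>t. s < t \<and> t < u \<and> P t"
proof -
  obtain b where b: "s < b" "\<And>y. s < y \<Longrightarrow> y < b \<Longrightarrow> P y" using assms(1) unfolding eventually_at_right_field by blast
  have "s < min b u" using b assms by simp
  then obtain t where "s < t" "t < min b u" using dense by blast
  then show ?thesis using b(2)[of t] by (intro exI[of _ t]) auto
qed

lemma eventually_left_witness:
  assumes "\<forall>\<^sub>F t in at_left (s::real). P t" "u < s" shows "\<exists>t. u < t \<and> t < s \<and> P t"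
proof -
  obtain b where b: "b < s" "\<And>y. b < y \<Longrightarrow> y < s \<Longrightarrow> P y" using assms(1) unfolding eventually_at_left_field by blast
  have "max b u < s" using b assms by simp
  then obtain t where "max b u < t" "t < s" using dense by blast
  then show ?thesis using b(2)[of t] by (intro exI[of _ t]) auto
qed

text \<open>If the arc were as long as \<open>\<eta>\<close>, the point at parameter a + \<eta>
  would share the cell with c(a), and the modulus of injectivity would force a multiple of the
  period between 0 and 2\<eta> \<le> L/2. As arc and chord are comparable, the diameter bound 2h of
  the cell then gives 16/7 h, rounded up to 3h.\<close>

lemma gap_short:
  assumes "a < b" "\<And>t. a \<le> t \<Longrightarrow> t \<le> b \<Longrightarrow> c t \<in> cell z"
  shows "b - a < \<eta>" "b - a \<le> 3 * h"
proof -
  show 1: "b - a < \<eta>"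
  proof (rule ccontr)
    assume "\<not> ?thesis"
    then have m: "a + \<eta> \<le> b" by simp
    have "dist (c (a + \<eta>)) (c a) < d"
      using cell_diam[OF assms(2)[of "a + \<eta>"] assms(2)[of a]] m eta_pos assms(1) h_d h_pos by (simp add: dist_norm)
    then obtain k :: int where k: "\<bar>a + \<eta> - a - of_int k * L\<bar> < \<eta>" using chord by blast
    then have "0 < of_int k * L" "of_int k * L < 2 * \<eta>" by linarith+
    then have "0 < k" using L_pos by (simp add: zero_less_mult_iff)
    then have "1 * L \<le> of_int k * L" using L_pos by (intro mult_right_mono) auto
    then show False using \<open>of_int k * L < 2 * \<eta>\<close> eta_L L_pos by linarith
  qed
  have "K * \<bar>b - a\<bar> \<le> K * \<eta>" using 1 K_pos assms(1) by (intro mult_left_mono) auto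
  then have "7 / 8 * \<bar>b - a\<bar> \<le> norm (c b - c a)" using chord_lower[of b a] eta_K by linarith
  also have "\<dots> \<le> 2 * h" using cell_diam[OF assms(2)[of b] assms(2)[of a]] assms(1) by simp
  finally have "7 / 8 * (b - a) \<le> 2 * h" using assms(1) by simp
  then show "b - a \<le> 3 * h" using h_pos by (simp add: field_simps)
qed

text \<open>The curve is outside the cell just before \<open>a\<close> and just after
  \<open>b\<close>. A further curve point in the cell would be separated from the arc by these two
  exits, against connectedness of the cut; so the cell sees this arc only.\<close>

lemma cell_cut:
  assumes ab: "a < b" "a \<in> Cr" "b \<in> Cr" and no: "\<And>t. a < t \<Longrightarrow> t < b \<Longrightarrow> t \<notin> Cr" 
    and z: "z \<in> lattice_pts h" and o: "\<And>t. a < t \<Longrightarrow> t < b \<Longrightarrow> c t \<in> ocell z"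
    and cl: "\<And>t. a \<le> t \<Longrightarrow> t \<le> b \<Longrightarrow> c t \<in> cell z"
  shows "cell z \<inter> zero_set \<psi> = c ` {a..b}" "cell z \<in> active_cells \<psi> h" 
    "frontier (cell z) \<inter> zero_set \<psi> = {c a, c b}" "c a \<noteq> c b"
proof -
  have short: "b - a < L / 2" using gap_short(1)[OF ab(1) cl] eta_L L_pos by linarith
  show act: "cell z \<in> active_cells \<psi> h"
    unfolding active_cells_def cells_def zero_set using z cl[of a] ab(1) by auto
  have con: "connected (cell z \<inter> range c)" using connected_cut[OF act] by (simp add: zero_set)
  have "\<not> (\<forall>\<^sub>F t in at_left b. c t \<notin> cell z)"
  proof
    assume "\<forall>\<^sub>F t in at_left b. c t \<notin> cell z"
    then obtain t where "a < t" "t < b" "c t \<notin> cell z" using eventually_left_witness ab(1) by blast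
    then show False using cl[of t] by simp
  qed
  then have right: "\<forall>\<^sub>F t in at_right b. c t \<notin> cell z" using crossing_sides[OF z ab(3) cl[of b]] ab(1) by auto
  have "\<not> (\<forall>\<^sub>F t in at_right a. c t \<notin> cell z)"
  proof
    assume "\<forall>\<^sub>F t in at_right a. c t \<notin> cell z"
    then obtain t where "a < t" "t < b" "c t \<notin> cell z" using eventually_right_witness ab(1) by blast
    then show False using cl[of t] by simp
  qed
  then have left: "\<forall>\<^sub>F t in at_left a. c t \<notin> cell z" using crossing_sides[OF z ab(2) cl[of a]] ab(1) by auto
  show eq: "cell z \<inter> zero_set \<psi> = c ` {a..b}"
  proof
    show "c ` {a..b} \<subseteq> cell z \<inter> zero_set \<psi>" using cl by (auto simp: zero_set)
    show "cell z \<inter> zero_set \<psi> \<subseteq> c ` {a..b}"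
    proof
      fix x assume x: "x \<in> cell z \<inter> zero_set \<psi>"
      then obtain t where t: "t \<in> {a..<a + L}" "x = c t" using range_c[of a] by (auto simp: zero_set)
      show "x \<in> c ` {a..b}"
      proof (rule ccontr)
        assume "x \<notin> c ` {a..b}"
        then have tb: "b < t" using t by auto
        obtain t1 where t1: "b < t1" "t1 < t" "c t1 \<notin> cell z" using eventually_right_witness[OF right tb] by blast
        have "t - L < a" using t by auto
        then obtain t2 where t2: "t - L < t2" "t2 < a" "c t2 \<notin> cell z" using eventually_left_witness[OF left] by blast
        \<comment> \<open>The closed curve is cut at two parameters outside the cell; the two closed
          pieces meet only in the corresponding exterior points.\<close>
        let ?A = "c ` {t2..t1}" and ?B = "c ` {t1..t2 + L}"
        have cA: "closed ?A" "closed ?B"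
          by (intro compact_imp_closed compact_continuous_image c_cont compact_Icc)+
        have cov: "range c \<subseteq> ?A \<union> ?B"
        proof
          fix y assume "y \<in> range c"
          then obtain u where "u \<in> {t2..<t2 + L}" "y = c u" using range_c[of t2] by auto
          then show "y \<in> ?A \<union> ?B" by (cases "u \<le> t1") auto
        qed
        have "?A \<inter> ?B \<inter> (cell z \<inter> range c) = {}"
        proof (rule ccontr)
          assume "\<not> ?thesis"
          then obtain y where y: "y \<in> ?A" "y \<in> ?B" "y \<in> cell z" by blast
          obtain u where u: "u \<in> {t2..t1}" "y = c u" using y(1) by blast
          obtain v where v: "v \<in> {t1..t2 + L}" "y = c v" using y(2) by blast
          have uv: "u \<in> {t2..t1}" "v \<in> {t1..t2 + L}" "c u = c v" "c u \<in> cell z" using u v y(3) by simp_all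
          show False
          proof (cases "v - u < L")
            case True
            then have "u = v" using inj_small[OF uv(3)] uv(1,2) by auto
            then have "u = t1" using uv(1,2) by auto
            then show False using uv(4) t1(3) by simp
          next
            case False
            then have "u = t2" using uv(1,2) by auto
            then show False using uv(4) t2(3) by simp
          qed
        qed
        moreover have "?A \<inter> (cell z \<inter> range c) \<noteq> {}"
        proof -
          have "a \<in> {t2..t1}" using t1 t2 ab(1) by auto
          then have "c a \<in> ?A" by (rule imageI)
          moreover have "c a \<in> cell z \<inter> range c" using cl[of a] ab(1) by simp
          ultimately show ?thesis by blast
        qed
        moreover have "?B \<inter> (cell z \<inter> range c) \<noteq> {}"
        proof -
          have "t \<in> {t1..t2 + L}" using t1 t2 by auto
          then have "c t \<in> ?B" by (rule imageI)
          moreover have "c t \<in> cell z \<inter> range c" using x t(2) by (simp add: zero_set)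
          ultimately show ?thesis by blast
        qed
        ultimately show False using connected_closedD[OF con _ _ cA] cov by blast
      qed
    qed
  qed
  have cr: "c s \<notin> ocell z" if "s \<in> Cr" for s
  proof
    assume "c s \<in> ocell z"
    moreover obtain i where "lattice_line h (c s $ i)" using \<open>s \<in> Cr\<close> unfolding Cr_def by blast
    ultimately show False
      using lattice_line_gap[OF h_pos, of "z $ i" "c s $ i"] z by (simp add: mem_open_cell lattice_pts_iff)
  qed
  show "frontier (cell z) \<inter> zero_set \<psi> = {c a, c b}"
  proof -
    have "frontier (cell z) \<inter> zero_set \<psi> = c ` {a..b} - ocell z"
      unfolding frontier_cbox eq[symmetric] by blast
    also have "\<dots> = {c a, c b}"
    proof
      show "c ` {a..b} - ocell z \<subseteq> {c a, c b}"
      proof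
        fix x assume "x \<in> c ` {a..b} - ocell z"
        then obtain t where t: "x = c t" "a \<le> t" "t \<le> b" "c t \<notin> ocell z" by auto
        then have "t = a \<or> t = b" using o[of t] by linarith
        then show "x \<in> {c a, c b}" using t(1) by blast
      qed
      show "{c a, c b} \<subseteq> c ` {a..b} - ocell z" using cr[OF ab(2)] cr[OF ab(3)] ab(1) by auto
    qed
    finally show ?thesis .
  qed
  show "c a \<noteq> c b"
  proof
    assume "c a = c b"
    then have "a = b" by (rule inj_small) (use short ab(1) L_pos in linarith)
    then show False using ab(1) by simp
  qed
qed

end

section \<open>The cyclic chain of cut cells\<close>

context curve_grid begin

text \<open>Without crossings the whole curve would lie in one cell, and arcs inside a cell are
  shorter than \<open>\<eta>\<close>.\<close>

lemma Cr_nonempty: "Cr \<noteq> {}"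
proof
  assume "Cr = {}"
  then obtain z where "\<And>t. 0 \<le> t \<Longrightarrow> t \<le> L \<Longrightarrow> c t \<in> cell z"
    using gap_cell[of 0 L] L_pos by blast
  then have "L < \<eta>" using gap_short(1)[of 0 L z] L_pos by simp
  then show False using eta_L L_pos by linarith
qed

lemma ocell_not_Cr: "w \<in> lattice_pts h \<Longrightarrow> c t \<in> ocell w \<Longrightarrow> t \<notin> Cr"
proof
  assume a: "w \<in> lattice_pts h" "c t \<in> ocell w" "t \<in> Cr"
  obtain i where "lattice_line h (c t $ i)" using a(3) unfolding Cr_def by blast
  then show False
    using lattice_line_gap[OF h_pos, of "w $ i" "c t $ i"] a(1,2) by (simp add: mem_open_cell lattice_pts_iff)
qed

lemma cell_not_Cr:
  assumes w: "w \<in> lattice_pts h" and "c t \<in> cell w" "t \<notin> Cr" shows "c t \<in> ocell w"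
  unfolding mem_open_cell
proof
  fix i
  have nl: "\<not> lattice_line h (c t $ i)" using assms(3) unfolding Cr_def by blast
  have wl: "lattice_line h (w $ i)" using w by (simp add: lattice_pts_iff)
  have "c t $ i \<noteq> w $ i" using nl wl by metis
  moreover have "c t $ i \<noteq> w $ i + h" using nl lattice_line_add[OF wl] by metis
  ultimately show "w $ i < c t $ i \<and> c t $ i < w $ i + h"
    using spec[OF assms(2)[unfolded mem_cell], of i] by linarith
qed

text \<open>The crossings in one period, sorted. Starting at a crossing makes the shifted starting
  point s 0 + L the last entry, so the chain closes up without a partial arc.\<close>

lemma crossing_chain:
  obtains n :: nat and s :: "nat \<Rightarrow> real" and z where "0 < n" "s n = s 0 + L"
    "\<And>i. i < n \<Longrightarrow> s i < s (Suc i)" "\<And>i. i \<le> n \<Longrightarrow> s i \<in> Cr"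
    "\<And>i t. i < n \<Longrightarrow> s i < t \<Longrightarrow> t < s (Suc i) \<Longrightarrow> t \<notin> Cr"
    "\<And>i. i < n \<Longrightarrow> z i \<in> lattice_pts h"
    "\<And>i t. i < n \<Longrightarrow> s i < t \<Longrightarrow> t < s (Suc i) \<Longrightarrow> c t \<in> ocell (z i)"
    "\<And>i t. i < n \<Longrightarrow> s i \<le> t \<Longrightarrow> t \<le> s (Suc i) \<Longrightarrow> c t \<in> cell (z i)"
proof -
  obtain s0 where s0: "s0 \<in> Cr" using Cr_nonempty by blast
  define A where "A = Cr \<inter> {s0..s0 + L}"
  have fin: "finite A" unfolding A_def by (rule Cr_finite)
  have sL: "s0 + L \<in> Cr" using Cr_period[of s0 1] s0 by simp
  have inA: "s0 \<in> A" "s0 + L \<in> A" using s0 sL L_pos by (auto simp: A_def)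
  define xs where "xs = sorted_list_of_set A"
  have xs: "set xs = A" "sorted_wrt (<) xs" using fin by (auto simp: xs_def strict_sorted_list_of_set)
  have mono: "xs ! i < xs ! j" if "i < j" "j < length xs" for i j
    using sorted_wrt_nth_less[OF xs(2) that] .
  obtain k where k: "k < length xs" "xs ! k = s0" using inA(1) xs(1) by (metis in_set_conv_nth)
  obtain m where m: "m < length xs" "xs ! m = s0 + L" using inA(2) xs(1) by (metis in_set_conv_nth)
  have rng: "s0 \<le> xs ! i" "xs ! i \<le> s0 + L" "xs ! i \<in> Cr" if "i < length xs" for i
  proof -
    have "xs ! i \<in> A" using nth_mem[OF that] xs(1) by simp
    then show "s0 \<le> xs ! i" "xs ! i \<le> s0 + L" "xs ! i \<in> Cr" by (auto simp: A_def)
  qed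
  have k0: "k = 0"
  proof (rule ccontr)
    assume "k \<noteq> 0"
    then have "xs ! 0 < s0" using mono[of 0 k] k by simp
    then show False using rng(1)[of 0] k(1) by linarith
  qed
  define n where "n = length xs - 1"
  have mn: "m = n"
  proof (rule ccontr)
    assume "m \<noteq> n"
    then have "s0 + L < xs ! n" using mono[of m n] m by (simp add: n_def)
    moreover have "n < length xs" using m(1) unfolding n_def by linarith
    ultimately show False using rng(2)[of n] by linarith
  qed
  have n0: "0 < n" using k0 mn k m L_pos by (cases "n = 0") auto
  have len: "length xs = Suc n" using k(1) by (simp add: n_def)
  have gap: "t \<notin> Cr" if "i < n" "xs ! i < t" "t < xs ! Suc i" for i t
  proof
    assume "t \<in> Cr"
    then have "t \<in> set xs" using rng(1)[of i] rng(2)[of "Suc i"] that len by (auto simp: xs(1) A_def)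
    then obtain j where j: "j < length xs" "t = xs ! j" by (metis in_set_conv_nth)
    have "i < j"
    proof (rule ccontr)
      assume "\<not> i < j"
      then have "j = i \<or> j < i" by linarith
      then show False using mono[of j i] that j len by auto
    qed
    moreover have "j < Suc i"
    proof (rule ccontr)
      assume "\<not> j < Suc i"
      then have "j = Suc i \<or> Suc i < j" by linarith
      then show False using mono[of "Suc i" j] that j len by auto
    qed
    ultimately show False by simp
  qed
  have "\<forall>i. \<exists>z. i < n \<longrightarrow> z \<in> lattice_pts h \<and> (\<forall>t. xs ! i < t \<longrightarrow> t < xs ! Suc i \<longrightarrow> c t \<in> ocell z)
     \<and> (\<forall>t. xs ! i \<le> t \<longrightarrow> t \<le> xs ! Suc i \<longrightarrow> c t \<in> cell z)"
  proof
    fix i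
    show "\<exists>z. i < n \<longrightarrow> z \<in> lattice_pts h \<and> (\<forall>t. xs ! i < t \<longrightarrow> t < xs ! Suc i \<longrightarrow> c t \<in> ocell z)
     \<and> (\<forall>t. xs ! i \<le> t \<longrightarrow> t \<le> xs ! Suc i \<longrightarrow> c t \<in> cell z)"
    proof (cases "i < n")
      case True
      then have "xs ! i < xs ! Suc i" using mono[of i "Suc i"] len by simp
      then show ?thesis
      proof (rule gap_cell[OF _ gap[OF True]])
        fix w assume "w \<in> lattice_pts h" "\<And>t. xs ! i < t \<Longrightarrow> t < xs ! Suc i \<Longrightarrow> c t \<in> ocell w"
          "\<And>t. xs ! i \<le> t \<Longrightarrow> t \<le> xs ! Suc i \<Longrightarrow> c t \<in> cell w"
        then show ?thesis by (intro exI[of _ w]) simp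
      qed
    qed simp
  qed
  from choice[OF this] obtain z where z: "\<forall>i. i < n \<longrightarrow> z i \<in> lattice_pts h \<and> (\<forall>t. xs ! i < t \<longrightarrow> t < xs ! Suc i \<longrightarrow> c t \<in> ocell (z i))
     \<and> (\<forall>t. xs ! i \<le> t \<longrightarrow> t \<le> xs ! Suc i \<longrightarrow> c t \<in> cell (z i))" by blast
  show ?thesis
  proof (rule that[of n "\<lambda>i. xs ! i" z])
    show "xs ! n = xs ! 0 + L" using k m k0 mn by simp
    show "xs ! i < xs ! Suc i" if "i < n" for i using mono[of i "Suc i"] len that by simp
    show "xs ! i \<in> Cr" if "i \<le> n" for i using rng(3)[of i] len that by simp
    show "t \<notin> Cr" if "i < n" "xs ! i < t" "t < xs ! Suc i" for i t by (rule gap[OF that])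
  qed (use n0 z in auto)
qed

end

locale chain_grid = curve_grid c c' c'' L K d \<eta> \<psi> h
  for c c' c'' L K d \<eta> \<psi> h +
  fixes n :: nat and s :: "nat \<Rightarrow> real" and z :: "nat \<Rightarrow> pt"
  assumes n_pos: "0 < n" and s_wrap: "s n = s 0 + L"
    and s_step: "\<And>i. i < n \<Longrightarrow> s i < s (Suc i)" and s_Cr: "\<And>i. i \<le> n \<Longrightarrow> s i \<in> Cr"
    and s_gap: "\<And>i t. i < n \<Longrightarrow> s i < t \<Longrightarrow> t < s (Suc i) \<Longrightarrow> t \<notin> Cr"
    and z_lattice: "\<And>i. i < n \<Longrightarrow> z i \<in> lattice_pts h"
    and s_ocell: "\<And>i t. i < n \<Longrightarrow> s i < t \<Longrightarrow> t < s (Suc i) \<Longrightarrow> c t \<in> ocell (z i)"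
    and s_cell: "\<And>i t. i < n \<Longrightarrow> s i \<le> t \<Longrightarrow> t \<le> s (Suc i) \<Longrightarrow> c t \<in> cell (z i)"
begin

lemma s_mono: "i < j \<Longrightarrow> j \<le> n \<Longrightarrow> s i < s j"
proof (induction j)
  case (Suc j)
  show ?case
  proof (cases "i = j")
    case True then show ?thesis using s_step[of j] Suc by simp
  next
    case False
    then have "s i < s j" using Suc by simp
    also have "s j < s (Suc j)" using s_step[of j] Suc by simp
    finally show ?thesis .
  qed
qed simp

lemma s_mono_le: "i \<le> j \<Longrightarrow> j \<le> n \<Longrightarrow> s i \<le> s j"
  using s_mono[of i j] by (cases "i = j") auto

lemma s_range: "i \<le> n \<Longrightarrow> s 0 \<le> s i" "i < n \<Longrightarrow> s (Suc i) \<le> s 0 + L" 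
  using s_mono_le[of 0 i] s_mono_le[of "Suc i" n] s_wrap by auto

lemmas cell_facts = cell_cut[OF s_step s_Cr s_Cr s_gap z_lattice s_ocell s_cell]

lemma cell_cut_i:
  assumes i: "i < n"
  shows "cell (z i) \<inter> zero_set \<psi> = c ` {s i..s (Suc i)}" "cell (z i) \<in> active_cells \<psi> h" 
    "frontier (cell (z i)) \<inter> zero_set \<psi> = {c (s i), c (s (Suc i))}" "c (s i) \<noteq> c (s (Suc i))"
  by (rule cell_facts; use i in simp)+

lemma gap_bounds:
  assumes i: "i < n" shows "s (Suc i) - s i < \<eta>" "s (Suc i) - s i \<le> 3 * h"
  using gap_short[OF s_step[OF i] s_cell[OF i]] by auto

lemma locate: "s 0 \<le> u \<Longrightarrow> u < s m \<Longrightarrow> m \<le> n \<Longrightarrow> \<exists>i<m. s i \<le> u \<and> u < s (Suc i)"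
proof (induction m)
  case (Suc m)
  show ?case
  proof (cases "u < s m")
    case True then show ?thesis using Suc less_SucI by (meson Suc_leD)
  next
    case False then show ?thesis using Suc.prems by (intro exI[of _ m]) auto
  qed
qed simp

lemma locate_period:
  obtains i k where "i < n" "s i \<le> u + of_int k * L" "u + of_int k * L < s (Suc i)"
proof -
  obtain k :: int where "u + of_int k * L \<in> {s 0..<s 0 + L}" using reduce_period by blast
  then show ?thesis using locate[of "u + of_int k * L" n] that s_wrap by auto
qed

lemma index_unique:
  assumes "i < n" "j < n" "s i < t" "t < s (Suc i)" "s j < t" "t < s (Suc j)" shows "i = j"
proof (rule ccontr)
  assume "i \<noteq> j"
  then consider "Suc i \<le> j" | "Suc j \<le> i" by linarith
  then show False using s_mono_le[of "Suc i" j] s_mono_le[of "Suc j" i] assms by cases auto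
qed

text \<open>The part of the curve inside a cell is a single arc. The midpoint of arc
  \<open>i\<close> is no crossing, so if cell \<open>j\<close> is the same it lies strictly inside
  arc \<open>j\<close> as well.\<close>

lemma z_inj: "inj_on (\<lambda>i. cell (z i)) {..<n}"
proof (rule inj_onI)
  fix i j assume ij: "i \<in> {..<n}" "j \<in> {..<n}" "cell (z i) = cell (z j)"
  then have i: "i < n" and j: "j < n" by auto
  define m where "m = (s i + s (Suc i)) / 2"
  have m: "s i < m" "m < s (Suc i)" using s_step[OF i] by (simp_all add: m_def)
  have "c m \<in> cell (z j) \<inter> zero_set \<psi>" using s_cell[OF i, of m] m ij(3) by (simp add: zero_set)
  then obtain t where t: "s j \<le> t" "t \<le> s (Suc j)" "c m = c t" unfolding cell_cut_i(1)[OF j] by auto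
  have "\<bar>m - t\<bar> < L" using m t(1,2) s_range(1)[of i] s_range(2)[OF i] s_range(1)[of j] s_range(2)[OF j] i j by linarith
  then have "m = t" by (rule inj_small[OF t(3)])
  moreover have "m \<notin> Cr" using s_gap[OF i] m by blast
  then have "m \<noteq> s j" "m \<noteq> s (Suc j)" using s_Cr[of j] s_Cr[of "Suc j"] j by auto
  ultimately show "i = j" using index_unique[OF i j m] t by simp
qed

text \<open>A cell that the curve touches at a crossing is entered right before or right after it,
  so every active cell has a curve point in its interior, and that point belongs to an arc of the
  chain.\<close>

lemma active_is_cell:
  assumes "A \<in> active_cells \<psi> h" shows "\<exists>i<n. A = cell (z i)"
proof -
  obtain w t where w: "w \<in> lattice_pts h" "A = cell w" "c t \<in> cell w"
    using assms unfolding active_cells_def cells_def zero_set by auto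
  have "\<exists>t'. c t' \<in> ocell w"
  proof (cases "t \<in> Cr")
    case False then show ?thesis using cell_not_Cr[OF w(1,3)] by blast
  next
    case True
    from crossing_sides[OF w(1) True w(3)] show ?thesis
    proof
      assume "(\<forall>\<^sub>F t in at_right t. c t \<in> ocell w) \<and> (\<forall>\<^sub>F t in at_left t. c t \<notin> cell w)"
      then show ?thesis using eventually_right_witness[of "\<lambda>t. c t \<in> ocell w" t "t + 1"] by auto
    next
      assume "(\<forall>\<^sub>F t in at_left t. c t \<in> ocell w) \<and> (\<forall>\<^sub>F t in at_right t. c t \<notin> cell w)"
      then show ?thesis using eventually_left_witness[of "\<lambda>t. c t \<in> ocell w" t "t - 1"] by auto
    qed
  qed
  then obtain t' where t': "c t' \<in> ocell w" by blast
  obtain i k where i: "i < n" "s i \<le> t' + of_int k * L" "t' + of_int k * L < s (Suc i)" by (rule locate_period)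
  have cu: "c (t' + of_int k * L) \<in> ocell w" using t' by (simp add: period_int)
  then have "t' + of_int k * L \<notin> Cr" using ocell_not_Cr[OF w(1)] by blast
  then have "s i \<noteq> t' + of_int k * L" using s_Cr[of i] i(1) by auto
  then have "c (t' + of_int k * L) \<in> cell (z i)" using s_cell[OF i(1)] i by simp
  then have "w = z i" by (rule open_cell_unique[OF h_pos w(1) z_lattice[OF i(1)] cu])
  then show ?thesis using w(2) i(1) by blast
qed

lemma cells_bij: "bij_betw (\<lambda>i. cell (z i)) {..<n} (active_cells \<psi> h)"
  unfolding bij_betw_def using z_inj cell_cut_i(2) active_is_cell by auto

lemma cut_ends_i:
  assumes i: "i < n"
  shows "cut_ends \<psi> (cell (z i)) = (c (s i), c (s (Suc i))) \<or> cut_ends \<psi> (cell (z i)) = (c (s (Suc i)), c (s i))"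
proof -
  let ?Q = "\<lambda>q. fst q \<noteq> snd q \<and> frontier (cell (z i)) \<inter> zero_set \<psi> = {fst q, snd q}"
  have "?Q (c (s i), c (s (Suc i)))" using cell_cut_i(3,4)[OF i] by simp
  then have "?Q (cut_ends \<psi> (cell (z i)))" unfolding cut_ends_def by (rule someI)
  then have "{c (s i), c (s (Suc i))} = {fst (cut_ends \<psi> (cell (z i))), snd (cut_ends \<psi> (cell (z i)))}"
    using cell_cut_i(3)[OF i] by simp
  then show ?thesis by (auto simp: doubleton_eq_iff prod_eq_iff)
qed

text \<open>Such a cell would be active with the same two cut points, so two different arcs would
  share their end points. In equal order their parameters coincide; in opposite order the arcs form
  a closed loop, whose length is a positive multiple of \<open>L\<close> but below 2\<eta>.\<close>

lemma ends_not_same_side: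
  assumes i: "i < n" and w: "w \<in> lattice_pts h" "w \<noteq> z i"
    and in_w: "c (s i) \<in> cell w" "c (s (Suc i)) \<in> cell w"
  shows False
proof -
  let ?a = "s i" and ?b = "s (Suc i)"
  have "cell w \<in> active_cells \<psi> h"
    unfolding active_cells_def cells_def zero_set using w(1) in_w(1) by auto
  then obtain j where j: "j < n" "cell w = cell (z j)" using active_is_cell by blast
  have ij: "i \<noteq> j"
  proof
    assume "i = j"
    define m where "m = (?a + ?b) / 2"
    have m: "?a < m" "m < ?b" using s_step[OF i] by (simp_all add: m_def)
    have "c m \<in> cell w" using s_cell[OF i, of m] m j(2) \<open>i = j\<close> by simp
    then have "z i = w" by (rule open_cell_unique[OF h_pos z_lattice[OF i] w(1) s_ocell[OF i m]])
    then show False using w(2) by simp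
  qed
  have "c ?a \<notin> ocell w" "c ?b \<notin> ocell w" using ocell_not_Cr[OF w(1)] s_Cr[of i] s_Cr[of "Suc i"] i by auto
  then have "{c ?a, c ?b} \<subseteq> frontier (cell w) \<inter> zero_set \<psi>" using in_w by (auto simp: frontier_cbox zero_set)
  then have sub: "{c ?a, c ?b} \<subseteq> {c (s j), c (s (Suc j))}" using cell_cut_i(3)[OF j(1)] j(2) by simp
  have ne: "c ?a \<noteq> c ?b" by (rule cell_cut_i(4)[OF i])
  consider "c ?a = c (s j)" | "c ?a = c (s (Suc j))" "c ?b = c (s j)" using sub ne by auto
  then show False
  proof cases
    case 1
    have "\<bar>?a - s j\<bar> < L" using s_range(1)[of i] s_range(2)[OF i] s_range(1)[of j] s_range(2)[OF j(1)] s_step[OF i] s_step[OF j(1)] i j(1) by linarith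
    then have "?a = s j" by (rule inj_small[OF 1])
    moreover have "i < j \<or> j < i" using ij by linarith
    ultimately show False using s_mono[of i j] s_mono[of j i] i j(1) by auto
  next
    case 2
    obtain k k' :: int where k: "?a - s (Suc j) = of_int k * L" "?b - s j = of_int k' * L"
      using inj_period[OF 2(1)] inj_period[OF 2(2)] by blast
    have "of_int (k' - k) * L = (?b - ?a) + (s (Suc j) - s j)" using k by (simp add: algebra_simps)
    then have "0 < of_int (k' - k) * L" "of_int (k' - k) * L < L"
      using s_step[OF i] s_step[OF j(1)] gap_bounds(1)[OF i] gap_bounds(1)[OF j(1)] eta_L L_pos by linarith+
    then have "0 < of_int (k' - k) * L" "of_int (k' - k) * L < 1 * L" by simp_all
    then have "0 < (of_int (k' - k) :: real)" "(of_int (k' - k) :: real) < 1"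
      using L_pos by (simp_all only: mult_less_cancel_right zero_less_mult_iff) auto
    then have "0 < k' - k" "k' - k < 1" by (simp_all only: of_int_0_less_iff of_int_less_1_iff)
    then show False by linarith
  qed
qed

text \<open>An interior point of the chord on a side of the cell would put both end points on that
  side, hence into the neighbouring cell, which is excluded. So \<open>cell_at\<close> is determined
  on the open chord, however short the cut.\<close>

lemma open_segment_ocell:
  assumes i: "i < n" and t: "0 < t" "t < 1"
  shows "(1 - t) *\<^sub>R c (s i) + t *\<^sub>R c (s (Suc i)) \<in> ocell (z i)"
  unfolding mem_open_cell
proof
  fix k
  let ?p = "c (s i) $ k" and ?q = "c (s (Suc i)) $ k" and ?x = "((1 - t) *\<^sub>R c (s i) + t *\<^sub>R c (s (Suc i))) $ k"
  have cl: "c (s i) \<in> cell (z i)" "c (s (Suc i)) \<in> cell (z i)" using s_cell[OF i, of "s i"] s_cell[OF i, of "s (Suc i)"] s_step[OF i] by auto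
  have pq: "z i $ k \<le> ?p" "?p \<le> z i $ k + h" "z i $ k \<le> ?q" "?q \<le> z i $ k + h"
    using spec[OF cl(1)[unfolded mem_cell], of k] spec[OF cl(2)[unfolded mem_cell], of k] by auto
  have side: False if e: "e = axis k 1 \<or> e = - axis k 1" and "\<And>m. m = k \<Longrightarrow> z i $ m + h * e $ m \<le> ?p \<and> ?p \<le> z i $ m + h * e $ m + h \<and> z i $ m + h * e $ m \<le> ?q \<and> ?q \<le> z i $ m + h * e $ m + h" for e
  proof (rule ends_not_same_side[OF i, of "z i + h *\<^sub>R e"])
    have "e \<in> dirs" using e unfolding dirs_def by auto
    then show "z i + h *\<^sub>R e \<in> lattice_pts h" using lattice_add_dir[OF z_lattice[OF i]] by blast
    show "z i + h *\<^sub>R e \<noteq> z i" using e h_pos by (auto simp: axis_eq_0_iff)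
    have em: "e $ m = 0" if "m \<noteq> k" for m using e that by (auto simp: axis_def)
    show "c (s i) \<in> cell (z i + h *\<^sub>R e)" unfolding mem_cell
    proof
      fix m show "(z i + h *\<^sub>R e) $ m \<le> c (s i) $ m \<and> c (s i) $ m \<le> (z i + h *\<^sub>R e) $ m + h"
        using that(2)[of m] em[of m] spec[OF cl(1)[unfolded mem_cell], of m] by (cases "m = k") auto
    qed
    show "c (s (Suc i)) \<in> cell (z i + h *\<^sub>R e)" unfolding mem_cell
    proof
      fix m show "(z i + h *\<^sub>R e) $ m \<le> c (s (Suc i)) $ m \<and> c (s (Suc i)) $ m \<le> (z i + h *\<^sub>R e) $ m + h"
        using that(2)[of m] em[of m] spec[OF cl(2)[unfolded mem_cell], of m] by (cases "m = k") auto
    qed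
  qed
  have x: "?x - z i $ k = (1 - t) * (?p - z i $ k) + t * (?q - z i $ k)"
    "z i $ k + h - ?x = (1 - t) * (z i $ k + h - ?p) + t * (z i $ k + h - ?q)" by (simp_all add: algebra_simps)
  have nn: "0 \<le> (1 - t) * (?p - z i $ k)" "0 \<le> t * (?q - z i $ k)" "0 \<le> (1 - t) * (z i $ k + h - ?p)" "0 \<le> t * (z i $ k + h - ?q)"
    using pq t by simp_all
  have "?x \<noteq> z i $ k"
  proof
    assume "?x = z i $ k"
    then have "(1 - t) * (?p - z i $ k) = 0" "t * (?q - z i $ k) = 0" using x(1) nn by linarith+
    then have "?p = z i $ k" "?q = z i $ k" using t by auto
    then show False using side[of "- axis k 1"] h_pos by (simp add: axis_def)
  qed
  moreover have "?x \<noteq> z i $ k + h"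
  proof
    assume "?x = z i $ k + h"
    then have "(1 - t) * (z i $ k + h - ?p) = 0" "t * (z i $ k + h - ?q) = 0" using x(2) nn by linarith+
    then have "?p = z i $ k + h" "?q = z i $ k + h" using t by auto
    then show False using side[of "axis k 1"] h_pos by (simp add: axis_def)
  qed
  ultimately show "z i $ k < ?x \<and> ?x < z i $ k + h" using x nn by linarith
qed

end

section \<open>Bilinear interpolation\<close>

definition bil :: "real \<Rightarrow> pt \<Rightarrow> (pt \<Rightarrow> real) \<Rightarrow> pt \<Rightarrow> real"
  where "bil h w E x = (let \<alpha> = (x $ 1 - w $ 1) / h; \<beta> = (x $ 2 - w $ 2) / h in
    (1 - \<alpha>) * (1 - \<beta>) * E w + \<alpha> * (1 - \<beta>) * E (w + h *\<^sub>R axis 1 1)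
    + (1 - \<alpha>) * \<beta> * E (w + h *\<^sub>R axis 2 1) + \<alpha> * \<beta> * E (w + h *\<^sub>R axis 1 1 + h *\<^sub>R axis 2 1))"

text \<open>The partial derivative of \<open>bil\<close> in the first coordinate, written as a
  convex combination, inside the cell, of the difference quotients on two opposite edges; likewise
  \<open>bil2\<close>. In this form gradient errors are errors of difference quotients.\<close>

definition bil1 :: "real \<Rightarrow> pt \<Rightarrow> (pt \<Rightarrow> real) \<Rightarrow> pt \<Rightarrow> real"
  where "bil1 h w E x = (let \<beta> = (x $ 2 - w $ 2) / h in
    (1 - \<beta>) * ((E (w + h *\<^sub>R axis 1 1) - E w) / h)
    + \<beta> * ((E (w + h *\<^sub>R axis 1 1 + h *\<^sub>R axis 2 1) - E (w + h *\<^sub>R axis 2 1)) / h))"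

definition bil2 :: "real \<Rightarrow> pt \<Rightarrow> (pt \<Rightarrow> real) \<Rightarrow> pt \<Rightarrow> real"
  where "bil2 h w E x = (let \<alpha> = (x $ 1 - w $ 1) / h in
    (1 - \<alpha>) * ((E (w + h *\<^sub>R axis 2 1) - E w) / h)
    + \<alpha> * ((E (w + h *\<^sub>R axis 1 1 + h *\<^sub>R axis 2 1) - E (w + h *\<^sub>R axis 1 1)) / h))"

lemma bil_deriv:
  assumes "0 < h"
  shows "((\<lambda>t. bil h w E (p + t *\<^sub>R v)) has_real_derivative
    v $ 1 * bil1 h w E (p + t *\<^sub>R v) + v $ 2 * bil2 h w E (p + t *\<^sub>R v)) (at t)"
  unfolding bil_def bil1_def bil2_def Let_def using assms
  by (auto intro!: derivative_eq_intros simp: field_simps)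

lemma bil_rate_cont: "0 < h \<Longrightarrow> continuous_on S (\<lambda>t. v $ 1 * bil1 h w E (p + t *\<^sub>R v) + v $ 2 * bil2 h w E (p + t *\<^sub>R v))"
  unfolding bil1_def bil2_def Let_def by (intro continuous_intros) auto

lemma hat_lattice:
  assumes h: "0 < h" and l: "lattice_line h w" "lattice_line h \<xi>" and x: "w \<le> x" "x \<le> w + h"
  shows "\<xi> = w \<Longrightarrow> hat ((x - \<xi>) / h) = 1 - (x - w) / h"
    "\<xi> = w + h \<Longrightarrow> hat ((x - \<xi>) / h) = (x - w) / h"
    "\<xi> \<noteq> w \<Longrightarrow> \<xi> \<noteq> w + h \<Longrightarrow> hat ((x - \<xi>) / h) = 0"
proof -
  have a: "0 \<le> (x - w) / h" "(x - w) / h \<le> 1" using h x by (auto simp: field_simps)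
  show "\<xi> = w \<Longrightarrow> hat ((x - \<xi>) / h) = 1 - (x - w) / h"
    unfolding hat_def by (simp only: abs_of_nonneg[OF a(1)]) (use a in simp)
  have "(x - (w + h)) / h = (x - w) / h - 1" using h by (simp add: field_simps)
  then show "\<xi> = w + h \<Longrightarrow> hat ((x - \<xi>) / h) = (x - w) / h" using a by (simp add: hat_def)
  assume ne: "\<xi> \<noteq> w" "\<xi> \<noteq> w + h"
  obtain m k :: int where mk: "w = h * of_int m" "\<xi> = h * of_int k" using l by (auto simp: lattice_line_def)
  have "k \<noteq> m" "k \<noteq> m + 1" using ne mk by (auto simp: distrib_left)
  then have "k \<le> m - 1 \<or> m + 2 \<le> k" by linarith
  then have "(of_int k :: real) \<le> of_int (m - 1) \<or> of_int (m + 2) \<le> (of_int k :: real)" by (simp only: of_int_le_iff)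
  moreover have "(x - \<xi>) / h = (x - w) / h + (of_int m - of_int k)" using h mk by (simp add: field_simps)
  ultimately have "1 \<le> \<bar>(x - \<xi>) / h\<bar>" using a by auto
  then show "hat ((x - \<xi>) / h) = 0" by (simp add: hat_def)
qed

definition cell_vertices :: "real \<Rightarrow> pt \<Rightarrow> pt set"
  where "cell_vertices h w = {w, w + h *\<^sub>R axis 1 1, w + h *\<^sub>R axis 2 1, w + h *\<^sub>R axis 1 1 + h *\<^sub>R axis 2 1}"

lemma cell_vertices_mem:
  assumes "0 < h" "w \<in> lattice_pts h"
  shows "cell_vertices h w \<subseteq> lattice_pts h \<inter> cbox w (w + vec h)"
proof -
  have d: "axis 1 1 \<in> dirs" "axis 2 1 \<in> dirs" by (auto simp: dirs_eq)
  have "cell_vertices h w \<subseteq> lattice_pts h"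
    unfolding cell_vertices_def using assms(2) lattice_add_dir d by auto
  moreover have "cell_vertices h w \<subseteq> cbox w (w + vec h)"
    using assms(1) unfolding cell_vertices_def by (auto simp: mem_cell axis_def)
  ultimately show ?thesis by blast
qed

text \<open>In a cell only the hats of its four vertices survive, so the global sum turns into the
  local formula whatever further nodes \<open>G\<close> contains.\<close>

lemma nodal_sum_bil:
  assumes h: "0 < h" and w: "w \<in> lattice_pts h" and x: "x \<in> cbox w (w + vec h)"
    and G: "finite G" "G \<subseteq> lattice_pts h" "cell_vertices h w \<subseteq> G"
  shows "(\<Sum>\<xi>\<in>G. E \<xi> * nodal h \<xi> x) = bil h w E x"
proof -
  have wl: "lattice_line h (w $ i)" for i using w by (simp add: lattice_pts_iff)
  have xi: "w $ i \<le> x $ i" "x $ i \<le> w $ i + h" for i using spec[OF x[unfolded mem_cell], of i] by auto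
  have z: "nodal h \<xi> x = 0" if "\<xi> \<in> G - cell_vertices h w" for \<xi>
  proof -
    have \<xi>l: "lattice_line h (\<xi> $ i)" for i using that G(2) by (auto simp: lattice_pts_iff)
    have "\<exists>i. \<xi> $ i \<noteq> w $ i \<and> \<xi> $ i \<noteq> w $ i + h"
    proof (rule ccontr)
      assume "\<not> ?thesis"
      then have "\<xi> $ 1 = w $ 1 \<or> \<xi> $ 1 = w $ 1 + h" "\<xi> $ 2 = w $ 2 \<or> \<xi> $ 2 = w $ 2 + h" by blast+
      then have "\<xi> \<in> cell_vertices h w"
        unfolding cell_vertices_def by (auto simp: vec_eq_iff forall_2 axis_def)
      then show False using that by blast
    qed
    then obtain i where i: "\<xi> $ i \<noteq> w $ i" "\<xi> $ i \<noteq> w $ i + h" by blast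
    have "hat ((x $ i - \<xi> $ i) / h) = 0" by (rule hat_lattice(3)[OF h wl \<xi>l xi i])
    then show ?thesis using exhaust_2[of i] by (auto simp: nodal_def)
  qed
  have ne: "w \<noteq> w + h *\<^sub>R axis 1 1" "w \<noteq> w + h *\<^sub>R axis 2 1" "w \<noteq> w + h *\<^sub>R axis 1 1 + h *\<^sub>R axis 2 1"
    "w + h *\<^sub>R axis 1 1 \<noteq> w + h *\<^sub>R axis 2 1" "w + h *\<^sub>R axis 1 1 \<noteq> w + h *\<^sub>R axis 1 1 + h *\<^sub>R axis 2 1"
    "w + h *\<^sub>R axis 2 1 \<noteq> w + h *\<^sub>R axis 1 1 + h *\<^sub>R axis 2 1"
    using h by (auto simp: vec_eq_iff forall_2 axis_def)
  have l: "lattice_line h (w $ i + h)" for i using lattice_line_add[OF wl] .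
  note H = hat_lattice(1)[OF h wl wl xi refl] hat_lattice(2)[OF h wl l xi refl]
  have comps: "(w + h *\<^sub>R axis 1 1) $ 1 = w $ 1 + h" "(w + h *\<^sub>R axis 1 1) $ 2 = w $ 2"
    "(w + h *\<^sub>R axis 2 1) $ 1 = w $ 1" "(w + h *\<^sub>R axis 2 1) $ 2 = w $ 2 + h"
    "(w + h *\<^sub>R axis 1 1 + h *\<^sub>R axis 2 1) $ 1 = w $ 1 + h" "(w + h *\<^sub>R axis 1 1 + h *\<^sub>R axis 2 1) $ 2 = w $ 2 + h"
    by (simp_all add: axis_def)
  define \<alpha> \<beta> where "\<alpha> = (x $ 1 - w $ 1) / h" and "\<beta> = (x $ 2 - w $ 2) / h"
  have nod: "nodal h w x = (1 - \<alpha>) * (1 - \<beta>)" "nodal h (w + h *\<^sub>R axis 1 1) x = \<alpha> * (1 - \<beta>)"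
    "nodal h (w + h *\<^sub>R axis 2 1) x = (1 - \<alpha>) * \<beta>" "nodal h (w + h *\<^sub>R axis 1 1 + h *\<^sub>R axis 2 1) x = \<alpha> * \<beta>"
    unfolding nodal_def comps H \<alpha>_def \<beta>_def by (rule refl)+
  have "(\<Sum>\<xi>\<in>G. E \<xi> * nodal h \<xi> x) = (\<Sum>\<xi>\<in>cell_vertices h w. E \<xi> * nodal h \<xi> x)"
    by (rule sum.mono_neutral_right) (use G z in auto)
  also have "\<dots> = bil h w E x"
  proof -
    have "(\<Sum>\<xi>\<in>cell_vertices h w. E \<xi> * nodal h \<xi> x) = E w * nodal h w x + (E (w + h *\<^sub>R axis 1 1) * nodal h (w + h *\<^sub>R axis 1 1) x
      + (E (w + h *\<^sub>R axis 2 1) * nodal h (w + h *\<^sub>R axis 2 1) x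
      + E (w + h *\<^sub>R axis 1 1 + h *\<^sub>R axis 2 1) * nodal h (w + h *\<^sub>R axis 1 1 + h *\<^sub>R axis 2 1) x))"
      unfolding cell_vertices_def
      by (subst sum.insert; (insert ne, simp)?)+
    then show ?thesis unfolding nod bil_def Let_def \<alpha>_def[symmetric] \<beta>_def[symmetric] by (simp only: mult_ac add_ac)
  qed
  finally show ?thesis .
qed

locale C2_field =
  fixes V :: "nat \<Rightarrow> nat \<Rightarrow> pt \<Rightarrow> real" and B :: real
  assumes V_deriv: "\<And>i j x. i + j \<le> 1 \<Longrightarrow> (V i j has_derivative (\<lambda>k. k $ 1 * V (Suc i) j x + k $ 2 * V i (Suc j) x)) (at x)"
    and V_bound: "\<And>i j x. i + j \<le> 2 \<Longrightarrow> \<bar>V i j x\<bar> \<le> B"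
begin

lemma B_nonneg: "0 \<le> B" using V_bound[of 0 0 0] by simp

lemma V_lip:
  assumes "i + j \<le> 1" shows "\<bar>V i j x - V i j y\<bar> \<le> 2 * B * norm (x - y)"
proof -
  have "norm (V i j x - V i j y) \<le> 2 * B * norm (x - y)"
  proof (rule differentiable_bound[of UNIV "V i j" "\<lambda>x k. k $ 1 * V (Suc i) j x + k $ 2 * V i (Suc j) x"])
    fix x
    show "(V i j has_derivative (\<lambda>k. k $ 1 * V (Suc i) j x + k $ 2 * V i (Suc j) x)) (at x within UNIV)"
      using V_deriv[OF assms] by simp
    show "onorm (\<lambda>k :: pt. k $ 1 * V (Suc i) j x + k $ 2 * V i (Suc j) x) \<le> 2 * B"
    proof (rule onorm_bound)
      show "0 \<le> 2 * B" using B_nonneg by simp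
    next
      fix k :: pt
      have "\<bar>k $ 1 * V (Suc i) j x\<bar> \<le> norm k * B" "\<bar>k $ 2 * V i (Suc j) x\<bar> \<le> norm k * B"
        unfolding abs_mult by (intro mult_mono V_bound component_le_norm_cart; use assms in simp)+
      then have "norm (k $ 1 * V (Suc i) j x + k $ 2 * V i (Suc j) x) \<le> norm k * B + norm k * B"
        unfolding real_norm_def by linarith
      also have "\<dots> = 2 * B * norm k" by simp
      finally show "norm (k $ 1 * V (Suc i) j x + k $ 2 * V i (Suc j) x) \<le> 2 * B * norm k" .
    qed
  qed auto
  then show ?thesis by simp
qed

lemma V_second: "\<bar>V 0 0 (x + k) - V 0 0 x - (k $ 1 * V 1 0 x + k $ 2 * V 0 1 x)\<bar> \<le> 2 * B * (norm k)\<^sup>2"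
  using second_order_expansion[of 0 0 V B x k] V_deriv V_bound by simp

text \<open>Two nodal errors give 2\<delta>/h, the Taylor remainder 2Bh, and moving the derivative
  from the node \<open>y\<close> to \<open>x\<close> another 4Bh. With \<delta> of order h^2 the
  total is of order h.\<close>

lemma difference_quotient:
  assumes h: "0 < h" and e: "\<bar>E y - V 0 0 y\<bar> \<le> \<delta>" "\<bar>E (y + h *\<^sub>R axis m 1) - V 0 0 (y + h *\<^sub>R axis m 1)\<bar> \<le> \<delta>"
    and x: "norm (x - y) \<le> 2 * h"
  shows "m = 1 \<Longrightarrow> \<bar>(E (y + h *\<^sub>R axis m 1) - E y) / h - V 1 0 x\<bar> \<le> 2 * \<delta> / h + 6 * B * h"
    "m = 2 \<Longrightarrow> \<bar>(E (y + h *\<^sub>R axis m 1) - E y) / h - V 0 1 x\<bar> \<le> 2 * \<delta> / h + 6 * B * h"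
proof -
  have key: "\<bar>(E (y + h *\<^sub>R axis m 1) - E y) / h - D x\<bar> \<le> 2 * \<delta> / h + 6 * B * h"
    if D: "\<bar>V 0 0 (y + h *\<^sub>R axis m 1) - V 0 0 y - h * D y\<bar> \<le> 2 * B * h\<^sup>2" "\<bar>D x - D y\<bar> \<le> 2 * B * norm (x - y)" for D
  proof -
    have "\<bar>E (y + h *\<^sub>R axis m 1) - E y - h * D x\<bar> \<le> 2 * \<delta> + 2 * B * h\<^sup>2 + h * (2 * B * norm (x - y))"
    proof -
      have "\<bar>h * (D x - D y)\<bar> \<le> h * (2 * B * norm (x - y))" using D(2) h by (simp add: abs_mult)
      moreover have "E (y + h *\<^sub>R axis m 1) - E y - h * D x = (E (y + h *\<^sub>R axis m 1) - V 0 0 (y + h *\<^sub>R axis m 1)) - (E y - V 0 0 y)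
        + (V 0 0 (y + h *\<^sub>R axis m 1) - V 0 0 y - h * D y) - h * (D x - D y)" by (simp add: algebra_simps)
      ultimately show ?thesis using e D(1) by linarith
    qed
    also have "h * (2 * B * norm (x - y)) \<le> h * (2 * B * (2 * h))"
      using x h B_nonneg by (intro mult_left_mono) auto
    finally have "\<bar>E (y + h *\<^sub>R axis m 1) - E y - h * D x\<bar> \<le> 2 * \<delta> + 6 * B * h\<^sup>2" by (simp add: power2_eq_square)
    then have "\<bar>E (y + h *\<^sub>R axis m 1) - E y - h * D x\<bar> / h \<le> (2 * \<delta> + 6 * B * h\<^sup>2) / h"
      using h by (intro divide_right_mono) auto
    also have "(2 * \<delta> + 6 * B * h\<^sup>2) / h = 2 * \<delta> / h + 6 * B * h" using h by (simp add: field_simps power2_eq_square)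
    finally have "\<bar>(E (y + h *\<^sub>R axis m 1) - E y - h * D x) / h\<bar> \<le> 2 * \<delta> / h + 6 * B * h"
      using h by (simp only: abs_divide abs_of_pos)
    moreover have "(E (y + h *\<^sub>R axis m 1) - E y - h * D x) / h = (E (y + h *\<^sub>R axis m 1) - E y) / h - D x"
      using h by (simp add: field_simps)
    ultimately show ?thesis by (simp only:)
  qed
  have n: "norm (h *\<^sub>R axis m 1 :: pt) = h" using h by simp
  show "m = 1 \<Longrightarrow> \<bar>(E (y + h *\<^sub>R axis m 1) - E y) / h - V 1 0 x\<bar> \<le> 2 * \<delta> / h + 6 * B * h"
    using V_second[of y "h *\<^sub>R axis m 1"] V_lip[of 1 0 x y] unfolding n by (intro key) (simp_all add: axis_def)
  show "m = 2 \<Longrightarrow> \<bar>(E (y + h *\<^sub>R axis m 1) - E y) / h - V 0 1 x\<bar> \<le> 2 * \<delta> / h + 6 * B * h"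
    using V_second[of y "h *\<^sub>R axis m 1"] V_lip[of 0 1 x y] unfolding n by (intro key) (simp_all add: axis_def)
qed

lemma convex_comb_close:
  fixes a b v e \<beta> :: real
  assumes "0 \<le> \<beta>" "\<beta> \<le> 1" "\<bar>a - v\<bar> \<le> e" "\<bar>b - v\<bar> \<le> e"
  shows "\<bar>(1 - \<beta>) * a + \<beta> * b - v\<bar> \<le> e"
proof -
  have "\<bar>(1 - \<beta>) * (a - v)\<bar> \<le> (1 - \<beta>) * e" "\<bar>\<beta> * (b - v)\<bar> \<le> \<beta> * e"
    using assms by (auto simp: abs_mult intro!: mult_left_mono)
  moreover have "(1 - \<beta>) * a + \<beta> * b - v = (1 - \<beta>) * (a - v) + \<beta> * (b - v)" "(1 - \<beta>) * e + \<beta> * e = e"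
    by (simp_all add: algebra_simps)
  ultimately show ?thesis by linarith
qed

lemma bil_approx:
  assumes h: "0 < h" and w: "w \<in> lattice_pts h" and x: "x \<in> cbox w (w + vec h)"
    and E: "\<And>\<xi>. \<xi> \<in> cell_vertices h w \<Longrightarrow> \<bar>E \<xi> - V 0 0 \<xi>\<bar> \<le> \<delta>"
  shows "\<bar>bil h w E x - V 0 0 x\<bar> \<le> \<delta> + 4 * B * h"
    "\<bar>bil1 h w E x - V 1 0 x\<bar> \<le> 2 * \<delta> / h + 6 * B * h"
    "\<bar>bil2 h w E x - V 0 1 x\<bar> \<le> 2 * \<delta> / h + 6 * B * h"
proof -
  define \<alpha> \<beta> where "\<alpha> = (x $ 1 - w $ 1) / h" and "\<beta> = (x $ 2 - w $ 2) / h"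
  have ab: "0 \<le> \<alpha>" "\<alpha> \<le> 1" "0 \<le> \<beta>" "\<beta> \<le> 1"
    using h spec[OF x[unfolded mem_cell], of 1] spec[OF x[unfolded mem_cell], of 2] by (auto simp: \<alpha>_def \<beta>_def field_simps)
  let ?w1 = "w + h *\<^sub>R axis 1 1" and ?w2 = "w + h *\<^sub>R axis 2 1" and ?w3 = "w + h *\<^sub>R axis 1 1 + h *\<^sub>R axis 2 1"
  have w3: "?w3 = ?w2 + h *\<^sub>R axis 1 1" "?w3 = ?w1 + h *\<^sub>R axis 2 1" by (simp_all add: algebra_simps)
  have vs: "w \<in> cell_vertices h w" "?w1 \<in> cell_vertices h w" "?w2 \<in> cell_vertices h w" "?w3 \<in> cell_vertices h w"
    by (simp_all add: cell_vertices_def)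
  have nx: "norm (x - \<xi>) \<le> 2 * h" if "\<xi> \<in> cell_vertices h w" for \<xi>
    using cell_diam[OF x] cell_vertices_mem[OF h w] that by blast
  have val: "\<bar>E \<xi> - V 0 0 x\<bar> \<le> \<delta> + 4 * B * h" if "\<xi> \<in> cell_vertices h w" for \<xi>
  proof -
    have "2 * B * norm (\<xi> - x) \<le> 2 * B * (2 * h)" using nx[OF that] B_nonneg by (intro mult_left_mono) (auto simp: norm_minus_commute)
    then show ?thesis using E[OF that] V_lip[of 0 0 \<xi> x] by simp
  qed
  have "bil h w E x = (1 - \<beta>) * ((1 - \<alpha>) * E w + \<alpha> * E ?w1) + \<beta> * ((1 - \<alpha>) * E ?w2 + \<alpha> * E ?w3)"
    unfolding bil_def Let_def \<alpha>_def[symmetric] \<beta>_def[symmetric] by (simp add: algebra_simps)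
  then show "\<bar>bil h w E x - V 0 0 x\<bar> \<le> \<delta> + 4 * B * h"
    using ab val vs by (simp only:) (intro convex_comb_close; blast)
  have A: "\<bar>(E ?w1 - E w) / h - V 1 0 x\<bar> \<le> 2 * \<delta> / h + 6 * B * h"
    by (rule difference_quotient(1)[OF h E[OF vs(1)] E[OF vs(2)] nx[OF vs(1)] refl])
  have "\<bar>(E ?w3 - E ?w2) / h - V 1 0 x\<bar> \<le> 2 * \<delta> / h + 6 * B * h"
    unfolding w3(1) by (rule difference_quotient(1)[OF h E[OF vs(3)] E[OF vs(4), unfolded w3(1)] nx[OF vs(3)] refl])
  from convex_comb_close[OF ab(3,4) A this]
  show "\<bar>bil1 h w E x - V 1 0 x\<bar> \<le> 2 * \<delta> / h + 6 * B * h"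
    unfolding bil1_def Let_def \<beta>_def[symmetric] .
  have A: "\<bar>(E ?w2 - E w) / h - V 0 1 x\<bar> \<le> 2 * \<delta> / h + 6 * B * h"
    by (rule difference_quotient(2)[OF h E[OF vs(1)] E[OF vs(3)] nx[OF vs(1)] refl])
  have "\<bar>(E ?w3 - E ?w1) / h - V 0 1 x\<bar> \<le> 2 * \<delta> / h + 6 * B * h"
    by (rule difference_quotient(2)[OF h E[OF vs(2)] E[OF vs(4)] nx[OF vs(2)] refl])
  from convex_comb_close[OF ab(1,2) A this]
  show "\<bar>bil2 h w E x - V 0 1 x\<bar> \<le> 2 * \<delta> / h + 6 * B * h"
    unfolding bil2_def Let_def \<alpha>_def[symmetric] .
qed

end

section \<open>Periodic test functions\<close>

text \<open>Short of the reflected angle 2 pi - y, comparing cosines is comparing angles. This turns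
  nearness on a circle into an inequality between smooth periodic functions.\<close>

lemma cos_arc_iff:
  assumes "0 \<le> y" "y \<le> pi" "0 \<le> x" "x \<le> 2 * pi - y"
  shows "cos y < cos x \<longleftrightarrow> x < y"
proof
  assume "x < y" then show "cos y < cos x" using cos_monotone_0_pi[of x y] assms by simp
next
  assume c: "cos y < cos x"
  show "x < y"
  proof (rule ccontr)
    assume "\<not> x < y"
    then have yx: "y \<le> x" by simp
    show False
    proof (cases "x \<le> pi")
      case True
      then show False using cos_monotone_0_pi_le[of y x] yx assms c by simp
    next
      case False
      have "cos (2 * pi - x) \<le> cos y" using cos_monotone_0_pi_le[of y "2 * pi - x"] assms False by simp
      then show False using c by (simp add: cos_diff)
    qed
  qed
qed

text \<open>Composition of the flat function with a cosine, which is periodic by itself, so no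
  translates have to be glued. For 0 < r \<le> L/2 and N > 0 it is positive exactly at distance
  below \<open>r\<close> from \<open>m\<close> modulo \<open>L\<close>.\<close>

definition periodic_bump :: "real \<Rightarrow> real \<Rightarrow> real \<Rightarrow> real \<Rightarrow> real \<Rightarrow> real"
  where "periodic_bump L m r N s = flat 0 (N * (cos (2 * pi / L * (s - m)) - cos (2 * pi / L * r)))"

lemma periodic_bump_smooth: "(deriv ^^ n) (periodic_bump L m r N) differentiable_on UNIV"
proof -
  define \<omega> where "\<omega> = 2 * pi / L"
  let ?q = "\<lambda>s. N * (cos (\<omega> * (s - m)) - cos (\<omega> * r))"
  let ?G = "{\<lambda>s. cos (\<omega> * (s - m)), \<lambda>s. sin (\<omega> * (s - m))} \<union> range (\<lambda>k s. flat k (?q s))"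
  have G: "\<exists>f'\<in>fun_alg ?G. \<forall>x. (f has_real_derivative f' x) (at x)" if "f \<in> ?G" for f
  proof -
    consider "f = (\<lambda>s. cos (\<omega> * (s - m)))" | "f = (\<lambda>s. sin (\<omega> * (s - m)))" | k where "f = (\<lambda>s. flat k (?q s))"
      using \<open>f \<in> ?G\<close> by blast
    then show ?thesis
    proof cases
      case 1
      show ?thesis
      proof (intro bexI[of _ "\<lambda>s. (- \<omega>) * sin (\<omega> * (s - m))"] allI)
        show "(f has_real_derivative (- \<omega>) * sin (\<omega> * (x - m))) (at x)" for x
          unfolding 1 by (auto intro!: derivative_eq_intros)
        show "(\<lambda>s. (- \<omega>) * sin (\<omega> * (s - m))) \<in> fun_alg ?G"
          by (intro fun_alg_mult fun_alg_const) (auto intro: fun_alg_gen)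
      qed
    next
      case 2
      show ?thesis
      proof (intro bexI[of _ "\<lambda>s. \<omega> * cos (\<omega> * (s - m))"] allI)
        show "(f has_real_derivative \<omega> * cos (\<omega> * (x - m))) (at x)" for x
          unfolding 2 by (auto intro!: derivative_eq_intros)
        show "(\<lambda>s. \<omega> * cos (\<omega> * (s - m))) \<in> fun_alg ?G"
          by (intro fun_alg_mult fun_alg_const) (auto intro: fun_alg_gen)
      qed
    next
      case 3
      show ?thesis
      proof (intro bexI[of _ "\<lambda>s. (flat (k + 2) (?q s) + (- real k) * flat (k + 1) (?q s)) * ((- (N * \<omega>)) * sin (\<omega> * (s - m)))"] allI)
        fix x
        have "(?q has_real_derivative - (N * \<omega>) * sin (\<omega> * (x - m))) (at x)"
          by (auto intro!: derivative_eq_intros)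
        from DERIV_chain2[OF flat_has_derivative this]
        show "(f has_real_derivative (flat (k + 2) (?q x) + (- real k) * flat (k + 1) (?q x)) * ((- (N * \<omega>)) * sin (\<omega> * (x - m)))) (at x)"
          unfolding 3 by simp
      next
        show "(\<lambda>s. (flat (k + 2) (?q s) + (- real k) * flat (k + 1) (?q s)) * ((- (N * \<omega>)) * sin (\<omega> * (s - m)))) \<in> fun_alg ?G"
          by (intro fun_alg_mult fun_alg_add fun_alg_const) (auto intro: fun_alg_gen)
      qed
    qed
  qed
  have "periodic_bump L m r N \<in> ?G" by (auto simp: periodic_bump_def[abs_def] \<omega>_def)
  then have "periodic_bump L m r N \<in> fun_alg ?G" by (rule fun_alg_gen)
  from fun_alg_deriv_funpow[OF G this]
  show ?thesis by (auto simp: differentiable_on_def real_differentiable_def)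
qed

lemma periodic_bump_periodic: "L \<noteq> 0 \<Longrightarrow> periodic_bump L m r N (s + L) = periodic_bump L m r N s"
proof -
  assume "L \<noteq> 0"
  then have "2 * pi / L * (s + L - m) = 2 * pi / L * (s - m) + 2 * pi" by (simp add: field_simps)
  then show ?thesis unfolding periodic_bump_def by (simp only: cos_periodic)
qed

lemma flat_scaled_limit: "(\<lambda>N. flat 0 (real N * y)) \<longlonglongrightarrow> (if 0 < y then 1 else 0)"
proof (cases "0 < y")
  case True
  have "(\<lambda>N. exp (- (1 / (real N * y)))) \<longlonglongrightarrow> exp (- 0)"
  proof (intro tendsto_exp tendsto_minus)
    have "(\<lambda>N. (1 / y) * (1 / real N)) \<longlonglongrightarrow> (1 / y) * 0" by (intro tendsto_mult tendsto_const lim_1_over_n)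
    then show "(\<lambda>N. 1 / (real N * y)) \<longlonglongrightarrow> 0" by (simp add: mult.commute)
  qed
  moreover have "\<forall>\<^sub>F N in sequentially. exp (- (1 / (real N * y))) = flat 0 (real N * y)"
    using eventually_gt_at_top[of 0] by eventually_elim (use True in \<open>simp add: flat_def\<close>)
  ultimately show ?thesis using True by (auto intro: Lim_transform_eventually)
next
  case False
  then have "flat 0 (real N * y) = 0" for N by (auto simp: flat_def mult_le_0_iff not_less zero_less_mult_iff)
  then show ?thesis using False by simp
qed

lemma borel_Ioo: "sets (borel :: real measure) = sigma_sets UNIV (range (\<lambda>(a, b). {a<..<b}))"
  by (subst borel_eq_box) (simp add: box_real case_prod_unfold)

text \<open>Open intervals are closed under intersection and generate the Borel sets, so vanishing
  integrals extend to all Borel sets by Dynkin's argument. The support condition serves the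
  complement step, which needs the total integral to vanish.\<close>

lemma interval_integrals_zero:
  fixes f :: "real \<Rightarrow> real"
  assumes f: "integrable lborel f" and z: "\<And>a b. a < b \<Longrightarrow> (LINT x|lborel. indicator {a<..<b} x * f x) = 0"
    and supp: "\<And>x. x \<notin> {a0<..<b0} \<Longrightarrow> f x = 0"
  shows "AE x in lborel. f x = 0"
proof (rule sigma_finite_measure.density_zero)
  show "sigma_finite_measure (lborel :: real measure)" by (rule lborel.sigma_finite_measure_axioms)
  show "integrable lborel f" by (rule f)
  have si: "set_integrable lborel A f" if "A \<in> sets borel" for A
    unfolding set_integrable_def using integrable_mult_indicator[OF _ f, of A] that by simp
  have zz: "set_lebesgue_integral lborel {a<..<b} f = 0" for a b
    using z[of a b] by (cases "a < b") (auto simp: set_lebesgue_integral_def)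
  have tot: "(LINT x|lborel. f x) = 0"
  proof -
    have "(LINT x|lborel. f x) = (LINT x|lborel. indicator {a0<..<b0} x *\<^sub>R f x)"
      by (rule Bochner_Integration.integral_cong) (use supp in \<open>auto simp: indicator_def\<close>)
    then show ?thesis using zz[of a0 b0] by (simp add: set_lebesgue_integral_def)
  qed
  fix A :: "real set" assume "A \<in> sets lborel"
  then have A: "A \<in> sigma_sets UNIV (range (\<lambda>(a, b). {a<..<b}))"
    by (simp add: borel_Ioo)
  have stable: "Int_stable (range (\<lambda>(a::real, b). {a<..<b}))"
    unfolding Int_stable_def
  proof (intro ballI)
    fix S T :: "real set" assume "S \<in> range (\<lambda>(a, b). {a<..<b})" "T \<in> range (\<lambda>(a, b). {a<..<b})"
    then obtain a b c d where "S = {a<..<b}" "T = {c<..<d}" by auto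
    then have "S \<inter> T = {max a c<..<min b d}" by auto
    then show "S \<inter> T \<in> range (\<lambda>(a, b). {a<..<b})" by auto
  qed
  have sub: "range (\<lambda>(a, b). {a<..<b}) \<subseteq> Pow (UNIV :: real set)" by simp
  show "set_lebesgue_integral lborel A f = 0"
    using stable sub A
  proof (induction rule: sigma_sets_induct_disjoint)
    case (basic A) then show ?case using zz by auto
  next
    case empty then show ?case by (simp add: set_lebesgue_integral_def)
  next
    case (compl A)
    then have A: "A \<in> sets borel" by (simp add: borel_Ioo)
    have "set_lebesgue_integral lborel (UNIV - A) f = (LINT x|lborel. f x - indicator A x *\<^sub>R f x)"
      unfolding set_lebesgue_integral_def by (rule Bochner_Integration.integral_cong) (auto simp: indicator_def)
    also have "\<dots> = 0" using compl.IH si[OF A] f tot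
      by (subst Bochner_Integration.integral_diff) (auto simp: set_integrable_def set_lebesgue_integral_def)
    finally show ?case .
  next
    case (union A)
    then have A: "A i \<in> sets borel" for i by (auto simp: borel_Ioo)
    have "set_lebesgue_integral lborel (\<Union>i. A i) f = (\<Sum>i. set_lebesgue_integral lborel (A i) f)"
      by (rule lebesgue_integral_countable_add) (use A union.hyps si in \<open>auto simp: disjoint_family_on_def\<close>)
    then show ?case using union.IH by simp
  qed
qed

lemma lebesgue_on_indicator_integral:
  fixes f :: "real \<Rightarrow> real"
  assumes "S \<in> sets lebesgue"
  shows "(LINT x|lebesgue_on S. f x) = (LINT x|lebesgue. indicator S x * f x)"
  using assms by (subst integral_restrict_space) auto

text \<open>The bumps converge to the indicator of an interval as \<open>N\<close> grows.\<close>
lemma periodic_test_zero: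
  fixes f :: "real \<Rightarrow> real"
  assumes L: "0 < L" and f: "integrable (lebesgue_on {0..L}) f"
    and test: "\<And>\<phi>. (\<forall>n. (deriv ^^ n) \<phi> differentiable_on UNIV) \<Longrightarrow> (\<forall>s. \<phi> (s + L) = \<phi> s)
      \<Longrightarrow> (LINT s|lebesgue_on {0..L}. f s * \<phi> s) = 0"
  shows "AE s in lebesgue_on {0..L}. f s = 0"
proof -
  have fm: "f \<in> borel_measurable (lebesgue_on {0..L})" using f by simp
  define f0 where "f0 s = indicator {0<..<L} s * f s" for s
  have ilf: "integrable lebesgue (\<lambda>s. indicator {0..L} s * f s)"
    using f by (subst (asm) integrable_restrict_space) auto
  have "integrable lebesgue (\<lambda>s. indicator {0<..<L} s *\<^sub>R (indicator {0..L} s * f s))"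
    by (rule integrable_mult_indicator[OF _ ilf]) simp
  also have "(\<lambda>s. indicator {0<..<L} s *\<^sub>R (indicator {0..L} s * f s)) = f0"
    by (auto simp: f0_def indicator_def fun_eq_iff)
  finally have f0i: "integrable lebesgue f0" .
  then obtain g where g: "g \<in> borel_measurable lborel" "AE x in lborel. f0 x = g x"
    using completion_ex_borel_measurable_real[of f0 lborel] by auto
  define g0 where "g0 s = indicator {0<..<L} s * g s" for s
  have gb: "g0 \<in> borel_measurable lborel" using g(1) unfolding g0_def by measurable
  have eq0: "AE x in lborel. f0 x = g0 x" using g(2)
  proof eventually_elim
    case (elim x)
    then show ?case by (cases "x \<in> {0<..<L}") (auto simp: f0_def g0_def)
  qed
  have eq: "AE x in lebesgue. f0 x = g0 x" using AE_completion[OF eq0] .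
  have g0m: "g0 \<in> borel_measurable lebesgue" using gb by (simp add: measurable_completion)
  have f0m: "f0 \<in> borel_measurable lebesgue" using f0i by simp
  have "integrable lebesgue g0" using f0i integrable_cong_AE[OF f0m g0m eq] by simp
  then have gi: "integrable lborel g0" using integrable_completion[OF gb] by simp
  have "AE x in lborel. g0 x = 0"
  proof (rule interval_integrals_zero[OF gi])
    show "g0 x = 0" if "x \<notin> {0<..<L}" for x using that by (simp add: g0_def)
    fix a0 b0 :: real assume "a0 < b0"
    define a b where "a = max 0 a0" and "b = min L b0"
    have ind: "indicator {a0<..<b0} x * g0 x = indicator {a<..<b} x * g0 x" for x
      by (auto simp: g0_def a_def b_def indicator_def)
    show "(LINT x|lborel. indicator {a0<..<b0} x * g0 x) = 0"
    proof (cases "a < b")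
      case False
      then show ?thesis unfolding ind by simp
    next
      case True
      define m r where "m = (a + b) / 2" and "r = (b - a) / 2"
      have ab: "0 \<le> a" "b \<le> L" by (auto simp: a_def b_def)
      have r: "0 < r" "r \<le> L / 2" "r \<le> m" "m + r \<le> L" "{a<..<b} = {m - r<..<m + r}"
        using True ab by (auto simp: m_def r_def field_simps)
      have lim: "(\<lambda>N. periodic_bump L m r (real N) s) \<longlonglongrightarrow> indicator {a<..<b} s" if "s \<in> {0<..<L}" for s
      proof -
        let ?w = "2 * pi / L"
        have w: "0 < ?w" using L by simp
        have "?w * r \<le> ?w * (L / 2)" using r w by (intro mult_left_mono) auto
        then have y: "0 \<le> ?w * r" "?w * r \<le> pi" using r(1) w L by auto
        \<comment> \<open>The interval lies in [0, L], so no point is farther from its midpoint than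
          the nearest end of a periodic copy; this is the range in which cosines decide
          membership.\<close>
        have "\<bar>s - m\<bar> \<le> L - r" using that r by (auto simp: abs_le_iff)
        then have "?w * \<bar>s - m\<bar> \<le> ?w * (L - r)" using w by (intro mult_left_mono) auto
        also have "\<dots> = 2 * pi - ?w * r" using L by (simp add: field_simps)
        finally have x: "?w * \<bar>s - m\<bar> \<le> 2 * pi - ?w * r" .
        have "cos (?w * r) < cos (?w * \<bar>s - m\<bar>) \<longleftrightarrow> ?w * \<bar>s - m\<bar> < ?w * r"
          by (rule cos_arc_iff[OF y _ x]) (use L in simp)
        also have "\<dots> \<longleftrightarrow> \<bar>s - m\<bar> < r" using w by (simp only: mult_less_cancel_left_pos)
        also have "\<dots> \<longleftrightarrow> s \<in> {a<..<b}" unfolding r(5) by auto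
        also have "cos (?w * \<bar>s - m\<bar>) = cos (?w * (s - m))"
        proof -
          have "?w * \<bar>s - m\<bar> = \<bar>?w * (s - m)\<bar>" using w by (simp only: abs_mult abs_of_pos)
          then show ?thesis by (simp only: cos_abs_real)
        qed
        finally have i: "0 < cos (?w * (s - m)) - cos (?w * r) \<longleftrightarrow> s \<in> {a<..<b}" by simp
        show ?thesis unfolding periodic_bump_def
          using flat_scaled_limit[of "cos (?w * (s - m)) - cos (?w * r)"] i by (auto simp: indicator_def)
      qed
      have bm: "(\<lambda>x. periodic_bump L m r (real N) x) \<in> borel_measurable borel" for N
      proof -
        have "continuous_on UNIV (periodic_bump L m r (real N))"
          using differentiable_imp_continuous_on[OF periodic_bump_smooth[of 0]] by simp
        then show ?thesis by (rule borel_measurable_continuous_onI)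
      qed
      have zeroN: "(LINT x|lborel. periodic_bump L m r (real N) x * g0 x) = 0" for N
      proof -
        have "(LINT s|lebesgue_on {0..L}. f s * periodic_bump L m r (real N) s) = 0"
          by (rule test) (use periodic_bump_smooth periodic_bump_periodic L in auto)
        then have "(LINT s|lebesgue. indicator {0..L} s * (f s * periodic_bump L m r (real N) s)) = 0"
          by (simp add: lebesgue_on_indicator_integral)
        moreover have "(LINT s|lebesgue. indicator {0..L} s * (f s * periodic_bump L m r (real N) s))
          = (LINT x|lebesgue. periodic_bump L m r (real N) x * g0 x)"
        proof (rule integral_cong_AE)
          have bmc: "periodic_bump L m r (real N) \<in> borel_measurable lebesgue" using bm[of N] by (simp add: measurable_completion)
          have "(\<lambda>s. indicator {0..L} s * f s) \<in> borel_measurable lebesgue" using ilf by simp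
          from borel_measurable_times[OF this bmc]
          show "(\<lambda>s. indicator {0..L} s * (f s * periodic_bump L m r (real N) s)) \<in> borel_measurable lebesgue"
            by (simp add: mult.assoc)
          show "(\<lambda>x. periodic_bump L m r (real N) x * g0 x) \<in> borel_measurable lebesgue"
            using borel_measurable_times[OF bmc g0m] .
          have "AE x in lebesgue. x \<noteq> 0 \<and> x \<noteq> L"
          proof -
            have "AE x in lborel. x \<noteq> 0" "AE x in lborel. x \<noteq> L" by (rule AE_lborel_singleton)+
            then have "AE x in lborel. x \<noteq> 0 \<and> x \<noteq> L" by eventually_elim simp
            then show ?thesis by (rule AE_completion)
          qed
          then show "AE x in lebesgue. indicator {0..L} x * (f x * periodic_bump L m r (real N) x) = periodic_bump L m r (real N) x * g0 x"
            using eq by eventually_elim (auto simp: f0_def indicator_def split: if_splits)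
        qed
        moreover have "(LINT x|lebesgue. periodic_bump L m r (real N) x * g0 x) = (LINT x|lborel. periodic_bump L m r (real N) x * g0 x)"
          by (rule integral_completion) (use bm[of N] gb in auto)
        ultimately show ?thesis by simp
      qed
      have "(\<lambda>N. LINT x|lborel. periodic_bump L m r (real N) x * g0 x) \<longlonglongrightarrow> (LINT x|lborel. indicator {a<..<b} x * g0 x)"
      proof (rule integral_dominated_convergence[where w="\<lambda>x. \<bar>g0 x\<bar>"])
        show "(\<lambda>x. indicator {a<..<b} x * g0 x) \<in> borel_measurable lborel" using gb by measurable
        show "(\<lambda>x. periodic_bump L m r (real N) x * g0 x) \<in> borel_measurable lborel" for N
          using bm[of N] gb by auto
        show "integrable lborel (\<lambda>x. \<bar>g0 x\<bar>)" using gi by simp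
        show "AE x in lborel. (\<lambda>N. periodic_bump L m r (real N) x * g0 x) \<longlonglongrightarrow> indicator {a<..<b} x * g0 x"
        proof (rule AE_I2)
          fix x show "(\<lambda>N. periodic_bump L m r (real N) x * g0 x) \<longlonglongrightarrow> indicator {a<..<b} x * g0 x"
          proof (cases "x \<in> {0<..<L}")
            case True then show ?thesis by (intro tendsto_mult lim tendsto_const)
          next
            case False then show ?thesis by (simp add: g0_def)
          qed
        qed
        show "AE x in lborel. norm (periodic_bump L m r (real N) x * g0 x) \<le> \<bar>g0 x\<bar>" for N
        proof (rule AE_I2)
          fix x
          have "\<bar>periodic_bump L m r (real N) x\<bar> \<le> 1" by (simp add: periodic_bump_def flat_def)
          from mult_right_mono[OF this abs_ge_zero[of "g0 x"]]
          show "norm (periodic_bump L m r (real N) x * g0 x) \<le> \<bar>g0 x\<bar>" by (simp add: abs_mult)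
        qed
      qed
      then have "(LINT x|lborel. indicator {a<..<b} x * g0 x) = 0" unfolding zeroN by (simp add: LIMSEQ_const_iff)
      then show ?thesis unfolding ind .
    qed
  qed
  then have "AE x in lebesgue. g0 x = 0" by (rule AE_completion)
  moreover have "AE x in lebesgue. x \<noteq> 0 \<and> x \<noteq> L"
  proof -
    have "AE x in lborel. x \<noteq> 0" "AE x in lborel. x \<noteq> L" by (rule AE_lborel_singleton)+
    then have "AE x in lborel. x \<noteq> 0 \<and> x \<noteq> L" by eventually_elim simp
    then show ?thesis by (rule AE_completion)
  qed
  ultimately have "AE x in lebesgue. x \<in> {0..L} \<longrightarrow> f x = 0"
    using eq by eventually_elim (auto simp: f0_def indicator_def split: if_splits)
  then show ?thesis by (subst AE_restrict_space_iff) auto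
qed

section \<open>Consistency and coercivity on a closed polygon\<close>

definition int01 :: "(real \<Rightarrow> real) \<Rightarrow> real"
  where "int01 f = (LINT t|lebesgue_on {0..1}. f t)"

abbreviation "cont01 \<equiv> continuous_on {0..1::real}"

lemma int01_integrable: "cont01 f \<Longrightarrow> integrable (lebesgue_on {0..1}) f" for f :: "real \<Rightarrow> real"
  by (rule continuous_imp_integrable_real)

lemma int01_add: "cont01 f \<Longrightarrow> cont01 g \<Longrightarrow> int01 (\<lambda>t. f t + g t) = int01 f + int01 g"
  unfolding int01_def by (intro Bochner_Integration.integral_add int01_integrable)

lemma int01_diff: "cont01 f \<Longrightarrow> cont01 g \<Longrightarrow> int01 (\<lambda>t. f t - g t) = int01 f - int01 g"
  unfolding int01_def by (intro Bochner_Integration.integral_diff int01_integrable)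

lemma int01_cmult: "int01 (\<lambda>t. a * f t) = a * int01 f"
  unfolding int01_def by simp

lemma int01_const: "int01 (\<lambda>t. a) = a"
  unfolding int01_def by (simp add: measure_restrict_space)

lemma int01_cong: "(\<And>t. 0 \<le> t \<Longrightarrow> t \<le> 1 \<Longrightarrow> f t = g t) \<Longrightarrow> int01 f = int01 g"
  unfolding int01_def by (rule Bochner_Integration.integral_cong) auto

lemma int01_mono:
  assumes "cont01 f" "cont01 g" "\<And>t. 0 \<le> t \<Longrightarrow> t \<le> 1 \<Longrightarrow> f t \<le> g t"
  shows "int01 f \<le> int01 g"
  unfolding int01_def by (rule integral_mono) (use assms int01_integrable in auto)

lemma int01_nonneg: "(\<And>t. 0 \<le> t \<Longrightarrow> t \<le> 1 \<Longrightarrow> 0 \<le> f t) \<Longrightarrow> 0 \<le> int01 f"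
  unfolding int01_def by (rule integral_nonneg_AE) auto

lemma int01_abs: "\<bar>int01 f\<bar> \<le> int01 (\<lambda>t. \<bar>f t\<bar>)"
  unfolding int01_def by (rule integral_abs_bound)

lemma int01_HK: "cont01 f \<Longrightarrow> int01 f = integral {0..1} f"
  unfolding int01_def by (intro lebesgue_integral_eq_integral int01_integrable) auto

lemma int01_FTC:
  assumes "cont01 f" "cont01 f'" "\<And>t. 0 < t \<Longrightarrow> t < 1 \<Longrightarrow> (f has_real_derivative f' t) (at t)"
  shows "int01 f' = f 1 - f 0"
proof -
  have "(f' has_integral (f 1 - f 0)) {0..1}"
    by (rule fundamental_theorem_of_calculus_interior)
      (use assms in \<open>auto simp: has_real_derivative_iff_has_vector_derivative\<close>)
  then show ?thesis using int01_HK[OF assms(2)] by (simp add: integral_unique)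
qed

lemma int01_variation:
  assumes f: "cont01 f" "cont01 f'" "\<And>t. 0 < t \<Longrightarrow> t < 1 \<Longrightarrow> (f has_real_derivative f' t) (at t)"
    and t: "0 \<le> t" "t \<le> 1"
  shows "\<bar>f t - f 0\<bar> \<le> int01 (\<lambda>t. \<bar>f' t\<bar>)"
proof -
  have sub: "{0..t} \<subseteq> {0..1}" using t by auto
  have "(f' has_integral (f t - f 0)) {0..t}"
    by (rule fundamental_theorem_of_calculus_interior)
      (use f t continuous_on_subset[OF f(1) sub] in \<open>auto simp: has_real_derivative_iff_has_vector_derivative\<close>)
  then have "f t - f 0 = integral {0..t} f'" by (simp add: integral_unique)
  also have "norm \<dots> \<le> integral {0..t} (\<lambda>t. \<bar>f' t\<bar>)"
    by (rule integral_norm_bound_integral) (use continuous_on_subset[OF f(2) sub] in \<open>auto intro!: integrable_continuous_real continuous_intros\<close>)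
  also have "\<dots> \<le> integral {0..1} (\<lambda>t. \<bar>f' t\<bar>)"
    by (rule integral_subset_le) (use continuous_on_subset[OF f(2) sub] f(2) sub in \<open>auto intro!: integrable_continuous_real continuous_intros\<close>)
  also have "\<dots> = int01 (\<lambda>t. \<bar>f' t\<bar>)" using f(2) by (intro int01_HK[symmetric] continuous_intros)
  finally show ?thesis by simp
qed

locale polygon =
  fixes n :: nat and len :: "nat \<Rightarrow> real" and \<Lambda> :: real
  assumes n_pos: "0 < n" and len_pos: "\<And>i. i < n \<Longrightarrow> 0 < len i" and total: "(\<Sum>i<n. len i) \<le> \<Lambda>"
begin

definition C1_on_edges :: "(nat \<Rightarrow> real \<Rightarrow> real) \<Rightarrow> (nat \<Rightarrow> real \<Rightarrow> real) \<Rightarrow> bool"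
  where "C1_on_edges v v' \<longleftrightarrow> (\<forall>i<n. cont01 (v i) \<and> cont01 (v' i) \<and>
    (\<forall>t. 0 < t \<longrightarrow> t < 1 \<longrightarrow> (v i has_real_derivative v' i t) (at t)))"

definition closed_chain :: "(nat \<Rightarrow> real \<Rightarrow> real) \<Rightarrow> bool"
  where "closed_chain v \<longleftrightarrow> (\<forall>i. Suc i < n \<longrightarrow> v i 1 = v (Suc i) 0) \<and> v (n - 1) 1 = v 0 0"

definition total_var :: "(nat \<Rightarrow> real \<Rightarrow> real) \<Rightarrow> real"
  where "total_var v' = (\<Sum>i<n. int01 (\<lambda>t. \<bar>v' i t\<bar>))"

text \<open>Edges are parametrised over the unit interval, so the arclength derivative is v' divided
  by the edge length, and the squared gradient integrates to the integral of v'^2 divided by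
  \<open>len i\<close>.\<close>

definition energy :: "(nat \<Rightarrow> real \<Rightarrow> real) \<Rightarrow> real"
  where "energy v' = (\<Sum>i<n. int01 (\<lambda>t. (v' i t)\<^sup>2) / len i)"

lemma total_pos: "0 < (\<Sum>i<n. len i)"
  using n_pos len_pos by (intro sum_pos) auto

lemma sum_len_const: "(\<Sum>i<n. len i * a) = a * (\<Sum>i<n. len i)"
proof -
  have "(\<Sum>i<n. len i * a) = (\<Sum>i<n. len i) * a" by (rule sum_distrib_right[symmetric])
  then show ?thesis by simp
qed

lemma total_var_nonneg: "0 \<le> total_var v'"
  unfolding total_var_def by (intro sum_nonneg int01_nonneg) auto

text \<open>The oscillation along the connected chain is at most the total variation, and the zero
  mean bounds the initial value by the same quantity. The constant does not involve the edge
  lengths.\<close>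

lemma poincare:
  assumes v: "C1_on_edges v v'" and ch: "\<And>i. Suc i < n \<Longrightarrow> v i 1 = v (Suc i) 0"
    and mean: "(\<Sum>i<n. len i * int01 (v i)) = 0"
    and i: "i < n" and t: "0 \<le> t" "t \<le> 1"
  shows "\<bar>v i t\<bar> \<le> 2 * total_var v'"
proof -
  define a where "a i = int01 (\<lambda>t. \<bar>v' i t\<bar>)" for i
  have a0: "0 \<le> a i" for i unfolding a_def by (rule int01_nonneg) simp
  have var: "\<bar>v i t - v i 0\<bar> \<le> a i" if "i < n" "0 \<le> t" "t \<le> 1" for i t
    unfolding a_def by (rule int01_variation) (use v that in \<open>auto simp: C1_on_edges_def\<close>)
  have start: "\<bar>v i 0 - v 0 0\<bar> \<le> (\<Sum>j<i. a j)" if "i < n" for i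
    using that
  proof (induction i)
    case (Suc i)
    have "\<bar>v i 1 - v i 0\<bar> \<le> a i" using var[of i 1] Suc.prems by simp
    moreover have "\<bar>v i 0 - v 0 0\<bar> \<le> (\<Sum>j<i. a j)" using Suc by simp
    ultimately show ?case using ch[OF Suc.prems] by simp
  qed simp
  have dev: "\<bar>v i t - v 0 0\<bar> \<le> total_var v'" if "i < n" "0 \<le> t" "t \<le> 1" for i t
  proof -
    have "\<bar>v i t - v 0 0\<bar> \<le> (\<Sum>j<Suc i. a j)" using var[OF that] start[OF that(1)] by simp
    also have "\<dots> \<le> (\<Sum>j<n. a j)" using that(1) a0 by (intro sum_mono2) auto
    finally show ?thesis by (simp add: total_var_def a_def)
  qed
  have cv: "cont01 (v i)" if "i < n" for i using v that by (simp add: C1_on_edges_def)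
  let ?S = "\<Sum>i<n. len i"
  have "v 0 0 * ?S = (\<Sum>i<n. len i * int01 (\<lambda>t. v 0 0 - v i t))"
    using mean cv by (simp add: int01_diff int01_const right_diff_distrib sum_subtractf sum_len_const)
  also have "\<bar>\<dots>\<bar> \<le> (\<Sum>i<n. len i * total_var v')"
  proof (rule order_trans[OF sum_abs], rule sum_mono)
    fix i assume "i \<in> {..<n}"
    then have i: "i < n" by simp
    have "\<bar>int01 (\<lambda>t. v 0 0 - v i t)\<bar> \<le> int01 (\<lambda>t. \<bar>v 0 0 - v i t\<bar>)" by (rule int01_abs)
    also have "\<dots> \<le> int01 (\<lambda>t. total_var v')"
      using dev[OF i] cv[OF i] by (intro int01_mono continuous_intros) (auto simp: abs_minus_commute)
    finally show "\<bar>len i * int01 (\<lambda>t. v 0 0 - v i t)\<bar> \<le> len i * total_var v'"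
      using len_pos[OF i] by (simp add: abs_mult int01_const)
  qed
  also have "\<dots> = total_var v' * ?S" by (rule sum_len_const)
  finally have "\<bar>v 0 0\<bar> * ?S \<le> total_var v' * ?S" using total_pos by (simp add: abs_mult)
  then have "\<bar>v 0 0\<bar> \<le> total_var v'" using total_pos by simp
  then show ?thesis using dev[OF i t] by linarith
qed

text \<open>Young's inequality with weight \<open>M\<close> absorbs the energy on the right-hand side.\<close>
lemma energy_absorb:
  assumes v': "\<And>i. i < n \<Longrightarrow> cont01 (v' i)" and M: "0 < M" and en: "energy v' \<le> M * total_var v'"
  shows "energy v' \<le> M\<^sup>2 * \<Lambda>" "total_var v' \<le> M * \<Lambda>"
proof -
  have "int01 (\<lambda>t. \<bar>v' i t\<bar>) \<le> (M * len i + int01 (\<lambda>t. (v' i t)\<^sup>2) / len i / M) / 2" if i: "i < n" for i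
  proof -
    have l: "0 < M * len i" using len_pos[OF i] M by simp
    have "\<bar>x\<bar> \<le> M * len i / 2 + (1 / (2 * (M * len i))) * x\<^sup>2" for x
    proof -
      have "0 \<le> (M * len i - \<bar>x\<bar>)\<^sup>2" by simp
      then have "2 * (M * len i) * \<bar>x\<bar> \<le> (M * len i)\<^sup>2 + x\<^sup>2" by (simp add: power2_diff)
      then have "\<bar>x\<bar> \<le> ((M * len i)\<^sup>2 + x\<^sup>2) / (2 * (M * len i))" using l by (simp add: pos_le_divide_eq mult.commute)
      also have "\<dots> = M * len i / 2 + (1 / (2 * (M * len i))) * x\<^sup>2" using l by (simp add: add_divide_distrib power2_eq_square)
      finally show ?thesis .
    qed
    then have "int01 (\<lambda>t. \<bar>v' i t\<bar>) \<le> int01 (\<lambda>t. M * len i / 2 + (1 / (2 * (M * len i))) * (v' i t)\<^sup>2)"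
      using v'[OF i] by (intro int01_mono continuous_intros) auto
    also have "\<dots> = M * len i / 2 + (1 / (2 * (M * len i))) * int01 (\<lambda>t. (v' i t)\<^sup>2)"
    proof -
      have "cont01 (\<lambda>t. (1 / (2 * (M * len i))) * (v' i t)\<^sup>2)" using v'[OF i] by (intro continuous_intros)
      then show ?thesis by (subst int01_add) (auto simp: int01_const int01_cmult simp del: times_divide_eq_left)
    qed
    also have "\<dots> = (M * len i + int01 (\<lambda>t. (v' i t)\<^sup>2) / len i / M) / 2" using l by (simp add: field_simps)
    finally show ?thesis .
  qed
  then have "total_var v' \<le> (\<Sum>i<n. (M * len i + int01 (\<lambda>t. (v' i t)\<^sup>2) / len i / M) / 2)"
    unfolding total_var_def by (intro sum_mono) simp
  also have "\<dots> = (M * (\<Sum>i<n. len i) + energy v' / M) / 2"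
  proof -
    have "(\<Sum>i<n. int01 (\<lambda>t. (v' i t)\<^sup>2) / len i / M) = energy v' / M"
      unfolding energy_def by (rule sum_divide_distrib[symmetric])
    then show ?thesis by (simp only: sum_divide_distrib[symmetric] sum.distrib sum_distrib_left[symmetric])
  qed
  also have "\<dots> \<le> (M * \<Lambda> + energy v' / M) / 2" using total M by simp
  finally have tv: "2 * total_var v' \<le> M * \<Lambda> + energy v' / M" by simp
  have eM: "energy v' / M \<le> total_var v'" using en M by (simp add: pos_divide_le_eq mult.commute)
  then show 1: "total_var v' \<le> M * \<Lambda>" using tv by linarith
  have "energy v' \<le> M * (M * \<Lambda>)" using en mult_left_mono[OF 1, of M] M by linarith
  then show "energy v' \<le> M\<^sup>2 * \<Lambda>" by (simp add: power2_eq_square mult.assoc)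
qed

lemma chain_telescope:
  assumes "closed_chain f" shows "(\<Sum>i<n. f i 1 - f i 0) = 0"
proof -
  have "(\<Sum>i<m. f i 1 - f i 0) = f (m - 1) 1 - f 0 0" if "0 < m" "m \<le> n" for m
    using that
  proof (induction m)
    case (Suc m)
    show ?case
    proof (cases "m = 0")
      case False
      then have "f (m - 1) 1 = f m 0" using assms Suc.prems unfolding closed_chain_def by (metis Suc_pred' Suc_le_eq not_gr_zero)
      then show ?thesis using Suc False by simp
    qed simp
  qed simp
  from this[of n] show ?thesis using assms n_pos by (simp add: closed_chain_def)
qed

text \<open>Here w is the comparison function from the reduced space, u the discrete solution and v
  = w - u; p and q are the first and second derivatives of the exact solution along the curve,
  pulled back by the foot. The product p v telescopes around the polygon, so the integrals of q
  \<sigma>' v and p v' cancel. What remains is w' - len p tested with v', and q (len - \<sigma>')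
  tested with v.\<close>

lemma strang_energy:
  assumes v: "C1_on_edges v v'" "closed_chain v" and p: "C1_on_edges p (\<lambda>i t. q i t * \<sigma>' i t)" "closed_chain p"
    and q: "\<And>i. i < n \<Longrightarrow> cont01 (q i)" and s: "\<And>i. i < n \<Longrightarrow> cont01 (\<sigma>' i)"
    and w: "\<And>i. i < n \<Longrightarrow> cont01 (w' i)" and u: "\<And>i. i < n \<Longrightarrow> cont01 (u' i)"
    and vwu: "\<And>i t. i < n \<Longrightarrow> 0 \<le> t \<Longrightarrow> t \<le> 1 \<Longrightarrow> v' i t = w' i t - u' i t"
    and galerkin: "(\<Sum>i<n. int01 (\<lambda>t. u' i t * v' i t) / len i) = - (\<Sum>i<n. len i * int01 (\<lambda>t. q i t * v i t))"
    and A: "\<And>i t. i < n \<Longrightarrow> 0 \<le> t \<Longrightarrow> t \<le> 1 \<Longrightarrow> \<bar>w' i t - len i * p i t\<bar> \<le> A * len i"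
      "\<And>i t. i < n \<Longrightarrow> 0 \<le> t \<Longrightarrow> t \<le> 1 \<Longrightarrow> \<bar>q i t * (len i - \<sigma>' i t)\<bar> \<le> A * len i"
  shows "energy v' \<le> A * (total_var v' + (\<Sum>i<n. len i * int01 (\<lambda>t. \<bar>v i t\<bar>)))"
proof -
  have cv: "cont01 (v i)" "cont01 (v' i)" "cont01 (p i)" if "i < n" for i
    using v(1) p(1) that by (simp_all add: C1_on_edges_def)
  note cs = cv q s w u
  have parts: "int01 (\<lambda>t. p i t * v' i t) + int01 (\<lambda>t. q i t * \<sigma>' i t * v i t) = p i 1 * v i 1 - p i 0 * v i 0" if i: "i < n" for i
  proof -
    have "int01 (\<lambda>t. p i t * v' i t + q i t * \<sigma>' i t * v i t) = p i 1 * v i 1 - p i 0 * v i 0"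
    proof (rule int01_FTC)
      show "cont01 (\<lambda>t. p i t * v i t)" "cont01 (\<lambda>t. p i t * v' i t + q i t * \<sigma>' i t * v i t)"
        by (intro continuous_intros cs i)+
      fix t :: real assume t: "0 < t" "t < 1"
      have "(p i has_real_derivative q i t * \<sigma>' i t) (at t)" "(v i has_real_derivative v' i t) (at t)"
        using v(1) p(1) i t by (simp_all add: C1_on_edges_def)
      from DERIV_mult[OF this]
      show "((\<lambda>t. p i t * v i t) has_real_derivative p i t * v' i t + q i t * \<sigma>' i t * v i t) (at t)"
        by (rule DERIV_cong) simp
    qed
    moreover have "cont01 (\<lambda>t. p i t * v' i t)" "cont01 (\<lambda>t. q i t * \<sigma>' i t * v i t)"
      by (intro continuous_intros cs i)+
    ultimately show ?thesis by (simp add: int01_add)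
  qed
  have zero: "(\<Sum>i<n. int01 (\<lambda>t. p i t * v' i t) + int01 (\<lambda>t. q i t * \<sigma>' i t * v i t)) = 0"
  proof -
    have "closed_chain (\<lambda>i t. p i t * v i t)" using v(2) p(2) by (simp add: closed_chain_def)
    from chain_telescope[OF this] show ?thesis using parts by simp
  qed
  have split: "int01 (\<lambda>t. (v' i t)\<^sup>2) / len i = int01 (\<lambda>t. w' i t * v' i t) / len i - int01 (\<lambda>t. u' i t * v' i t) / len i" if i: "i < n" for i
  proof -
    have "int01 (\<lambda>t. (v' i t)\<^sup>2) = int01 (\<lambda>t. w' i t * v' i t - u' i t * v' i t)"
      by (rule int01_cong) (simp add: vwu[OF i] power2_eq_square algebra_simps)
    also have "\<dots> = int01 (\<lambda>t. w' i t * v' i t) - int01 (\<lambda>t. u' i t * v' i t)"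
      by (rule int01_diff; intro continuous_intros cs i)
    finally show ?thesis by (simp add: diff_divide_distrib)
  qed
  \<comment> \<open>The two consistency residuals: \<open>R1\<close> for the rate of the comparison
    function along the chord, \<open>R2\<close> for integrating the load over the chord instead of
    the curve.\<close>
  define R1 where "R1 i = int01 (\<lambda>t. (w' i t - len i * p i t) * v' i t)" for i
  define R2 where "R2 i = int01 (\<lambda>t. q i t * (len i - \<sigma>' i t) * v i t)" for i
  have R1: "int01 (\<lambda>t. w' i t * v' i t) / len i = R1 i / len i + int01 (\<lambda>t. p i t * v' i t)" if i: "i < n" for i
  proof -
    have "R1 i = int01 (\<lambda>t. w' i t * v' i t - len i * (p i t * v' i t))"
      unfolding R1_def by (rule int01_cong) (simp add: algebra_simps)
    also have "\<dots> = int01 (\<lambda>t. w' i t * v' i t) - len i * int01 (\<lambda>t. p i t * v' i t)"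
      by (subst int01_diff) (intro continuous_intros cs i | simp add: int01_cmult)+
    finally show ?thesis using len_pos[OF i] by (simp add: field_simps)
  qed
  have R2: "len i * int01 (\<lambda>t. q i t * v i t) = R2 i + int01 (\<lambda>t. q i t * \<sigma>' i t * v i t)" if i: "i < n" for i
  proof -
    have "R2 i = int01 (\<lambda>t. len i * (q i t * v i t) - q i t * \<sigma>' i t * v i t)"
      unfolding R2_def by (rule int01_cong) (simp add: algebra_simps)
    also have "\<dots> = len i * int01 (\<lambda>t. q i t * v i t) - int01 (\<lambda>t. q i t * \<sigma>' i t * v i t)"
      by (subst int01_diff) (intro continuous_intros cs i | simp add: int01_cmult)+
    finally show ?thesis by simp
  qed
  have "energy v' = (\<Sum>i<n. int01 (\<lambda>t. w' i t * v' i t) / len i) - (\<Sum>i<n. int01 (\<lambda>t. u' i t * v' i t) / len i)"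
    unfolding energy_def sum_subtractf[symmetric] by (rule sum.cong) (use split in auto)
  also have "\<dots> = (\<Sum>i<n. int01 (\<lambda>t. w' i t * v' i t) / len i) + (\<Sum>i<n. len i * int01 (\<lambda>t. q i t * v i t))"
    unfolding galerkin by simp
  also have "\<dots> = (\<Sum>i<n. R1 i / len i + R2 i) + (\<Sum>i<n. int01 (\<lambda>t. p i t * v' i t) + int01 (\<lambda>t. q i t * \<sigma>' i t * v i t))"
    unfolding sum.distrib[symmetric] by (rule sum.cong) (use R1 R2 in auto)
  also have "\<dots> = (\<Sum>i<n. R1 i / len i + R2 i)" unfolding zero by simp
  also have "\<dots> \<le> (\<Sum>i<n. A * int01 (\<lambda>t. \<bar>v' i t\<bar>) + A * (len i * int01 (\<lambda>t. \<bar>v i t\<bar>)))"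
  proof (rule sum_mono)
    fix i assume "i \<in> {..<n}"
    then have i: "i < n" by simp
    have l: "0 < len i" by (rule len_pos[OF i])
    have "R1 i \<le> int01 (\<lambda>t. \<bar>(w' i t - len i * p i t) * v' i t\<bar>)" unfolding R1_def using int01_abs abs_le_D1 by blast
    also have "\<dots> \<le> int01 (\<lambda>t. A * len i * \<bar>v' i t\<bar>)"
    proof (rule int01_mono)
      show "\<bar>(w' i t - len i * p i t) * v' i t\<bar> \<le> A * len i * \<bar>v' i t\<bar>" if "0 \<le> t" "t \<le> 1" for t
        unfolding abs_mult by (intro mult_right_mono A(1)[OF i that]) simp
    qed (intro continuous_intros cs i)+
    finally have "R1 i / len i \<le> A * int01 (\<lambda>t. \<bar>v' i t\<bar>)"
      using l by (simp add: int01_cmult pos_divide_le_eq mult_ac)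
    moreover have "R2 i \<le> int01 (\<lambda>t. \<bar>q i t * (len i - \<sigma>' i t) * v i t\<bar>)" unfolding R2_def using int01_abs abs_le_D1 by blast
    moreover have "int01 (\<lambda>t. \<bar>q i t * (len i - \<sigma>' i t) * v i t\<bar>) \<le> int01 (\<lambda>t. A * len i * \<bar>v i t\<bar>)"
    proof (rule int01_mono)
      show "\<bar>q i t * (len i - \<sigma>' i t) * v i t\<bar> \<le> A * len i * \<bar>v i t\<bar>" if "0 \<le> t" "t \<le> 1" for t
        unfolding abs_mult[of _ "v i t"] by (intro mult_right_mono A(2)[OF i that]) simp
    qed (intro continuous_intros cs i)+
    ultimately show "R1 i / len i + R2 i \<le> A * int01 (\<lambda>t. \<bar>v' i t\<bar>) + A * (len i * int01 (\<lambda>t. \<bar>v i t\<bar>))"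
      by (simp add: int01_cmult mult.assoc)
  qed
  also have "\<dots> = A * (total_var v' + (\<Sum>i<n. len i * int01 (\<lambda>t. \<bar>v i t\<bar>)))"
    unfolding total_var_def by (simp add: sum.distrib sum_distrib_left distrib_left)
  finally show ?thesis .
qed

text \<open>The Poincare estimate bounds the term with values by the total variation at the cost of
  the factor 1 + 2\<Lambda>, after which the energy is absorbed with M = A (1 + 2\<Lambda>).\<close>

lemma strang_bound:
  assumes v: "C1_on_edges v v'" "closed_chain v" and mean: "(\<Sum>i<n. len i * int01 (v i)) = 0"
    and A: "0 < A" and en: "energy v' \<le> A * (total_var v' + (\<Sum>i<n. len i * int01 (\<lambda>t. \<bar>v i t\<bar>)))"
  shows "energy v' \<le> (A * (1 + 2 * \<Lambda>))\<^sup>2 * \<Lambda>"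
    "\<And>i t. i < n \<Longrightarrow> 0 \<le> t \<Longrightarrow> t \<le> 1 \<Longrightarrow> \<bar>v i t\<bar> \<le> 2 * (A * (1 + 2 * \<Lambda>)) * \<Lambda>"
proof -
  have \<Lambda>: "0 < \<Lambda>" using total_pos total by linarith
  have ch: "v i 1 = v (Suc i) 0" if "Suc i < n" for i using v(2) that by (simp add: closed_chain_def)
  note po = poincare[OF v(1) ch mean]
  have cv: "cont01 (v i)" "cont01 (v' i)" if "i < n" for i using v(1) that by (simp_all add: C1_on_edges_def)
  have "(\<Sum>i<n. len i * int01 (\<lambda>t. \<bar>v i t\<bar>)) \<le> (\<Sum>i<n. len i * (2 * total_var v'))"
  proof (rule sum_mono)
    fix i assume "i \<in> {..<n}"
    then have i: "i < n" by simp
    have "int01 (\<lambda>t. \<bar>v i t\<bar>) \<le> int01 (\<lambda>t. 2 * total_var v')"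
      using po[OF _ i] cv[OF i] by (intro int01_mono continuous_intros) auto
    then show "len i * int01 (\<lambda>t. \<bar>v i t\<bar>) \<le> len i * (2 * total_var v')"
      using len_pos[OF i] by (simp add: int01_const)
  qed
  also have "\<dots> = 2 * total_var v' * (\<Sum>i<n. len i)" by (rule sum_len_const)
  also have "\<dots> \<le> 2 * total_var v' * \<Lambda>" using total total_var_nonneg by (intro mult_left_mono) auto
  finally have "A * (total_var v' + (\<Sum>i<n. len i * int01 (\<lambda>t. \<bar>v i t\<bar>))) \<le> A * (total_var v' + 2 * total_var v' * \<Lambda>)"
    using A by (intro mult_left_mono) auto
  then have en': "energy v' \<le> A * (1 + 2 * \<Lambda>) * total_var v'" using en by (simp add: algebra_simps)
  have M: "0 < A * (1 + 2 * \<Lambda>)" using A \<Lambda> by simp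
  note ab = energy_absorb[OF cv(2) M en']
  show "energy v' \<le> (A * (1 + 2 * \<Lambda>))\<^sup>2 * \<Lambda>" by (rule ab(1))
  show "\<bar>v i t\<bar> \<le> 2 * (A * (1 + 2 * \<Lambda>)) * \<Lambda>" if "i < n" "0 \<le> t" "t \<le> 1" for i t
    using po[OF _ that] ab(2) by simp
qed

end

text \<open>\<open>cut_ends\<close> may list the end points against the orientation of the curve;
  this makes integrals over a segment independent of that order.\<close>

lemma int01_flip: "int01 (\<lambda>t. f (1 - t)) = int01 f" for f :: "real \<Rightarrow> real"
proof -
  have "int01 f = (LINT t|lebesgue. indicator {0..1} t *\<^sub>R f t)"
    unfolding int01_def by (subst integral_restrict_space) auto
  also have "\<dots> = \<bar>- 1\<bar> *\<^sub>R (LINT t|lebesgue. indicator {0..1} (1 + (- 1) * t) *\<^sub>R f (1 + (- 1) * t))"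
    by (rule lebesgue_integral_real_affine) simp
  also have "\<dots> = (LINT t|lebesgue. indicator {0..1} t *\<^sub>R f (1 - t))"
    by (simp, rule Bochner_Integration.integral_cong) (auto simp: indicator_def)
  also have "\<dots> = int01 (\<lambda>t. f (1 - t))"
    unfolding int01_def by (subst integral_restrict_space) auto
  finally show ?thesis by simp
qed

section \<open>The discrete curve as a polygon\<close>

context chain_grid begin

definition "PP i = c (s i)"
definition "QQ i = c (s (Suc i))"
definition "seglen i = norm (QQ i - PP i)"
definition "X i t = PP i + t *\<^sub>R (QQ i - PP i)"

lemma chord_locale: "i < n \<Longrightarrow> curve_chord c c' c'' L K d \<eta> (s i) (s (Suc i))"
proof unfold_locales
  assume i: "i < n"
  show "s i < s (Suc i)" by (rule s_step[OF i])
  have "K * (s (Suc i) - s i) \<le> K * (3 * h)" using gap_bounds(2)[OF i] K_pos by (intro mult_left_mono) auto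
  then show "K * (s (Suc i) - s i) \<le> 1 / 8" using h_K by simp
  have "2 * (s (Suc i) - s i) \<le> 2 * (3 * h)" using gap_bounds(2)[OF i] by (rule mult_left_mono) simp
  then show "2 * (s (Suc i) - s i) < d" using h_d h_pos by linarith
qed

text \<open>Collects the chord estimates for one segment, with the arc length replaced by its bound
  3h; hence 42 = 14 times 3 and 9 = 3 times 3.\<close>

lemma segment_foot:
  assumes i: "i < n"
  shows "\<exists>\<sigma> \<sigma>'. \<sigma> 0 = s i \<and> \<sigma> 1 = s (Suc i) \<and> continuous_on {0..1} \<sigma> \<and> continuous_on {0..1} \<sigma>' \<and>
    (\<forall>t. 0 < t \<longrightarrow> t < 1 \<longrightarrow> (\<sigma> has_real_derivative \<sigma>' t) (at t)) \<and>
    (\<forall>t. 0 \<le> t \<longrightarrow> t \<le> 1 \<longrightarrow> proj \<psi> (X i t) = c (\<sigma> t) \<and> norm (X i t - c (\<sigma> t)) \<le> 3 * h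
      \<and> \<bar>\<sigma>' t - seglen i\<bar> \<le> 42 * K * h * seglen i \<and> norm (QQ i - PP i - seglen i *\<^sub>R c' (\<sigma> t)) \<le> 9 * K * h * seglen i) \<and>
    (\<forall>S. negligible S \<longrightarrow> negligible {t \<in> {0..1}. \<sigma> t \<in> S})"
proof -
  interpret curve_chord c c' c'' L K d \<eta> "s i" "s (Suc i)" by (rule chord_locale[OF i])
  have e: "P = PP i" "Q = QQ i" "len = seglen i" by (simp_all add: P_def Q_def len_def PP_def QQ_def seglen_def)
  have x: "chord_pt t = X i t" for t by (simp add: chord_pt_def X_def e)
  have g: "s (Suc i) - s i \<le> 3 * h" "0 \<le> seglen i" using gap_bounds(2)[OF i] by (simp_all add: seglen_def)
  have sc: "a * K * (s (Suc i) - s i) * seglen i \<le> a * K * (3 * h) * seglen i" if "0 \<le> a" for a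
    using g K_pos that by (intro mult_right_mono mult_left_mono) auto
  have "proj \<psi> (X i t) = c (foot t) \<and> norm (X i t - c (foot t)) \<le> 3 * h
      \<and> \<bar>1 / foot_speed (foot t) - seglen i\<bar> \<le> 42 * K * h * seglen i
      \<and> norm (QQ i - PP i - seglen i *\<^sub>R c' (foot t)) \<le> 9 * K * h * seglen i" if t: "0 \<le> t" "t \<le> 1" for t
  proof -
    have ti: "t \<in> {0..1}" using t by simp
    have ft: "s i \<le> foot t" "foot t \<le> s (Suc i)" using foot_in[OF ti] by auto
    have "norm (X i t - c (foot t)) \<le> 3 * h" using closest_point_foot(2)[OF ti] g(1) by (simp add: x)
    moreover have "\<bar>1 / foot_speed (foot t) - seglen i\<bar> \<le> 42 * K * h * seglen i"
      using foot_speed_bounds(3)[OF ft] sc[of 14] unfolding e by (simp add: mult_ac)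
    moreover have "norm (QQ i - PP i - seglen i *\<^sub>R c' (foot t)) \<le> 9 * K * h * seglen i"
      using direction_close[OF ft] sc[of 3] unfolding e by (simp add: mult_ac)
    ultimately show ?thesis using closest_point_foot(1)[OF ti] by (simp add: proj_def zero_set x)
  qed
  then show ?thesis
    by (intro exI[of _ foot] exI[of _ "\<lambda>t. 1 / foot_speed (foot t)"])
      (use foot_ends foot_cont foot_rate_cont foot_deriv foot_null in auto)
qed

lemma seglen_pos: assumes "i < n" shows "0 < seglen i"
  using not_sym[OF cell_cut_i(4)[OF assms]] by (simp add: seglen_def PP_def QQ_def)

lemma seglen_sum: "(\<Sum>i<n. seglen i) \<le> L"
proof -
  have "(\<Sum>i<n. seglen i) \<le> (\<Sum>i<n. s (Suc i) - s i)"
  proof (rule sum_mono)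
    fix i assume "i \<in> {..<n}"
    then show "seglen i \<le> s (Suc i) - s i"
      using c_lip[of "s (Suc i)" "s i"] s_step[of i] by (simp add: seglen_def PP_def QQ_def)
  qed
  also have "\<dots> = L" using s_wrap by (simp add: sum_lessThan_telescope)
  finally show ?thesis .
qed

sublocale poly: polygon n seglen L
  by unfold_locales (use n_pos seglen_pos seglen_sum in auto)

lemma X_conv: "X i t = (1 - t) *\<^sub>R c (s i) + t *\<^sub>R c (s (Suc i))"
  by (simp add: X_def PP_def QQ_def algebra_simps)

lemma X_ocell: "i < n \<Longrightarrow> 0 < t \<Longrightarrow> t < 1 \<Longrightarrow> X i t \<in> ocell (z i)"
  unfolding X_conv by (rule open_segment_ocell)

lemma ends_cell: "i < n \<Longrightarrow> c (s i) \<in> cell (z i)" "i < n \<Longrightarrow> c (s (Suc i)) \<in> cell (z i)"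
  using s_cell[of i "s i"] s_cell[of i "s (Suc i)"] s_step[of i] by auto

lemma X_cell: "i < n \<Longrightarrow> 0 \<le> t \<Longrightarrow> t \<le> 1 \<Longrightarrow> X i t \<in> cell (z i)"
  unfolding X_conv using convexD_alt[OF convex_box(1), of "c (s i)" "z i" "z i + vec h" "c (s (Suc i))" t] ends_cell by blast

lemma cut_segment_i: "i < n \<Longrightarrow> cut_segment \<psi> (cell (z i)) = closed_segment (c (s i)) (c (s (Suc i)))"
  using cut_ends_i[of i] by (auto simp: cut_segment_def closed_segment_commute)

lemma X_in_segment: "i < n \<Longrightarrow> 0 \<le> t \<Longrightarrow> t \<le> 1 \<Longrightarrow> X i t \<in> cut_segment \<psi> (cell (z i))"
  unfolding cut_segment_i X_conv closed_segment_def by blast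

lemma cut_segment_cell: "i < n \<Longrightarrow> cut_segment \<psi> (cell (z i)) \<subseteq> cell (z i)"
  unfolding cut_segment_i by (rule closed_segment_subset) (auto simp: ends_cell)

lemma X_Gamh: "i < n \<Longrightarrow> 0 \<le> t \<Longrightarrow> t \<le> 1 \<Longrightarrow> X i t \<in> Gamh \<psi> h"
  unfolding Gamh_def using X_in_segment cell_cut_i(2) by blast

lemma Gamh_subset: "Gamh \<psi> h \<subseteq> \<Union> (active_cells \<psi> h)"
  unfolding Gamh_def using active_is_cell cut_segment_cell by blast

lemma cell_at_X:
  assumes i: "i < n" and t: "0 < t" "t < 1" shows "cell_at \<psi> h (X i t) = cell (z i)"
  unfolding cell_at_def
proof (rule some_equality)
  show "cell (z i) \<in> active_cells \<psi> h \<and> X i t \<in> cut_segment \<psi> (cell (z i))"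
    using cell_cut_i(2)[OF i] X_in_segment[OF i] t by simp
  fix A assume A: "A \<in> active_cells \<psi> h \<and> X i t \<in> cut_segment \<psi> A"
  then obtain j where j: "j < n" "A = cell (z j)" using active_is_cell by blast
  then have "X i t \<in> cell (z j)" using A cut_segment_cell by blast
  then have "z i = z j" by (rule open_cell_unique[OF h_pos z_lattice[OF i] z_lattice[OF j(1)] X_ocell[OF i t]])
  then show "A = cell (z i)" using j(2) by simp
qed

lemma Gamh_integral_eq: "Gamh_integral \<psi> h f = (\<Sum>i<n. seglen i * int01 (\<lambda>t. f (X i t)))"
proof -
  have "Gamh_integral \<psi> h f = (\<Sum>i<n. dist (fst (cut_ends \<psi> (cell (z i)))) (snd (cut_ends \<psi> (cell (z i)))) *
      int01 (\<lambda>t. f (cut_point \<psi> (cell (z i)) t)))"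
    unfolding Gamh_integral_def int01_def by (rule sum.reindex_bij_betw[OF cells_bij, symmetric])
  also have "\<dots> = (\<Sum>i<n. seglen i * int01 (\<lambda>t. f (X i t)))"
  proof (rule sum.cong[OF refl])
    fix i assume "i \<in> {..<n}"
    then have i: "i < n" by simp
    from cut_ends_i[OF i] show "dist (fst (cut_ends \<psi> (cell (z i)))) (snd (cut_ends \<psi> (cell (z i)))) *
      int01 (\<lambda>t. f (cut_point \<psi> (cell (z i)) t)) = seglen i * int01 (\<lambda>t. f (X i t))"
    proof
      assume "cut_ends \<psi> (cell (z i)) = (c (s i), c (s (Suc i)))"
      then show ?thesis by (simp add: cut_point_def X_conv seglen_def PP_def QQ_def dist_norm norm_minus_commute)
    next
      assume a: "cut_ends \<psi> (cell (z i)) = (c (s (Suc i)), c (s i))"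
      have "cut_point \<psi> (cell (z i)) t = X i (1 - t)" for t
        using a by (simp add: cut_point_def X_conv add.commute)
      then show ?thesis using a int01_flip[of "\<lambda>t. f (X i t)"] by (simp add: seglen_def PP_def QQ_def dist_norm)
    qed
  qed
  finally show ?thesis .
qed

text \<open>The unit tangent is determined only up to sign, but it occurs twice in the tangential
  gradient, so the sign cancels.\<close>

lemma tgrad_segment:
  assumes i: "i < n" and t: "0 < t" "t < 1"
    and v: "((\<lambda>t. v (X i t)) has_real_derivative v') (at t)"
  shows "tgrad_h \<psi> h v (X i t) = (v' / (seglen i)\<^sup>2) *\<^sub>R (QQ i - PP i)"
proof -
  have l: "seglen i \<noteq> 0" using seglen_pos[OF i] by simp
  obtain \<epsilon> :: real where \<epsilon>: "\<bar>\<epsilon>\<bar> = 1" "tangent_h \<psi> h (X i t) = (\<epsilon> / seglen i) *\<^sub>R (QQ i - PP i)"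
    using cut_ends_i[OF i]
  proof
    assume a: "cut_ends \<psi> (cell (z i)) = (c (s i), c (s (Suc i)))"
    have "tangent_h \<psi> h (X i t) = (1 / seglen i) *\<^sub>R (QQ i - PP i)"
      using a by (simp add: tangent_h_def cell_at_X[OF i t] sgn_div_norm seglen_def PP_def QQ_def divide_inverse)
    then show thesis using that[of 1] by simp
  next
    assume a: "cut_ends \<psi> (cell (z i)) = (c (s (Suc i)), c (s i))"
    have "tangent_h \<psi> h (X i t) = (- 1 / seglen i) *\<^sub>R (QQ i - PP i)"
      using a by (simp add: tangent_h_def cell_at_X[OF i t] sgn_div_norm seglen_def PP_def QQ_def divide_inverse norm_minus_commute algebra_simps)
    then show thesis using that[of "- 1"] by simp
  qed
  have "X i t + r *\<^sub>R tangent_h \<psi> h (X i t) = X i (t + r * (\<epsilon> / seglen i))" for r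
    unfolding \<epsilon>(2) by (simp add: X_def algebra_simps)
  then have "(\<lambda>r. v (X i t + r *\<^sub>R tangent_h \<psi> h (X i t))) = (\<lambda>r. v (X i (t + r * (\<epsilon> / seglen i))))" by simp
  moreover have "((\<lambda>r. v (X i (t + r * (\<epsilon> / seglen i)))) has_real_derivative v' * (\<epsilon> / seglen i)) (at 0)"
  proof (rule DERIV_chain2[where f="\<lambda>t. v (X i t)"])
    show "((\<lambda>t. v (X i t)) has_real_derivative v') (at (t + 0 * (\<epsilon> / seglen i)))" using v by simp
    show "((\<lambda>r. t + r * (\<epsilon> / seglen i)) has_real_derivative \<epsilon> / seglen i) (at 0)"
      by (auto intro!: derivative_eq_intros simp: l)
  qed
  ultimately have "deriv (\<lambda>r. v (X i t + r *\<^sub>R tangent_h \<psi> h (X i t))) 0 = v' * (\<epsilon> / seglen i)"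
    by (simp add: DERIV_imp_deriv)
  then have "tgrad_h \<psi> h v (X i t) = (v' * (\<epsilon> / seglen i) * (\<epsilon> / seglen i)) *\<^sub>R (QQ i - PP i)"
    by (simp add: tgrad_h_def \<epsilon>(2))
  moreover have "\<epsilon> * \<epsilon> = 1" using \<epsilon>(1) by (metis abs_mult_self_eq mult_1)
  ultimately show ?thesis by (simp add: power2_eq_square)
qed

lemma lattice_in_cell: "w \<in> lattice_pts h \<Longrightarrow> lattice_pts h \<inter> cell w = cell_vertices h w"
proof
  assume w: "w \<in> lattice_pts h"
  show "cell_vertices h w \<subseteq> lattice_pts h \<inter> cell w" by (rule cell_vertices_mem[OF h_pos w])
  show "lattice_pts h \<inter> cell w \<subseteq> cell_vertices h w"
  proof
    fix \<xi> assume \<xi>: "\<xi> \<in> lattice_pts h \<inter> cell w"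
    have "\<xi> $ i = w $ i \<or> \<xi> $ i = w $ i + h" for i
      by (rule lattice_line_endpoints[OF h_pos]) (use \<xi> w in \<open>auto simp: lattice_pts_iff mem_cell\<close>)
    from this[of 1] this[of 2] show "\<xi> \<in> cell_vertices h w"
      unfolding cell_vertices_def by (auto simp: vec_eq_iff forall_2 axis_def)
  qed
qed

lemma gam_eq: "gam \<psi> h = (\<Union>i<n. cell_vertices h (z i))"
proof -
  have "\<Union> (active_cells \<psi> h) = (\<Union>i<n. cell (z i))"
    using bij_betw_imp_surj_on[OF cells_bij] by auto
  then have "gam \<psi> h = (\<Union>i<n. lattice_pts h \<inter> cell (z i))" unfolding gam_def by auto
  then show ?thesis using lattice_in_cell z_lattice by auto
qed

lemma gam_finite: "finite (gam \<psi> h)"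
  unfolding gam_eq by (auto simp: cell_vertices_def)

lemma gam_vertices: "i < n \<Longrightarrow> cell_vertices h (z i) \<subseteq> gam \<psi> h"
  unfolding gam_eq by auto

lemma nodal_sum_X:
  assumes i: "i < n" and t: "0 \<le> t" "t \<le> 1"
  shows "(\<Sum>\<xi>\<in>gam \<psi> h. E \<xi> * nodal h \<xi> (X i t)) = bil h (z i) E (X i t)"
  by (rule nodal_sum_bil[OF h_pos z_lattice[OF i] X_cell[OF i t] gam_finite _ gam_vertices[OF i]]) (auto simp: gam_def)

text \<open>Trace of the finite element function with nodal values \<open>E\<close> on segment
  \<open>i\<close>, over the unit interval. The bilinear formula of one cell is used for all real
  \<open>t\<close>, so differentiability holds at the ends as well.\<close>

definition fe :: "(pt \<Rightarrow> real) \<Rightarrow> nat \<Rightarrow> real \<Rightarrow> real"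
  where "fe E i t = bil h (z i) E (X i t)"

definition fe' :: "(pt \<Rightarrow> real) \<Rightarrow> nat \<Rightarrow> real \<Rightarrow> real"
  where "fe' E i t = (QQ i - PP i) $ 1 * bil1 h (z i) E (X i t) + (QQ i - PP i) $ 2 * bil2 h (z i) E (X i t)"

lemma fe_deriv: "(fe E i has_real_derivative fe' E i t) (at t)"
  unfolding fe_def[abs_def] fe'_def X_def by (rule bil_deriv[OF h_pos])

lemma fe'_cont: "continuous_on S (fe' E i)"
  unfolding fe'_def[abs_def] X_def by (rule bil_rate_cont[OF h_pos])

lemma fe_cont: "continuous_on S (fe E i)"
  by (meson DERIV_continuous_on fe_deriv has_field_derivative_at_within)

lemma fe_C1: "poly.C1_on_edges (fe E) (fe' E)"
  unfolding poly.C1_on_edges_def using fe_deriv fe'_cont fe_cont by blast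

lemma X_ends: "X i 0 = c (s i)" "X i 1 = c (s (Suc i))"
  by (simp_all add: X_conv)

text \<open>Consecutive segments share an end point, where the bilinear formulas of both cells equal
  the same global nodal sum; at the last segment the period of the curve closes the chain.\<close>

lemma fe_closed: "poly.closed_chain (fe E)"
  unfolding poly.closed_chain_def
proof (intro conjI allI impI)
  have v: "fe E i t = (\<Sum>\<xi>\<in>gam \<psi> h. E \<xi> * nodal h \<xi> (X i t))" if "i < n" "0 \<le> t" "t \<le> 1" for i t
    unfolding fe_def using nodal_sum_X[OF that] by simp
  fix i assume "Suc i < n"
  then show "fe E i 1 = fe E (Suc i) 0" by (simp add: v X_ends)
next
  have v: "fe E i t = (\<Sum>\<xi>\<in>gam \<psi> h. E \<xi> * nodal h \<xi> (X i t))" if "i < n" "0 \<le> t" "t \<le> 1" for i t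
    unfolding fe_def using nodal_sum_X[OF that] by simp
  show "fe E (n - 1) 1 = fe E 0 0" using n_pos s_wrap period by (simp add: v X_ends)
qed

lemma W_red_iff:
  "v \<in> W_red \<psi> h l N w \<longleftrightarrow> (\<exists>v2. v = restrict (\<lambda>x. \<Sum>\<xi>\<in>gam \<psi> h. E_vec \<psi> h l N w v2 \<xi> * nodal h \<xi> x) (Gamh \<psi> h))"
proof -
  define F where "F v2 x = (\<Sum>\<xi>\<in>gam \<psi> h. E_vec \<psi> h l N w v2 \<xi> * nodal h \<xi> x)" for v2 x
  have R: "restrict (restrict (F v2) (\<Union> (active_cells \<psi> h))) (Gamh \<psi> h) = restrict (F v2) (Gamh \<psi> h)" for v2
    using Gamh_subset by (auto simp: fun_eq_iff restrict_def)
  have "W_red \<psi> h l N w = (\<lambda>v. restrict v (Gamh \<psi> h)) ` range (\<lambda>v2. restrict (F v2) (\<Union> (active_cells \<psi> h)))"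
    unfolding W_red_def V_red_def F_def by (simp only: full_SetCompr_eq simp_thms)
  also have "\<dots> = range (\<lambda>v2. restrict (F v2) (Gamh \<psi> h))"
    unfolding image_image R ..
  finally have W: "W_red \<psi> h l N w = range (\<lambda>v2. restrict (F v2) (Gamh \<psi> h))" .
  have "F = (\<lambda>v2 x. \<Sum>\<xi>\<in>gam \<psi> h. E_vec \<psi> h l N w v2 \<xi> * nodal h \<xi> x)" by (intro ext) (simp add: F_def)
  then show ?thesis unfolding W by auto
qed

lemma restrict_fe:
  assumes i: "i < n" and t: "0 \<le> t" "t \<le> 1"
  shows "restrict (\<lambda>x. \<Sum>\<xi>\<in>gam \<psi> h. E \<xi> * nodal h \<xi> x) (Gamh \<psi> h) (X i t) = fe E i t"
  using X_Gamh[OF assms] nodal_sum_X[OF assms] by (simp add: fe_def)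

lemma restrict_fe_deriv:
  assumes i: "i < n" and t: "0 < t" "t < 1"
  shows "((\<lambda>t. restrict (\<lambda>x. \<Sum>\<xi>\<in>gam \<psi> h. E \<xi> * nodal h \<xi> x) (Gamh \<psi> h) (X i t)) has_real_derivative fe' E i t) (at t)"
proof -
  have "\<forall>\<^sub>F u in nhds t. u \<in> {0<..<1}" using t by (intro eventually_nhds_in_open) auto
  then have "\<forall>\<^sub>F u in nhds t. restrict (\<lambda>x. \<Sum>\<xi>\<in>gam \<psi> h. E \<xi> * nodal h \<xi> x) (Gamh \<psi> h) (X i u) = fe E i u"
    by eventually_elim (intro restrict_fe[OF i]; simp)
  then show ?thesis using fe_deriv[of E i t] by (subst DERIV_cong_ev[OF refl _ refl]) auto
qed

lemma fe_add_const:
  assumes i: "i < n" and t: "0 \<le> t" "t \<le> 1"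
    and E: "\<And>\<xi>. \<xi> \<in> gam \<psi> h \<Longrightarrow> E' \<xi> = E \<xi> - a"
  shows "fe E' i t = fe E i t - a" "fe' E' i t = fe' E i t"
proof -
  have v: "cell_vertices h (z i) \<subseteq> gam \<psi> h" by (rule gam_vertices[OF i])
  have e: "E' (z i) = E (z i) - a" "E' (z i + h *\<^sub>R axis 1 1) = E (z i + h *\<^sub>R axis 1 1) - a"
    "E' (z i + h *\<^sub>R axis 2 1) = E (z i + h *\<^sub>R axis 2 1) - a"
    "E' (z i + h *\<^sub>R axis 1 1 + h *\<^sub>R axis 2 1) = E (z i + h *\<^sub>R axis 1 1 + h *\<^sub>R axis 2 1) - a"
    using v E by (auto simp: cell_vertices_def)
  have "(1 - \<alpha>) * (1 - \<beta>) * (e0 - a) + \<alpha> * (1 - \<beta>) * (e1 - a) + (1 - \<alpha>) * \<beta> * (e2 - a) + \<alpha> * \<beta> * (e3 - a)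
    = (1 - \<alpha>) * (1 - \<beta>) * e0 + \<alpha> * (1 - \<beta>) * e1 + (1 - \<alpha>) * \<beta> * e2 + \<alpha> * \<beta> * e3 - a" for \<alpha> \<beta> e0 e1 e2 e3 :: real
    by (simp add: algebra_simps)
  then show "fe E' i t = fe E i t - a" unfolding fe_def bil_def Let_def e by (simp only:)
  show "fe' E' i t = fe' E i t" by (simp add: fe'_def bil1_def bil2_def Let_def e)
qed

lemma fe_diff: "fe (\<lambda>\<xi>. E \<xi> - E' \<xi>) i t = fe E i t - fe E' i t" "fe' (\<lambda>\<xi>. E \<xi> - E' \<xi>) i t = fe' E i t - fe' E' i t"
proof -
  have "(1 - \<alpha>) * (1 - \<beta>) * (e0 - f0) + \<alpha> * (1 - \<beta>) * (e1 - f1) + (1 - \<alpha>) * \<beta> * (e2 - f2) + \<alpha> * \<beta> * (e3 - f3)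
    = ((1 - \<alpha>) * (1 - \<beta>) * e0 + \<alpha> * (1 - \<beta>) * e1 + (1 - \<alpha>) * \<beta> * e2 + \<alpha> * \<beta> * e3)
    - ((1 - \<alpha>) * (1 - \<beta>) * f0 + \<alpha> * (1 - \<beta>) * f1 + (1 - \<alpha>) * \<beta> * f2 + \<alpha> * \<beta> * f3)"
    for \<alpha> \<beta> e0 e1 e2 e3 f0 f1 f2 f3 :: real
    by (simp add: algebra_simps)
  then show "fe (\<lambda>\<xi>. E \<xi> - E' \<xi>) i t = fe E i t - fe E' i t" unfolding fe_def bil_def Let_def by (simp only:)
  have g: "(1 - \<beta>) * (((e1 - f1) - (e0 - f0)) / h) + \<beta> * (((e3 - f3) - (e2 - f2)) / h)
    = ((1 - \<beta>) * ((e1 - e0) / h) + \<beta> * ((e3 - e2) / h)) - ((1 - \<beta>) * ((f1 - f0) / h) + \<beta> * ((f3 - f2) / h))"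
    for \<beta> e0 e1 e2 e3 f0 f1 f2 f3 :: real
    by (simp add: algebra_simps diff_divide_distrib add_divide_distrib)
  show "fe' (\<lambda>\<xi>. E \<xi> - E' \<xi>) i t = fe' E i t - fe' E' i t"
    unfolding fe'_def bil1_def bil2_def Let_def g by (simp only: right_diff_distrib)
qed

end

section \<open>The error of the reduced trace solution\<close>

text \<open>Nothing is assumed on \<open>f\<close> beyond agreement with a continuous function off a
  null set; completeness of Lebesgue measure yields integrability. It covers the end points of
  segments and the exceptional set of the load \<open>g\<close>.\<close>

lemma int01_spike:
  fixes f F :: "real \<Rightarrow> real"
  assumes F: "cont01 F" and S: "negligible S" "\<And>t. 0 \<le> t \<Longrightarrow> t \<le> 1 \<Longrightarrow> t \<notin> S \<Longrightarrow> f t = F t"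
  shows "int01 f = int01 F"
proof -
  have a: "F absolutely_integrable_on {0..1}"
    by (rule absolutely_integrable_continuous_real[OF F])
  have b: "f absolutely_integrable_on {0..1}"
    by (rule absolutely_integrable_spike[OF a S(1)]) (use S(2) in auto)
  have i: "int01 k = integral {0..1} k" if "k absolutely_integrable_on {0..1}" for k :: "real \<Rightarrow> real"
  proof -
    have "int01 k = set_lebesgue_integral lebesgue {0..1} k"
      unfolding int01_def set_lebesgue_integral_def by (subst integral_restrict_space) auto
    then show ?thesis using set_lebesgue_integral_eq_integral(2)[OF that] by simp
  qed
  have "integral {0..1} f = integral {0..1} F"
    by (rule integral_spike[OF S(1)]) (use S(2) in auto)
  then show ?thesis using i[OF a] i[OF b] by simp
qed

text \<open>A function that is not integrable has integral zero by convention, and the nonnegativity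
  of \<open>F\<close> covers this case; so no measurability of \<open>f\<close> enters.\<close>

lemma int01_le:
  fixes f F :: "real \<Rightarrow> real"
  assumes F: "cont01 F" and le: "\<And>t. 0 < t \<Longrightarrow> t < 1 \<Longrightarrow> f t \<le> F t" and nn: "\<And>t. 0 \<le> t \<Longrightarrow> t \<le> 1 \<Longrightarrow> 0 \<le> F t"
  shows "int01 f \<le> int01 F"
proof (cases "integrable (lebesgue_on {0..1}) f")
  case True
  have "AE t in lborel. t \<noteq> 0" "AE t in lborel. t \<noteq> (1::real)" by (rule AE_lborel_singleton)+
  then have "AE t in lborel. t \<noteq> 0 \<and> t \<noteq> (1::real)" by eventually_elim simp
  then have "AE t in lebesgue. t \<noteq> 0 \<and> t \<noteq> (1::real)" by (rule AE_completion)
  then have "AE t in lebesgue. t \<in> {0..1} \<longrightarrow> f t \<le> F t" by eventually_elim (use le in auto)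
  then have "AE t in lebesgue_on {0..1}. f t \<le> F t" by (subst AE_restrict_space_iff) auto
  then show ?thesis unfolding int01_def by (intro integral_mono_AE True int01_integrable F)
next
  case False
  then have "int01 f = 0" unfolding int01_def by (rule not_integrable_integral_eq)
  then show ?thesis using int01_nonneg[OF nn] by simp
qed

locale field_on_curve = chain_grid + C2_field +
  assumes V_cont: "\<And>i j S. i + j \<le> 2 \<Longrightarrow> continuous_on S (V i j)"
begin

definition "Vc r = V 0 0 (c r)"
definition "Vc' r = c' r $ 1 * V 1 0 (c r) + c' r $ 2 * V 0 1 (c r)"
text \<open>Second arclength derivative of the field restricted to the curve, the curvature term
  first. By the equation on the curve it is minus the load, up to a null set.\<close>

definition "Vc'' r = c'' r $ 1 * V 1 0 (c r) + c'' r $ 2 * V 0 1 (c r)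
  + c' r $ 1 * (c' r $ 1 * V 2 0 (c r) + c' r $ 2 * V 1 1 (c r))
  + c' r $ 2 * (c' r $ 1 * V 1 1 (c r) + c' r $ 2 * V 0 2 (c r))"

lemma V_along: "i + j \<le> 1 \<Longrightarrow> ((\<lambda>r. V i j (c r)) has_real_derivative c' r $ 1 * V (Suc i) j (c r) + c' r $ 2 * V i (Suc j) (c r)) (at r)"
  unfolding has_field_derivative_def
  by (rule has_derivative_eq_rhs[OF has_derivative_compose[OF c_deriv[unfolded has_vector_derivative_def] V_deriv]])
    (auto simp: algebra_simps)

lemma Vc_deriv: "(Vc has_real_derivative Vc' r) (at r)"
  unfolding Vc_def[abs_def] Vc'_def using V_along[of 0 0 r] by simp

lemma c'_comp_deriv: "((\<lambda>r. c' r $ i) has_real_derivative c'' r $ i) (at r)"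
  using bounded_linear.has_vector_derivative[OF bounded_linear_vec_nth c'_deriv]
  by (simp add: has_real_derivative_iff_has_vector_derivative)

lemma Vc'_deriv: "(Vc' has_real_derivative Vc'' r) (at r)"
proof -
  have 1: "((\<lambda>r. V 1 0 (c r)) has_real_derivative c' r $ 1 * V 2 0 (c r) + c' r $ 2 * V 1 1 (c r)) (at r)"
    using V_along[of 1 0 r] by (simp add: numeral_2_eq_2)
  have 2: "((\<lambda>r. V 0 1 (c r)) has_real_derivative c' r $ 1 * V 1 1 (c r) + c' r $ 2 * V 0 2 (c r)) (at r)"
    using V_along[of 0 1 r] by (simp add: numeral_2_eq_2)
  show ?thesis
    unfolding Vc'_def[abs_def] Vc''_def
    by (rule DERIV_cong[OF DERIV_add[OF DERIV_mult[OF c'_comp_deriv 1] DERIV_mult[OF c'_comp_deriv 2]]])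
      (simp add: algebra_simps)
qed

lemma Vc''_cont: "continuous_on S Vc''"
proof -
  have "continuous_on S (\<lambda>r. V i j (c r))" if "i + j \<le> 2" for i j
    by (rule continuous_on_compose2[OF V_cont[OF that, of UNIV] c_cont]) simp
  then show ?thesis
    unfolding Vc''_def[abs_def] by (intro continuous_intros c'_cont continuous_on_subset[OF c''_cont]) auto
qed

lemma comp_unit: "\<bar>c' r $ i\<bar> \<le> 1" using component_le_norm_cart[of "c' r" i] unit_speed[of r] by simp

lemma comp_curv: "\<bar>c'' r $ i\<bar> \<le> K" using component_le_norm_cart[of "c'' r" i] curvature[of r] by linarith

lemma Vc'_bound: "\<bar>Vc' r\<bar> \<le> 2 * B"
proof -
  have "\<bar>c' r $ i * V k l (c r)\<bar> \<le> 1 * B" if "k + l \<le> 2" for i k l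
    unfolding abs_mult by (intro mult_mono comp_unit V_bound that) auto
  from this[of 1 0 1] this[of 0 1 2] show ?thesis unfolding Vc'_def by simp
qed

lemma Vc''_bound: "\<bar>Vc'' r\<bar> \<le> (2 * K + 4) * B"
proof -
  have a: "\<bar>c'' r $ i * V k l (c r)\<bar> \<le> K * B" if "k + l \<le> 2" for i k l
    unfolding abs_mult by (intro mult_mono comp_curv V_bound that) (use K_pos in auto)
  have b: "\<bar>c' r $ i * V k l (c r)\<bar> \<le> 1 * B" if "k + l \<le> 2" for i k l
    unfolding abs_mult by (intro mult_mono comp_unit V_bound that) auto
  have d: "\<bar>c' r $ j * x\<bar> \<le> 1 * (2 * B)" if "\<bar>x\<bar> \<le> 2 * B" for j x
    unfolding abs_mult by (intro mult_mono comp_unit that) auto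
  have "\<bar>c' r $ 1 * V 2 0 (c r) + c' r $ 2 * V 1 1 (c r)\<bar> \<le> 2 * B" using b[of 2 0 1] b[of 1 1 2] by simp
  note d1 = d[OF this, of 1]
  have "\<bar>c' r $ 1 * V 1 1 (c r) + c' r $ 2 * V 0 2 (c r)\<bar> \<le> 2 * B" using b[of 1 1 1] b[of 0 2 2] by simp
  note d2 = d[OF this, of 2]
  have "\<bar>Vc'' r\<bar> \<le> K * B + K * B + 2 * B + 2 * B"
    unfolding Vc''_def using a[of 1 0 1, simplified] a[of 0 1 2, simplified] d1[simplified] d2[simplified]
    unfolding One_nat_def by linarith
  then show ?thesis by (simp add: algebra_simps)
qed

text \<open>Shifting the parameter by \<open>L\<close> leaves the restricted field unchanged because
  \<open>c\<close> is periodic; uniqueness of derivatives passes this on to both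
  derivatives.\<close>

lemma Vc'_period: "Vc' (r + L) = Vc' r" "Vc'' (r + L) = Vc'' r"
proof -
  have shift: "((\<lambda>r. r + L) has_real_derivative 1) (at r)" for r by (auto intro!: derivative_eq_intros)
  have "(\<lambda>r. Vc (r + L)) = Vc" by (simp add: Vc_def period fun_eq_iff)
  then have "(Vc has_real_derivative Vc' (r + L)) (at r)" for r
    using DERIV_chain2[OF Vc_deriv shift, of r] by simp
  then have e: "Vc' (r + L) = Vc' r" for r using DERIV_unique Vc_deriv by blast
  then show "Vc' (r + L) = Vc' r" .
  have "(\<lambda>r. Vc' (r + L)) = Vc'" using e by (simp add: fun_eq_iff)
  then have "(Vc' has_real_derivative Vc'' (r + L)) (at r)"
    using DERIV_chain2[OF Vc'_deriv shift, of r] by simp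
  then show "Vc'' (r + L) = Vc'' r" using DERIV_unique Vc'_deriv by blast
qed

end

text \<open>The setting for a fixed grid after all choices are made: \<open>E\<close> is the reduced
  vector of the smooth field, \<open>Eu\<close> that of the discrete solution. The discrete equation
  is stated for \<open>E - Eu\<close> minus a constant, the one function it is tested with.\<close>

locale reduced_fem = field_on_curve +
  fixes \<sigma> \<sigma>' :: "nat \<Rightarrow> real \<Rightarrow> real" and u g uh :: "pt \<Rightarrow> real" and E Eu :: "pt \<Rightarrow> real" and C1 :: real
  assumes foot_ends: "\<And>i. i < n \<Longrightarrow> \<sigma> i 0 = s i" "\<And>i. i < n \<Longrightarrow> \<sigma> i 1 = s (Suc i)"
    and foot_cont: "\<And>i. i < n \<Longrightarrow> cont01 (\<sigma> i)" "\<And>i. i < n \<Longrightarrow> cont01 (\<sigma>' i)"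
    and foot_deriv: "\<And>i t. i < n \<Longrightarrow> 0 < t \<Longrightarrow> t < 1 \<Longrightarrow> (\<sigma> i has_real_derivative \<sigma>' i t) (at t)"
    and foot_proj: "\<And>i t. i < n \<Longrightarrow> 0 \<le> t \<Longrightarrow> t \<le> 1 \<Longrightarrow> proj \<psi> (X i t) = c (\<sigma> i t)"
    and foot_dist: "\<And>i t. i < n \<Longrightarrow> 0 \<le> t \<Longrightarrow> t \<le> 1 \<Longrightarrow> norm (X i t - c (\<sigma> i t)) \<le> 3 * h"
    and foot_rate: "\<And>i t. i < n \<Longrightarrow> 0 \<le> t \<Longrightarrow> t \<le> 1 \<Longrightarrow> \<bar>\<sigma>' i t - seglen i\<bar> \<le> 42 * K * h * seglen i"
    and foot_dir: "\<And>i t. i < n \<Longrightarrow> 0 \<le> t \<Longrightarrow> t \<le> 1 \<Longrightarrow> norm (QQ i - PP i - seglen i *\<^sub>R c' (\<sigma> i t)) \<le> 9 * K * h * seglen i"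
    and foot_null: "\<And>i S. i < n \<Longrightarrow> negligible S \<Longrightarrow> negligible {t \<in> {0..1}. \<sigma> i t \<in> S}"
    and u_eq: "\<And>s. u (c s) = Vc s"
    and g_eq: "negligible {s. g (c s) \<noteq> - Vc'' s}"
    and E_approx: "\<And>\<xi>. \<xi> \<in> gam \<psi> h \<Longrightarrow> \<bar>E \<xi> - V 0 0 \<xi>\<bar> \<le> C1 * B * h\<^sup>2" and C1: "0 \<le> C1"
    and uh_eq: "uh = restrict (\<lambda>x. \<Sum>\<xi>\<in>gam \<psi> h. Eu \<xi> * nodal h \<xi> x) (Gamh \<psi> h)"
    and uh_mean: "Gamh_integral \<psi> h uh = 0"
    and galerkin: "\<And>Ev a. (\<And>\<xi>. \<xi> \<in> gam \<psi> h \<Longrightarrow> Ev \<xi> = E \<xi> - Eu \<xi> - a) \<Longrightarrow>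
      Gamh_integral \<psi> h (restrict (\<lambda>x. \<Sum>\<xi>\<in>gam \<psi> h. Ev \<xi> * nodal h \<xi> x) (Gamh \<psi> h)) = 0 \<Longrightarrow>
      Gamh_integral \<psi> h (\<lambda>x. tgrad_h \<psi> h uh x \<bullet> tgrad_h \<psi> h (restrict (\<lambda>x. \<Sum>\<xi>\<in>gam \<psi> h. Ev \<xi> * nodal h \<xi> x) (Gamh \<psi> h)) x)
        = Gamh_integral \<psi> h (\<lambda>x. g (proj \<psi> x) * restrict (\<lambda>x. \<Sum>\<xi>\<in>gam \<psi> h. Ev \<xi> * nodal h \<xi> x) (Gamh \<psi> h) x)"
    and h_le: "h \<le> 1"
begin

abbreviation "fe_trace Ev \<equiv> restrict (\<lambda>x. \<Sum>\<xi>\<in>gam \<psi> h. Ev \<xi> * nodal h \<xi> x) (Gamh \<psi> h)"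

lemma Gamh_integral_trace: "Gamh_integral \<psi> h (fe_trace Ev) = (\<Sum>i<n. seglen i * int01 (fe Ev i))"
  unfolding Gamh_integral_eq
proof (rule sum.cong[OF refl])
  fix i assume "i \<in> {..<n}"
  then have "int01 (\<lambda>t. fe_trace Ev (X i t)) = int01 (fe Ev i)" by (intro int01_cong restrict_fe) auto
  then show "seglen i * int01 (\<lambda>t. fe_trace Ev (X i t)) = seglen i * int01 (fe Ev i)" by simp
qed

lemma inner_tgrad_trace:
  "Gamh_integral \<psi> h (\<lambda>x. tgrad_h \<psi> h (fe_trace E1) x \<bullet> tgrad_h \<psi> h (fe_trace E2) x)
    = (\<Sum>i<n. int01 (\<lambda>t. fe' E1 i t * fe' E2 i t) / seglen i)"
  unfolding Gamh_integral_eq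
proof (rule sum.cong[OF refl])
  fix i assume "i \<in> {..<n}"
  then have i: "i < n" by simp
  have l: "0 < seglen i" by (rule seglen_pos[OF i])
  have "int01 (\<lambda>t. tgrad_h \<psi> h (fe_trace E1) (X i t) \<bullet> tgrad_h \<psi> h (fe_trace E2) (X i t))
    = int01 (\<lambda>t. (1 / (seglen i)\<^sup>2) * (fe' E1 i t * fe' E2 i t))"
  proof (rule int01_spike[where S="{0, 1}"])
    show "cont01 (\<lambda>t. (1 / (seglen i)\<^sup>2) * (fe' E1 i t * fe' E2 i t))" by (intro continuous_intros fe'_cont)
    fix t :: real assume "0 \<le> t" "t \<le> 1" "t \<notin> {0, 1}"
    then have t: "0 < t" "t < 1" by auto
    have "(QQ i - PP i) \<bullet> (QQ i - PP i) = (seglen i)\<^sup>2" by (simp add: seglen_def power2_norm_eq_inner)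
    then show "tgrad_h \<psi> h (fe_trace E1) (X i t) \<bullet> tgrad_h \<psi> h (fe_trace E2) (X i t) = (1 / (seglen i)\<^sup>2) * (fe' E1 i t * fe' E2 i t)"
      using l unfolding tgrad_segment[OF i t restrict_fe_deriv[OF i t]] by (simp add: power2_eq_square)
  qed simp
  then show "seglen i * int01 (\<lambda>t. tgrad_h \<psi> h (fe_trace E1) (X i t) \<bullet> tgrad_h \<psi> h (fe_trace E2) (X i t))
    = int01 (\<lambda>t. fe' E1 i t * fe' E2 i t) / seglen i"
    using l by (simp only: int01_cmult) (simp add: power2_eq_square)
qed

lemma load_trace:
  "Gamh_integral \<psi> h (\<lambda>x. g (proj \<psi> x) * fe_trace Ev x) = - (\<Sum>i<n. seglen i * int01 (\<lambda>t. Vc'' (\<sigma> i t) * fe Ev i t))"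
  unfolding Gamh_integral_eq sum_negf[symmetric]
proof (rule sum.cong[OF refl])
  fix i assume "i \<in> {..<n}"
  then have i: "i < n" by simp
  have "int01 (\<lambda>t. g (proj \<psi> (X i t)) * fe_trace Ev (X i t)) = int01 (\<lambda>t. (- 1) * (Vc'' (\<sigma> i t) * fe Ev i t))"
  proof (rule int01_spike[OF _ foot_null[OF i g_eq]])
    show "cont01 (\<lambda>t. (- 1) * (Vc'' (\<sigma> i t) * fe Ev i t))"
      by (intro continuous_intros fe_cont continuous_on_compose2[OF Vc''_cont[of UNIV] foot_cont(1)[OF i]]) simp
    fix t :: real assume t: "0 \<le> t" "t \<le> 1" "t \<notin> {t \<in> {0..1}. \<sigma> i t \<in> {s. g (c s) \<noteq> - Vc'' s}}"
    then show "g (proj \<psi> (X i t)) * fe_trace Ev (X i t) = (- 1) * (Vc'' (\<sigma> i t) * fe Ev i t)"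
      using restrict_fe[OF i t(1,2)] foot_proj[OF i t(1,2)] by simp
  qed
  then show "seglen i * int01 (\<lambda>t. g (proj \<psi> (X i t)) * fe_trace Ev (X i t)) = - (seglen i * int01 (\<lambda>t. Vc'' (\<sigma> i t) * fe Ev i t))"
    by (simp only: int01_cmult)
qed

text \<open>In each coordinate difference quotients contribute 2 C1 + 6, moving from the chord to
  the foot 6, and the deviation of the chord direction from the tangent 9K; two coordinates double
  the sum. The segment length stays as a factor throughout.\<close>

lemma rate_consistency:
  assumes i: "i < n" and t: "0 \<le> t" "t \<le> 1"
  shows "\<bar>fe' E i t - seglen i * Vc' (\<sigma> i t)\<bar> \<le> ((4 * C1 + 24 + 18 * K) * B * h) * seglen i"
proof -
  let ?D = "QQ i - PP i" and ?x = "X i t" and ?y = "c (\<sigma> i t)" and ?l = "seglen i"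
  have l: "0 < ?l" by (rule seglen_pos[OF i])
  have D: "\<bar>?D $ k\<bar> \<le> ?l" for k unfolding seglen_def by (rule component_le_norm_cart)
  have F: "\<bar>(?D - ?l *\<^sub>R c' (\<sigma> i t)) $ k\<bar> \<le> 9 * K * h * ?l" for k
    using component_le_norm_cart[of "?D - ?l *\<^sub>R c' (\<sigma> i t)" k] foot_dir[OF i t] by linarith
  have app: "\<bar>bil1 h (z i) E ?x - V 1 0 ?x\<bar> \<le> (2 * C1 + 6) * B * h" "\<bar>bil2 h (z i) E ?x - V 0 1 ?x\<bar> \<le> (2 * C1 + 6) * B * h"
  proof -
    have "\<bar>E \<xi> - V 0 0 \<xi>\<bar> \<le> C1 * B * h\<^sup>2" if "\<xi> \<in> cell_vertices h (z i)" for \<xi>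
      using E_approx gam_vertices[OF i] that by blast
    from bil_approx(2,3)[OF h_pos z_lattice[OF i] X_cell[OF i t] this]
    show "\<bar>bil1 h (z i) E ?x - V 1 0 ?x\<bar> \<le> (2 * C1 + 6) * B * h" "\<bar>bil2 h (z i) E ?x - V 0 1 ?x\<bar> \<le> (2 * C1 + 6) * B * h"
      using h_pos by (simp_all add: power2_eq_square algebra_simps)
  qed
  have lip: "\<bar>V k m ?x - V k m ?y\<bar> \<le> 6 * B * h" if "k + m \<le> 1" for k m
  proof -
    have "2 * B * norm (?x - ?y) \<le> 2 * B * (3 * h)" using foot_dist[OF i t] B_nonneg by (intro mult_left_mono) auto
    then show ?thesis using V_lip[OF that, of ?x ?y] by simp
  qed
  have comp: "\<bar>?D $ k * b - ?l * (c' (\<sigma> i t) $ k * v)\<bar> \<le> ((2 * C1 + 12 + 9 * K) * B * h) * ?l"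
    if "\<bar>b - vx\<bar> \<le> (2 * C1 + 6) * B * h" "\<bar>vx - v\<bar> \<le> 6 * B * h" "\<bar>v\<bar> \<le> B" for k b v vx
  proof -
    have e: "?D $ k * b - ?l * (c' (\<sigma> i t) $ k * v) = ?D $ k * (b - v) + (?D - ?l *\<^sub>R c' (\<sigma> i t)) $ k * v"
      by (simp add: algebra_simps)
    have "\<bar>b - v\<bar> \<le> (2 * C1 + 6) * B * h + 6 * B * h" using that by linarith
    then have "\<bar>?D $ k * (b - v)\<bar> \<le> ?l * ((2 * C1 + 6) * B * h + 6 * B * h)"
      unfolding abs_mult using D l by (intro mult_mono) auto
    moreover have "\<bar>(?D - ?l *\<^sub>R c' (\<sigma> i t)) $ k * v\<bar> \<le> (9 * K * h * ?l) * B"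
      unfolding abs_mult using F that(3) by (intro mult_mono) (use h_pos K_pos l in auto)
    ultimately have "\<bar>?D $ k * b - ?l * (c' (\<sigma> i t) $ k * v)\<bar> \<le> ?l * ((2 * C1 + 6) * B * h + 6 * B * h) + (9 * K * h * ?l) * B"
      unfolding e by linarith
    then show ?thesis by (simp add: algebra_simps)
  qed
  have "fe' E i t - ?l * Vc' (\<sigma> i t) = (?D $ 1 * bil1 h (z i) E ?x - ?l * (c' (\<sigma> i t) $ 1 * V 1 0 ?y))
    + (?D $ 2 * bil2 h (z i) E ?x - ?l * (c' (\<sigma> i t) $ 2 * V 0 1 ?y))"
    by (simp add: fe'_def Vc'_def algebra_simps)
  then have "\<bar>fe' E i t - ?l * Vc' (\<sigma> i t)\<bar> \<le> ((2 * C1 + 12 + 9 * K) * B * h) * ?l + ((2 * C1 + 12 + 9 * K) * B * h) * ?l"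
    using comp[OF app(1) lip V_bound, of 1] comp[OF app(2) lip V_bound, of 2]
    by (smt (verit) One_nat_def add.right_neutral add_0 le_numeral_extra(4) one_le_numeral)
  then show ?thesis by (simp add: algebra_simps)
qed

text \<open>4Bh comes from bilinear interpolation and 6Bh from the distance 3h to the foot. The
  nodal error of order h^2 is weakened to order h by means of h \<le> 1.\<close>

lemma value_consistency:
  assumes i: "i < n" and t: "0 \<le> t" "t \<le> 1"
  shows "\<bar>Vc (\<sigma> i t) - fe E i t\<bar> \<le> (C1 + 10) * B * h"
proof -
  let ?x = "X i t" and ?y = "c (\<sigma> i t)"
  have "\<bar>E \<xi> - V 0 0 \<xi>\<bar> \<le> C1 * B * h\<^sup>2" if "\<xi> \<in> cell_vertices h (z i)" for \<xi>
    using E_approx gam_vertices[OF i] that by blast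
  from bil_approx(1)[OF h_pos z_lattice[OF i] X_cell[OF i t] this]
  have "\<bar>fe E i t - V 0 0 ?x\<bar> \<le> C1 * B * h\<^sup>2 + 4 * B * h" by (simp add: fe_def)
  moreover have "C1 * B * h\<^sup>2 \<le> C1 * B * h"
    using h_le h_pos C1 B_nonneg by (intro mult_left_mono) (auto simp: power2_eq_square mult_left_le)
  moreover have "\<bar>V 0 0 ?x - V 0 0 ?y\<bar> \<le> 6 * B * h"
  proof -
    have "2 * B * norm (?x - ?y) \<le> 2 * B * (3 * h)" using foot_dist[OF i t] B_nonneg by (intro mult_left_mono) auto
    then show ?thesis using V_lip[of 0 0 ?x ?y] by simp
  qed
  ultimately have "\<bar>V 0 0 ?y - fe E i t\<bar> \<le> C1 * B * h + 4 * B * h + 6 * B * h" by linarith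
  then show ?thesis unfolding Vc_def by (simp add: algebra_simps)
qed

lemma weighted_mean_le:
  assumes "\<And>i. i < n \<Longrightarrow> int01 (f i) \<le> a"
  shows "(\<Sum>i<n. seglen i * int01 (f i)) \<le> a * (\<Sum>i<n. seglen i)"
proof -
  have "(\<Sum>i<n. seglen i * int01 (f i)) \<le> (\<Sum>i<n. seglen i * a)"
    by (intro sum_mono mult_left_mono) (use assms seglen_pos in \<open>auto intro: less_imp_le\<close>)
  then show ?thesis using poly.sum_len_const by simp
qed

text \<open>A common constant for both consistency conditions of the energy estimate: the rate of
  the comparison function, and the bound (2K + 4) B of the second derivative times the relative foot
  rate 42 K h.\<close>

definition "C2 = 4 * C1 + 24 + 18 * K + (2 * K + 4) * (42 * K)"

text \<open>The three summands bound the L2 part, the gradient part of the consistency error and the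
  energy of the discrete difference, in units of (B' h)^2; the outer factors 2 come from (x + y)^2
  \<le> 2x^2 + 2y^2.\<close>

definition "C3 = L * (2 * (C1 + 10) + 2 * (C2 * (1 + 2 * L)) * L)\<^sup>2 + 2 * (84 * K + C2)\<^sup>2 * L + 2 * (C2 * (1 + 2 * L))\<^sup>2 * L"

lemma C2_pos: "0 < C2" unfolding C2_def using C1 K_pos by (intro add_pos_pos add_nonneg_pos) auto

text \<open>The absorption of the energy needs a positive constant, and \<open>B\<close> may be
  zero. A strictly larger \<open>B'\<close> takes its place and is let down to \<open>B\<close>
  afterwards.\<close>

theorem H1_error:
  assumes B': "B < B'"
  shows "H1_norm_h \<psi> h (\<lambda>x. lifted \<psi> h u x - uh x) \<le> sqrt C3 * (B' * h)"
proof -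
  let ?S = "\<Sum>i<n. seglen i"
  have S: "0 < ?S" by (rule poly.total_pos)
  \<comment> \<open>Means over the discrete curve: \<open>a\<close> of the comparison function,
    \<open>m\<close> of the lifted exact solution. Subtracting \<open>a\<close> puts the difference
    to the discrete solution into the mean-free test space.\<close>
  define a where "a = (\<Sum>i<n. seglen i * int01 (fe E i)) / ?S"
  define m where "m = (\<Sum>i<n. seglen i * int01 (\<lambda>t. Vc (\<sigma> i t))) / ?S"
  define Ev where "Ev \<xi> = E \<xi> - Eu \<xi> - a" for \<xi>
  have Vc_cont: "continuous_on S Vc" "continuous_on S Vc'" for S
    by (meson DERIV_continuous_on Vc_deriv Vc'_deriv has_field_derivative_at_within)+
  have sc: "cont01 (\<lambda>t. Vc (\<sigma> i t))" "cont01 (\<lambda>t. Vc' (\<sigma> i t))" "cont01 (\<lambda>t. Vc'' (\<sigma> i t))" if "i < n" for i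
    by (rule continuous_on_compose2[OF _ foot_cont(1)[OF that] subset_UNIV], intro Vc_cont Vc''_cont)+
  have fv: "fe Ev i t = fe E i t - fe Eu i t - a" "fe' Ev i t = fe' E i t - fe' Eu i t" if "i < n" "0 \<le> t" "t \<le> 1" for i t
    using fe_add_const[OF that, of Ev "\<lambda>\<xi>. E \<xi> - Eu \<xi>" a] fe_diff by (simp_all add: Ev_def)
  have umean: "(\<Sum>i<n. seglen i * int01 (fe Eu i)) = 0"
    using uh_mean unfolding uh_eq Gamh_integral_trace .
  have vmean: "(\<Sum>i<n. seglen i * int01 (fe Ev i)) = 0"
  proof -
    have "int01 (fe Ev i) = int01 (fe E i) - int01 (fe Eu i) - a" if "i < n" for i
    proof -
      have "int01 (fe Ev i) = int01 (\<lambda>t. (fe E i t - fe Eu i t) - a)" by (rule int01_cong) (use fv that in auto)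
      also have "\<dots> = int01 (\<lambda>t. fe E i t - fe Eu i t) - int01 (\<lambda>t. a)" by (intro int01_diff continuous_intros fe_cont)
      also have "int01 (\<lambda>t. fe E i t - fe Eu i t) = int01 (fe E i) - int01 (fe Eu i)" by (intro int01_diff fe_cont)
      finally show ?thesis by (simp add: int01_const)
    qed
    then have "(\<Sum>i<n. seglen i * int01 (fe Ev i)) = (\<Sum>i<n. seglen i * int01 (fe E i)) - (\<Sum>i<n. seglen i * int01 (fe Eu i)) - (\<Sum>i<n. seglen i * a)"
      by (simp add: right_diff_distrib sum_subtractf)
    moreover have "(\<Sum>i<n. seglen i * a) = ?S * a" by (simp only: sum_distrib_right)
    moreover have "?S * a = (\<Sum>i<n. seglen i * int01 (fe E i))" unfolding a_def using S by simp
    ultimately show ?thesis using umean by simp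
  qed
  have gal: "(\<Sum>i<n. int01 (\<lambda>t. fe' Eu i t * fe' Ev i t) / seglen i) = - (\<Sum>i<n. seglen i * int01 (\<lambda>t. Vc'' (\<sigma> i t) * fe Ev i t))"
  proof -
    have "Gamh_integral \<psi> h (fe_trace Ev) = 0" unfolding Gamh_integral_trace by (rule vmean)
    note galerkin[of Ev a, OF Ev_def this]
    then show ?thesis unfolding uh_eq inner_tgrad_trace load_trace .
  qed
  define A where "A = C2 * B' * h"
  have B'0: "0 < B'" using B' B_nonneg by simp
  have A0: "0 < A" unfolding A_def using C2_pos B'0 h_pos by simp
  have BB: "B * h \<le> B' * h" using B' h_pos by simp
  have A1: "\<bar>fe' E i t - seglen i * Vc' (\<sigma> i t)\<bar> \<le> A * seglen i" if "i < n" "0 \<le> t" "t \<le> 1" for i t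
  proof -
    have "(4 * C1 + 24 + 18 * K) * B * h \<le> C2 * B' * h"
    proof -
      have "(4 * C1 + 24 + 18 * K) * (B * h) \<le> C2 * (B' * h)"
        using BB C1 K_pos B_nonneg h_pos by (intro mult_mono) (auto simp: C2_def)
      then show ?thesis by (simp add: mult.assoc)
    qed
    then show ?thesis using rate_consistency[OF that] seglen_pos[OF that(1)]
      unfolding A_def by (meson mult_right_mono less_imp_le order_trans)
  qed
  have A2: "\<bar>Vc'' (\<sigma> i t) * (seglen i - \<sigma>' i t)\<bar> \<le> A * seglen i" if "i < n" "0 \<le> t" "t \<le> 1" for i t
  proof -
    have l: "0 < seglen i" by (rule seglen_pos[OF that(1)])
    have "\<bar>Vc'' (\<sigma> i t) * (seglen i - \<sigma>' i t)\<bar> \<le> ((2 * K + 4) * B) * (42 * K * h * seglen i)"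
      unfolding abs_mult using foot_rate[OF that] by (intro mult_mono Vc''_bound) (use K_pos B_nonneg in \<open>auto simp: abs_minus_commute\<close>)
    also have "\<dots> = ((2 * K + 4) * (42 * K)) * (B * h) * seglen i" by (simp add: mult_ac)
    also have "\<dots> \<le> C2 * (B' * h) * seglen i"
      using BB C1 K_pos B_nonneg h_pos l by (intro mult_right_mono mult_mono) (auto simp: C2_def)
    finally show ?thesis by (simp add: A_def mult.assoc)
  qed
  have pC1: "poly.C1_on_edges (\<lambda>i t. Vc' (\<sigma> i t)) (\<lambda>i t. Vc'' (\<sigma> i t) * \<sigma>' i t)"
    unfolding poly.C1_on_edges_def
    using sc foot_cont foot_deriv DERIV_chain2[OF Vc'_deriv] by (auto intro!: continuous_on_mult)
  have pcl: "poly.closed_chain (\<lambda>i t. Vc' (\<sigma> i t))"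
    unfolding poly.closed_chain_def using foot_ends n_pos s_wrap Vc'_period(1) by simp
  have en: "poly.energy (fe' Ev) \<le> A * (poly.total_var (fe' Ev) + (\<Sum>i<n. seglen i * int01 (\<lambda>t. \<bar>fe Ev i t\<bar>)))"
    by (rule poly.strang_energy[OF fe_C1 fe_closed pC1 pcl, where w'="fe' E" and u'="fe' Eu"])
      (use sc foot_cont fe'_cont fv gal A1 A2 in auto)
  note SB = poly.strang_bound[OF fe_C1 fe_closed vmean A0 en]
  define D0 where "D0 = (C1 + 10) * (B' * h)"
  have D0: "\<bar>Vc (\<sigma> i t) - fe E i t\<bar> \<le> D0" if "i < n" "0 \<le> t" "t \<le> 1" for i t
  proof -
    have "(C1 + 10) * B * h \<le> D0" unfolding D0_def mult.assoc using BB C1 by (intro mult_left_mono) auto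
    then show ?thesis using value_consistency[OF that] by linarith
  qed
  \<comment> \<open>The two means are averages of functions that differ by at most
    \<open>D0\<close>, so they differ by no more.\<close>
  have ma: "\<bar>m - a\<bar> \<le> D0"
  proof -
    have d: "int01 (\<lambda>t. Vc (\<sigma> i t)) - int01 (fe E i) = int01 (\<lambda>t. Vc (\<sigma> i t) - fe E i t)" if "i < n" for i
      using sc(1)[OF that] fe_cont by (simp add: int01_diff)
    have ub: "int01 (\<lambda>t. \<bar>Vc (\<sigma> i t) - fe E i t\<bar>) \<le> D0" if "i < n" for i
    proof -
      have "int01 (\<lambda>t. \<bar>Vc (\<sigma> i t) - fe E i t\<bar>) \<le> int01 (\<lambda>t. D0)"
        using D0[OF that] sc(1)[OF that] by (intro int01_mono continuous_intros fe_cont) auto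
      then show ?thesis by (simp add: int01_const)
    qed
    have ms: "(m - a) * ?S = (\<Sum>i<n. seglen i * int01 (\<lambda>t. Vc (\<sigma> i t) - fe E i t))"
    proof -
      have "(m - a) * ?S = (\<Sum>i<n. seglen i * int01 (\<lambda>t. Vc (\<sigma> i t))) - (\<Sum>i<n. seglen i * int01 (fe E i))"
        using S by (simp add: m_def a_def left_diff_distrib)
      also have "\<dots> = (\<Sum>i<n. seglen i * int01 (\<lambda>t. Vc (\<sigma> i t) - fe E i t))"
        unfolding sum_subtractf[symmetric] by (rule sum.cong) (use d in \<open>auto simp flip: right_diff_distrib\<close>)
      finally show ?thesis .
    qed
    have "\<bar>(m - a) * ?S\<bar> \<le> (\<Sum>i<n. seglen i * int01 (\<lambda>t. \<bar>Vc (\<sigma> i t) - fe E i t\<bar>))"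
      unfolding ms
    proof (rule order_trans[OF sum_abs], rule sum_mono)
      fix i assume "i \<in> {..<n}"
      then have "0 < seglen i" using seglen_pos by simp
      then show "\<bar>seglen i * int01 (\<lambda>t. Vc (\<sigma> i t) - fe E i t)\<bar> \<le> seglen i * int01 (\<lambda>t. \<bar>Vc (\<sigma> i t) - fe E i t\<bar>)"
        unfolding abs_mult using int01_abs by (simp add: mult_left_mono)
    qed
    also have "\<dots> \<le> D0 * ?S" by (rule weighted_mean_le) (use ub in auto)
    finally have "\<bar>m - a\<bar> * ?S \<le> D0 * ?S" using S by (simp add: abs_mult)
    then show ?thesis using S by simp
  qed
  have lift: "lifted \<psi> h u (X i t) = Vc (\<sigma> i t) - m" if "i < n" "0 \<le> t" "t \<le> 1" for i t
  proof -
    have "Gamh_integral \<psi> h (\<lambda>y. u (proj \<psi> y)) = (\<Sum>i<n. seglen i * int01 (\<lambda>t. Vc (\<sigma> i t)))"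
      unfolding Gamh_integral_eq
    proof (rule sum.cong[OF refl])
      fix i assume "i \<in> {..<n}"
      then have "int01 (\<lambda>t. u (proj \<psi> (X i t))) = int01 (\<lambda>t. Vc (\<sigma> i t))"
        by (intro int01_cong) (simp add: foot_proj u_eq)
      then show "seglen i * int01 (\<lambda>t. u (proj \<psi> (X i t))) = seglen i * int01 (\<lambda>t. Vc (\<sigma> i t))" by simp
    qed
    moreover have "Gamh_integral \<psi> h (\<lambda>y. 1) = ?S" unfolding Gamh_integral_eq by (simp add: int01_const)
    ultimately show ?thesis by (simp add: lifted_def m_def foot_proj[OF that] u_eq)
  qed
  define e where "e x = lifted \<psi> h u x - uh x" for x
  define B1 where "B1 = 2 * D0 + 2 * (A * (1 + 2 * L)) * L"
  define A3 where "A3 = (84 * K) * (B' * h) + A"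
  have eX: "e (X i t) = Vc (\<sigma> i t) - m - fe Eu i t" if "i < n" "0 \<le> t" "t \<le> 1" for i t
    unfolding e_def uh_eq lift[OF that] restrict_fe[OF that] ..
  have e_bound: "\<bar>e (X i t)\<bar> \<le> B1" if "i < n" "0 \<le> t" "t \<le> 1" for i t
  proof -
    \<comment> \<open>The error splits into the interpolation error, the difference of the means and
      the discrete difference \<open>Ev\<close>. The first two are at most \<open>D0\<close> each,
      which explains the 2 D0 in \<open>B1\<close>.\<close>
    have "e (X i t) = (Vc (\<sigma> i t) - fe E i t) - (m - a) + fe Ev i t" using eX[OF that] fv(1)[OF that] by simp
    then show ?thesis using D0[OF that] ma SB(2)[OF that] unfolding B1_def by linarith
  qed
  have e_deriv: "((\<lambda>t. e (X i t)) has_real_derivative Vc' (\<sigma> i t) * \<sigma>' i t - fe' Eu i t) (at t)" if i: "i < n" and t: "0 < t" "t < 1" for i t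
  proof -
    have "((\<lambda>t. Vc (\<sigma> i t) - m - fe Eu i t) has_real_derivative Vc' (\<sigma> i t) * \<sigma>' i t - 0 - fe' Eu i t) (at t)"
      by (intro DERIV_diff DERIV_chain2[OF Vc_deriv foot_deriv[OF that]] DERIV_const fe_deriv)
    moreover have "\<forall>\<^sub>F r in nhds t. r \<in> {0<..<1}" using t by (intro eventually_nhds_in_open) auto
    then have "\<forall>\<^sub>F r in nhds t. e (X i r) = Vc (\<sigma> i r) - m - fe Eu i r"
      by eventually_elim (intro eX[OF i]; simp)
    ultimately show ?thesis by (subst DERIV_cong_ev[OF refl _ refl]) auto
  qed
  have grad_bound: "(norm (tgrad_h \<psi> h e (X i t)))\<^sup>2 \<le> 2 * A3\<^sup>2 + 2 * ((fe' Ev i t)\<^sup>2 / (seglen i)\<^sup>2)" if i: "i < n" and t: "0 < t" "t < 1" for i t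
  proof -
    let ?l = "seglen i"
    have l: "0 < ?l" by (rule seglen_pos[OF i])
    have t': "0 \<le> t" "t \<le> 1" using t by auto
    \<comment> \<open>The rate of the error along the segment is \<open>?w\<close> plus that of
      \<open>Ev\<close>; \<open>?w\<close> contains consistency errors only and is at most
      \<open>A3\<close> times the segment length.\<close>
    let ?w = "Vc' (\<sigma> i t) * \<sigma>' i t - fe' E i t"
    have "\<bar>Vc' (\<sigma> i t) * (\<sigma>' i t - ?l)\<bar> \<le> (2 * B) * (42 * K * h * ?l)"
      unfolding abs_mult using foot_rate[OF i t'] by (intro mult_mono Vc'_bound) (use B_nonneg in auto)
    also have "\<dots> = (84 * K) * (B * h) * ?l" by (simp add: mult_ac)
    also have "\<dots> \<le> (84 * K) * (B' * h) * ?l" using BB K_pos l by (intro mult_right_mono[OF mult_left_mono[OF BB]]) auto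
    finally have "\<bar>Vc' (\<sigma> i t) * (\<sigma>' i t - ?l)\<bar> \<le> (84 * K) * (B' * h) * ?l" .
    moreover have "?w = Vc' (\<sigma> i t) * (\<sigma>' i t - ?l) - (fe' E i t - ?l * Vc' (\<sigma> i t))" by (simp add: algebra_simps)
    ultimately have "\<bar>?w\<bar> \<le> (84 * K) * (B' * h) * ?l + A * ?l" using A1[OF i t'] by linarith
    then have w: "\<bar>?w\<bar> \<le> A3 * ?l" by (simp add: A3_def algebra_simps)
    have nD: "norm (QQ i - PP i) = ?l" by (simp add: seglen_def)
    have "norm (tgrad_h \<psi> h e (X i t)) = \<bar>?w + fe' Ev i t\<bar> / ?l"
      unfolding tgrad_segment[OF i t e_deriv[OF i t]] using l fv(2)[OF i t'] by (simp add: nD abs_divide power2_eq_square)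
    then have "(norm (tgrad_h \<psi> h e (X i t)))\<^sup>2 = (?w + fe' Ev i t)\<^sup>2 / ?l\<^sup>2" by (simp add: power_divide)
    also have "\<dots> \<le> (2 * ?w\<^sup>2 + 2 * (fe' Ev i t)\<^sup>2) / ?l\<^sup>2"
      using sum_squares_bound[of ?w "fe' Ev i t"] by (intro divide_right_mono) (auto simp: power2_sum)
    also have "\<dots> = 2 * (?w\<^sup>2 / ?l\<^sup>2) + 2 * ((fe' Ev i t)\<^sup>2 / ?l\<^sup>2)" by (simp add: add_divide_distrib)
    also have "?w\<^sup>2 / ?l\<^sup>2 \<le> A3\<^sup>2"
    proof -
      have "?w\<^sup>2 \<le> (A3 * ?l)\<^sup>2" using w by (metis abs_ge_zero power2_abs power_mono)
      then show ?thesis using l by (simp add: pos_divide_le_eq power_mult_distrib)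
    qed
    finally show ?thesis by simp
  qed
  have i1: "Gamh_integral \<psi> h (\<lambda>x. (e x)\<^sup>2) \<le> B1\<^sup>2 * L"
  proof -
    have "int01 (\<lambda>t. (e (X i t))\<^sup>2) \<le> B1\<^sup>2" if "i < n" for i
    proof -
      have "int01 (\<lambda>t. (e (X i t))\<^sup>2) \<le> int01 (\<lambda>t. B1\<^sup>2)"
      proof (rule int01_le)
        fix t :: real assume "0 < t" "t < 1"
        then show "(e (X i t))\<^sup>2 \<le> B1\<^sup>2" using e_bound[OF that, of t] by (simp add: power2_le_iff_abs_le)
      qed auto
      then show ?thesis by (simp add: int01_const)
    qed
    then have "Gamh_integral \<psi> h (\<lambda>x. (e x)\<^sup>2) \<le> B1\<^sup>2 * ?S" unfolding Gamh_integral_eq by (rule weighted_mean_le)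
    also have "\<dots> \<le> B1\<^sup>2 * L" using seglen_sum by (intro mult_left_mono) auto
    finally show ?thesis .
  qed
  have i2: "Gamh_integral \<psi> h (\<lambda>x. (norm (tgrad_h \<psi> h e x))\<^sup>2) \<le> 2 * A3\<^sup>2 * L + 2 * poly.energy (fe' Ev)"
  proof -
    have "Gamh_integral \<psi> h (\<lambda>x. (norm (tgrad_h \<psi> h e x))\<^sup>2) \<le> (\<Sum>i<n. seglen i * (2 * A3\<^sup>2) + 2 * (int01 (\<lambda>t. (fe' Ev i t)\<^sup>2) / seglen i))"
      unfolding Gamh_integral_eq
    proof (rule sum_mono)
      fix i assume "i \<in> {..<n}"
      then have i: "i < n" by simp
      have l: "0 < seglen i" by (rule seglen_pos[OF i])
      have c1: "cont01 (\<lambda>t. (2 / (seglen i)\<^sup>2) * (fe' Ev i t)\<^sup>2)" by (intro continuous_intros fe'_cont)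
      have "int01 (\<lambda>t. (norm (tgrad_h \<psi> h e (X i t)))\<^sup>2) \<le> int01 (\<lambda>t. 2 * A3\<^sup>2 + (2 / (seglen i)\<^sup>2) * (fe' Ev i t)\<^sup>2)"
        by (rule int01_le) (use c1 grad_bound[OF i] in \<open>auto intro!: continuous_intros\<close>)
      also have "\<dots> = 2 * A3\<^sup>2 + (2 / (seglen i)\<^sup>2) * int01 (\<lambda>t. (fe' Ev i t)\<^sup>2)"
        by (subst int01_add[OF _ c1]) (simp_all only: int01_const int01_cmult continuous_on_const)
      finally have "seglen i * int01 (\<lambda>t. (norm (tgrad_h \<psi> h e (X i t)))\<^sup>2) \<le> seglen i * (2 * A3\<^sup>2 + (2 / (seglen i)\<^sup>2) * int01 (\<lambda>t. (fe' Ev i t)\<^sup>2))"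
        using l by (intro mult_left_mono) auto
      also have "\<dots> = seglen i * (2 * A3\<^sup>2) + 2 * (int01 (\<lambda>t. (fe' Ev i t)\<^sup>2) / seglen i)"
        using l by (simp add: distrib_left power2_eq_square)
      finally show "seglen i * int01 (\<lambda>t. (norm (tgrad_h \<psi> h e (X i t)))\<^sup>2) \<le> seglen i * (2 * A3\<^sup>2) + 2 * (int01 (\<lambda>t. (fe' Ev i t)\<^sup>2) / seglen i)" .
    qed
    also have "\<dots> = 2 * A3\<^sup>2 * ?S + 2 * poly.energy (fe' Ev)"
      by (simp only: sum.distrib poly.sum_len_const poly.energy_def sum_distrib_left)
    also have "\<dots> \<le> 2 * A3\<^sup>2 * L + 2 * poly.energy (fe' Ev)" using seglen_sum by (intro add_right_mono mult_left_mono) auto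
    finally show ?thesis .
  qed
  have "Gamh_integral \<psi> h (\<lambda>x. (e x)\<^sup>2) + Gamh_integral \<psi> h (\<lambda>x. (norm (tgrad_h \<psi> h e x))\<^sup>2)
    \<le> B1\<^sup>2 * L + (2 * A3\<^sup>2 * L + 2 * ((A * (1 + 2 * L))\<^sup>2 * L))"
    using i1 i2 SB(1) by linarith
  also have "\<dots> = C3 * (B' * h)\<^sup>2"
  proof -
    have "B1 = (2 * (C1 + 10) + 2 * (C2 * (1 + 2 * L)) * L) * (B' * h)"
      unfolding B1_def D0_def A_def by (simp add: algebra_simps)
    moreover have "A3 = (84 * K + C2) * (B' * h)" unfolding A3_def A_def by (simp add: algebra_simps)
    moreover have "A * (1 + 2 * L) = (C2 * (1 + 2 * L)) * (B' * h)" unfolding A_def by (simp add: algebra_simps)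
    moreover have "(p * x)\<^sup>2 * L + (2 * (q * x)\<^sup>2 * L + 2 * ((r * x)\<^sup>2 * L)) = (L * p\<^sup>2 + 2 * q\<^sup>2 * L + 2 * r\<^sup>2 * L) * x\<^sup>2"
      for p q r x :: real by (simp add: power_mult_distrib algebra_simps)
    ultimately show ?thesis unfolding C3_def by (simp only:)
  qed
  finally have "H1_norm_h \<psi> h e \<le> sqrt (C3 * (B' * h)\<^sup>2)" unfolding H1_norm_h_def by simp
  also have "\<dots> = sqrt C3 * (B' * h)" using B'0 h_pos by (simp add: real_sqrt_mult)
  finally show ?thesis unfolding e_def .
qed

end

section \<open>Uniform constants and rigid motions\<close>

text \<open>On the compact set of parameter pairs in one period whose distance modulo
  \<open>L\<close> is at least \<open>\<eta>\<close>, the planar distance is continuous, and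
  positive by injectivity, so it has a positive minimum. Parameter differences lie in [-L, L], hence
  the three shifts -1, 0, 1 suffice.\<close>

lemma (in param_curve) chord_modulus:
  assumes \<eta>: "0 < \<eta>"
  shows "\<exists>d>0. \<forall>s t. dist (c s) (c t) < d \<longrightarrow> (\<exists>k::int. \<bar>s - t - of_int k * L\<bar> < \<eta>)"
proof -
  define F where "F = (\<lambda>p. dist (c (fst p)) (c (snd p)))"
  define A where "A = ({0..L} \<times> {0..L}) \<inter>
    (\<Inter>k\<in>{-1, 0, 1::int}. {p. \<eta> \<le> \<bar>fst p - snd p - of_int k * L\<bar>})"
  have clo: "closed {p. \<eta> \<le> \<bar>fst p - snd p - of_int k * L\<bar>}" for k :: int
    by (intro closed_Collect_le continuous_intros)
  have "compact A" unfolding A_def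
    by (intro compact_Int_closed compact_Times compact_Icc closed_INT ballI clo)
  moreover have "continuous_on A F" unfolding F_def
    by (intro continuous_intros continuous_on_compose2[OF c_cont[of UNIV]]) auto
  ultimately have ex: "A = {} \<or> (\<exists>p\<in>A. \<forall>q\<in>A. F p \<le> F q)"
    using continuous_attains_inf by blast
  have pos: "0 < F p" if p: "p \<in> A" for p
  proof (rule ccontr)
    assume "\<not> 0 < F p"
    then have "c (fst p) = c (snd p)" by (simp add: F_def)
    from inj_period[OF this] obtain k :: int where k: "fst p - snd p = of_int k * L" by blast
    have r: "fst p \<in> {0..L}" "snd p \<in> {0..L}" using p by (auto simp: A_def)
    then have "\<bar>of_int k * L\<bar> \<le> 1 * L" unfolding k[symmetric] by auto
    then have "\<bar>of_int k :: real\<bar> \<le> 1" using L_pos by (simp add: abs_mult)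
    then have "k \<in> {-1, 0, 1}" by auto
    then have "\<eta> \<le> \<bar>fst p - snd p - of_int k * L\<bar>" using p unfolding A_def by blast
    then show False using k \<eta> by simp
  qed
  obtain d where d: "0 < d" "\<And>q. q \<in> A \<Longrightarrow> d \<le> F q"
  proof (cases "A = {}")
    case True then show ?thesis using that[of 1] by simp
  next
    case False
    then obtain p where "p \<in> A" "\<And>q. q \<in> A \<Longrightarrow> F p \<le> F q" using ex by blast
    then show ?thesis using that[of "F p"] pos by blast
  qed
  have "\<exists>k::int. \<bar>s - t - of_int k * L\<bar> < \<eta>" if st: "dist (c s) (c t) < d" for s t
  proof -
    obtain i j :: int where ij: "s + of_int i * L \<in> {0..<0 + L}" "t + of_int j * L \<in> {0..<0 + L}"
      using reduce_period by meson
    let ?p = "(s + of_int i * L, t + of_int j * L)"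
    have "F ?p < d" using st by (simp add: F_def period_int)
    then have "?p \<notin> A" using d(2)[of ?p] by linarith
    moreover have "?p \<in> {0..L} \<times> {0..L}" using ij by auto
    ultimately obtain k :: int where "?p \<notin> {p. \<eta> \<le> \<bar>fst p - snd p - of_int k * L\<bar>}"
      unfolding A_def by blast
    then have "\<bar>s - t - of_int (k + j - i) * L\<bar> < \<eta>" by (simp add: algebra_simps)
    then show ?thesis by blast
  qed
  then show ?thesis using d(1) by blast
qed

text \<open>The second derivative is continuous and inherits the period, hence it is bounded on the
  line. One is added to the bound to have \<open>K\<close> positive.\<close>

lemma smooth_closed_curve_param:
  assumes "smooth_closed_curve c L"
  obtains c'' K where "param_curve c (\<lambda>s. vector_derivative c (at s)) c'' L K"
proof -
  define D where "D = (\<lambda>(f :: real \<Rightarrow> pt) s. vector_derivative f (at s))"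
  have sm: "(D ^^ n) c differentiable_on UNIV" and L: "0 < L" and per: "\<And>s. c (s + L) = c s"
    and inj: "inj_on c {0..<L}" and unit: "\<And>s. norm (vector_derivative c (at s)) = 1" for n
    using assms unfolding smooth_closed_curve_def D_def by auto
  have d: "(f has_vector_derivative D f s) (at s)" if "f differentiable_on UNIV" for f s
    using that unfolding D_def differentiable_on_def by (simp add: vector_derivative_works[symmetric])
  have d0: "(c has_vector_derivative D c s) (at s)" and d1: "(D c has_vector_derivative D (D c) s) (at s)" for s
    using d[OF sm[of 0], of s] d[OF sm[of 1], of s] by simp_all
  have cont: "continuous_on S (D (D c))" for S
    using continuous_on_subset[OF differentiable_imp_continuous_on[OF sm[of 2]] subset_UNIV] by (simp add: numeral_2_eq_2)
  have shift: "D f (s + L) = D f s" if f: "\<And>s. (f has_vector_derivative D f s) (at s)" "\<And>s. f (s + L) = f s" for f s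
  proof -
    have "((f \<circ> (\<lambda>s. s + L)) has_vector_derivative 1 *\<^sub>R D f (s + L)) (at s)"
      by (rule vector_diff_chain_at) (auto intro!: derivative_eq_intros f(1))
    moreover have "f \<circ> (\<lambda>s. s + L) = f" using f(2) by auto
    ultimately have "(f has_vector_derivative D f (s + L)) (at s)" by simp
    then show ?thesis using f(1) vector_derivative_unique_at by blast
  qed
  have p1: "D c (s + L) = D c s" for s by (rule shift[OF d0 per])
  have p2: "D (D c) (s + L) = D (D c) s" for s by (rule shift[OF d1 p1])
  have "compact (D (D c) ` {0..L})" by (intro compact_continuous_image cont compact_Icc)
  then obtain B where B: "\<And>s. s \<in> {0..L} \<Longrightarrow> norm (D (D c) s) \<le> B" using compact_imp_bounded bounded_iff by (metis imageI)
  have pn: "D (D c) (s + real n * L) = D (D c) s" for s n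
  proof (induction n)
    case (Suc n) then show ?case using p2[of "s + real n * L"] by (simp add: algebra_simps)
  qed simp
  have pz: "D (D c) (s + of_int k * L) = D (D c) s" for s and k :: int
  proof (cases "0 \<le> k")
    case True then show ?thesis using pn[of s "nat k"] by simp
  next
    case False then show ?thesis using pn[of "s + of_int k * L" "nat (- k)"] by simp
  qed
  have bd: "norm (D (D c) s) \<le> \<bar>B\<bar> + 1" for s
  proof -
    define k where "k = - \<lfloor>s / L\<rfloor>"
    have "of_int \<lfloor>s / L\<rfloor> \<le> s / L" "s / L \<le> of_int \<lfloor>s / L\<rfloor> + 1" by linarith+
    then have "of_int \<lfloor>s / L\<rfloor> * L \<le> s" "s \<le> (of_int \<lfloor>s / L\<rfloor> + 1) * L"
      by (simp_all only: pos_le_divide_eq[OF L] pos_divide_le_eq[OF L])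
    then have "s + of_int k * L \<in> {0..L}" by (simp add: k_def algebra_simps)
    from B[OF this] show ?thesis unfolding pz by simp
  qed
  show ?thesis
  proof (rule that, unfold_locales)
    show "(c has_vector_derivative vector_derivative c (at s)) (at s)" for s using d0[of s] by (simp add: D_def)
    show "((\<lambda>s. vector_derivative c (at s)) has_vector_derivative D (D c) s) (at s)" for s
      using d1[of s] by (simp add: D_def)
    show "norm (D (D c) s) \<le> \<bar>B\<bar> + 1" for s by (rule bd)
    show "continuous_on UNIV (D (D c))" by (rule cont)
  qed (use unit per L inj in auto)
qed

text \<open>Length, curvature bound and modulus of injectivity survive unchanged. The estimate for
  the moved curve therefore has the same constants, which is the independence of the cut
  position.\<close>

lemma proper_curve_rigid:
  assumes "proper_curve c c' c'' L K d \<eta>" and R: "orthogonal_transformation R"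
  shows "proper_curve (\<lambda>s. a + R (c s)) (\<lambda>s. R (c' s)) (\<lambda>s. R (c'' s)) L K d \<eta>"
proof -
  interpret proper_curve c c' c'' L K d \<eta> by (rule assms(1))
  have lin: "bounded_linear R" using orthogonal_transformation_linear[OF R] by (rule linear_conv_bounded_linear[THEN iffD1])
  have nr: "norm (R x) = norm x" for x by (rule orthogonal_transformation_norm[OF R])
  have di: "dist (a + R x) (a + R y) = dist x y" for x y
    using nr[of "x - y"] by (simp add: dist_norm linear_diff[OF orthogonal_transformation_linear[OF R]])
  show ?thesis
  proof unfold_locales
    show "((\<lambda>s. a + R (c s)) has_vector_derivative R (c' s)) (at s)" for s
      using has_vector_derivative_add[OF has_vector_derivative_const bounded_linear.has_vector_derivative[OF lin c_deriv]] by simp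
    show "((\<lambda>s. R (c' s)) has_vector_derivative R (c'' s)) (at s)" for s
      by (rule bounded_linear.has_vector_derivative[OF lin c'_deriv])
    show "continuous_on UNIV (\<lambda>s. R (c'' s))" by (rule bounded_linear.continuous_on[OF lin c''_cont])
    show "inj_on (\<lambda>s. a + R (c s)) {0..<L}" 
    proof (rule inj_onI)
      fix x y assume xy: "x \<in> {0..<L}" "y \<in> {0..<L}" and "a + R (c x) = a + R (c y)"
      then have "c x = c y" using orthogonal_transformation_inj[OF R] by (simp add: inj_eq)
      then show "x = y" using inj xy by (simp add: inj_on_eq_iff)
    qed
    show "\<exists>k::int. \<bar>s - t - of_int k * L\<bar> < \<eta>" if "dist (a + R (c s)) (a + R (c t)) < d" for s t
      using chord that unfolding di by blast
  qed (use unit_speed curvature K_pos period L_pos d_pos eta_pos eta_L eta_K nr in auto)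
qed

lemma rigid_motion_region:
  fixes R :: "pt \<Rightarrow> pt"
  assumes R: "orthogonal_transformation R" and \<Omega>: "open \<Omega>" "\<Omega> \<subseteq> cball 0 r"
  shows "open ((\<lambda>x. a + R x) ` \<Omega>)" "frontier ((\<lambda>x. a + R x) ` \<Omega>) = (\<lambda>x. a + R x) ` frontier \<Omega>"
    "(\<lambda>x. a + R x) ` \<Omega> \<subseteq> cball a r"
proof -
  have lin: "linear R" "inj R" "surj R"
    using R by (simp_all add: orthogonal_transformation_linear orthogonal_transformation_inj orthogonal_transformation_surj)
  have e: "(\<lambda>x. a + R x) ` S = (+) a ` (R ` S)" for S by auto
  have o: "open (R ` \<Omega>)" by (rule open_surjective_linear_image[OF \<Omega>(1) lin(1,3)])
  show "open ((\<lambda>x. a + R x) ` \<Omega>)" unfolding e by (rule open_translation[OF o])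
  have "frontier (R ` \<Omega>) = R ` closure \<Omega> - R ` \<Omega>"
    unfolding frontier_def interior_open[OF o] closure_injective_linear_image[OF lin(1,2)] ..
  also have "\<dots> = R ` frontier \<Omega>" unfolding frontier_def interior_open[OF \<Omega>(1)] by (rule image_set_diff[OF lin(2), symmetric])
  finally show "frontier ((\<lambda>x. a + R x) ` \<Omega>) = (\<lambda>x. a + R x) ` frontier \<Omega>" unfolding e frontier_translation by simp
  show "(\<lambda>x. a + R x) ` \<Omega> \<subseteq> cball a r"
  proof clarify
    fix x assume "x \<in> \<Omega>"
    then have "norm x \<le> r" using \<Omega>(2) by auto
    then show "a + R x \<in> cball a r" by (simp add: dist_norm orthogonal_transformation_norm[OF R])
  qed
qed

lemma level_set_neg:
  assumes "level_set_function \<Omega> \<psi>" "open \<Omega>" "\<psi> x < 0" shows "x \<in> \<Omega>"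
proof (rule ccontr)
  assume x: "x \<notin> \<Omega>"
  have "\<psi> x = 0" if "x \<in> closure \<Omega>"
  proof -
    have "x \<in> frontier \<Omega>" using that x assms(2) by (simp add: frontier_def interior_open)
    then show ?thesis using assms(1) unfolding level_set_function_def by blast
  qed
  moreover have "0 < \<psi> x" if "x \<notin> closure \<Omega>" using that assms(1) unfolding level_set_function_def by blast
  ultimately show False using assms(3) by fastforce
qed

section \<open>Classical form of the data\<close>

lemma periodic_integral_by_parts:
  fixes F F' \<phi> \<phi>' :: "real \<Rightarrow> real"
  assumes L: "0 < L" and F: "\<And>s. (F has_real_derivative F' s) (at s)" "continuous_on UNIV F'" "F L = F 0"
    and \<phi>: "\<And>s. (\<phi> has_real_derivative \<phi>' s) (at s)" "continuous_on UNIV \<phi>'" "\<phi> L = \<phi> 0"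
  shows "(LINT s|lebesgue_on {0..L}. F s * \<phi>' s) = - (LINT s|lebesgue_on {0..L}. F' s * \<phi> s)"
proof -
  have Fc: "continuous_on UNIV F" "continuous_on UNIV \<phi>"
    by (intro continuous_at_imp_continuous_on ballI DERIV_isCont[OF F(1)] DERIV_isCont[OF \<phi>(1)])+
  have i: "integrable (lebesgue_on {0..L}) (\<lambda>s. F s * \<phi>' s)" "integrable (lebesgue_on {0..L}) (\<lambda>s. F' s * \<phi> s)"
    by (intro continuous_imp_integrable_real continuous_on_mult continuous_on_subset[OF Fc(1)] continuous_on_subset[OF Fc(2)]
        continuous_on_subset[OF F(2)] continuous_on_subset[OF \<phi>(2)] subset_UNIV)+
  have d: "((\<lambda>s. F s * \<phi> s) has_real_derivative F' s * \<phi> s + F s * \<phi>' s) (at s)" for s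
    by (rule DERIV_cong[OF DERIV_mult[OF F(1) \<phi>(1)]]) (simp add: algebra_simps)
  have "((\<lambda>s. F' s * \<phi> s + F s * \<phi>' s) has_integral F L * \<phi> L - F 0 * \<phi> 0) {0..L}"
  proof (rule fundamental_theorem_of_calculus)
    show "((\<lambda>s. F s * \<phi> s) has_vector_derivative F' s * \<phi> s + F s * \<phi>' s) (at s within {0..L})" for s
      using d[of s] by (auto simp: has_real_derivative_iff_has_vector_derivative intro: has_vector_derivative_at_within)
  qed (use L in simp)
  then have "integral {0..L} (\<lambda>s. F' s * \<phi> s + F s * \<phi>' s) = 0" using F(3) \<phi>(3) by (simp add: integral_unique)
  then have "(LINT s|lebesgue_on {0..L}. F' s * \<phi> s + F s * \<phi>' s) = 0"
    by (subst lebesgue_integral_eq_integral) (use i in auto)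
  then show ?thesis using i by simp
qed

lemma L2_curve_integrable:
  assumes "L2_curve c L v" shows "integrable (lebesgue_on {0..L}) (\<lambda>s. v (c s))"
proof (rule Bochner_Integration.integrable_bound)
  show "integrable (lebesgue_on {0..L}) (\<lambda>s. 1 + (v (c s))\<^sup>2)"
    using assms unfolding L2_curve_def by (auto intro!: Bochner_Integration.integrable_add continuous_imp_integrable_real)
  show "(\<lambda>s. v (c s)) \<in> borel_measurable (lebesgue_on {0..L})" using assms unfolding L2_curve_def by simp
  have "\<bar>x\<bar> \<le> 1 + x\<^sup>2" for x :: real using sum_squares_bound[of "\<bar>x\<bar>" 1] by simp
  then show "AE s in lebesgue_on {0..L}. norm (v (c s)) \<le> norm (1 + (v (c s))\<^sup>2)" by (auto intro: order_trans)
qed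

text \<open>\<open>sderiv\<close> is some weak derivative, picked by choice. The classical
  derivative satisfies the same identity by integration by parts, and the difference annihilates all
  smooth periodic test functions.\<close>

lemma sderiv_classical:
  fixes F F' :: "real \<Rightarrow> real"
  assumes H1: "H1_curve c L v" and L: "0 < L" and v: "AE s in lebesgue_on {0..L}. v (c s) = F s"
    and F: "\<And>s. (F has_real_derivative F' s) (at s)" "continuous_on UNIV F'" "F L = F 0"
  shows "AE s in lebesgue_on {0..L}. sderiv c L v (c s) = F' s"
proof -
  have "\<exists>w. L2_curve c L w \<and> is_weak_sderiv c L v w" using H1 unfolding H1_curve_def by blast
  then have w: "L2_curve c L (sderiv c L v)" "is_weak_sderiv c L v (sderiv c L v)"
    unfolding sderiv_def by (rule someI2_ex, simp)+
  let ?w = "\<lambda>s. sderiv c L v (c s)"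
  have F'i: "integrable (lebesgue_on {0..L}) F'"
    by (intro continuous_imp_integrable_real continuous_on_subset[OF F(2)]) simp
  have wi: "integrable (lebesgue_on {0..L}) ?w" by (rule L2_curve_integrable[OF w(1)])
  have "AE s in lebesgue_on {0..L}. ?w s - F' s = 0"
  proof (rule periodic_test_zero[OF L])
    show "integrable (lebesgue_on {0..L}) (\<lambda>s. ?w s - F' s)" using wi F'i by simp
    fix \<phi> :: "real \<Rightarrow> real"
    assume sm: "\<forall>n. (deriv ^^ n) \<phi> differentiable_on UNIV" and per: "\<forall>s. \<phi> (s + L) = \<phi> s"
    have "\<phi> differentiable_on UNIV" using sm[rule_format, of 0] by simp
    then have d: "(\<phi> has_real_derivative deriv \<phi> s) (at s)" for s
      unfolding differentiable_on_def by (simp add: DERIV_deriv_iff_real_differentiable)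
    have c: "continuous_on UNIV \<phi>" using \<open>\<phi> differentiable_on UNIV\<close> by (rule differentiable_imp_continuous_on)
    have d1: "continuous_on UNIV (deriv \<phi>)"
      using sm[rule_format, of 1] differentiable_imp_continuous_on by simp
    obtain b where b: "\<And>s. s \<in> {0..L} \<Longrightarrow> \<bar>\<phi> s\<bar> \<le> b"
    proof -
      have "compact (\<phi> ` {0..L})" by (intro compact_continuous_image continuous_on_subset[OF c] compact_Icc) simp
      then show ?thesis using that compact_imp_bounded bounded_iff by (metis imageI real_norm_def)
    qed
    have \<phi>m: "\<phi> \<in> borel_measurable (lebesgue_on {0..L})"
      by (intro continuous_imp_measurable_on_sets_lebesgue continuous_on_subset[OF c]) auto
    have mi: "integrable (lebesgue_on {0..L}) (\<lambda>s. k s * \<phi> s)" if k: "integrable (lebesgue_on {0..L}) k" for k :: "real \<Rightarrow> real"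
    proof (rule Bochner_Integration.integrable_bound)
      show "integrable (lebesgue_on {0..L}) (\<lambda>s. \<bar>b\<bar> * k s)" using k by simp
      show "(\<lambda>s. k s * \<phi> s) \<in> borel_measurable (lebesgue_on {0..L})" using k \<phi>m by measurable
      show "AE s in lebesgue_on {0..L}. norm (k s * \<phi> s) \<le> norm (\<bar>b\<bar> * k s)"
      proof (rule AE_I2)
        fix s assume "s \<in> space (lebesgue_on {0..L})"
        then have "\<bar>\<phi> s\<bar> \<le> \<bar>b\<bar>" using b[of s] by (auto simp: space_restrict_space)
        then show "norm (k s * \<phi> s) \<le> norm (\<bar>b\<bar> * k s)"
          using mult_left_mono[of "\<bar>\<phi> s\<bar>" "\<bar>b\<bar>" "\<bar>k s\<bar>"] by (simp add: abs_mult mult.commute)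
      qed
    qed
    have "(LINT s|lebesgue_on {0..L}. v (c s) * deriv \<phi> s) = - (LINT s|lebesgue_on {0..L}. ?w s * \<phi> s)"
      using w(2) sm per unfolding is_weak_sderiv_def by blast
    moreover have "(LINT s|lebesgue_on {0..L}. v (c s) * deriv \<phi> s) = (LINT s|lebesgue_on {0..L}. F s * deriv \<phi> s)"
    proof (rule integral_cong_AE)
      have "(\<lambda>s. v (c s)) \<in> borel_measurable (lebesgue_on {0..L})"
        using H1 unfolding H1_curve_def L2_curve_def by blast
      moreover have "deriv \<phi> \<in> borel_measurable (lebesgue_on {0..L})"
        by (intro continuous_imp_measurable_on_sets_lebesgue continuous_on_subset[OF d1]) auto
      moreover have "F \<in> borel_measurable (lebesgue_on {0..L})"
        by (intro continuous_imp_measurable_on_sets_lebesgue continuous_at_imp_continuous_on ballI DERIV_isCont[OF F(1)]) auto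
      ultimately show "(\<lambda>s. v (c s) * deriv \<phi> s) \<in> borel_measurable (lebesgue_on {0..L})"
        "(\<lambda>s. F s * deriv \<phi> s) \<in> borel_measurable (lebesgue_on {0..L})" by measurable
      show "AE s in lebesgue_on {0..L}. v (c s) * deriv \<phi> s = F s * deriv \<phi> s" using v by eventually_elim simp
    qed
    moreover have "(LINT s|lebesgue_on {0..L}. F s * deriv \<phi> s) = - (LINT s|lebesgue_on {0..L}. F' s * \<phi> s)"
      using per[rule_format, of 0] by (intro periodic_integral_by_parts[OF L F d d1]) simp
    ultimately have "(LINT s|lebesgue_on {0..L}. ?w s * \<phi> s) - (LINT s|lebesgue_on {0..L}. F' s * \<phi> s) = 0" by linarith
    then have "(LINT s|lebesgue_on {0..L}. ?w s * \<phi> s - F' s * \<phi> s) = 0"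
      using mi[OF wi] mi[OF F'i] by simp
    then show "(LINT s|lebesgue_on {0..L}. (?w s - F' s) * \<phi> s) = 0" by (simp add: left_diff_distrib)
  qed
  then show ?thesis by eventually_elim simp
qed

text \<open>The data are given for parameters in [0, L], whereas the feet of the segments run
  through a period that starts at a crossing. Countably many translates of one null set cover the
  exceptional set.\<close>

lemma (in param_curve) negligible_periodic:
  assumes P: "AE s in lebesgue_on {0..L}. P s" and per: "\<And>s. P (s + L) = P s"
  shows "negligible {s. \<not> P s}"
proof -
  define S where "S = {s \<in> {0..L}. \<not> P s}"
  have "AE s in lebesgue. s \<in> {0..L} \<longrightarrow> P s" using P by (subst (asm) AE_restrict_space_iff) auto
  then have "AE s in lebesgue. s \<notin> S" by eventually_elim (auto simp: S_def)
  then obtain N where "N \<in> null_sets lebesgue" "S \<subseteq> N" unfolding eventually_ae_filter by auto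
  then have S: "negligible S" by (metis negligible_iff_null_sets negligible_subset)
  have pn: "P (s + real n * L) = P s" for s n
  proof (induction n)
    case (Suc n) then show ?case using per[of "s + real n * L"] by (simp add: algebra_simps)
  qed simp
  have pz: "P (s + of_int k * L) = P s" for s and k :: int
  proof (cases "0 \<le> k")
    case True then show ?thesis using pn[of s "nat k"] by simp
  next
    case False then show ?thesis using pn[of "s + of_int k * L" "nat (- k)"] by simp
  qed
  have "negligible (\<Union>k::int. (+) (of_int k * L) ` S)"
    by (intro negligible_countable_Union) (auto intro: negligible_translation S)
  then show ?thesis
  proof (rule negligible_subset, clarify)
    fix s assume s: "\<not> P s"
    obtain k :: int where k: "s + of_int k * L \<in> {0..<0 + L}" using reduce_period by meson
    then have "s + of_int k * L \<in> S" using s pz by (auto simp: S_def)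
    then have "s \<in> (+) (of_int (- k) * L) ` S" by (intro image_eqI[of _ _ "s + of_int k * L"]) auto
    then show "s \<in> (\<Union>k::int. (+) (of_int k * L) ` S)" by blast
  qed
qed

lemma pd_eq:
  assumes S: "open S" "x \<in> S" and f: "\<And>y. y \<in> S \<Longrightarrow> f y = F y" and F: "(F has_derivative D) (at x)"
  shows "pd k f x = D (axis k 1)"
proof -
  have "(f has_derivative D) (at x)"
    by (rule has_derivative_transform_within_open[OF F S]) (simp add: f)
  then show ?thesis unfolding pd_def by (simp add: frechet_derivative_at[symmetric])
qed

text \<open>A node of \<open>gam2\<close> is one mesh step away from an interior node, so with h
  \<le> 1 the radius of the domain grows by at most one.\<close>

lemma (in cut_grid) interior_nodes_bounded:
  assumes lev: "level_set_function \<Omega> \<psi>" and \<Omega>: "open \<Omega>" "\<Omega> \<subseteq> cball a r" and h: "h \<le> 1"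
  shows "V_int \<psi> h \<union> gam2 \<psi> h \<subseteq> cball a (r + 1)"
proof
  have V: "y \<in> cball a r" if "y \<in> V_int \<psi> h" for y
    using that level_set_neg[OF lev \<Omega>(1)] \<Omega>(2) unfolding V_int_def by blast
  fix x assume x: "x \<in> V_int \<psi> h \<union> gam2 \<psi> h"
  show "x \<in> cball a (r + 1)"
  proof (cases "x \<in> V_int \<psi> h")
    case True then show ?thesis using V[of x] by simp
  next
    case False
    then obtain y where y: "y \<in> gam1 \<psi> h" "nbr h x y" using x unfolding gam2_def by auto
    then obtain e where e: "e \<in> dirs" "y = x + h *\<^sub>R e" unfolding nbr_def by blast
    have "norm e = 1" using e(1) unfolding dirs_eq by auto
    then have "dist x y \<le> 1" using e(2) h h_pos by (simp add: dist_norm)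
    moreover have "dist a y \<le> r" using V[of y] y(1) gam1_subset by auto
    ultimately show ?thesis using dist_triangle[of a x y] by (simp add: dist_commute)
  qed
qed

text \<open>The maximum principle is applied with \<tau> = B h^2/6, which gives r^2/24. The affine
  comparison on a stencil is the Taylor polynomial at its node, with remainder 2B (\<kappa>
  h)^2.\<close>

lemma (in cut_grid) E_vec_consistency:
  assumes V: "C2_field V B" and five: "\<And>x. \<bar>five_point h (V 0 0) x - h\<^sup>2 * (V 2 0 x + V 0 2 x)\<bar> \<le> B * h ^ 4 / 6"
    and harm: "\<And>x. x \<in> V_int \<psi> h \<Longrightarrow> V 2 0 x + V 0 2 x = 0"
    and ball: "V_int \<psi> h \<union> gam2 \<psi> h \<subseteq> cball a r"
    and ex: "local_extrapolation \<psi> h N w m W \<kappa>"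
    and inv: "invertible_on (gam2 \<psi> h) (layer_kernel \<psi> h l)"
    and \<xi>: "\<xi> \<in> gam \<psi> h"
  shows "\<bar>E_vec \<psi> h l N w (V 0 0) \<xi> - V 0 0 \<xi>\<bar> \<le> (3 + real m * \<bar>W\<bar>) * (r\<^sup>2 / 24 + 2 * \<kappa>\<^sup>2) * B * h\<^sup>2"
proof -
  interpret C2_field V B by (rule V)
  have "\<bar>E_vec \<psi> h l N w (V 0 0) \<xi> - V 0 0 \<xi>\<bar>
    \<le> (3 + real m * \<bar>W\<bar>) * ((B * h\<^sup>2 / 6) * r\<^sup>2 / 4 + 2 * B * (\<kappa> * h)\<^sup>2)"
  proof (rule E_vec_approximates[OF ex inv _ ball _ _ _ \<xi>])
    show "\<bar>five_point h (V 0 0) x\<bar> \<le> h\<^sup>2 * (B * h\<^sup>2 / 6)" if "x \<in> V_int \<psi> h" for x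
      using five[of x] harm[OF that] by (simp add: power2_eq_square power4_eq_xxxx mult_ac)
    fix \<eta> assume \<eta>: "\<eta> \<in> gam3 \<psi> h"
    define b where "b = V 1 0 \<eta> *\<^sub>R axis 1 1 + V 0 1 \<eta> *\<^sub>R (axis 2 1 :: pt)"
    have b: "b \<bullet> x = V 1 0 \<eta> * x $ 1 + V 0 1 \<eta> * x $ 2" for x
      by (simp add: b_def inner_add_left inner_axis')
    define q where "q x = (V 0 0 \<eta> - b \<bullet> \<eta>) + b \<bullet> x" for x
    show "\<exists>q. affine_fun q \<and> q \<eta> = V 0 0 \<eta> \<and> (\<forall>\<xi>\<in>N \<eta>. \<bar>V 0 0 \<xi> - q \<xi>\<bar> \<le> 2 * B * (\<kappa> * h)\<^sup>2)"
    proof (intro exI[of _ q] conjI ballI)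
      show "affine_fun q" unfolding affine_fun_def q_def by blast
      show "q \<eta> = V 0 0 \<eta>" by (simp add: q_def)
      fix \<zeta> assume "\<zeta> \<in> N \<eta>"
      from extrapolation_props(5)[OF ex \<eta> this] have "(norm (\<zeta> - \<eta>))\<^sup>2 \<le> (\<kappa> * h)\<^sup>2" by (intro power_mono) auto
      then have "2 * B * (norm (\<zeta> - \<eta>))\<^sup>2 \<le> 2 * B * (\<kappa> * h)\<^sup>2" using B_nonneg by (intro mult_left_mono) auto
      moreover have "V 0 0 \<zeta> - q \<zeta> = V 0 0 (\<eta> + (\<zeta> - \<eta>)) - V 0 0 \<eta> - ((\<zeta> - \<eta>) $ 1 * V 1 0 \<eta> + (\<zeta> - \<eta>) $ 2 * V 0 1 \<eta>)"
        unfolding q_def b by (simp add: algebra_simps)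
      ultimately show "\<bar>V 0 0 \<zeta> - q \<zeta>\<bar> \<le> 2 * B * (\<kappa> * h)\<^sup>2" using V_second[of \<eta> "\<zeta> - \<eta>"] by linarith
    qed
  qed (use B_nonneg in auto)
  also have "\<dots> = (3 + real m * \<bar>W\<bar>) * (r\<^sup>2 / 24 + 2 * \<kappa>\<^sup>2) * B * h\<^sup>2"
  proof -
    have "B * h\<^sup>2 / 6 * r\<^sup>2 / 4 + 2 * B * (\<kappa> * h)\<^sup>2 = (r\<^sup>2 / 24 + 2 * \<kappa>\<^sup>2) * (B * h\<^sup>2)"
      by (simp add: power_mult_distrib algebra_simps)
    then show ?thesis by (simp only: mult.assoc)
  qed
  finally show ?thesis .
qed

text \<open>Equality with \<open>U\<close> on an open set carries over to second derivatives, so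
  \<open>V\<close> inherits the Laplace equation; continuity up to the closure identifies the
  boundary values.\<close>

lemma harmonic_classical:
  assumes \<Omega>: "open \<Omega>" and U: "harmonic_extension \<Omega> u U" and V: "C2_field V B" and VU: "\<And>x. x \<in> \<Omega> \<Longrightarrow> V 0 0 x = U x"
  shows "x \<in> \<Omega> \<Longrightarrow> V 2 0 x + V 0 2 x = 0" "x \<in> frontier \<Omega> \<Longrightarrow> u x = V 0 0 x"
proof -
  interpret C2_field V B by (rule V)
  have dV: "(V i j has_derivative (\<lambda>k. k $ 1 * V (Suc i) j x + k $ 2 * V i (Suc j) x)) (at x)" if "i + j \<le> 1" for i j x
    using V_deriv[OF that] .
  have p: "pd 1 U x = V 1 0 x" "pd 2 U x = V 0 1 x" if "x \<in> \<Omega>" for x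
    using pd_eq[OF \<Omega> that _ dV[of 0 0 x], of U] VU by (simp_all add: axis_def)
  have pp: "pd 1 (pd 1 U) x = V 2 0 x" "pd 2 (pd 2 U) x = V 0 2 x" if "x \<in> \<Omega>" for x
    using pd_eq[OF \<Omega> that _ dV[of 1 0 x], of "pd 1 U"] pd_eq[OF \<Omega> that _ dV[of 0 1 x], of "pd 2 U"] p
    by (simp_all add: numeral_2_eq_2 axis_def)
  show "x \<in> \<Omega> \<Longrightarrow> V 2 0 x + V 0 2 x = 0" using U pp unfolding harmonic_extension_def by fastforce
  assume x: "x \<in> frontier \<Omega>"
  have "continuous_on UNIV (V 0 0)" using dV[of 0 0] by (intro continuous_at_imp_continuous_on ballI has_derivative_continuous) auto
  then have "continuous_on (closure \<Omega>) (\<lambda>x. V 0 0 x - U x)"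
    using U continuous_on_subset unfolding harmonic_extension_def by (intro continuous_on_diff) blast+
  moreover have "x \<in> closure \<Omega>" using x by (simp add: frontier_def)
  ultimately have "V 0 0 x - U x = 0"
    using continuous_constant_on_closure[of \<Omega> "\<lambda>x. V 0 0 x - U x" 0 x] VU by simp
  moreover have "U x = u x" using U x unfolding harmonic_extension_def by blast
  ultimately show "u x = V 0 0 x" by simp
qed

section \<open>Assembly on one grid\<close>

context chain_grid
begin

lemma segment_feet:
  obtains \<sigma> \<sigma>' where "\<And>i. i < n \<Longrightarrow> \<sigma> i 0 = s i" "\<And>i. i < n \<Longrightarrow> \<sigma> i 1 = s (Suc i)"
    "\<And>i. i < n \<Longrightarrow> cont01 (\<sigma> i)" "\<And>i. i < n \<Longrightarrow> cont01 (\<sigma>' i)"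
    "\<And>i t. i < n \<Longrightarrow> 0 < t \<Longrightarrow> t < 1 \<Longrightarrow> (\<sigma> i has_real_derivative \<sigma>' i t) (at t)"
    "\<And>i t. i < n \<Longrightarrow> 0 \<le> t \<Longrightarrow> t \<le> 1 \<Longrightarrow> proj \<psi> (X i t) = c (\<sigma> i t)"
    "\<And>i t. i < n \<Longrightarrow> 0 \<le> t \<Longrightarrow> t \<le> 1 \<Longrightarrow> norm (X i t - c (\<sigma> i t)) \<le> 3 * h"
    "\<And>i t. i < n \<Longrightarrow> 0 \<le> t \<Longrightarrow> t \<le> 1 \<Longrightarrow> \<bar>\<sigma>' i t - seglen i\<bar> \<le> 42 * K * h * seglen i"
    "\<And>i t. i < n \<Longrightarrow> 0 \<le> t \<Longrightarrow> t \<le> 1 \<Longrightarrow> norm (QQ i - PP i - seglen i *\<^sub>R c' (\<sigma> i t)) \<le> 9 * K * h * seglen i"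
    "\<And>i S. i < n \<Longrightarrow> negligible S \<Longrightarrow> negligible {t \<in> {0..1}. \<sigma> i t \<in> S}"
proof -
  define P where "P i \<sigma> \<sigma>' \<longleftrightarrow> \<sigma> 0 = s i \<and> \<sigma> 1 = s (Suc i) \<and> continuous_on {0..1} \<sigma> \<and> continuous_on {0..1} \<sigma>' \<and>
    (\<forall>t. 0 < t \<longrightarrow> t < 1 \<longrightarrow> (\<sigma> has_real_derivative \<sigma>' t) (at t)) \<and>
    (\<forall>t. 0 \<le> t \<longrightarrow> t \<le> 1 \<longrightarrow> proj \<psi> (X i t) = c (\<sigma> t) \<and> norm (X i t - c (\<sigma> t)) \<le> 3 * h
      \<and> \<bar>\<sigma>' t - seglen i\<bar> \<le> 42 * K * h * seglen i \<and> norm (QQ i - PP i - seglen i *\<^sub>R c' (\<sigma> t)) \<le> 9 * K * h * seglen i) \<and>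
    (\<forall>S. negligible S \<longrightarrow> negligible {t \<in> {0..1}. \<sigma> t \<in> S})" for i and \<sigma> \<sigma>' :: "real \<Rightarrow> real"
  have "\<forall>i. \<exists>\<sigma>. i < n \<longrightarrow> (\<exists>\<sigma>'. P i \<sigma> \<sigma>')" using segment_foot unfolding P_def by simp
  then obtain \<sigma> where "\<forall>i. i < n \<longrightarrow> (\<exists>\<sigma>'. P i (\<sigma> i) \<sigma>')" using choice[of "\<lambda>i \<sigma>. i < n \<longrightarrow> (\<exists>\<sigma>'. P i \<sigma> \<sigma>')"] by blast
  then have "\<forall>i. \<exists>\<sigma>'. i < n \<longrightarrow> P i (\<sigma> i) \<sigma>'" by blast
  then obtain \<sigma>' where "\<forall>i. i < n \<longrightarrow> P i (\<sigma> i) (\<sigma>' i)" using choice[of "\<lambda>i \<sigma>'. i < n \<longrightarrow> P i (\<sigma> i) \<sigma>'"] by blast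
  then have f: "P i (\<sigma> i) (\<sigma>' i)" if "i < n" for i using that by blast
  show ?thesis by (rule that[of \<sigma> \<sigma>']) (use f in \<open>simp_all only: P_def\<close>)
qed

text \<open>The data v - v2 - a on \<open>gam2\<close> generate the required nodal vector, because
  \<open>E_vec\<close> is linear and reproduces constants. Hence differences corrected by a constant
  are legitimate test functions once their mean vanishes.\<close>

lemma reduced_galerkin:
  assumes uh: "reduced_trace_solution \<psi> h l N w g uh"
    and ex: "local_extrapolation \<psi> h N w m W \<kappa>" and inv: "invertible_on (gam2 \<psi> h) (layer_kernel \<psi> h l)"
  obtains v2 where "uh = restrict (\<lambda>x. \<Sum>\<xi>\<in>gam \<psi> h. E_vec \<psi> h l N w v2 \<xi> * nodal h \<xi> x) (Gamh \<psi> h)"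
    "Gamh_integral \<psi> h uh = 0"
    "\<And>v Ev a. (\<And>\<xi>. \<xi> \<in> gam \<psi> h \<Longrightarrow> Ev \<xi> = E_vec \<psi> h l N w v \<xi> - E_vec \<psi> h l N w v2 \<xi> - a) \<Longrightarrow>
      Gamh_integral \<psi> h (restrict (\<lambda>x. \<Sum>\<xi>\<in>gam \<psi> h. Ev \<xi> * nodal h \<xi> x) (Gamh \<psi> h)) = 0 \<Longrightarrow>
      Gamh_integral \<psi> h (\<lambda>x. tgrad_h \<psi> h uh x \<bullet> tgrad_h \<psi> h (restrict (\<lambda>x. \<Sum>\<xi>\<in>gam \<psi> h. Ev \<xi> * nodal h \<xi> x) (Gamh \<psi> h)) x)
        = Gamh_integral \<psi> h (\<lambda>x. g (proj \<psi> x) * restrict (\<lambda>x. \<Sum>\<xi>\<in>gam \<psi> h. Ev \<xi> * nodal h \<xi> x) (Gamh \<psi> h) x)"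
proof -
  have W: "uh \<in> W_red \<psi> h l N w" and mean: "Gamh_integral \<psi> h uh = 0"
    and gal: "\<And>v. v \<in> W_red \<psi> h l N w \<Longrightarrow> Gamh_integral \<psi> h v = 0 \<Longrightarrow>
      Gamh_integral \<psi> h (\<lambda>x. tgrad_h \<psi> h uh x \<bullet> tgrad_h \<psi> h v x) = Gamh_integral \<psi> h (\<lambda>x. g (proj \<psi> x) * v x)"
    using uh unfolding reduced_trace_solution_def W_red0_def by auto
  obtain v2 where v2: "uh = restrict (\<lambda>x. \<Sum>\<xi>\<in>gam \<psi> h. E_vec \<psi> h l N w v2 \<xi> * nodal h \<xi> x) (Gamh \<psi> h)"
    using W unfolding W_red_iff by blast
  show ?thesis
  proof (rule that[OF v2 mean], rule gal)
    fix v Ev :: "pt \<Rightarrow> real" and a :: real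
    assume Ev: "\<And>\<xi>. \<xi> \<in> gam \<psi> h \<Longrightarrow> Ev \<xi> = E_vec \<psi> h l N w v \<xi> - E_vec \<psi> h l N w v2 \<xi> - a"
    define k where "k = (\<lambda>x. 1 * v x + (-1) * (1 * v2 x + 1 * a))"
    have "E_vec \<psi> h l N w k \<xi> = Ev \<xi>" if "\<xi> \<in> gam \<psi> h" for \<xi>
      unfolding k_def E_vec_linear[of \<psi> h l N w 1 v "-1" "\<lambda>x. 1 * v2 x + 1 * a"] E_vec_linear[of \<psi> h l N w 1 v2 1 "\<lambda>_. a"]
      using E_vec_const[OF ex inv that] Ev[OF that] by simp
    then have "(\<lambda>x. \<Sum>\<xi>\<in>gam \<psi> h. Ev \<xi> * nodal h \<xi> x) = (\<lambda>x. \<Sum>\<xi>\<in>gam \<psi> h. E_vec \<psi> h l N w k \<xi> * nodal h \<xi> x)" by simp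
    then show "restrict (\<lambda>x. \<Sum>\<xi>\<in>gam \<psi> h. Ev \<xi> * nodal h \<xi> x) (Gamh \<psi> h) \<in> W_red \<psi> h l N w"
      unfolding W_red_iff by (intro exI[of _ k]) simp
  qed
qed

end

context field_on_curve
begin

text \<open>On the curve \<open>u\<close> is the smooth function \<open>Vc\<close>, so its two weak
  derivatives are identified one after the other, and the equation determines \<open>g\<close>
  almost everywhere.\<close>

lemma load_classical:
  assumes "problem_data c L g u" and u: "\<And>s. u (c s) = Vc s"
  shows "negligible {s. g (c s) \<noteq> - Vc'' s}"
proof -
  have wrap: "f L = f 0" if "\<And>r. f (r + L) = f r" for f :: "real \<Rightarrow> real" using that[of 0] by simp
  have H: "H1_curve c L u" "H1_curve c L (sderiv c L u)"
    and gl: "AE s in lebesgue_on {0..L}. - laplace_beltrami c L u (c s) = g (c s)"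
    using assms(1) unfolding problem_data_def H2_curve_def by auto
  have Vc'_cont: "continuous_on UNIV Vc'"
    by (intro continuous_at_imp_continuous_on ballI DERIV_isCont[OF Vc'_deriv])
  have "AE s in lebesgue_on {0..L}. sderiv c L u (c s) = Vc' s"
    by (rule sderiv_classical[OF H(1) L_pos _ Vc_deriv Vc'_cont]) (auto simp: u Vc_def intro!: wrap simp: period)
  then have "AE s in lebesgue_on {0..L}. sderiv c L (sderiv c L u) (c s) = Vc'' s"
    by (rule sderiv_classical[OF H(2) L_pos _ Vc'_deriv Vc''_cont wrap]) (rule Vc'_period(1))
  then have "AE s in lebesgue_on {0..L}. g (c s) = - Vc'' s"
    using gl unfolding laplace_beltrami_def by eventually_elim simp
  from negligible_periodic[OF this] show ?thesis by (simp add: period Vc'_period)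
qed

end

text \<open>Removes the slack between \<open>B'\<close> and \<open>B\<close>; the denominator k + 1
  avoids a case distinction for k = 0.\<close>

lemma le_of_all_greater:
  fixes x k B :: real
  assumes k: "0 \<le> k" and le: "\<And>B'. B < B' \<Longrightarrow> x \<le> k * B'"
  shows "x \<le> k * B"
proof (rule field_le_epsilon)
  fix e :: real assume e: "0 < e"
  have "x \<le> k * (B + e / (k + 1))" using e k by (intro le) simp
  moreover have "k * (e / (k + 1)) \<le> e" using e k by (simp add: pos_divide_le_eq algebra_simps)
  ultimately show "x \<le> k * B + e" by (simp add: distrib_left)
qed

text \<open>The estimate for one position of the curve. The centre \<open>a\<close> of the ball is
  absent from the bound, and \<open>C3\<close> depends on \<open>L\<close>, \<open>K\<close> and the
  nodal constant only, so nothing refers to the place of the curve in the plane.\<close>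

theorem (in proper_curve) reduced_trace_error:
  assumes \<Omega>: "open \<Omega>" "frontier \<Omega> = range c" "\<Omega> \<subseteq> cball a r"
    and lev: "level_set_function \<Omega> \<psi>"
    and h: "0 < h" "8 * h < d" "24 * K * h \<le> 1" "h \<le> 1"
    and grid: "active_grid c \<psi> h"
    and ex: "local_extrapolation \<psi> h N w m W \<kappa>"
    and data: "problem_data c L g u" and harm: "harmonic_extension \<Omega> u U"
    and reg: "data_regularity \<Omega> T Ext U BE BI"
    and inv: "invertible_on (gam2 \<psi> h) (layer_kernel \<psi> h l)"
    and uh: "reduced_trace_solution \<psi> h l N w g uh"
  shows "H1_norm_h \<psi> h (\<lambda>x. lifted \<psi> h u x - uh x)
    \<le> sqrt (reduced_fem.C3 L K ((3 + real m * \<bar>W\<bar>) * ((r + 1)\<^sup>2 / 24 + 2 * \<kappa>\<^sup>2))) * (\<bar>BE\<bar> * \<bar>BI\<bar>)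
      * h * Winf_norm 4 (\<Omega> \<inter> T) U"
proof -
  interpret cut_grid \<psi> h
    by unfold_locales (use h lev grid in \<open>auto simp: level_set_function_def active_grid_def\<close>)
  interpret curve_grid c c' c'' L K d \<eta> \<psi> h
  proof unfold_locales
    show "zero_set \<psi> = range c" using lev \<Omega>(2) by (simp add: level_set_function_def zero_set_def)
    show "c' s $ i \<noteq> 0" if "lattice_line h (c s $ i)" for s i
      using grid that vector_derivative_at[OF c_deriv, of s] unfolding active_grid_def lattice_line_def by metis
    show "connected (A \<inter> zero_set \<psi>)" if "A \<in> active_cells \<psi> h" for A
      using grid that unfolding active_grid_def by blast
  qed (use h in auto)
  obtain n s z where chain: "0 < n" "s n = s 0 + L"
    "\<And>i. i < n \<Longrightarrow> s i < s (Suc i)" "\<And>i. i \<le> n \<Longrightarrow> s i \<in> Cr"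
    "\<And>i t. i < n \<Longrightarrow> s i < t \<Longrightarrow> t < s (Suc i) \<Longrightarrow> t \<notin> Cr"
    "\<And>i. i < n \<Longrightarrow> z i \<in> lattice_pts h"
    "\<And>i t. i < n \<Longrightarrow> s i < t \<Longrightarrow> t < s (Suc i) \<Longrightarrow> c t \<in> ocell (z i)"
    "\<And>i t. i < n \<Longrightarrow> s i \<le> t \<Longrightarrow> t \<le> s (Suc i) \<Longrightarrow> c t \<in> cell (z i)"
    using crossing_chain by blast
  interpret chain_grid c c' c'' L K d \<eta> \<psi> h n s z
    by unfold_locales (fact chain)+
  have WU: "Winf 4 \<Omega> U" "Winf 4 (\<Omega> \<inter> T) U" and bE: "bounded_extension 4 \<Omega> Ext BE"
    and nE: "Winf_norm 4 UNIV (Ext U) \<le> BE * Winf_norm 4 \<Omega> U"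
    and nI: "Winf_norm 4 \<Omega> U \<le> BI * Winf_norm 4 (\<Omega> \<inter> T) U"
    using reg unfolding data_regularity_def by auto
  define B where "B = Winf_norm 4 UNIV (Ext U)"
  have WE: "Winf 4 UNIV (Ext U)" and EU: "AE x in lebesgue_on \<Omega>. Ext U x = U x"
    using bE WU(1) unfolding bounded_extension_def by auto
  obtain V where V: "\<And>i j x. i + j \<le> 2 \<Longrightarrow>
      (V i j has_derivative (\<lambda>k. k $ 1 * V (Suc i) j x + k $ 2 * V i (Suc j) x)) (at x)"
    "\<And>i j x. i + j \<le> 3 \<Longrightarrow> \<bar>V i j x\<bar> \<le> B"
    "\<And>h x. \<bar>five_point h (V 0 0) x - h\<^sup>2 * (V 2 0 x + V 0 2 x)\<bar> \<le> B * h ^ 4 / 6"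
    "\<And>S u x. open S \<Longrightarrow> continuous_on S u \<Longrightarrow> (AE x in lebesgue_on S. Ext U x = u x) \<Longrightarrow> x \<in> S \<Longrightarrow> V 0 0 x = u x"
  proof (rule W4inf_classical[OF WE B_def], goal_cases)
    case (1 V)
    show thesis by (rule that[of V]) (fact 1)+
  qed
  have C2: "C2_field V B" by unfold_locales (use V(1,2) in auto)
  interpret C2_field V B by (rule C2)
  have "continuous_on (closure \<Omega>) U" using harm unfolding harmonic_extension_def by (rule conjunct1)
  then have "continuous_on \<Omega> U" by (rule continuous_on_subset[OF _ closure_subset])
  from V(4)[OF \<Omega>(1) this EU] have VU: "V 0 0 x = U x" if "x \<in> \<Omega>" for x using that .
  note hc = harmonic_classical[OF \<Omega>(1) harm C2 VU]
  interpret field_on_curve c c' c'' L K d \<eta> \<psi> h n s z V B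
    by unfold_locales (intro continuous_at_imp_continuous_on ballI has_derivative_continuous[OF V(1)])
  have u: "u (c r) = Vc r" for r using hc(2)[of "c r"] \<Omega>(2) by (simp add: Vc_def)
  define C1 where "C1 = (3 + real m * \<bar>W\<bar>) * ((r + 1)\<^sup>2 / 24 + 2 * \<kappa>\<^sup>2)"
  have ball: "V_int \<psi> h \<union> gam2 \<psi> h \<subseteq> cball a (r + 1)"
    by (rule interior_nodes_bounded[OF lev \<Omega>(1,3) h(4)])
  have hV: "V 2 0 x + V 0 2 x = 0" if "x \<in> V_int \<psi> h" for x
    using that level_set_neg[OF lev \<Omega>(1)] hc(1) unfolding V_int_def by blast
  obtain v2 where v2: "uh = restrict (\<lambda>x. \<Sum>\<xi>\<in>gam \<psi> h. E_vec \<psi> h l N w v2 \<xi> * nodal h \<xi> x) (Gamh \<psi> h)"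
    "Gamh_integral \<psi> h uh = 0"
    "\<And>v Ev a. (\<And>\<xi>. \<xi> \<in> gam \<psi> h \<Longrightarrow> Ev \<xi> = E_vec \<psi> h l N w v \<xi> - E_vec \<psi> h l N w v2 \<xi> - a) \<Longrightarrow>
      Gamh_integral \<psi> h (restrict (\<lambda>x. \<Sum>\<xi>\<in>gam \<psi> h. Ev \<xi> * nodal h \<xi> x) (Gamh \<psi> h)) = 0 \<Longrightarrow>
      Gamh_integral \<psi> h (\<lambda>x. tgrad_h \<psi> h uh x \<bullet> tgrad_h \<psi> h (restrict (\<lambda>x. \<Sum>\<xi>\<in>gam \<psi> h. Ev \<xi> * nodal h \<xi> x) (Gamh \<psi> h)) x)
        = Gamh_integral \<psi> h (\<lambda>x. g (proj \<psi> x) * restrict (\<lambda>x. \<Sum>\<xi>\<in>gam \<psi> h. Ev \<xi> * nodal h \<xi> x) (Gamh \<psi> h) x)"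
  proof (rule reduced_galerkin[OF uh ex inv], goal_cases)
    case (1 v2)
    show thesis by (rule that[of v2]) (fact 1)+
  qed
  obtain \<sigma> \<sigma>' where feet: "\<And>i. i < n \<Longrightarrow> \<sigma> i 0 = s i" "\<And>i. i < n \<Longrightarrow> \<sigma> i 1 = s (Suc i)"
    "\<And>i. i < n \<Longrightarrow> cont01 (\<sigma> i)" "\<And>i. i < n \<Longrightarrow> cont01 (\<sigma>' i)"
    "\<And>i t. i < n \<Longrightarrow> 0 < t \<Longrightarrow> t < 1 \<Longrightarrow> (\<sigma> i has_real_derivative \<sigma>' i t) (at t)"
    "\<And>i t. i < n \<Longrightarrow> 0 \<le> t \<Longrightarrow> t \<le> 1 \<Longrightarrow> proj \<psi> (X i t) = c (\<sigma> i t)"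
    "\<And>i t. i < n \<Longrightarrow> 0 \<le> t \<Longrightarrow> t \<le> 1 \<Longrightarrow> norm (X i t - c (\<sigma> i t)) \<le> 3 * h"
    "\<And>i t. i < n \<Longrightarrow> 0 \<le> t \<Longrightarrow> t \<le> 1 \<Longrightarrow> \<bar>\<sigma>' i t - seglen i\<bar> \<le> 42 * K * h * seglen i"
    "\<And>i t. i < n \<Longrightarrow> 0 \<le> t \<Longrightarrow> t \<le> 1 \<Longrightarrow> norm (QQ i - PP i - seglen i *\<^sub>R c' (\<sigma> i t)) \<le> 9 * K * h * seglen i"
    "\<And>i S. i < n \<Longrightarrow> negligible S \<Longrightarrow> negligible {t \<in> {0..1}. \<sigma> i t \<in> S}"
  proof (rule segment_feet, goal_cases)
    case (1 \<sigma> \<sigma>')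
    show thesis by (rule that[of \<sigma> \<sigma>']) (fact 1)+
  qed
  interpret reduced_fem c c' c'' L K d \<eta> \<psi> h n s z V B \<sigma> \<sigma>' u g uh
    "E_vec \<psi> h l N w (V 0 0)" "E_vec \<psi> h l N w v2" C1
  proof unfold_locales
    show "\<bar>E_vec \<psi> h l N w (V 0 0) \<xi> - V 0 0 \<xi>\<bar> \<le> C1 * B * h\<^sup>2" if "\<xi> \<in> gam \<psi> h" for \<xi>
      unfolding C1_def by (rule E_vec_consistency[OF C2 V(3) hV ball ex inv that])
    show "0 \<le> C1" unfolding C1_def by simp
    show "negligible {s. g (c s) \<noteq> - Vc'' s}" by (rule load_classical[OF data u])
  qed (fact feet u v2 h(4))+
  have C30: "0 \<le> C3" unfolding C3_def using L_pos by simp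
  have "H1_norm_h \<psi> h (\<lambda>x. lifted \<psi> h u x - uh x) \<le> (sqrt C3 * h) * B"
  proof (rule le_of_all_greater)
    show "0 \<le> sqrt C3 * h" using C30 h by simp
    show "H1_norm_h \<psi> h (\<lambda>x. lifted \<psi> h u x - uh x) \<le> sqrt C3 * h * B'" if "B < B'" for B'
      using H1_error[OF that] by (simp add: mult_ac)
  qed
  also have "\<dots> \<le> (sqrt C3 * h) * (\<bar>BE\<bar> * (\<bar>BI\<bar> * Winf_norm 4 (\<Omega> \<inter> T) U))"
  proof (rule mult_left_mono)
    have n0: "0 \<le> Winf_norm 4 \<Omega> U" "0 \<le> Winf_norm 4 (\<Omega> \<inter> T) U"
      using weak_pderiv_props(4)[OF WU(1), of 0 0] weak_pderiv_props(4)[OF WU(2), of 0 0] by simp_all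
    have "B \<le> \<bar>BE\<bar> * Winf_norm 4 \<Omega> U"
      using nE mult_right_mono[OF abs_ge_self n0(1), of BE] unfolding B_def by linarith
    also have "Winf_norm 4 \<Omega> U \<le> \<bar>BI\<bar> * Winf_norm 4 (\<Omega> \<inter> T) U"
      using nI mult_right_mono[OF abs_ge_self n0(2), of BI] by linarith
    finally show "B \<le> \<bar>BE\<bar> * (\<bar>BI\<bar> * Winf_norm 4 (\<Omega> \<inter> T) U)" by (simp add: mult_left_mono)
    show "0 \<le> sqrt C3 * h" using C30 h by simp
  qed
  finally show ?thesis unfolding C1_def by (simp only: mult_ac)
qed

theorem theorem20:
  fixes c :: "real \<Rightarrow> real^2" and \<Omega> :: "(real^2) set"
    and L \<delta> Bgeo BE BI W \<kappa> :: real and n :: nat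
  assumes "smooth_closed_curve c L"
    and "open \<Omega>" and "connected \<Omega>" and "bounded \<Omega>" and "\<Omega> \<noteq> {}"
    and "frontier \<Omega> = range c"
    and "tubular (range c) \<delta>"
  shows "\<exists>h0>0. \<exists>C. \<forall>M \<psi> h l N w Ext g u U uh.
    rigid_motion M \<and>
    level_set_function (M ` \<Omega>) \<psi> \<and>
    0 < h \<and> h < h0 \<and>
    active_grid (M \<circ> c) \<psi> h \<and>
    standard_estimates (M \<circ> c) (M ` \<Omega>) \<psi> h Bgeo \<and>
    local_extrapolation \<psi> h N w n W \<kappa> \<and>
    problem_data (M \<circ> c) L g u \<and>
    harmonic_extension (M ` \<Omega>) u U \<and>
    data_regularity (M ` \<Omega>) (tube (range (M \<circ> c)) \<delta>) Ext U BE BI \<and>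
    invertible_on (gam2 \<psi> h) (layer_kernel \<psi> h l) \<and>
    reduced_trace_solution \<psi> h l N w g uh
    \<longrightarrow> H1_norm_h \<psi> h (\<lambda>x. lifted \<psi> h u x - uh x)
      \<le> C * h * (H2_norm (M \<circ> c) L u
          + Winf_norm 4 (M ` \<Omega> \<inter> tube (range (M \<circ> c)) \<delta>) U)"
proof -
  obtain c'' K where pc: "param_curve c (\<lambda>s. vector_derivative c (at s)) c'' L K"
    by (rule smooth_closed_curve_param[OF assms(1)])
  interpret param_curve c "\<lambda>s. vector_derivative c (at s)" c'' L K by (rule pc)
  \<comment> \<open>The two entries are exactly the bounds that \<open>proper_curve\<close> asks of
    \<open>\<eta>\<close>; a matching \<open>d\<close> is then furnished by compactness.\<close>
  define \<eta> where "\<eta> = min (L / 4) (1 / (8 * K))"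
  have \<eta>: "0 < \<eta>" "\<eta> \<le> L / 4" "K * \<eta> \<le> 1 / 8"
  proof -
    show "0 < \<eta>" "\<eta> \<le> L / 4" unfolding \<eta>_def using L_pos K_pos by auto
    have "K * \<eta> \<le> K * (1 / (8 * K))" unfolding \<eta>_def using K_pos by (intro mult_left_mono) auto
    then show "K * \<eta> \<le> 1 / 8" using K_pos by simp
  qed
  obtain d where d: "0 < d" "\<And>s t. dist (c s) (c t) < d \<Longrightarrow> \<exists>k::int. \<bar>s - t - of_int k * L\<bar> < \<eta>"
    using chord_modulus[OF \<eta>(1)] by blast
  have proper: "proper_curve c (\<lambda>s. vector_derivative c (at s)) c'' L K d \<eta>"
    by unfold_locales (fact d \<eta>)+
  obtain r where "\<And>x. x \<in> \<Omega> \<Longrightarrow> norm x \<le> r" using assms(4) unfolding bounded_iff by auto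
  then have r: "\<Omega> \<subseteq> cball 0 r" by auto
  \<comment> \<open>Fixed before the motion, the mesh and the data are chosen; r + 1 is the radius
    of a ball around the interior nodes and \<open>gam2\<close>.\<close>
  define C where "C = sqrt (reduced_fem.C3 L K ((3 + real n * \<bar>W\<bar>) * ((r + 1)\<^sup>2 / 24 + 2 * \<kappa>\<^sup>2))) * (\<bar>BE\<bar> * \<bar>BI\<bar>)"
  \<comment> \<open>The entries give h \<le> 1 for the ball and the nodal error, and 8h < d and 24 K
    h \<le> 1 for the arcs inside a cell.\<close>
  define h0 where "h0 = min 1 (min (d / 8) (1 / (24 * K)))"
  have "0 < h0" using d(1) K_pos by (simp add: h0_def)
  moreover have "H1_norm_h \<psi> h (\<lambda>x. lifted \<psi> h u x - uh x)
      \<le> \<bar>C\<bar> * h * (H2_norm (M \<circ> c) L u + Winf_norm 4 (M ` \<Omega> \<inter> tube (range (M \<circ> c)) \<delta>) U)"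
    if A: "rigid_motion M" "level_set_function (M ` \<Omega>) \<psi>" "0 < h" "h < h0"
      "active_grid (M \<circ> c) \<psi> h" "local_extrapolation \<psi> h N w n W \<kappa>"
      "problem_data (M \<circ> c) L g u" "harmonic_extension (M ` \<Omega>) u U"
      "data_regularity (M ` \<Omega>) (tube (range (M \<circ> c)) \<delta>) Ext U BE BI"
      "invertible_on (gam2 \<psi> h) (layer_kernel \<psi> h l)" "reduced_trace_solution \<psi> h l N w g uh"
    for M \<psi> h l N w Ext g u U uh
  proof -
    let ?T = "tube (range (M \<circ> c)) \<delta>"
    obtain a R where R: "orthogonal_transformation R" and M: "M = (\<lambda>x. a + R x)"
      using A(1) unfolding rigid_motion_def by blast
    have Mc: "(\<lambda>s. a + R (c s)) = M \<circ> c" unfolding M by auto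
    note reg = rigid_motion_region[OF R assms(2) r, of a, folded M]
    have fr: "frontier (M ` \<Omega>) = range (M \<circ> c)" unfolding reg(2) assms(6) by auto
    have h: "8 * h < d" "24 * K * h \<le> 1" "h \<le> 1"
    proof -
      show "8 * h < d" "h \<le> 1" using A(4) unfolding h0_def by simp_all
      have "h \<le> 1 / (24 * K)" using A(4) unfolding h0_def by simp
      then show "24 * K * h \<le> 1" using K_pos by (simp add: pos_le_divide_eq mult.commute)
    qed
    have le: "H1_norm_h \<psi> h (\<lambda>x. lifted \<psi> h u x - uh x) \<le> C * h * Winf_norm 4 (M ` \<Omega> \<inter> ?T) U"
      unfolding C_def
      by (rule proper_curve.reduced_trace_error[OF proper_curve_rigid[OF proper R, of a, unfolded Mc]
          reg(1) fr reg(3) A(2,3) h A(5-11)])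
    have "Winf 4 (M ` \<Omega> \<inter> ?T) U" using A(9) unfolding data_regularity_def by blast
    from weak_pderiv_props(4)[OF this, of 0 0] have W0: "0 \<le> Winf_norm 4 (M ` \<Omega> \<inter> ?T) U" by simp
    have "0 \<le> H2_norm (M \<circ> c) L u"
      unfolding H2_norm_def curve_integral_def by (intro real_sqrt_ge_zero integral_nonneg_AE AE_I2) auto
    \<comment> \<open>The absolute value allows the nonnegative \<open>H2_norm\<close> to be added
      without deciding the sign of \<open>C\<close>.\<close>
    then have "C * h * Winf_norm 4 (M ` \<Omega> \<inter> ?T) U \<le> \<bar>C\<bar> * h * (H2_norm (M \<circ> c) L u + Winf_norm 4 (M ` \<Omega> \<inter> ?T) U)"
      using W0 A(3) by (intro mult_mono) auto
    with le show ?thesis by linarith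
  qed
  ultimately show ?thesis by blast
qed

end
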